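(* Let $K$ be an algebraically closed field of characteristic $0$, let $\Lambda$ be an algebraic variety defined over $K$, and let $P\colon(\lambda,z)\in\Lambda\times\mathbb{A}^1\mapsto(\lambda,P_\lambda(z))\in\Lambda\times\mathbb{A}^1$ be an algebraic family of polynomials of degree $d\ge2$. Let $(\lambda_0,z_0)$ be any point in $\Lambda\times\mathbb{A}^1$ which belongs to an infinite sequence $\{Z_i\}_{i\ge0}$ of distinct irreducible hypersurfaces included in $\mathrm{Preper}$. Then, after a base change, conjugating the family by suitable affine transformations, and possibly replacing $P$ by some iterate, we are in the following situation: (1) The point $z_0$ is fixed by $P_\lambda$ for any parameter $\lambda$. Further, it is super-attracting for $P_{\lambda_0}$, and the local degree function $\lambda\mapsto\mathrm{ord}_{z_0}(P_\lambda)$ is not locally constant near $\lambda_0$. (2) One can find a sequence of integers $n_i\to\infty$ such that $Z_i$ is a component of $\{(\lambda,z):\ P^{n_i}_\lambda(z)=z_0\}$.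
   Context: An algebraic family of degree $d$ polynomials parametrized by $\Lambda$ is a map $(\lambda,z)\mapsto(\lambda,P_\lambda(z))$ of algebraic varieties such that $P_\lambda$ is a polynomial of degree $d$ for every $\lambda\in\Lambda$; $P_\lambda^n$ denotes the $n$-th iterate of $P_\lambda$. The set $\mathrm{Preper}=\{(\lambda,z)\in\Lambda\times\mathbb{A}^1:\ \{P_\lambda^n(z)\}_{n\ge1}\text{ is finite}\}$ is a countable union of irreducible hypersurfaces of $\Lambda\times\mathbb{A}^1$. A base change means replacing the family by its pull-back $P_{\pi(\lambda')}$ under a morphism of algebraic varieties $\pi\colon\Lambda'\to\Lambda$ (and $\lambda_0$, $Z_i$ by corresponding objects over $\Lambda'$); conjugating by affine transformations means replacing $P_\lambda$ by $\phi_\lambda\circ P_\lambda\circ\phi_\lambda^{-1}$ for a family of affine maps $\phi_\lambda$ (and transporting $z_0$ and $Z_i$ accordingly). A fixed point is super-attracting if the derivative of the polynomial vanishes there. The local degree $\mathrm{ord}_{z_0}(P_\lambda)$ at a fixed point $z_0$ is the order of vanishing of $P_\lambda(z)-z_0$ at $z=z_0$.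
   Formalization: If z_0 is not periodic for P_{λ_0} the claim fails (e.g. z^3-z^2+λz at (0,1)); here the fixed point in (1) and (2) is the image of some P_{λ_0}^l(z_0) under the affine conjugation, with l=0 whenever z_0 is periodic. *)

theory Defs
  imports "HOL-Analysis.Analysis" "HOL-Computational_Algebra.Computational_Algebra"
begin

section \<open>Irreducible subsets, components and codimension in a topological space\<close>

definition irreducible_in :: "'a topology \<Rightarrow> 'a set \<Rightarrow> bool" where
  "irreducible_in T Z \<longleftrightarrow> Z \<subseteq> topspace T \<and> Z \<noteq> {} \<and>
     (\<forall>A B. closedin T A \<and> closedin T B \<and> Z \<subseteq> A \<union> B \<longrightarrow> Z \<subseteq> A \<or> Z \<subseteq> B)"

definition irreducible_component :: "'a topology \<Rightarrow> 'a set \<Rightarrow> 'a set \<Rightarrow> bool" where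
  "irreducible_component T S Z \<longleftrightarrow> irreducible_in T Z \<and> Z \<subseteq> S \<and>
     (\<forall>W. irreducible_in T W \<and> Z \<subseteq> W \<and> W \<subseteq> S \<longrightarrow> W = Z)"

definition codimension :: "'a topology \<Rightarrow> 'a set \<Rightarrow> enat" where
  "codimension T Z = Sup {enat n | n. \<exists>C :: nat \<Rightarrow> 'a set. C 0 = Z \<and>
     (\<forall>i\<le>n. closedin T (C i) \<and> irreducible_in T (C i)) \<and> (\<forall>i<n. C i \<subset> C (Suc i))}"

definition irreducible_hypersurface :: "'a topology \<Rightarrow> 'a set \<Rightarrow> bool" where
  "irreducible_hypersurface T Z \<longleftrightarrow>
     closedin T Z \<and> irreducible_in T Z \<and> codimension T Z = 1"


section \<open>Spaces with functions\<close>

text \<open>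
  Varieties over an algebraically closed field are treated in the classical language: a
  topological space together with a sheaf of field-valued functions. The sheaf is recorded by
  its germs: \<open>regular_at X x f\<close> says that the function \<open>f\<close> is regular near the point \<open>x\<close>
  (values of \<open>f\<close> away from \<open>x\<close> are irrelevant, see \<open>germ_local\<close>), and
  the sections over an open set \<open>U\<close> are the functions regular at every point of \<open>U\<close>.
\<close>

record ('a, 'k) fspace =
  zariski :: "'a topology"
  regular_at :: "'a \<Rightarrow> ('a \<Rightarrow> 'k) \<Rightarrow> bool"

abbreviation points :: "('a, 'k) fspace \<Rightarrow> 'a set" where
  "points X \<equiv> topspace (zariski X)"

definition regular_on :: "('a, 'k) fspace \<Rightarrow> 'a set \<Rightarrow> ('a \<Rightarrow> 'k) \<Rightarrow> bool" where
  "regular_on X U f \<longleftrightarrow> (\<forall>x\<in>U. regular_at X x f)"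

definition germ_local :: "('a, 'k) fspace \<Rightarrow> bool" where
  "germ_local X \<longleftrightarrow> (\<forall>U x f g. openin (zariski X) U \<and> x \<in> U \<and> (\<forall>y\<in>U. f y = g y) \<and>
     regular_at X x f \<longrightarrow> regular_at X x g)"

definition morphism :: "('a, 'k) fspace \<Rightarrow> ('b, 'k) fspace \<Rightarrow> ('a \<Rightarrow> 'b) \<Rightarrow> bool" where
  "morphism X Y f \<longleftrightarrow> continuous_map (zariski X) (zariski Y) f \<and>
     (\<forall>x\<in>points X. \<forall>g. regular_at Y (f x) g \<longrightarrow> regular_at X x (g \<circ> f))"

definition isomorphic :: "('a, 'k) fspace \<Rightarrow> ('b, 'k) fspace \<Rightarrow> bool" where
  "isomorphic X Y \<longleftrightarrow> (\<exists>f g. morphism X Y f \<and> morphism Y X g \<and>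
     (\<forall>x\<in>points X. g (f x) = x) \<and> (\<forall>y\<in>points Y. f (g y) = y))"

definition open_subspace :: "('a, 'k) fspace \<Rightarrow> 'a set \<Rightarrow> ('a, 'k) fspace" where
  "open_subspace X U = \<lparr>zariski = subtopology (zariski X) U, regular_at = regular_at X\<rparr>"


section \<open>Affine algebraic sets\<close>

text \<open>Affine \<open>n\<close>-space is the set of sequences vanishing from index \<open>n\<close> on.\<close>

definition affine_space :: "nat \<Rightarrow> (nat \<Rightarrow> 'k::field) set" where
  "affine_space n = {x. \<forall>i\<ge>n. x i = 0}"

inductive_set poly_funs :: "nat \<Rightarrow> ((nat \<Rightarrow> 'k::field) \<Rightarrow> 'k) set" for n where
  const: "(\<lambda>x. c) \<in> poly_funs n"
| coord: "i < n \<Longrightarrow> (\<lambda>x. x i) \<in> poly_funs n"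
| add: "f \<in> poly_funs n \<Longrightarrow> g \<in> poly_funs n \<Longrightarrow> (\<lambda>x. f x + g x) \<in> poly_funs n"
| mult: "f \<in> poly_funs n \<Longrightarrow> g \<in> poly_funs n \<Longrightarrow> (\<lambda>x. f x * g x) \<in> poly_funs n"

definition algebraic_set :: "nat \<Rightarrow> (nat \<Rightarrow> 'k::field) set \<Rightarrow> bool" where
  "algebraic_set n V \<longleftrightarrow>
     (\<exists>S \<subseteq> poly_funs n. V = {x \<in> affine_space n. \<forall>f\<in>S. f x = 0})"

text \<open>
  The Zariski topology is generated by the principal open sets. Every regular germ is a quotient
  \<open>p / q\<close> on a whole principal open set \<open>q \<noteq> 0\<close>: if it is so only on the smaller set where also
  \<open>s \<noteq> 0\<close>, replace \<open>p / q\<close> by \<open>(p * s) / (q * s)\<close>.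
\<close>

definition affine_fspace :: "nat \<Rightarrow> (nat \<Rightarrow> 'k::field) set \<Rightarrow> (nat \<Rightarrow> 'k, 'k) fspace" where
  "affine_fspace n V =
     \<lparr>zariski = topology_generated_by {{x \<in> V. f x \<noteq> 0} | f. f \<in> poly_funs n},
      regular_at = (\<lambda>x f. \<exists>p\<in>poly_funs n. \<exists>q\<in>poly_funs n. q x \<noteq> 0 \<and>
         (\<forall>y\<in>V. q y \<noteq> 0 \<longrightarrow> f y = p y / q y))\<rparr>"

text \<open>The affine line, with the field itself as set of points.\<close>

definition affine_line :: "('k::field, 'k) fspace" where
  "affine_line =
     \<lparr>zariski = topology_generated_by {{z. poly f z \<noteq> 0} | f. True},
      regular_at = (\<lambda>z f. \<exists>p q. poly q z \<noteq> 0 \<and>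
         (\<forall>w. poly q w \<noteq> 0 \<longrightarrow> f w = poly p w / poly q w))\<rparr>"


section \<open>Products and varieties\<close>

text \<open>
  The product of two varieties (not the product topology): basic open sets are the non-vanishing
  loci of functions \<open>h (x, y) = (\<Sum>i<m. f i x * g i y)\<close> with \<open>f i\<close>, \<open>g i\<close> regular on open
  sets \<open>U\<close>, \<open>V\<close>, and regular germs are quotients of such functions.
\<close>

definition tensor_funs ::
  "('a, 'k::field) fspace \<Rightarrow> ('b, 'k) fspace \<Rightarrow> 'a set \<Rightarrow> 'b set \<Rightarrow> ('a \<times> 'b \<Rightarrow> 'k) set" where
  "tensor_funs X Y U V = {h. \<exists>(m::nat) f g. (\<forall>i<m. regular_on X U (f i) \<and> regular_on Y V (g i)) \<and>
     h = (\<lambda>(x, y). \<Sum>i<m. f i x * g i y)}"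

definition product :: "('a, 'k::field) fspace \<Rightarrow> ('b, 'k) fspace \<Rightarrow> ('a \<times> 'b, 'k) fspace" where
  "product X Y =
     \<lparr>zariski = topology_generated_by
        {{p \<in> U \<times> V. h p \<noteq> 0} | U V h. openin (zariski X) U \<and> openin (zariski Y) V \<and>
            h \<in> tensor_funs X Y U V},
      regular_at = (\<lambda>p F. \<exists>U V. openin (zariski X) U \<and> openin (zariski Y) V \<and> p \<in> U \<times> V \<and>
         (\<exists>h\<in>tensor_funs X Y U V. \<exists>h'\<in>tensor_funs X Y U V. h' p \<noteq> 0 \<and>
            (\<forall>r\<in>U \<times> V. h' r \<noteq> 0 \<longrightarrow> F r = h r / h' r)))\<rparr>"

text \<open>
  A variety is covered by finitely many affine open subsets and is separated (the diagonal is
  closed). Equivalently, it is a reduced separated scheme of finite type over the field; it is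
  not required to be irreducible.
\<close>

definition variety :: "('a, 'k::field) fspace \<Rightarrow> bool" where
  "variety X \<longleftrightarrow> germ_local X \<and>
     (\<exists>\<U>. finite \<U> \<and> \<Union>\<U> = points X \<and>
        (\<forall>U\<in>\<U>. openin (zariski X) U \<and>
           (\<exists>n V. algebraic_set n V \<and> isomorphic (open_subspace X U) (affine_fspace n V)))) \<and>
     closedin (zariski (product X X)) {(x, x) | x. x \<in> points X}"

abbreviation times_line :: "('a, 'k::field) fspace \<Rightarrow> ('a \<times> 'k, 'k) fspace" where
  "times_line X \<equiv> product X affine_line"


section \<open>Families of polynomials\<close>

definition algebraic_family :: "('a, 'k::field) fspace \<Rightarrow> nat \<Rightarrow> ('a \<Rightarrow> 'k poly) \<Rightarrow> bool" where
  "algebraic_family X d P \<longleftrightarrow> (\<forall>t\<in>points X. degree (P t) = d) \<and>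
     morphism (times_line X) (times_line X) (\<lambda>(t, z). (t, poly (P t) z))"

definition Preper :: "('a, 'k::field) fspace \<Rightarrow> ('a \<Rightarrow> 'k poly) \<Rightarrow> ('a \<times> 'k) set" where
  "Preper X P = {(t, z). t \<in> points X \<and> finite {(poly (P t) ^^ n) z | n. n \<ge> 1}}"

definition iterate_poly :: "nat \<Rightarrow> 'k::field poly \<Rightarrow> 'k poly" where
  "iterate_poly n p = ((\<lambda>q. p \<circ>\<^sub>p q) ^^ n) [:0, 1:]"

lemma poly_iterate_poly: "poly (iterate_poly n p) z = (poly p ^^ n) z"
  by (induction n) (simp_all add: iterate_poly_def poly_pcompose)

text \<open>Conjugation by the affine map \<open>z \<mapsto> a * z + b\<close>.\<close>

definition conj_poly :: "'k::field \<Rightarrow> 'k \<Rightarrow> 'k poly \<Rightarrow> 'k poly" where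
  "conj_poly a b p = [:b, a:] \<circ>\<^sub>p p \<circ>\<^sub>p [:- b / a, 1 / a:]"

lemma poly_conj_poly:
  "a \<noteq> 0 \<Longrightarrow> poly (conj_poly a b p) (a * z + b) = a * poly p z + b"
  by (simp add: conj_poly_def poly_pcompose add_divide_distrib)

definition affine_family :: "('a, 'k::field) fspace \<Rightarrow> ('a \<Rightarrow> 'k) \<Rightarrow> ('a \<Rightarrow> 'k) \<Rightarrow> bool" where
  "affine_family X a b \<longleftrightarrow>
     regular_on X (points X) a \<and> regular_on X (points X) b \<and> (\<forall>t\<in>points X. a t \<noteq> 0)"

text \<open>The order of vanishing of \<open>p z - w\<close> at \<open>z = w\<close>, meaningful when \<open>w\<close> is fixed by \<open>p\<close>.\<close>

definition local_degree :: "'k::field \<Rightarrow> 'k poly \<Rightarrow> nat" where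
  "local_degree w p = order w (p - [:w:])"

definition super_attracting :: "'k::field poly \<Rightarrow> 'k \<Rightarrow> bool" where
  "super_attracting p w \<longleftrightarrow> poly p w = w \<and> poly (pderiv p) w = 0"

definition locally_constant_near :: "'a topology \<Rightarrow> 'a \<Rightarrow> ('a \<Rightarrow> 'b) \<Rightarrow> bool" where
  "locally_constant_near T x f \<longleftrightarrow> (\<exists>U. openin T U \<and> x \<in> U \<and> (\<forall>y\<in>U. f y = f x))"

text \<open>
  Base change of the pointed sequence \<open>(t\<^sub>0, z\<^sub>0) \<in> Z i\<close> along \<open>\<pi>\<close>: a point \<open>t\<^sub>0'\<close> above \<open>t\<^sub>0\<close>, and
  distinct irreducible hypersurfaces \<open>Z' i\<close> through \<open>(t\<^sub>0', z\<^sub>0)\<close>, each of which is a component of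
  the preimage of \<open>Z i\<close>.
\<close>

definition base_change ::
  "('a, 'k::field) fspace \<Rightarrow> 'a \<Rightarrow> 'k \<Rightarrow> (nat \<Rightarrow> ('a \<times> 'k) set) \<Rightarrow>
   ('b, 'k) fspace \<Rightarrow> ('b \<Rightarrow> 'a) \<Rightarrow> 'b \<Rightarrow> (nat \<Rightarrow> ('b \<times> 'k) set) \<Rightarrow> bool" where
  "base_change X t\<^sub>0 z\<^sub>0 Z X' \<pi> t\<^sub>0' Z' \<longleftrightarrow>
     variety X' \<and> morphism X' X \<pi> \<and> t\<^sub>0' \<in> points X' \<and> \<pi> t\<^sub>0' = t\<^sub>0 \<and> inj Z' \<and>
     (\<forall>i. irreducible_hypersurface (zariski (times_line X')) (Z' i) \<and>
          irreducible_component (zariski (times_line X'))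
            {(t, z). t \<in> points X' \<and> (\<pi> t, z) \<in> Z i} (Z' i) \<and>
          (t\<^sub>0', z\<^sub>0) \<in> Z' i)"

text \<open>
  If \<open>z\<^sub>0\<close> is strictly preperiodic for \<open>P t\<^sub>0\<close>, no conjugate of an iterate can fix it. For instance
  \<open>P t z = z^3 - z^2 + t * z\<close> has infinitely many irreducible preperiodic curves through \<open>(0, 1)\<close>,
  but \<open>1\<close> is mapped by \<open>P 0\<close> to the super-attracting fixed point \<open>0\<close>. The marked fixed point is
  therefore taken to be a point \<open>(P t\<^sub>0)^l z\<^sub>0\<close> of the orbit, with \<open>l = 0\<close> whenever \<open>z\<^sub>0\<close> is periodic;
  the hypersurfaces themselves always pass through the original point.
\<close>

end

theory Submission
  imports Defs
begin

text \<open>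
  On a preperiodic hypersurface all points satisfy one relation \<open>P^a(z) = P^b(z)\<close>. Over an
  uncountable field this is a counting argument. In general, let the coordinates of a transcendence
  basis range over integers in a fixed residue class: these points are dense, and modulo a valuation
  ring over a large prime only finitely many residual orbits remain. Residually equal orbits have
  the same period up to a power of the residue characteristic, so two primes bound the period. The
  preperiod is bounded because a periodic point \<open>w\<close> is the only preimage of \<open>w\<close> in its residue
  class, once the leading coefficient of the local expansion at \<open>w\<close> is a unit.

  Let \<open>g\<close> be an iterate for which the orbit of \<open>z\<^sub>0\<close> at \<open>t\<^sub>0\<close> lands on a fixed point \<open>w\<^sub>0\<close> whose
  multiplier is \<open>1\<close> or not a root of unity. Then \<open>(g^N - X) / (g - X)\<close> does not vanish at
  \<open>(t\<^sub>0, w\<^sub>0)\<close>, so on each \<open>Z i\<close> the orbit lands on a fixed point of \<open>g\<close>. Pull back to the cover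
  \<open>{(t, w). g t w = w}\<close> and translate \<open>w\<close> to \<open>0\<close>; the landing point lifts \<open>Z i\<close> to the cover. If
  the local degree \<open>e\<close> at \<open>w\<close> were constant near \<open>(t\<^sub>0, w\<^sub>0)\<close>, then \<open>g t z - w\<close> would be
  \<open>(z - w)^e\<close> times a function not vanishing at \<open>w\<close>, and on every \<open>Z i\<close> the orbit would land no
  later than that of \<open>(t\<^sub>0, z\<^sub>0)\<close>; but only finitely many \<open>Z i\<close> satisfy \<open>g^(n+1)(z) = g^n(z)\<close>
  for a given \<open>n\<close>. Super-attraction follows, since otherwise the local degree is \<open>1\<close> near \<open>(t\<^sub>0, w\<^sub>0)\<close>.
\<close>

text \<open>The field may be countable, so pointwise preperiodicity bounds neither period nor
  preperiod by counting, and it has no preferred ring of integers in which to reduce. The places are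
  therefore built by hand: a finitely generated ring containing all coefficients in sight is
  enlarged, inside the field itself, to a valuation ring. The residue field may be infinite;
  finiteness comes from fixing the residues of the basis coordinates, since each remaining
  coordinate is then a root of one fixed residual polynomial. Residual equality does not lift. The
  true period can exceed the residual one by the order of the residual multiplier and an unknown
  power of the residue characteristic, and an orbit may stay in the residue class of its limit
  without reaching it. The first failure concerns only derivatives along the orbit; the second needs
  the order of contact at the limit, which may jump, so it is controlled on each component of the
  fixed-point cover separately. Codimension is given only by chains of closed sets. Every dimension
  argument is hence phrased as a chain of length two that is excluded, or projected to one that
  is.\<close>

definition fun_ring :: "('x \<Rightarrow> 'r::comm_ring_1) set \<Rightarrow> bool" where
  "fun_ring S \<longleftrightarrow> (\<lambda>_. 0) \<in> S \<and> (\<lambda>_. 1) \<in> S \<and> (\<forall>f\<in>S. (\<lambda>x. - f x) \<in> S) \<and>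
     (\<forall>f\<in>S. \<forall>g\<in>S. (\<lambda>x. f x + g x) \<in> S \<and> (\<lambda>x. f x * g x) \<in> S)"

definition vanishes :: "'x set \<Rightarrow> ('x \<Rightarrow> 'r::zero) \<Rightarrow> bool" where
  "vanishes Y f \<longleftrightarrow> (\<forall>x\<in>Y. f x = 0)"

text \<open>The functions of \<open>S\<close> vanishing on \<open>Y\<close> form a prime ideal. The
  quotient domain and its fraction field are never formed: statements about them are made on
  \<open>Y\<close>, after multiplication by a function that does not vanish identically
  there.\<close>

definition irreducible_on :: "('x \<Rightarrow> 'r::comm_ring_1) set \<Rightarrow> 'x set \<Rightarrow> bool" where
  "irreducible_on S Y \<longleftrightarrow> Y \<noteq> {} \<and>
     (\<forall>f\<in>S. \<forall>g\<in>S. vanishes Y (\<lambda>x. f x * g x) \<longrightarrow> vanishes Y f \<or> vanishes Y g)"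

text \<open>A model of the polynomial ring over \<open>S\<close> by functions. The degree bound is
  uniform because degrees may drop at single points; without it infinitely many coefficient
  functions could be nonzero.\<close>

definition poly_maps :: "('x \<Rightarrow> 'r::comm_ring_1) set \<Rightarrow> ('x \<Rightarrow> 'r poly) set" where
  "poly_maps S = {F. (\<exists>D. \<forall>x. degree (F x) \<le> D) \<and> (\<forall>i. (\<lambda>x. coeff (F x) i) \<in> S)}"

definition adjoin :: "('x \<Rightarrow> 'r::comm_ring_1) set \<Rightarrow> ('x \<Rightarrow> 'r) \<Rightarrow> ('x \<Rightarrow> 'r) set" where
  "adjoin S w = {\<lambda>x. poly (F x) (w x) | F. F \<in> poly_maps S}"

context
  fixes S :: "('x \<Rightarrow> 'r::comm_ring_1) set"
  assumes S: "fun_ring S"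
begin

lemma fr_0: "(\<lambda>_. 0) \<in> S" and fr_1: "(\<lambda>_. 1) \<in> S"
  and fr_uminus: "f \<in> S \<Longrightarrow> (\<lambda>x. - f x) \<in> S"
  and fr_add: "f \<in> S \<Longrightarrow> g \<in> S \<Longrightarrow> (\<lambda>x. f x + g x) \<in> S"
  and fr_mult: "f \<in> S \<Longrightarrow> g \<in> S \<Longrightarrow> (\<lambda>x. f x * g x) \<in> S"
  using S by (auto simp: fun_ring_def)

lemma fr_diff: "f \<in> S \<Longrightarrow> g \<in> S \<Longrightarrow> (\<lambda>x. f x - g x) \<in> S"
  using fr_add[of f "\<lambda>x. - g x"] fr_uminus[of g] by simp

lemma fr_sum: "(\<And>i. i \<in> A \<Longrightarrow> f i \<in> S) \<Longrightarrow> (\<lambda>x. \<Sum>i\<in>A. f i x) \<in> S"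
  by (induction A rule: infinite_finite_induct) (auto intro: fr_0 fr_add)

lemma fr_prod: "(\<And>i. i \<in> A \<Longrightarrow> f i \<in> S) \<Longrightarrow> (\<lambda>x. \<Prod>i\<in>A. f i x) \<in> S"
  by (induction A rule: infinite_finite_induct) (auto intro: fr_1 fr_mult)

lemma fr_power: "f \<in> S \<Longrightarrow> (\<lambda>x. f x ^ n) \<in> S"
  by (induction n) (auto intro: fr_1 fr_mult)

lemma pm_const: "f \<in> S \<Longrightarrow> (\<lambda>x. [:f x:]) \<in> poly_maps S"
proof -
  assume f: "f \<in> S"
  have "(\<lambda>x. coeff [:f x:] i) \<in> S" for i
    using f fr_0 by (cases i) auto
  moreover have "\<forall>x. degree [:f x:] \<le> 0" by simp
  ultimately show ?thesis unfolding poly_maps_def by blast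
qed

lemma pm_monom: "f \<in> S \<Longrightarrow> (\<lambda>x. monom (f x) k) \<in> poly_maps S"
proof -
  assume f: "f \<in> S"
  have "(\<lambda>x. if k = i then f x else 0) \<in> S" for i
    using f fr_0 by (cases "k = i") auto
  hence "(\<lambda>x. coeff (monom (f x) k) i) \<in> S" for i by simp
  moreover have "\<forall>x. degree (monom (f x) k) \<le> k" using degree_monom_le by blast
  ultimately show ?thesis unfolding poly_maps_def by blast
qed

lemma pm_fun_ring: "fun_ring (poly_maps S)"
  unfolding fun_ring_def
proof (intro conjI ballI)
  show "(\<lambda>_. 0) \<in> poly_maps S" using fr_0 by (auto simp: poly_maps_def)
  show "(\<lambda>_. 1) \<in> poly_maps S" using pm_const[OF fr_1] by (simp add: one_pCons)
  fix F assume F: "F \<in> poly_maps S"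
  then obtain D where D: "\<And>x. degree (F x) \<le> D" by (auto simp: poly_maps_def)
  show "(\<lambda>x. - F x) \<in> poly_maps S" using F fr_uminus by (auto simp: poly_maps_def)
  fix G assume G: "G \<in> poly_maps S"
  then obtain E where E: "\<And>x. degree (G x) \<le> E" by (auto simp: poly_maps_def)
  have "degree (F x + G x) \<le> max D E" for x
    by (meson D E degree_add_le_max le_max_iff_disj max.cobounded1 max.cobounded2 max.mono order_trans)
  thus "(\<lambda>x. F x + G x) \<in> poly_maps S" using F G fr_add by (auto simp: poly_maps_def)
  have "degree (F x * G x) \<le> D + E" for x
    by (meson D E add_mono degree_mult_le order_trans)
  moreover have "(\<lambda>x. coeff (F x * G x) i) \<in> S" for i
    using F G unfolding coeff_mult by (intro fr_sum fr_mult) (auto simp: poly_maps_def)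
  ultimately show "(\<lambda>x. F x * G x) \<in> poly_maps S" by (auto simp: poly_maps_def)
qed

lemma pm_coeff: "F \<in> poly_maps S \<Longrightarrow> (\<lambda>x. coeff (F x) i) \<in> S"
  by (simp add: poly_maps_def)

lemma pm_cutoff: "F \<in> poly_maps S \<Longrightarrow> (\<lambda>x. poly_cutoff n (F x)) \<in> poly_maps S"
proof -
  assume F: "F \<in> poly_maps S"
  then obtain D where D: "\<And>x. degree (F x) \<le> D" by (auto simp: poly_maps_def)
  have "degree (poly_cutoff n (F x)) \<le> D" for x
    by (rule degree_le) (use D in \<open>auto simp: coeff_poly_cutoff intro!: coeff_eq_0 order.strict_trans1[OF D]\<close>)
  moreover have "(\<lambda>x. coeff (poly_cutoff n (F x)) i) \<in> S" for i
    using F fr_0 by (cases "i < n") (auto simp: coeff_poly_cutoff poly_maps_def)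
  ultimately show ?thesis by (auto simp: poly_maps_def)
qed

lemma pm_smult: "f \<in> S \<Longrightarrow> F \<in> poly_maps S \<Longrightarrow> (\<lambda>x. smult (f x) (F x)) \<in> poly_maps S"
proof -
  assume f: "f \<in> S" and F: "F \<in> poly_maps S"
  obtain D where "\<And>x. degree (F x) \<le> D" using F by (auto simp: poly_maps_def)
  hence "\<forall>x. degree (smult (f x) (F x)) \<le> D" using degree_smult_le order_trans by blast
  moreover have "(\<lambda>x. coeff (smult (f x) (F x)) i) \<in> S" for i
    using fr_mult[OF f pm_coeff[OF F]] by simp
  ultimately show ?thesis unfolding poly_maps_def by blast
qed

lemma pm_X: "(\<lambda>x. [:0, 1:]) \<in> poly_maps S"
  using pm_monom[OF fr_1, of 1] by (simp add: monom_altdef)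

end

lemma pcompose_power: "(p ^ n) \<circ>\<^sub>p q = (p \<circ>\<^sub>p q) ^ n" for p q :: "'r::comm_ring_1 poly"
  by (induction n) (simp_all add: pcompose_1 pcompose_mult)

lemma poly_maps_pcompose:
  assumes S: "fun_ring S" and F: "F \<in> poly_maps S" and G: "G \<in> poly_maps S"
  shows "(\<lambda>x. F x \<circ>\<^sub>p G x) \<in> poly_maps S"
proof -
  obtain D where D: "\<And>x. degree (F x) \<le> D" using F by (auto simp: poly_maps_def)
  have "F x \<circ>\<^sub>p G x = (\<Sum>i\<le>D. smult (coeff (F x) i) (G x ^ i))" for x
  proof -
    have "F x = (\<Sum>i\<le>D. monom (coeff (F x) i) i)"
      using D by (simp add: poly_as_sum_of_monoms')
    hence "F x \<circ>\<^sub>p G x = (\<Sum>i\<le>D. monom (coeff (F x) i) i) \<circ>\<^sub>p G x" by simp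
    also have "\<dots> = (\<Sum>i\<le>D. smult (coeff (F x) i) (G x ^ i))"
      by (simp add: pcompose_sum monom_altdef pcompose_smult pcompose_pCons pcompose_power)
    finally show ?thesis .
  qed
  moreover have "(\<lambda>x. \<Sum>i\<le>D. smult (coeff (F x) i) (G x ^ i)) \<in> poly_maps S"
    using F G by (intro fr_sum[OF pm_fun_ring[OF S]] pm_smult[OF S] pm_coeff[OF S] fr_power[OF pm_fun_ring[OF S]])
  ultimately show ?thesis by simp
qed

lemma adjoin_fun_ring:
  assumes S: "fun_ring S"
  shows "fun_ring (adjoin S w)"
proof -
  note R = pm_fun_ring[OF S]
  have I: "\<And>F. F \<in> poly_maps S \<Longrightarrow> (\<lambda>x. poly (F x) (w x)) \<in> adjoin S w"
    by (auto simp: adjoin_def)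
  show ?thesis unfolding fun_ring_def
  proof (intro conjI ballI)
    show "(\<lambda>_. 0) \<in> adjoin S w" using I[OF fr_0[OF R]] by simp
    show "(\<lambda>_. 1) \<in> adjoin S w" using I[OF fr_1[OF R]] by simp
    fix f assume "f \<in> adjoin S w"
    then obtain F where F: "F \<in> poly_maps S" "f = (\<lambda>x. poly (F x) (w x))" by (auto simp: adjoin_def)
    show "(\<lambda>x. - f x) \<in> adjoin S w" using I[OF fr_uminus[OF R F(1)]] F by simp
    fix g assume "g \<in> adjoin S w"
    then obtain G where G: "G \<in> poly_maps S" "g = (\<lambda>x. poly (G x) (w x))" by (auto simp: adjoin_def)
    show "(\<lambda>x. f x + g x) \<in> adjoin S w" using I[OF fr_add[OF R F(1) G(1)]] F G by simp
    show "(\<lambda>x. f x * g x) \<in> adjoin S w" using I[OF fr_mult[OF R F(1) G(1)]] F G by simp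
  qed
qed

lemma adjoinI: "F \<in> poly_maps S \<Longrightarrow> (\<lambda>x. poly (F x) (w x)) \<in> adjoin S w"
  by (auto simp: adjoin_def)

lemma adjoin_base: "fun_ring S \<Longrightarrow> f \<in> S \<Longrightarrow> f \<in> adjoin S w"
  using adjoinI[OF pm_const, of S f w] by simp

lemma adjoin_self: "fun_ring S \<Longrightarrow> w \<in> adjoin S w"
  using adjoinI[OF pm_X, of S w] by simp

section \<open>Irreducible sets, pseudo-division and algebraic elements\<close>

lemma irreducible_on_mono: "irreducible_on S Y \<Longrightarrow> S' \<subseteq> S \<Longrightarrow> irreducible_on S' Y"
  unfolding irreducible_on_def by blast

lemma irreducible_on_mult:
  "irreducible_on S Y \<Longrightarrow> f \<in> S \<Longrightarrow> g \<in> S \<Longrightarrow> vanishes Y (\<lambda>x. f x * g x) \<Longrightarrow> \<not> vanishes Y f \<Longrightarrow> vanishes Y g"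
  unfolding irreducible_on_def by blast

lemma irreducible_on_power:
  fixes f :: "'x \<Rightarrow> 'r::comm_ring_1"
  assumes S: "fun_ring S" and irr: "irreducible_on S Y" and f: "f \<in> S" and nz: "\<not> vanishes Y f"
  shows "\<not> vanishes Y (\<lambda>x. f x ^ n)"
proof (induction n)
  case 0
  thus ?case using nz irr by (auto simp: vanishes_def irreducible_on_def)
next
  case (Suc n)
  show ?case using irreducible_on_mult[OF irr f fr_power[OF S f], of n] Suc nz by auto
qed

text \<open>The coefficient \<open>coeff (F x) e\<close> is in general no unit and may vanish at
  some points, so \<open>e\<close> is a formal degree and each division step multiplies by that
  coefficient. The bound on the degree of \<open>Q\<close> later shows a cofactor to be shorter than
  the minimal polynomial.\<close>

lemma pseudo_division:
  fixes F G :: "'x \<Rightarrow> 'r::comm_ring_1 poly"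
  assumes S: "fun_ring S" and F: "F \<in> poly_maps S" and G: "G \<in> poly_maps S"
    and e: "\<And>x. degree (F x) \<le> e" "e \<ge> 1" and D: "\<And>x. degree (G x) \<le> D"
  shows "\<exists>s Q R. Q \<in> poly_maps S \<and> R \<in> poly_maps S \<and>
    (\<forall>x. smult (coeff (F x) e ^ s) (G x) = Q x * F x + R x) \<and>
    (\<forall>x. degree (R x) < e) \<and> (\<forall>x. degree (Q x) \<le> D - e)"
  using G D
proof (induction D arbitrary: G rule: less_induct)
  case (less D G)
  note R = pm_fun_ring[OF S]
  show ?case
  proof (cases "D < e")
    case True
    have "\<forall>x. degree (G x) < e" using less.prems(2) True order.strict_trans1 by blast
    thus ?thesis
      using fr_0[OF R] less.prems by (intro exI[of _ 0] exI[of _ "\<lambda>_. 0"] exI[of _ G]) auto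
  next
    case False
    let ?M = "\<lambda>x. monom (coeff (G x) D) (D - e)"
    define G' where "G' = (\<lambda>x. smult (coeff (F x) e) (G x) - ?M x * F x)"
    have M: "?M \<in> poly_maps S" by (intro pm_monom[OF S] pm_coeff[OF S] less.prems)
    have G': "G' \<in> poly_maps S" unfolding G'_def
      by (intro fr_diff[OF R] fr_mult[OF R] M F pm_smult[OF S] pm_coeff[OF S] less.prems)
    have deg: "degree (G' x) \<le> D - 1" for x
    proof (rule degree_le, intro allI impI)
      fix i assume i: "i > D - 1"
      have c: "coeff (?M x * F x) i = (if i < D - e then 0 else coeff (G x) D * coeff (F x) (i - (D - e)))"
        using False by (simp add: coeff_monom_mult)
      show "coeff (G' x) i = 0"
      proof (cases "i = D")
        case True
        thus ?thesis using False c by (simp add: G'_def algebra_simps)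
      next
        case ne: False
        hence "i > D" using i by simp
        moreover have "coeff (G x) i = 0" using less.prems(2)[of x] \<open>i > D\<close> by (intro coeff_eq_0) auto
        moreover have "coeff (F x) (i - (D - e)) = 0"
          using e(1)[of x] \<open>i > D\<close> False by (intro coeff_eq_0) auto
        ultimately show ?thesis using c by (simp add: G'_def)
      qed
    qed
    have "D - 1 < D" using False e(2) by simp
    from less.IH[OF this G' deg] obtain s Q T where
      IH: "Q \<in> poly_maps S" "T \<in> poly_maps S" "\<And>x. smult (coeff (F x) e ^ s) (G' x) = Q x * F x + T x"
      "\<And>x. degree (T x) < e" "\<And>x. degree (Q x) \<le> D - 1 - e" by blast
    define Q' where "Q' = (\<lambda>x. Q x + smult (coeff (F x) e ^ s) (?M x))"
    have Q': "Q' \<in> poly_maps S" unfolding Q'_def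
      by (intro fr_add[OF R] IH pm_smult[OF S] fr_power[OF S] pm_coeff[OF S] F M)
    have "smult (coeff (F x) e ^ Suc s) (G x) = Q' x * F x + T x" for x
    proof -
      have "smult (coeff (F x) e ^ Suc s) (G x)
          = smult (coeff (F x) e ^ s) (G' x) + smult (coeff (F x) e ^ s) (?M x * F x)"
        by (simp add: G'_def smult_diff_right algebra_simps)
      thus ?thesis by (simp add: IH(3) Q'_def algebra_simps)
    qed
    moreover have "degree (Q' x) \<le> D - e" for x
    proof -
      have "degree (smult (coeff (F x) e ^ s) (?M x)) \<le> D - e"
        using degree_smult_le degree_monom_le order_trans by blast
      moreover have "degree (Q x) \<le> D - e" using IH(5)[of x] by linarith
      ultimately show ?thesis unfolding Q'_def by (intro degree_add_le)
    qed
    ultimately show ?thesis using Q' IH by blast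
  qed
qed

text \<open>Coefficients that vanish on \<open>Y\<close> may be nonzero elsewhere. Cutting them off
  turns the generic degree on \<open>Y\<close> into a bound valid everywhere, as pseudo-division
  requires.\<close>

lemma poly_maps_top_coeff:
  fixes F :: "'x \<Rightarrow> 'r::comm_ring_1 poly"
  assumes S: "fun_ring S" and F: "F \<in> poly_maps S" and nz: "\<not> vanishes Y (\<lambda>x. coeff (F x) i)"
  shows "\<exists>j. \<exists>F'\<in>poly_maps S. (\<forall>x. degree (F' x) \<le> j) \<and> \<not> vanishes Y (\<lambda>x. coeff (F' x) j) \<and>
    (\<forall>x\<in>Y. F' x = F x) \<and> (\<forall>B. (\<forall>x\<in>Y. degree (F x) \<le> B) \<longrightarrow> j \<le> B)"
proof -
  obtain D where D: "\<And>x. degree (F x) \<le> D" using F by (auto simp: poly_maps_def)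
  let ?P = "\<lambda>i. \<not> vanishes Y (\<lambda>x. coeff (F x) i)"
  have bd: "j \<le> B" if "\<And>x. x \<in> Y \<Longrightarrow> degree (F x) \<le> B" "?P j" for B j
    using that by (meson coeff_eq_0 linorder_not_less order.strict_trans1 vanishes_def)
  define j where "j = (GREATEST i. ?P i)"
  have Pj: "?P j" unfolding j_def by (rule GreatestI_nat[of ?P i D]) (use nz bd D in auto)
  have le: "i \<le> j" if "?P i" for i unfolding j_def by (rule Greatest_le_nat[of ?P i D]) (use that bd D in auto)
  define F' where "F' = (\<lambda>x. poly_cutoff (Suc j) (F x))"
  have eq: "F' x = F x" if "x \<in> Y" for x
  proof (rule poly_eqI)
    fix n
    have "coeff (F x) n = 0" if "n > j" using le[of n] that \<open>x \<in> Y\<close> by (auto simp: vanishes_def)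
    thus "coeff (F' x) n = coeff (F x) n" by (auto simp: F'_def coeff_poly_cutoff)
  qed
  have deg: "degree (F' x) \<le> j" for x unfolding F'_def by (rule degree_le) (auto simp: coeff_poly_cutoff)
  have nv: "\<not> vanishes Y (\<lambda>x. coeff (F' x) j)" using Pj by (simp add: F'_def coeff_poly_cutoff)
  have "\<forall>B. (\<forall>x\<in>Y. degree (F x) \<le> B) \<longrightarrow> j \<le> B" using bd Pj by blast
  moreover have "F' \<in> poly_maps S" unfolding F'_def by (rule pm_cutoff[OF S F])
  ultimately show ?thesis using eq deg nv by blast
qed

definition algebraic_over :: "('x \<Rightarrow> 'r::comm_ring_1) set \<Rightarrow> 'x set \<Rightarrow> ('x \<Rightarrow> 'r) \<Rightarrow> bool" where
  "algebraic_over S Y w \<longleftrightarrow> (\<exists>F\<in>poly_maps S. vanishes Y (\<lambda>x. poly (F x) (w x)) \<and>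
     (\<exists>i. \<not> vanishes Y (\<lambda>x. coeff (F x) i)))"

text \<open>A minimal polynomial over the fraction field of the functions on \<open>Y\<close>, with
  denominators cleared and hence not monic. Minimality is tested with formal degrees and up to
  coefficients vanishing on \<open>Y\<close>.\<close>

definition min_polynomial where
  "min_polynomial S Y w F e \<longleftrightarrow> F \<in> poly_maps S \<and> e \<ge> 1 \<and> (\<forall>x. degree (F x) \<le> e) \<and>
     vanishes Y (\<lambda>x. poly (F x) (w x)) \<and> \<not> vanishes Y (\<lambda>x. coeff (F x) e) \<and>
     (\<forall>G\<in>poly_maps S. (\<forall>x. degree (G x) < e) \<longrightarrow> vanishes Y (\<lambda>x. poly (G x) (w x)) \<longrightarrow>
        (\<forall>i. vanishes Y (\<lambda>x. coeff (G x) i)))"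

lemma min_polynomial_exists:
  assumes S: "fun_ring S" and alg: "algebraic_over S Y w"
  shows "\<exists>F e. min_polynomial S Y w F e"
proof -
  define A where "A e F \<longleftrightarrow> F \<in> poly_maps S \<and> (\<forall>x. degree (F x) \<le> e) \<and>
     vanishes Y (\<lambda>x. poly (F x) (w x)) \<and> \<not> vanishes Y (\<lambda>x. coeff (F x) e)" for e F
  have top: "\<exists>j F'. A j F' \<and> (\<forall>B. (\<forall>x\<in>Y. degree (F x) \<le> B) \<longrightarrow> j \<le> B)"
    if F: "F \<in> poly_maps S" "vanishes Y (\<lambda>x. poly (F x) (w x))" "\<not> vanishes Y (\<lambda>x. coeff (F x) i)" for F i
  proof -
    obtain j F' where "F' \<in> poly_maps S" "\<forall>x. degree (F' x) \<le> j" "\<not> vanishes Y (\<lambda>x. coeff (F' x) j)"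
      "\<forall>x\<in>Y. F' x = F x" "\<forall>B. (\<forall>x\<in>Y. degree (F x) \<le> B) \<longrightarrow> j \<le> B"
      using poly_maps_top_coeff[OF S F(1,3)] by blast
    thus ?thesis using F(2) by (intro exI[of _ j] exI[of _ F']) (auto simp: A_def vanishes_def)
  qed
  define e where "e = (LEAST e. \<exists>F. A e F)"
  have "\<exists>e F. A e F" using alg top unfolding algebraic_over_def by blast
  then obtain F where F: "A e F" 
    using LeastI_ex[of "\<lambda>e. \<exists>F. A e F"] unfolding e_def by blast
  have "e \<noteq> 0"
  proof
    assume "e = 0"
    hence "degree (F x) = 0" for x using F by (simp add: A_def)
    hence "poly (F x) (w x) = coeff (F x) 0" for x
      by (metis degree_eq_zeroE poly_pCons poly_0 mult_zero_right add_0_right coeff_pCons_0)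
    thus False using F \<open>e = 0\<close> by (simp add: A_def)
  qed
  moreover have "vanishes Y (\<lambda>x. coeff (G x) i)"
    if G: "G \<in> poly_maps S" "\<forall>x. degree (G x) < e" "vanishes Y (\<lambda>x. poly (G x) (w x))" for G i
  proof (rule ccontr)
    assume "\<not> ?thesis"
    from top[OF G(1,3) this] obtain j F' where "A j F'" "\<forall>B. (\<forall>x\<in>Y. degree (G x) \<le> B) \<longrightarrow> j \<le> B" by blast
    hence "j \<le> e - 1" using G(2) by (metis Suc_diff_1 \<open>e \<noteq> 0\<close> gr0I less_Suc_eq_le)
    moreover have "e \<le> j" using \<open>A j F'\<close> unfolding e_def by (intro Least_le) blast
    ultimately show False using \<open>e \<noteq> 0\<close> by simp
  qed
  ultimately show ?thesis using F by (intro exI[of _ F] exI[of _ e]) (auto simp: A_def min_polynomial_def)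
qed

text \<open>The pseudo-remainder vanishes at \<open>w\<close> on \<open>Y\<close> and has degree
  below \<open>e\<close>, so minimality kills its coefficients on \<open>Y\<close>.\<close>

lemma min_polynomial_divides:
  assumes S: "fun_ring S" and m: "min_polynomial S Y w F e" and G: "G \<in> poly_maps S"
    and v: "vanishes Y (\<lambda>x. poly (G x) (w x))"
  shows "\<exists>s Q R. Q \<in> poly_maps S \<and> R \<in> poly_maps S \<and>
    (\<forall>x. smult (coeff (F x) e ^ s) (G x) = Q x * F x + R x) \<and> (\<forall>i. vanishes Y (\<lambda>x. coeff (R x) i))"
proof -
  note m' = m[unfolded min_polynomial_def]
  obtain D where "\<And>x. degree (G x) \<le> D" using G by (auto simp: poly_maps_def)
  then obtain s Q R where d: "Q \<in> poly_maps S" "R \<in> poly_maps S"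
    "\<And>x. smult (coeff (F x) e ^ s) (G x) = Q x * F x + R x" "\<forall>x. degree (R x) < e"
    using pseudo_division[OF S _ G, of F e D] m' by blast
  have "poly (R x) (w x) = 0" if "x \<in> Y" for x
    using arg_cong[OF d(3)[of x], of "\<lambda>p. poly p (w x)"] v m' that by (auto simp: vanishes_def)
  hence "vanishes Y (\<lambda>x. poly (R x) (w x))" by (simp add: vanishes_def)
  hence "\<forall>i. vanishes Y (\<lambda>x. coeff (R x) i)" using m' d by blast
  thus ?thesis using d by blast
qed

text \<open>Stands for inverting \<open>h\<close> in an algebraic extension. Among the multiples of
  \<open>h\<close> that do not vanish on \<open>Y\<close>, one of least degree in \<open>w\<close>
  is taken; a positive degree would produce, by pseudo-division, a factorisation of the minimal
  polynomial.\<close>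

lemma min_polynomial_associate:
  fixes w :: "'x \<Rightarrow> 'r::comm_ring_1"
  assumes S: "fun_ring S" and irr: "irreducible_on (adjoin S w) Y" and alg: "algebraic_over S Y w"
    and h: "h \<in> adjoin S w" "\<not> vanishes Y h"
  shows "\<exists>b\<in>adjoin S w. \<exists>r\<in>S. \<not> vanishes Y r \<and> (\<forall>x\<in>Y. b x * h x = r x)"
proof -
  obtain F e where m: "min_polynomial S Y w F e" using min_polynomial_exists[OF S alg] by blast
  have F: "F \<in> poly_maps S" "e \<ge> 1" "\<And>x. degree (F x) \<le> e" "\<And>x. x \<in> Y \<Longrightarrow> poly (F x) (w x) = 0"
     and nz: "\<not> vanishes Y (\<lambda>x. coeff (F x) e)"
    and min: "\<And>G i. G \<in> poly_maps S \<Longrightarrow> (\<And>x. degree (G x) < e) \<Longrightarrow> vanishes Y (\<lambda>x. poly (G x) (w x)) \<Longrightarrow>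
        vanishes Y (\<lambda>x. coeff (G x) i)"
    using m unfolding min_polynomial_def vanishes_def by blast+
  note A = adjoin_fun_ring[OF S, of w] and base = adjoin_base[OF S, of _ w]
  define B where "B n b R \<longleftrightarrow> b \<in> adjoin S w \<and> R \<in> poly_maps S \<and> (\<forall>x. degree (R x) \<le> n) \<and>
    \<not> vanishes Y (\<lambda>x. poly (R x) (w x)) \<and> (\<forall>x\<in>Y. b x * h x = poly (R x) (w x))" for n b R
  have ex: "\<exists>n. \<exists>b R. B n b R"
  proof -
    obtain R where R: "R \<in> poly_maps S" "h = (\<lambda>x. poly (R x) (w x))" using h by (auto simp: adjoin_def)
    then obtain D where "\<forall>x. degree (R x) \<le> D" by (auto simp: poly_maps_def)
    hence "B D (\<lambda>_. 1) R" using R h fr_1[OF A] by (auto simp: B_def)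
    thus ?thesis by blast
  qed
  define n where "n = (LEAST n. \<exists>b R. B n b R)"
  obtain b R where B: "B n b R" using LeastI_ex[OF ex] unfolding n_def by blast
  have least: "n \<le> n'" if "B n' b' R'" for n' b' R' unfolding n_def using that by (intro Least_le) blast
  have b: "b \<in> adjoin S w" and R: "R \<in> poly_maps S" and dR: "\<And>x. degree (R x) \<le> n"
    and nv: "\<not> vanishes Y (\<lambda>x. poly (R x) (w x))" and bh: "\<And>x. x \<in> Y \<Longrightarrow> b x * h x = poly (R x) (w x)"
    using B by (auto simp: B_def)
  have "n = 0"
  proof (rule ccontr)
    assume "n \<noteq> 0"
    \<comment> \<open>A longer \<open>R\<close> could be reduced modulo \<open>F\<close>; the factor
      \<open>coeff (F x) e ^ s\<close> does not vanish identically on \<open>Y\<close>, so the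
      multiple of \<open>h\<close> stays nonzero.\<close>
    have ne: "n < e"
    proof (rule ccontr)
      assume "\<not> n < e"
      obtain s Q T where d: "T \<in> poly_maps S" "Q \<in> poly_maps S"
        "\<And>x. smult (coeff (F x) e ^ s) (R x) = Q x * F x + T x" "\<forall>x. degree (T x) < e"
        using pseudo_division[OF S F(1) R F(3,2) dR] by blast
      have e: "poly (T x) (w x) = coeff (F x) e ^ s * b x * h x" if "x \<in> Y" for x
        using arg_cong[OF d(3)[of x], of "\<lambda>p. poly p (w x)"] F(4)[OF that] bh[OF that]
        by (simp add: mult.assoc)
      have "\<not> vanishes Y (\<lambda>x. coeff (F x) e ^ s)"
        by (rule irreducible_on_power[OF A irr base[OF pm_coeff[OF S F(1)]] nz])
      hence "\<not> vanishes Y (\<lambda>x. coeff (F x) e ^ s * poly (R x) (w x))"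
        using irreducible_on_mult[OF irr base[OF fr_power[OF S pm_coeff[OF S F(1)]]] adjoinI[OF R]] nv by blast
      moreover have "poly (T x) (w x) = coeff (F x) e ^ s * poly (R x) (w x)" if "x \<in> Y" for x
        using e[OF that] bh[OF that] by (simp add: mult.assoc)
      ultimately have "\<not> vanishes Y (\<lambda>x. poly (T x) (w x))" by (auto simp: vanishes_def)
      moreover have "degree (T x) \<le> e - 1" for x using d(4) F(2) by (metis Suc_diff_1 less_Suc_eq_le less_eq_Suc_le One_nat_def)
      ultimately have "B (e - 1) (\<lambda>x. coeff (F x) e ^ s * b x) T"
        unfolding B_def using d(1) e fr_mult[OF A base[OF fr_power[OF S pm_coeff[OF S F(1)]]] b, of e s] by simp
      from least[OF this] show False using \<open>\<not> n < e\<close> F(2) by linarith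
    qed
    have nzn: "\<not> vanishes Y (\<lambda>x. coeff (R x) n)"
    proof
      assume v: "vanishes Y (\<lambda>x. coeff (R x) n)"
      have eq: "poly_cutoff n (R x) = R x" if "x \<in> Y" for x
      proof (rule poly_eqI)
        fix i
        have "coeff (R x) i = 0" if "i > n" using dR[of x] that by (intro coeff_eq_0) simp
        moreover have "coeff (R x) n = 0" using v \<open>x \<in> Y\<close> by (simp add: vanishes_def)
        ultimately show "coeff (poly_cutoff n (R x)) i = coeff (R x) i"
          by (cases "i = n") (auto simp: coeff_poly_cutoff not_less)
      qed
      have "degree (poly_cutoff n (R x)) \<le> n - 1" for x
        by (rule degree_le) (auto simp: coeff_poly_cutoff)
      hence "B (n - 1) b (\<lambda>x. poly_cutoff n (R x))"
        using b pm_cutoff[OF S R] nv bh eq by (auto simp: B_def vanishes_def)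
      from least[OF this] show False using \<open>n \<noteq> 0\<close> by simp
    qed
    have "n \<ge> 1" using \<open>n \<noteq> 0\<close> by simp
    \<comment> \<open>The remainder \<open>T(w)\<close> is again a multiple of \<open>h\<close>, of
      degree below \<open>n\<close>, so it vanishes on \<open>Y\<close>, and \<open>T\<close> with
      it. Then \<open>Q(w) * R(w) = 0\<close>, so \<open>Q\<close> vanishes too, having degree below
      \<open>e\<close>; the product of the leading coefficients of \<open>R\<close> and
      \<open>F\<close> would be zero.\<close>
    obtain s Q T where d: "Q \<in> poly_maps S" "T \<in> poly_maps S"
      "\<And>x. smult (coeff (R x) n ^ s) (F x) = Q x * R x + T x" "\<And>x. degree (T x) < n" "\<And>x. degree (Q x) \<le> e - n"
      using pseudo_division[OF S R F(1) dR \<open>n \<ge> 1\<close> F(3)] by blast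
    have T: "poly (T x) (w x) = - poly (Q x) (w x) * b x * h x" if "x \<in> Y" for x
      using arg_cong[OF d(3)[of x], of "\<lambda>p. poly p (w x)"] F(4)[OF that] bh[OF that]
      by (simp add: mult.assoc eq_neg_iff_add_eq_0 add.commute)
    have vT: "vanishes Y (\<lambda>x. poly (T x) (w x))"
    proof (rule ccontr)
      assume "\<not> ?thesis"
      moreover have "degree (T x) \<le> n - 1" for x using d(4)[of x] by simp
      ultimately have "B (n - 1) (\<lambda>x. - poly (Q x) (w x) * b x) T"
        using d(2) T fr_mult[OF A fr_uminus[OF A adjoinI[OF d(1)]] b] by (auto simp: B_def)
      from least[OF this] show False using \<open>n \<noteq> 0\<close> by simp
    qed
    have cT: "vanishes Y (\<lambda>x. coeff (T x) i)" for i
      using min[OF d(2) _ vT] d(4) ne less_trans by blast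
    have "poly (Q x) (w x) * poly (R x) (w x) = 0" if "x \<in> Y" for x
      using arg_cong[OF d(3)[of x], of "\<lambda>p. poly p (w x)"] F(4)[OF that] vT that by (auto simp: vanishes_def)
    hence "vanishes Y (\<lambda>x. poly (R x) (w x) * poly (Q x) (w x))" by (auto simp: vanishes_def mult.commute)
    hence "vanishes Y (\<lambda>x. poly (Q x) (w x))"
      using irreducible_on_mult[OF irr adjoinI[OF R] adjoinI[OF d(1)]] nv by blast
    moreover have "degree (Q x) < e" for x using d(5)[of x] \<open>n \<ge> 1\<close> F(2) by linarith
    ultimately have cQ: "vanishes Y (\<lambda>x. coeff (Q x) i)" for i using min[OF d(1)] by blast
    have "coeff (R x) n ^ s * coeff (F x) e = 0" if "x \<in> Y" for x
    proof -
      have "Q x = 0" using cQ that by (auto simp: vanishes_def poly_eq_iff)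
      moreover have "T x = 0" using cT that by (auto simp: vanishes_def poly_eq_iff)
      ultimately show ?thesis using arg_cong[OF d(3)[of x], of "\<lambda>p. coeff p e"] by simp
    qed
    hence "vanishes Y (\<lambda>x. coeff (R x) n ^ s * coeff (F x) e)" by (simp add: vanishes_def)
    thus False
      using irreducible_on_mult[OF irr base[OF fr_power[OF S pm_coeff[OF S R]]] base[OF pm_coeff[OF S F(1)]]]
        irreducible_on_power[OF A irr base[OF pm_coeff[OF S R]] nzn] nz by blast
  qed
  hence e: "poly (R x) (w x) = coeff (R x) 0" for x
    using dR[of x] by (auto elim!: degree_eq_zeroE)
  show ?thesis
    using b pm_coeff[OF S R, of 0] nv bh unfolding e by blast
qed

text \<open>Primes of \<open>adjoin S w\<close> with the same trace on \<open>S\<close> cannot be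
  strictly nested: a function not vanishing on \<open>Y\<close> has a nonzero multiple in
  \<open>S\<close>, and that multiple would vanish on \<open>W\<close>.\<close>

lemma algebraic_incomparability:
  fixes w :: "'x \<Rightarrow> 'r::comm_ring_1"
  assumes S: "fun_ring S" and irr: "irreducible_on (adjoin S w) Y" and alg: "algebraic_over S Y w"
    and sub: "W \<subseteq> Y" and eq: "\<And>f. f \<in> S \<Longrightarrow> vanishes W f \<Longrightarrow> vanishes Y f"
    and h: "h \<in> adjoin S w" "vanishes W h"
  shows "vanishes Y h"
proof (rule ccontr)
  assume "\<not> ?thesis"
  then obtain b r where br: "r \<in> S" "\<not> vanishes Y r" "\<forall>x\<in>Y. b x * h x = r x"
    using min_polynomial_associate[OF S irr alg h(1)] by blast
  have "r x = 0" if "x \<in> W" for x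
  proof -
    have "h x = 0" using h(2) that by (simp add: vanishes_def)
    moreover have "b x * h x = r x" using br(3) sub that by blast
    ultimately show ?thesis by simp
  qed
  hence "vanishes W r" by (simp add: vanishes_def)
  thus False using eq br by blast
qed

section \<open>Noetherian rings of functions\<close>

inductive_set ideal_of :: "('x \<Rightarrow> 'r::comm_ring_1) set \<Rightarrow> ('x \<Rightarrow> 'r) set \<Rightarrow> ('x \<Rightarrow> 'r) set" for S I where
  zero: "(\<lambda>_. 0) \<in> ideal_of S I"
| step: "r \<in> S \<Longrightarrow> g \<in> I \<Longrightarrow> f \<in> ideal_of S I \<Longrightarrow> (\<lambda>x. r x * g x + f x) \<in> ideal_of S I"

definition noetherian :: "('x \<Rightarrow> 'r::comm_ring_1) set \<Rightarrow> bool" where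
  "noetherian S \<longleftrightarrow> fun_ring S \<and> (\<forall>I\<subseteq>S. \<exists>J\<subseteq>I. finite J \<and> I \<subseteq> ideal_of S J)"

lemma ideal_of_gen: "fun_ring S \<Longrightarrow> g \<in> I \<Longrightarrow> g \<in> ideal_of S I"
  using ideal_of.step[OF fr_1 _ ideal_of.zero, of S g I] by simp

lemma ideal_of_add: "f \<in> ideal_of S I \<Longrightarrow> g \<in> ideal_of S I \<Longrightarrow> (\<lambda>x. f x + g x) \<in> ideal_of S I"
  by (induction rule: ideal_of.induct) (auto simp: add.assoc intro: ideal_of.step)

lemma ideal_of_mult:
  assumes "fun_ring S" "r \<in> S" "f \<in> ideal_of S I" shows "(\<lambda>x. r x * f x) \<in> ideal_of S I"
  using assms(3)
proof induction
  case (step q g f)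
  show ?case using ideal_of.step[OF fr_mult[OF assms(1,2) step.hyps(1)] step.hyps(2) step.IH]
    by (simp add: algebra_simps)
qed (use ideal_of.zero in simp)

lemma ideal_of_mono: "I \<subseteq> J \<Longrightarrow> f \<in> ideal_of S I \<Longrightarrow> f \<in> ideal_of S J"
  by (rotate_tac, induction rule: ideal_of.induct) (auto intro: ideal_of.intros)

lemma ideal_of_idem:
  assumes "fun_ring S" "I \<subseteq> ideal_of S J" "f \<in> ideal_of S I" shows "f \<in> ideal_of S J"
  using assms(3)
proof induction
  case (step r g f)
  have "(\<lambda>x. r x * g x) \<in> ideal_of S J"
    using assms(2) step.hyps by (intro ideal_of_mult[OF assms(1)]) auto
  from ideal_of_add[OF this step.IH] show ?case .
qed (rule ideal_of.zero)

lemma ideal_of_sub: "fun_ring S \<Longrightarrow> I \<subseteq> S \<Longrightarrow> ideal_of S I \<subseteq> S"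
proof
  fix f assume "fun_ring S" "I \<subseteq> S" "f \<in> ideal_of S I"
  from this(3) show "f \<in> S" by induction (use \<open>fun_ring S\<close> \<open>I \<subseteq> S\<close> in \<open>auto intro!: fr_0 fr_add fr_mult\<close>)
qed

lemma ideal_of_finite_support:
  assumes "f \<in> ideal_of S I" shows "\<exists>J\<subseteq>I. finite J \<and> f \<in> ideal_of S J"
  using assms
proof induction
  case zero
  show ?case by (intro exI[of _ "{}"]) (auto intro: ideal_of.zero)
next
  case (step r g f)
  then obtain J where J: "J \<subseteq> I" "finite J" "f \<in> ideal_of S J" by blast
  hence "f \<in> ideal_of S (insert g J)" using ideal_of_mono[of J "insert g J"] by blast
  thus ?case using J step by (intro exI[of _ "insert g J"]) (auto intro: ideal_of.step)
qed

lemma ideal_of_image: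
  fixes a :: "nat \<Rightarrow> _"
  assumes S: "fun_ring S" and "f \<in> ideal_of S (a ` {..<m})"
  shows "\<exists>r. (\<forall>i. r i \<in> S) \<and> f = (\<lambda>x. \<Sum>i<m. r i x * a i x)"
  using assms(2)
proof induction
  case zero
  show ?case by (intro exI[of _ "\<lambda>_ _. 0"]) (auto intro: fr_0[OF S])
next
  case (step q g f)
  then obtain r i where r: "\<forall>i. r i \<in> S" "f = (\<lambda>x. \<Sum>i<m. r i x * a i x)" "i < m" "g = a i" by blast
  define r' where "r' = (\<lambda>j x. (if j = i then q x else 0) + r j x)"
  have "r' j \<in> S" for j unfolding r'_def
    using step.hyps r fr_0[OF S] by (intro fr_add[OF S]) (cases "j = i", auto)
  moreover have "(\<Sum>j<m. r' j x * a j x) = q x * g x + f x" for x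
  proof -
    have "(\<Sum>j<m. r' j x * a j x) = (\<Sum>j<m. (if j = i then q x * a j x else 0)) + f x"
      unfolding r'_def r(2) sum.distrib[symmetric] by (intro sum.cong) (auto simp: algebra_simps)
    also have "(\<Sum>j<m. (if j = i then q x * a j x else 0)) = q x * g x"
      using r(3) unfolding r(4) by (subst sum.delta) auto
    finally show ?thesis .
  qed
  ultimately show ?case by metis
qed

lemma noetherian_constants: "noetherian (range (\<lambda>(c::'k::field) (_::'x). c))"
proof -
  let ?S = "range (\<lambda>(c::'k) (_::'x). c)"
  have S: "fun_ring ?S" by (auto simp: fun_ring_def)
  have "\<exists>J\<subseteq>I. finite J \<and> I \<subseteq> ideal_of ?S J" if I: "I \<subseteq> ?S" for I
  proof (cases "I \<subseteq> {\<lambda>_. 0}")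
    case True
    thus ?thesis using ideal_of.zero by (intro exI[of _ "{}"]) auto
  next
    case False
    then obtain c where c: "(\<lambda>_. c) \<in> I" "c \<noteq> 0" using I by auto
    have "f \<in> ideal_of ?S {\<lambda>_. c}" if f: "f \<in> I" for f
    proof -
      obtain a where a: "f = (\<lambda>_. a)" using I f by auto
      have "(\<lambda>_::'x. a / c) \<in> ?S" by simp
      from ideal_of.step[OF this singletonI[of "\<lambda>_. c"] ideal_of.zero] show ?thesis using a c by simp
    qed
    thus ?thesis using c by (intro exI[of _ "{\<lambda>_. c}"]) auto
  qed
  thus ?thesis using S by (simp add: noetherian_def)
qed

text \<open>Hilbert's argument with formal degrees: elements are picked outside the ideal generated
  by their predecessors, with least degree bound. Since \<open>S\<close> is noetherian, some leading
  coefficient is a combination of the earlier ones, and subtraction gives an element with a smaller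
  bound.\<close>

theorem hilbert_basis:
  fixes S :: "('x \<Rightarrow> 'r::comm_ring_1) set"
  assumes "noetherian S" shows "noetherian (poly_maps S)"
proof -
  have S: "fun_ring S" and N: "\<And>I. I \<subseteq> S \<Longrightarrow> \<exists>J\<subseteq>I. finite J \<and> I \<subseteq> ideal_of S J"
    using assms by (auto simp: noetherian_def)
  note R = pm_fun_ring[OF S]
  have fg: "\<exists>J\<subseteq>K. finite J \<and> K \<subseteq> ideal_of (poly_maps S) J"
    if K: "K \<subseteq> poly_maps S" and KK: "ideal_of (poly_maps S) K \<subseteq> K" for K
  proof (rule ccontr)
    assume "\<not> ?thesis"
    hence no: "\<exists>G. G \<in> K - ideal_of (poly_maps S) J" if "J \<subseteq> K" "finite J" for J using that by blast
    define bd where "bd d G \<longleftrightarrow> (\<forall>x. degree (G x) \<le> d)" for d and G :: "'x \<Rightarrow> 'r poly"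
    define C where "C J d G \<longleftrightarrow> G \<in> K - ideal_of (poly_maps S) J \<and> bd d G" for J d G
    have ex: "\<exists>d G. C J d G" if "J \<subseteq> K" "finite J" for J
      using no[OF that] K unfolding C_def bd_def poly_maps_def by blast
    define dm where "dm J = (LEAST d. \<exists>G. C J d G)" for J
    define sel where "sel J = (SOME G. C J (dm J) G)" for J
    have sel: "C J (dm J) (sel J)" if "J \<subseteq> K" "finite J" for J
      using LeastI_ex[OF ex[OF that]] unfolding sel_def dm_def by (rule someI_ex)
    have least: "dm J \<le> d" if "C J d G" for J d G unfolding dm_def using that by (intro Least_le) blast
    define A where "A = rec_nat {} (\<lambda>_ J. insert (sel J) J)"
    define G where "G n = sel (A n)" for n
    have ASuc: "A (Suc n) = insert (G n) (A n)" for n by (simp add: A_def G_def)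
    have A0: "A 0 = {}" by (simp add: A_def)
    have Aeq: "A n = G ` {..<n}" for n by (induction n) (auto simp: A0 ASuc lessThan_Suc)
    have AK: "A n \<subseteq> K \<and> finite (A n)" for n
    proof (induction n)
      case (Suc n)
      thus ?case using sel[of "A n"] by (auto simp: ASuc G_def C_def)
    qed (simp add: A0)
    define d where "d n = dm (A n)" for n
    have CG: "C (A n) (d n) (G n)" for n using sel AK unfolding G_def d_def by blast
    have GK: "G n \<in> K" "G n \<in> poly_maps S" "G n \<notin> ideal_of (poly_maps S) (A n)" "\<And>x. degree (G n x) \<le> d n" for n
      using CG[of n] K by (auto simp: C_def bd_def)
    define a where "a n = (\<lambda>x. coeff (G n x) (d n))" for n
    have aS: "a n \<in> S" for n unfolding a_def by (rule pm_coeff[OF S GK(2)])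
    obtain J where J: "J \<subseteq> range a" "finite J" "range a \<subseteq> ideal_of S J" using N[of "range a"] aS by blast
    obtain I0 where I0: "finite I0" "J = a ` I0" using finite_subset_image[OF J(2,1)] by blast
    \<comment> \<open>The finitely many generators occur among \<open>a 0, ..., a (m - 1)\<close>,
      so \<open>a m\<close> is a combination of these.\<close>
    obtain m where m: "I0 \<subseteq> {..<m}" using finite_nat_set_iff_bounded[of I0] I0 by auto
    have "a m \<in> ideal_of S (a ` {..<m})" using J(3) ideal_of_mono[of J "a ` {..<m}"] I0(2) m by blast
    from ideal_of_image[OF S this] obtain r where
      r: "\<And>i. r i \<in> S" "a m = (\<lambda>x. \<Sum>i<m. r i x * a i x)" by blast
    have dle: "d i \<le> d m" if "i < m" for i
    proof -
      have "A i \<subseteq> A m" using that by (auto simp: Aeq)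
      hence "C (A i) (d m) (G m)" using CG[of m] ideal_of_mono[of "A i" "A m"] by (auto simp: C_def)
      thus ?thesis unfolding d_def[of i] by (rule least)
    qed
    \<comment> \<open>The shifts by \<open>d m - d i\<close> align the leading terms, so the
      coefficient of degree \<open>d m\<close> cancels.\<close>
    define G' where "G' = (\<lambda>x. G m x - (\<Sum>i<m. monom (r i x) (d m - d i) * G i x))"
    have T: "(\<lambda>x. \<Sum>i<m. monom (r i x) (d m - d i) * G i x) \<in> ideal_of (poly_maps S) (A m)"
    proof -
      have "(\<lambda>x. \<Sum>i<n. monom (r i x) (d m - d i) * G i x) \<in> ideal_of (poly_maps S) (A m)" if "n \<le> m" for n
        using that
      proof (induction n)
        case (Suc n)
        hence "G n \<in> A m" by (auto simp: Aeq)
        from ideal_of.step[OF pm_monom[OF S r(1)[of n], of "d m - d n"] this Suc.IH] Suc.prems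
        show ?case by (simp add: add.commute)
      qed (simp add: ideal_of.zero)
      thus ?thesis by blast
    qed
    have TK: "ideal_of (poly_maps S) (A m) \<subseteq> ideal_of (poly_maps S) K" using ideal_of_mono AK by blast
    have G'n: "G' \<notin> ideal_of (poly_maps S) (A m)"
    proof
      assume "G' \<in> ideal_of (poly_maps S) (A m)"
      from ideal_of_add[OF this T] show False using GK(3)[of m] by (simp add: G'_def)
    qed
    have "(\<lambda>x. - (1::'r poly)) \<in> poly_maps S" by (rule fr_uminus[OF R fr_1[OF R]])
    from ideal_of_mult[OF R this T] have "(\<lambda>x. - (\<Sum>i<m. monom (r i x) (d m - d i) * G i x)) \<in> ideal_of (poly_maps S) K"
      using TK by auto
    from ideal_of_add[OF ideal_of_gen[OF R GK(1)[of m]] this] have "G' \<in> K" using KK by (auto simp: G'_def)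
    have c0: "coeff (G' x) (d m) = 0" for x
    proof -
      have "coeff (monom (r i x) (d m - d i) * G i x) (d m) = r i x * a i x" if "i < m" for i
        using dle[OF that] by (simp add: coeff_monom_mult a_def)
      hence "coeff (\<Sum>i<m. monom (r i x) (d m - d i) * G i x) (d m) = (\<Sum>i<m. r i x * a i x)"
        by (simp add: coeff_sum)
      also have "\<dots> = coeff (G m x) (d m)" using fun_cong[OF r(2), of x] by (simp add: a_def)
      finally show ?thesis by (simp add: G'_def)
    qed
    have cb: "coeff (G' x) j = 0" if "j > d m" for x j
    proof -
      have "coeff (monom (r i x) (d m - d i) * G i x) j = 0" if "i < m" for i
      proof -
        have "coeff (G i x) (j - (d m - d i)) = 0"
          using dle[OF that] GK(4)[of i x] \<open>j > d m\<close> by (intro coeff_eq_0) linarith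
        thus ?thesis by (simp add: coeff_monom_mult)
      qed
      moreover have "coeff (G m x) j = 0" using GK(4)[of m x] that by (intro coeff_eq_0) auto
      ultimately show ?thesis by (simp add: G'_def coeff_sum)
    qed
    show False
    proof (cases "d m = 0")
      case True
      hence "G' = (\<lambda>_. 0)" using c0 cb by (intro ext poly_eqI) (metis coeff_0 gr0I)
      thus False using G'n ideal_of.zero by auto
    next
      case False
      have "degree (G' x) \<le> d m - 1" for x
        by (rule degree_le) (use c0 cb in \<open>metis Suc_pred' False gr0I less_antisym not_less_eq\<close>)
      hence "C (A m) (d m - 1) G'" using \<open>G' \<in> K\<close> G'n by (auto simp: C_def bd_def)
      from least[OF this] show False using False by (simp add: d_def)
    qed
  qed
  have "\<exists>J\<subseteq>I. finite J \<and> I \<subseteq> ideal_of (poly_maps S) J" if I: "I \<subseteq> poly_maps S" for I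
  proof -
    \<comment> \<open>Finite generation is known for sets closed under ideal combinations. Each of
      the finitely many generators of \<open>?K\<close> involves only finitely many elements of
      \<open>I\<close>, and these are collected.\<close>
    let ?K = "ideal_of (poly_maps S) I"
    obtain J where J: "J \<subseteq> ?K" "finite J" "?K \<subseteq> ideal_of (poly_maps S) J"
      using fg[of ?K] ideal_of_sub[OF R I] ideal_of_idem[OF R, of ?K I] by blast
    have "\<forall>g\<in>J. \<exists>L\<subseteq>I. finite L \<and> g \<in> ideal_of (poly_maps S) L" using ideal_of_finite_support J(1) by blast
    then obtain L where L: "\<And>g. g \<in> J \<Longrightarrow> L g \<subseteq> I \<and> finite (L g) \<and> g \<in> ideal_of (poly_maps S) (L g)" by metis
    let ?L = "\<Union>g\<in>J. L g"
    have "J \<subseteq> ideal_of (poly_maps S) ?L" using L ideal_of_mono[of _ ?L] by blast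
    hence "I \<subseteq> ideal_of (poly_maps S) ?L"
      using ideal_of_idem[OF R] J(3) ideal_of_gen[OF R, of _ I] by blast
    thus ?thesis using L J(2) by (intro exI[of _ ?L]) auto
  qed
  thus ?thesis using R by (simp add: noetherian_def)
qed

lemma noetherian_adjoin:
  assumes "noetherian S" shows "noetherian (adjoin S w)"
proof -
  have S: "fun_ring S" using assms by (simp add: noetherian_def)
  define ev where "ev F = (\<lambda>x. poly (F x) (w x))" for F
  have "\<exists>J\<subseteq>I. finite J \<and> I \<subseteq> ideal_of (adjoin S w) J" if I: "I \<subseteq> adjoin S w" for I
  proof -
    let ?I = "{F \<in> poly_maps S. ev F \<in> I}"
    obtain J where J: "J \<subseteq> ?I" "finite J" "?I \<subseteq> ideal_of (poly_maps S) J"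
      using hilbert_basis[OF assms] unfolding noetherian_def by (metis (no_types, lifting) mem_Collect_eq subsetI)
    have "ev F \<in> ideal_of (adjoin S w) (ev ` J)" if "F \<in> ideal_of (poly_maps S) J" for F
      using that
    proof induction
      case zero thus ?case using ideal_of.zero by (simp add: ev_def)
    next
      case (step r g f)
      have "ev r \<in> adjoin S w" using step by (auto simp: ev_def adjoin_def)
      from ideal_of.step[OF this imageI[OF step.hyps(2)] step.IH] show ?case by (simp add: ev_def)
    qed
    moreover have "\<exists>F\<in>?I. f = ev F" if "f \<in> I" for f using I that by (auto simp: ev_def adjoin_def)
    ultimately have "I \<subseteq> ideal_of (adjoin S w) (ev ` J)" using J(3) by blast
    thus ?thesis using J by (intro exI[of _ "ev ` J"]) auto
  qed
  thus ?thesis using adjoin_fun_ring[OF S] by (simp add: noetherian_def)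
qed

text \<open>Noetherian induction on the vanishing ideal: a reducible \<open>Q\<close> splits along
  two functions whose product vanishes on it, and both parts have strictly larger vanishing ideals.
  The pieces are subsets of \<open>Q\<close> and need not be closed.\<close>

theorem finite_irreducible_decomposition:
  fixes S :: "('x \<Rightarrow> 'r::idom) set"
  assumes "noetherian S"
  shows "\<exists>\<Y>. finite \<Y> \<and> \<Union>\<Y> = Q \<and> (\<forall>Y\<in>\<Y>. irreducible_on S Y)"
proof -
  have S: "fun_ring S" using assms by (simp add: noetherian_def)
  define v where "v Q = {f \<in> S. vanishes Q f}" for Q :: "'x set"
  have "wf {(Q, Q'). v Q' \<subset> v Q}"
  proof (subst wf_iff_no_infinite_down_chain, rule notI)
    assume "\<exists>f. \<forall>i. (f (Suc i), f i) \<in> {(Q, Q'). v Q' \<subset> v Q}"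
    then obtain f where f: "\<And>i. v (f i) \<subset> v (f (Suc i))" by auto
    have mono: "v (f i) \<subseteq> v (f j)" if "i \<le> j" for i j using lift_Suc_mono_le[of "\<lambda>i. v (f i)"] f that by blast
    obtain J where J: "J \<subseteq> (\<Union>i. v (f i))" "finite J" "(\<Union>i. v (f i)) \<subseteq> ideal_of S J"
      using assms unfolding noetherian_def by (metis (no_types, lifting) UN_least v_def mem_Collect_eq subsetI)
    have "\<exists>m. J \<subseteq> v (f m)" using J(2,1)
    proof (induction J rule: finite_induct)
      case (insert g J)
      then obtain m k where "J \<subseteq> v (f m)" "g \<in> v (f k)" by blast
      hence "insert g J \<subseteq> v (f (max m k))" using mono[of m "max m k"] mono[of k "max m k"] by auto
      thus ?case by blast
    qed auto
    then obtain m where m: "J \<subseteq> v (f m)" by blast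
    have "g \<in> v (f m)" if "g \<in> ideal_of S J" for g
      using that by induction (use m in \<open>auto simp: v_def vanishes_def intro!: fr_0[OF S] fr_add[OF S] fr_mult[OF S]\<close>)
    thus False using J(3) f[of m] by blast
  qed
  thus ?thesis
  proof (induction Q rule: wf_induct_rule)
    case (less Q)
    show ?case
    proof (cases "Q = {} \<or> irreducible_on S Q")
      case True
      thus ?thesis
        by (cases "Q = {}") (auto intro: exI[of _ "{}"] exI[of _ "{Q}"])
    next
      case False
      then obtain f g where fg: "f \<in> S" "g \<in> S" "vanishes Q (\<lambda>x. f x * g x)" "\<not> vanishes Q f" "\<not> vanishes Q g"
        unfolding irreducible_on_def by blast
      have R: "\<exists>\<Y>. finite \<Y> \<and> \<Union>\<Y> = {x\<in>Q. h x = 0} \<and> (\<forall>Y\<in>\<Y>. irreducible_on S Y)"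
        if "h \<in> S" "\<not> vanishes Q h" for h
      proof (rule less.IH)
        have "v Q \<subseteq> v {x \<in> Q. h x = 0}" "h \<in> v {x \<in> Q. h x = 0}" "h \<notin> v Q"
          using that by (auto simp: v_def vanishes_def)
        thus "({x \<in> Q. h x = 0}, Q) \<in> {(Q, Q'). v Q' \<subset> v Q}" by auto
      qed
      from R[OF fg(1,4)] obtain \<Y>1 where
        Y1: "finite \<Y>1 \<and> \<Union>\<Y>1 = {x\<in>Q. f x = 0} \<and> (\<forall>Y\<in>\<Y>1. irreducible_on S Y)" ..
      from R[OF fg(2,5)] obtain \<Y>2 where
        Y2: "finite \<Y>2 \<and> \<Union>\<Y>2 = {x\<in>Q. g x = 0} \<and> (\<forall>Y\<in>\<Y>2. irreducible_on S Y)" ..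
      have "Q = {x\<in>Q. f x = 0} \<union> {x\<in>Q. g x = 0}" using fg(3) by (auto simp: vanishes_def)
      also have "\<dots> = \<Union>(\<Y>1 \<union> \<Y>2)" using Y1 Y2 by simp
      finally have "\<Union>(\<Y>1 \<union> \<Y>2) = Q" by (rule sym)
      moreover have "finite (\<Y>1 \<union> \<Y>2)" "\<forall>Y\<in>\<Y>1 \<union> \<Y>2. irreducible_on S Y" using Y1 Y2 by auto
      ultimately show ?thesis by (intro exI conjI)
    qed
  qed
qed

section \<open>Polynomial functions in chosen coordinates\<close>

inductive_set pfuns :: "nat set \<Rightarrow> ((nat \<Rightarrow> 'k::field) \<Rightarrow> 'k) set" for J where
  const: "(\<lambda>x. c) \<in> pfuns J"
| coord: "i \<in> J \<Longrightarrow> (\<lambda>x. x i) \<in> pfuns J"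
| add: "f \<in> pfuns J \<Longrightarrow> g \<in> pfuns J \<Longrightarrow> (\<lambda>x. f x + g x) \<in> pfuns J"
| mult: "f \<in> pfuns J \<Longrightarrow> g \<in> pfuns J \<Longrightarrow> (\<lambda>x. f x * g x) \<in> pfuns J"

lemma poly_funs_pfuns: "poly_funs n = pfuns {..<n}"
proof (intro equalityI subsetI)
  fix f :: "(nat \<Rightarrow> 'a) \<Rightarrow> 'a" assume "f \<in> poly_funs n"
  thus "f \<in> pfuns {..<n}" by induction (auto intro: pfuns.intros)
next
  fix f :: "(nat \<Rightarrow> 'a) \<Rightarrow> 'a" assume "f \<in> pfuns {..<n}"
  thus "f \<in> poly_funs n" by induction (auto intro: poly_funs.intros)
qed

lemma pfuns_fun_ring: "fun_ring (pfuns J :: ((nat \<Rightarrow> 'k::field) \<Rightarrow> 'k) set)"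
  unfolding fun_ring_def
proof (intro conjI ballI)
  fix f :: "(nat \<Rightarrow> 'k) \<Rightarrow> 'k" assume "f \<in> pfuns J"
  from pfuns.mult[OF pfuns.const[of "-1"] this] show "(\<lambda>x. - f x) \<in> pfuns J" by simp
qed (auto intro: pfuns.intros)

lemma pfuns_mono: "J \<subseteq> J' \<Longrightarrow> pfuns J \<subseteq> pfuns J'"
proof
  fix f :: "(nat \<Rightarrow> 'a) \<Rightarrow> 'a" assume "J \<subseteq> J'" "f \<in> pfuns J"
  from this(2) show "f \<in> pfuns J'" by induction (use \<open>J \<subseteq> J'\<close> in \<open>auto intro: pfuns.intros\<close>)
qed

lemma pfuns_cong: "f \<in> pfuns J \<Longrightarrow> (\<And>i. i \<in> J \<Longrightarrow> x i = y i) \<Longrightarrow> f x = f y"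
  by (induction rule: pfuns.induct) auto

lemma poly_maps_cong:
  assumes "F \<in> poly_maps (pfuns J)" "\<And>i. i \<in> J \<Longrightarrow> x i = y i" shows "F x = F y"
  by (rule poly_eqI) (rule pfuns_cong[OF pm_coeff[OF pfuns_fun_ring assms(1)]], rule assms(2))

text \<open>Coordinates are added one at a time, in any order, which reduces polynomials in several
  variables to the results on \<open>adjoin\<close>. Arbitrary index sets are needed for
  transcendence bases.\<close>

lemma pfuns_insert: "pfuns (insert j J) = adjoin (pfuns J) (\<lambda>x. x j)"
proof (intro equalityI subsetI)
  note R = adjoin_fun_ring[OF pfuns_fun_ring, of J "\<lambda>x. x j"]
  fix f :: "(nat \<Rightarrow> 'a) \<Rightarrow> 'a" assume "f \<in> pfuns (insert j J)"
  thus "f \<in> adjoin (pfuns J) (\<lambda>x. x j)"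
  proof induction
    case (coord i)
    thus ?case by (cases "i = j") (auto intro: adjoin_self adjoin_base pfuns_fun_ring pfuns.intros)
  qed (auto intro: fr_add[OF R] fr_mult[OF R] adjoin_base[OF pfuns_fun_ring] pfuns.intros)
next
  note R = pfuns_fun_ring[of "insert j J"]
  fix f :: "(nat \<Rightarrow> 'a) \<Rightarrow> 'a" assume "f \<in> adjoin (pfuns J) (\<lambda>x. x j)"
  then obtain F where F: "F \<in> poly_maps (pfuns J)" "f = (\<lambda>x. poly (F x) (x j))" by (auto simp: adjoin_def)
  then obtain D where D: "\<And>x. degree (F x) \<le> D" by (auto simp: poly_maps_def)
  have "f = (\<lambda>x. \<Sum>i\<le>D. coeff (F x) i * x j ^ i)"
    unfolding F(2)
  proof
    fix x
    show "poly (F x) (x j) = (\<Sum>i\<le>D. coeff (F x) i * x j ^ i)"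
      unfolding poly_altdef using D[of x]
      by (intro sum.mono_neutral_left) (auto simp: coeff_eq_0)
  qed
  moreover have "(\<lambda>x. \<Sum>i\<le>D. coeff (F x) i * x j ^ i) \<in> pfuns (insert j J)"
    using pm_coeff[OF pfuns_fun_ring F(1)] pfuns_mono[of J "insert j J"]
    by (intro fr_sum[OF R] fr_mult[OF R] fr_power[OF R]) (auto intro: pfuns.intros)
  ultimately show "f \<in> pfuns (insert j J)" by simp
qed

lemma pfuns_noetherian: "finite J \<Longrightarrow> noetherian (pfuns J :: ((nat \<Rightarrow> 'k::field) \<Rightarrow> 'k) set)"
proof (induction J rule: finite_induct)
  case empty
  have "pfuns {} = range (\<lambda>(c::'k) (_::nat \<Rightarrow> 'k). c)"
  proof (intro equalityI subsetI)
    fix f :: "(nat \<Rightarrow> 'k) \<Rightarrow> 'k" assume "f \<in> pfuns {}"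
    thus "f \<in> range (\<lambda>c _. c)" by induction auto
  qed (auto intro: pfuns.intros)
  thus ?case using noetherian_constants by simp
next
  case (insert j J)
  thus ?case using noetherian_adjoin by (simp add: pfuns_insert)
qed

lemma algebraic_over_mono: "algebraic_over S Y w \<Longrightarrow> S \<subseteq> S' \<Longrightarrow> algebraic_over S' Y w"
  unfolding algebraic_over_def poly_maps_def by blast

text \<open>\<open>min_polynomial_associate\<close> is applied once for each algebraic coordinate in
  \<open>D\<close>, which takes a nonvanishing function down to the coordinates in
  \<open>X\<close>.\<close>

lemma algebraic_tower_associate:
  fixes Y :: "(nat \<Rightarrow> 'k::field) set"
  assumes "finite D" "irreducible_on (pfuns (X \<union> D)) Y"
    and "\<And>j. j \<in> D \<Longrightarrow> algebraic_over (pfuns X) Y (\<lambda>x. x j)"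
    and "h \<in> pfuns (X \<union> D)" "\<not> vanishes Y h"
  shows "\<exists>b\<in>pfuns (X \<union> D). \<exists>H\<in>pfuns X. \<not> vanishes Y H \<and> (\<forall>x\<in>Y. b x * h x = H x)"
  using assms
proof (induction D arbitrary: h rule: finite_induct)
  case empty
  thus ?case by (intro bexI[of _ "\<lambda>_. 1"] bexI[of _ h]) (auto intro: pfuns.intros)
next
  case (insert j D)
  let ?J = "X \<union> D"
  have J: "X \<union> insert j D = insert j ?J" by auto
  have irr: "irreducible_on (adjoin (pfuns ?J) (\<lambda>x. x j)) Y" using insert.prems(1) by (simp add: J pfuns_insert)
  have "algebraic_over (pfuns ?J) Y (\<lambda>x. x j)"
    using algebraic_over_mono[OF insert.prems(2) pfuns_mono[of X ?J]] by auto
  from min_polynomial_associate[OF pfuns_fun_ring irr this, of h] insert.prems(3,4)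
  obtain b r where br: "b \<in> pfuns (insert j ?J)" "r \<in> pfuns ?J" "\<not> vanishes Y r" "\<And>x. x \<in> Y \<Longrightarrow> b x * h x = r x"
    by (auto simp: J pfuns_insert)
  have "irreducible_on (pfuns ?J) Y"
    using irreducible_on_mono[OF insert.prems(1)[unfolded J] pfuns_mono[of ?J "insert j ?J"]] by auto
  from insert.IH[OF this insert.prems(2) br(2,3)] obtain b' H where
    H: "b' \<in> pfuns ?J" "H \<in> pfuns X" "\<not> vanishes Y H" "\<And>x. x \<in> Y \<Longrightarrow> b' x * r x = H x" by auto
  have "b' \<in> pfuns (insert j ?J)" using H(1) pfuns_mono[of ?J "insert j ?J"] by auto
  thus ?case unfolding J using H br
    by (intro bexI[of _ "\<lambda>x. b' x * b x"] bexI[of _ H]) (auto simp: mult.assoc intro: pfuns.mult)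
qed

text \<open>Each new coordinate is a root of the minimal polynomial; over an algebraically closed
  field it exists as soon as the leading coefficient is nonzero. \<open>H\<close> collects multiples
  of these leading coefficients that lie in the ring of the basis coordinates.\<close>

lemma algebraic_tower_lift:
  fixes Y :: "(nat \<Rightarrow> 'k::alg_closed_field) set"
  assumes "finite D" "X \<inter> D = {}" "irreducible_on (pfuns (X \<union> D)) Y"
    and "\<And>j. j \<in> D \<Longrightarrow> algebraic_over (pfuns X) Y (\<lambda>x. x j)"
  shows "\<exists>H\<in>pfuns X. \<not> vanishes Y H \<and>
    (\<forall>y. (\<forall>f\<in>pfuns X. vanishes Y f \<longrightarrow> f y = 0) \<longrightarrow> H y \<noteq> 0 \<longrightarrow>
       (\<exists>x. (\<forall>i\<in>X. x i = y i) \<and> (\<forall>f\<in>pfuns (X \<union> D). vanishes Y f \<longrightarrow> f x = 0)))"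
  using assms
proof (induction D rule: finite_induct)
  case empty
  hence "\<not> vanishes Y (\<lambda>_. 1::'k)" by (auto simp: vanishes_def irreducible_on_def)
  thus ?case by (intro bexI[of _ "\<lambda>_. 1"]) (auto intro: pfuns.intros)
next
  case (insert j D)
  let ?J = "X \<union> D"
  have J: "X \<union> insert j D = insert j ?J" by auto
  have jJ: "j \<notin> ?J" using insert by auto
  have irrJ: "irreducible_on (pfuns ?J) Y"
    using irreducible_on_mono[OF insert.prems(2)[unfolded J] pfuns_mono[of ?J "insert j ?J"]] by auto
  have irrX: "irreducible_on (pfuns X) Y" using irreducible_on_mono[OF irrJ pfuns_mono[of X ?J]] by auto
  obtain H1 where H1: "H1 \<in> pfuns X" "\<not> vanishes Y H1"
    "\<And>y. (\<forall>f\<in>pfuns X. vanishes Y f \<longrightarrow> f y = 0) \<Longrightarrow> H1 y \<noteq> 0 \<Longrightarrow>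
       (\<exists>x. (\<forall>i\<in>X. x i = y i) \<and> (\<forall>f\<in>pfuns ?J. vanishes Y f \<longrightarrow> f x = 0))"
    using insert.IH insert.prems irrJ by auto
  have "algebraic_over (pfuns ?J) Y (\<lambda>x. x j)"
    using algebraic_over_mono[OF insert.prems(3) pfuns_mono[of X ?J]] by auto
  from min_polynomial_exists[OF pfuns_fun_ring this] obtain F e where
    m: "min_polynomial (pfuns ?J) Y (\<lambda>x. x j) F e" by blast
  note m' = m[unfolded min_polynomial_def]
  have F: "F \<in> poly_maps (pfuns ?J)" "e \<ge> 1" "\<not> vanishes Y (\<lambda>x. coeff (F x) e)" using m' by auto
  let ?f = "\<lambda>x. coeff (F x) e"
  have f: "?f \<in> pfuns ?J" by (rule pm_coeff[OF pfuns_fun_ring F(1)])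
  obtain b H2 where H2: "b \<in> pfuns ?J" "H2 \<in> pfuns X" "\<not> vanishes Y H2" "\<And>x. x \<in> Y \<Longrightarrow> b x * ?f x = H2 x"
    using algebraic_tower_associate[OF insert.hyps(1) irrJ insert.prems(3) f F(3)] by auto
  show ?case
  proof (intro bexI[of _ "\<lambda>x. H1 x * H2 x"] conjI allI impI)
    show "(\<lambda>x. H1 x * H2 x) \<in> pfuns X" using H1 H2 by (auto intro: pfuns.mult)
    show "\<not> vanishes Y (\<lambda>x. H1 x * H2 x)" using irreducible_on_mult[OF irrX H1(1) H2(2)] H1 H2 by blast
    fix y assume y: "\<forall>f\<in>pfuns X. vanishes Y f \<longrightarrow> f y = 0" "H1 y * H2 y \<noteq> 0"
    then obtain x where x: "\<And>i. i \<in> X \<Longrightarrow> x i = y i" "\<And>f. f \<in> pfuns ?J \<Longrightarrow> vanishes Y f \<Longrightarrow> f x = 0"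
      using H1(3)[of y] by auto
    have "(\<lambda>x. b x * ?f x - H2 x) \<in> pfuns ?J"
      using H2 f pfuns_mono[of X ?J] by (intro fr_diff[OF pfuns_fun_ring] fr_mult[OF pfuns_fun_ring]) auto
    hence "b x * ?f x = H2 x" using x(2)[of "\<lambda>x. b x * ?f x - H2 x"] H2(4) by (auto simp: vanishes_def)
    also have "H2 x = H2 y" by (rule pfuns_cong[OF H2(2)]) (use x in auto)
    finally have fx: "?f x \<noteq> 0" using y(2) by auto
    hence "degree (F x) \<ge> e" by (rule le_degree)
    then obtain v where v: "poly (F x) v = 0"
      using alg_closed_imp_poly_has_root[of "F x"] F(2) by auto
    define x' where "x' = x(j := v)"
    \<comment> \<open>Any root \<open>v\<close> of \<open>F x\<close> will do: a power of the
      leading coefficient times a relation \<open>G\<close> is a multiple of \<open>F\<close>, up to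
      coefficients vanishing on \<open>Y\<close>.\<close>
    have "g x' = 0" if g: "g \<in> pfuns (insert j ?J)" "vanishes Y g" for g
    proof -
      obtain G where G: "G \<in> poly_maps (pfuns ?J)" "g = (\<lambda>x. poly (G x) (x j))"
        using g(1) by (auto simp: pfuns_insert adjoin_def)
      obtain s Q R where d: "R \<in> poly_maps (pfuns ?J)" "\<And>x. smult (?f x ^ s) (G x) = Q x * F x + R x"
        "\<And>i. vanishes Y (\<lambda>x. coeff (R x) i)"
        using min_polynomial_divides[OF pfuns_fun_ring m G(1)] g(2) G(2) by blast
      have "R x = 0" using x(2)[OF pm_coeff[OF pfuns_fun_ring d(1)] d(3)] by (simp add: poly_eq_iff)
      hence "?f x ^ s * poly (G x) v = 0"
        using arg_cong[OF d(2)[of x], of "\<lambda>p. poly p v"] v by simp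
      hence "poly (G x) v = 0" using fx by simp
      moreover have "G x' = G x" by (rule poly_maps_cong[OF G(1)]) (use jJ in \<open>auto simp: x'_def\<close>)
      ultimately show ?thesis by (simp add: G(2) x'_def)
    qed
    moreover have "\<forall>i\<in>X. x' i = y i" using x(1) jJ by (auto simp: x'_def)
    ultimately show "\<exists>x. (\<forall>i\<in>X. x i = y i) \<and> (\<forall>f\<in>pfuns (X \<union> insert j D). vanishes Y f \<longrightarrow> f x = 0)"
      unfolding J by blast
  qed
qed

text \<open>Zariski density of the integer points in a residue class, one variable at a time: a
  nonzero polynomial has finitely many roots, while in characteristic \<open>0\<close> the
  progression \<open>c j + M * n\<close> is infinite.\<close>

lemma pfuns_nonzero_on_grid:
  fixes H :: "(nat \<Rightarrow> 'k::field_char_0) \<Rightarrow> 'k"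
  assumes "finite X" "H \<in> pfuns X" "H x \<noteq> 0" "M \<noteq> (0::int)"
  shows "\<exists>y. H (\<lambda>i. of_int (c i + M * y i)) \<noteq> 0"
  using assms(1-3)
proof (induction X arbitrary: H x rule: finite_induct)
  case empty
  have "H (\<lambda>i. of_int (c i + M * (\<lambda>_. 0) i)) = H x" by (rule pfuns_cong[OF empty.prems(1)]) auto
  with empty.prems(2) have "H (\<lambda>i. of_int (c i + M * (\<lambda>_. 0) i)) \<noteq> 0" by (simp only: simp_thms)
  thus ?case by (rule exI[of _ "\<lambda>_. 0"])
next
  case (insert j X)
  obtain F where F: "F \<in> poly_maps (pfuns X)" "H = (\<lambda>x. poly (F x) (x j))"
    using insert.prems by (auto simp: pfuns_insert adjoin_def)
  then obtain i where "coeff (F x) i \<noteq> 0" using insert.prems(2) by (metis poly_0 poly_eqI coeff_0)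
  from insert.IH[OF pm_coeff[OF pfuns_fun_ring F(1)] this] obtain y where
    y: "coeff (F (\<lambda>i. of_int (c i + M * y i))) i \<noteq> 0" by blast
  let ?p = "F (\<lambda>i. of_int (c i + M * y i))"
  have "?p \<noteq> 0" using y by auto
  hence fin: "finite {z. poly ?p z = 0}" by (rule poly_roots_finite)
  have "inj (\<lambda>n::int. of_int (c j + M * n) :: 'k)" using assms(4) by (intro injI) simp
  hence "infinite (range (\<lambda>n::int. of_int (c j + M * n) :: 'k))"
    using finite_imageD infinite_UNIV_int by blast
  hence "\<not> range (\<lambda>n::int. of_int (c j + M * n) :: 'k) \<subseteq> {z. poly ?p z = 0}"
    using fin finite_subset by blast
  then obtain n where n: "poly ?p (of_int (c j + M * n)) \<noteq> 0" by auto
  define y' where "y' = y(j := n)"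
  have "F (\<lambda>i. of_int (c i + M * y' i)) = ?p"
    by (rule poly_maps_cong[OF F(1)]) (use insert.hyps in \<open>auto simp: y'_def\<close>)
  hence "H (\<lambda>i. of_int (c i + M * y' i)) \<noteq> 0" using n by (simp add: F(2) y'_def)
  thus ?case by blast
qed

section \<open>Subrings and valuation rings of a field\<close>

definition subring :: "'k::field set \<Rightarrow> bool" where
  "subring A \<longleftrightarrow> 1 \<in> A \<and> (\<forall>a\<in>A. \<forall>b\<in>A. a - b \<in> A \<and> a * b \<in> A)"

lemma subringD:
  assumes "subring A"
  shows "0 \<in> A" "1 \<in> A" "a \<in> A \<Longrightarrow> - a \<in> A" "a \<in> A \<Longrightarrow> b \<in> A \<Longrightarrow> a + b \<in> A"
    "a \<in> A \<Longrightarrow> b \<in> A \<Longrightarrow> a - b \<in> A" "a \<in> A \<Longrightarrow> b \<in> A \<Longrightarrow> a * b \<in> A"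
proof -
  show 1: "1 \<in> A" and m: "\<And>a b. a \<in> A \<Longrightarrow> b \<in> A \<Longrightarrow> a - b \<in> A" "a \<in> A \<Longrightarrow> b \<in> A \<Longrightarrow> a * b \<in> A"
    using assms by (auto simp: subring_def)
  show 0: "0 \<in> A" using m(1)[OF 1 1] by simp
  have n: "- a \<in> A" if "a \<in> A" for a using m(1)[OF 0 that] by simp
  show "a \<in> A \<Longrightarrow> - a \<in> A" by (rule n)
  show "a \<in> A \<Longrightarrow> b \<in> A \<Longrightarrow> a + b \<in> A" using m(1)[of a "- b"] n[of b] by simp
qed

lemma subring_sum: "subring A \<Longrightarrow> (\<And>i. i \<in> I \<Longrightarrow> f i \<in> A) \<Longrightarrow> (\<Sum>i\<in>I. f i) \<in> A"
  by (induction I rule: infinite_finite_induct) (auto intro: subringD)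

lemma subring_power: "subring A \<Longrightarrow> a \<in> A \<Longrightarrow> a ^ n \<in> A"
  by (induction n) (auto intro: subringD)

definition poly_over :: "'k::field set \<Rightarrow> 'k poly set" where
  "poly_over A = {p. \<forall>i. coeff p i \<in> A}"

lemma poly_over_ops:
  assumes A: "subring A"
  shows "p \<in> poly_over A \<Longrightarrow> q \<in> poly_over A \<Longrightarrow> p - q \<in> poly_over A"
    and "p \<in> poly_over A \<Longrightarrow> q \<in> poly_over A \<Longrightarrow> p + q \<in> poly_over A"
    and "p \<in> poly_over A \<Longrightarrow> q \<in> poly_over A \<Longrightarrow> p * q \<in> poly_over A"
    and "a \<in> A \<Longrightarrow> monom a n \<in> poly_over A"
  using subringD[OF A] by (auto simp: poly_over_def coeff_mult intro!: subring_sum[OF A])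

lemma poly_in_subring: "subring A \<Longrightarrow> p \<in> poly_over A \<Longrightarrow> x \<in> A \<Longrightarrow> poly p x \<in> A"
  by (auto simp: poly_altdef poly_over_def intro!: subring_sum subringD(6) subring_power)

lemma subring_image_poly:
  assumes A: "subring A" shows "subring ((\<lambda>p. poly p x) ` poly_over A)"
  unfolding subring_def
proof (intro conjI ballI)
  let ?I = "(\<lambda>p. poly p x) ` poly_over A"
  have "1 \<in> poly_over A" using poly_over_ops(4)[OF A, of 1 0] subringD(2)[OF A] by simp
  thus "1 \<in> ?I" by (metis imageI poly_1)
  fix a b assume "a \<in> ?I" "b \<in> ?I"
  then obtain p q where "p \<in> poly_over A" "q \<in> poly_over A" "a = poly p x" "b = poly q x" by auto
  hence "p - q \<in> poly_over A" "poly (p - q) x = a - b" "p * q \<in> poly_over A" "poly (p * q) x = a * b"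
    using poly_over_ops[OF A] by auto
  thus "a - b \<in> ?I" "a * b \<in> ?I" by (metis imageI)+
qed

definition valuation_ring :: "'k::field set \<Rightarrow> bool" where
  "valuation_ring A \<longleftrightarrow> subring A \<and> (\<forall>a. a \<in> A \<or> inverse a \<in> A)"

text \<open>The reduction step in Chevalley's extension theorem. The relation
  \<open>q(y) = u\<close>, multiplied by \<open>a\<close>, has an invertible constant part
  \<open>1 - a * coeff q 0\<close>; after multiplication by \<open>x ^ m\<close> it expresses
  \<open>x ^ m\<close> by lower powers of \<open>x\<close>, which shortens \<open>p\<close>.\<close>

lemma degree_reduction:
  assumes A: "subring A" and xy: "x * y = 1" and a: "a \<in> A" "a * u = 1"
    and unit: "\<And>c. c \<in> A \<Longrightarrow> inverse (1 - a * c) \<in> A \<and> 1 - a * c \<noteq> 0"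
    and p: "p \<in> poly_over A" "poly p x = u" and q: "q \<in> poly_over A" "poly q y = u"
    and deg: "degree q \<le> degree p" "degree q \<ge> 1"
  shows "\<exists>p'\<in>poly_over A. poly p' x = u \<and> degree p' < degree p"
proof -
  define m n where "m = degree q" and "n = degree p"
  define v where "v = 1 - a * coeff q 0"
  have cA: "coeff q i \<in> A" "coeff p i \<in> A" for i using p q by (auto simp: poly_over_def)
  have v: "inverse v \<in> A" "v \<noteq> 0" using unit[OF cA(1)[of 0]] by (auto simp: v_def)
  define r where "r j = inverse v * a * coeff q j" for j
  have rA: "r j \<in> A" for j unfolding r_def using v a cA by (intro subringD[OF A])
  have "1 = a * (\<Sum>j\<le>m. coeff q j * y ^ j)" using q(2) a(2) by (simp add: poly_altdef m_def)
  also have "\<dots> = a * coeff q 0 + a * (\<Sum>j\<in>{1..m}. coeff q j * y ^ j)"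
    by (simp add: sum.atMost_shift sum.atLeast1_atMost_eq lessThan_atLeast0 algebra_simps)
  finally have "v = a * (\<Sum>j\<in>{1..m}. coeff q j * y ^ j)" by (simp add: v_def algebra_simps)
  hence "inverse v * v = inverse v * (a * (\<Sum>j\<in>{1..m}. coeff q j * y ^ j))" by simp
  hence one: "1 = (\<Sum>j\<in>{1..m}. r j * y ^ j)" using v(2) by (simp add: r_def sum_distrib_left mult.assoc)
  \<comment> \<open>Reversing the relation \<open>1 = \<Sum> r j * y ^ j\<close> gives a polynomial
    of degree below \<open>m\<close> whose value at \<open>x\<close> is
    \<open>x ^ m\<close>.\<close>
  define R where "R = (\<Sum>j\<in>{1..m}. monom (r j) (m - j))"
  have "poly R x = (\<Sum>j\<in>{1..m}. r j * x ^ (m - j))" by (simp add: R_def poly_sum poly_monom)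
  also have "\<dots> = (\<Sum>j\<in>{1..m}. r j * y ^ j * x ^ m)"
  proof (intro sum.cong refl)
    fix j assume j: "j \<in> {1..m}"
    have "x ^ m = x ^ j * x ^ (m - j)" using j by (simp flip: power_add)
    moreover have "y ^ j * x ^ j = 1" using xy by (simp flip: power_mult_distrib add: mult.commute)
    ultimately show "r j * x ^ (m - j) = r j * y ^ j * x ^ m" by (simp add: mult.assoc)
  qed
  also have "\<dots> = x ^ m" using one by (simp flip: sum_distrib_right)
  finally have Rx: "poly R x = x ^ m" .
  have RA: "R \<in> poly_over A" unfolding R_def poly_over_def
    using rA subringD(1)[OF A] by (auto simp: coeff_sum intro!: subring_sum[OF A])
  have dR: "degree R \<le> m - 1" unfolding R_def
    by (intro degree_sum_le) (auto intro!: order.trans[OF degree_monom_le])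
  define p' where "p' = p - monom (coeff p n) n + monom (coeff p n) (n - m) * R"
  have mn: "m \<le> n" "m \<ge> 1" using deg by (auto simp: m_def n_def)
  have "p' \<in> poly_over A" unfolding p'_def
    by (intro poly_over_ops[OF A] p RA cA)
  moreover have "poly p' x = u"
    using mn p(2) by (simp add: p'_def poly_monom Rx flip: power_add)
  moreover have "degree p' < n"
  proof -
    have "degree (p - monom (coeff p n) n) \<le> n - 1"
    proof (rule degree_le, intro allI impI)
      fix i assume "n - 1 < i"
      thus "coeff (p - monom (coeff p n) n) i = 0"
        by (cases "i = n") (auto simp: n_def intro!: coeff_eq_0)
    qed
    moreover have "degree (monom (coeff p n) (n - m) * R) \<le> n - 1"
      using degree_mult_le[of "monom (coeff p n) (n - m)" R] degree_monom_le[of "coeff p n" "n - m"] dR mn by linarith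
    ultimately have "degree p' \<le> n - 1" unfolding p'_def by (rule degree_add_le)
    thus ?thesis using mn by linarith
  qed
  ultimately show ?thesis unfolding n_def by blast
qed

text \<open>A subring maximal among those containing \<open>A\<close> and avoiding \<open>u\<close>
  is a valuation ring. If it contained neither \<open>x\<close> nor \<open>inverse x\<close>, then
  \<open>u\<close> would be a polynomial in each of them, and of two shortest such expressions the
  longer one could be shortened.\<close>

lemma valuation_ring_exists:
  assumes A: "subring A" and u: "u \<notin> A" "inverse u \<in> A"
  shows "\<exists>B. valuation_ring B \<and> A \<subseteq> B \<and> u \<notin> B"
proof -
  define C where "C = {B. subring B \<and> A \<subseteq> B \<and> u \<notin> B}"
  have "\<exists>M\<in>C. \<forall>X\<in>C. M \<subseteq> X \<longrightarrow> X = M"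
  proof (rule subset_Zorn_nonempty)
    show "C \<noteq> {}" using assms by (auto simp: C_def)
    fix \<C> assume ne: "\<C> \<noteq> {}" and ch: "subset.chain C \<C>"
    have sub: "\<And>B. B \<in> \<C> \<Longrightarrow> subring B \<and> A \<subseteq> B \<and> u \<notin> B" using ch by (auto simp: subset.chain_def C_def)
    have both: "\<exists>B\<in>\<C>. a \<in> B \<and> b \<in> B" if "a \<in> \<Union>\<C>" "b \<in> \<Union>\<C>" for a b
      using that ch unfolding subset_chain_def by blast
    have "subring (\<Union>\<C>)" unfolding subring_def
    proof (intro conjI ballI)
      show "1 \<in> \<Union>\<C>" using ne sub by (auto simp: subring_def)
      fix a b assume "a \<in> \<Union>\<C>" "b \<in> \<Union>\<C>"
      then obtain B where "B \<in> \<C>" "a \<in> B" "b \<in> B" using both by blast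
      thus "a - b \<in> \<Union>\<C>" "a * b \<in> \<Union>\<C>" using sub[of B] by (auto simp: subring_def)
    qed
    thus "\<Union>\<C> \<in> C" using ne sub by (auto simp: C_def)
  qed
  then obtain M where MC: "M \<in> C" and max: "\<And>B. B \<in> C \<Longrightarrow> M \<subseteq> B \<Longrightarrow> B = M" by metis
  have M: "subring M" "A \<subseteq> M" "u \<notin> M" using MC by (auto simp: C_def)
  define a where "a = inverse u"
  have "u \<noteq> 0" using M subringD(1) by blast
  hence au: "a * u = 1" "a \<in> M" using M u by (auto simp: a_def)
  \<comment> \<open>The powers of \<open>1 - a * c\<close> are \<open>1\<close> modulo
    \<open>a\<close>, and \<open>a * u = 1\<close>; so \<open>u = b / (1 - a * c) ^ k\<close> would
    force \<open>u\<close> into \<open>M\<close>. Inverting \<open>1 - a * c\<close> thus does not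
    create \<open>u\<close>, and maximality puts the inverse into \<open>M\<close>.\<close>
  have unit: "inverse (1 - a * c) \<in> M \<and> 1 - a * c \<noteq> 0" if c: "c \<in> M" for c
  proof -
    let ?v = "1 - a * c"
    have "?v \<noteq> 0"
    proof
      assume "?v = 0"
      hence "a * c = a * u" using au by simp
      moreover have "a \<noteq> 0" using au by auto
      ultimately have "c = u" by simp
      thus False using c M by simp
    qed
    have vM: "?v \<in> M" by (intro subringD[OF M(1)] au c)
    have pw: "\<exists>c'\<in>M. ?v ^ k = 1 - a * c'" for k
    proof (induction k)
      case 0
      show ?case by (rule bexI[of _ 0]) (auto intro: subringD[OF M(1)])
    next
      case (Suc k)
      then obtain c' where c': "c' \<in> M" "?v ^ k = 1 - a * c'" by blast
      have "?v ^ Suc k = 1 - a * (c + c' - a * c * c')" by (simp add: c'(2) algebra_simps)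
      moreover have "c + c' - a * c * c' \<in> M" by (intro subringD[OF M(1)] c c' au)
      ultimately show ?case by blast
    qed
    define B where "B = {b * inverse ?v ^ k | b k. b \<in> M}"
    have MB: "M \<subseteq> B"
    proof
      fix b assume "b \<in> M"
      moreover have "b = b * inverse ?v ^ 0" by simp
      ultimately show "b \<in> B" unfolding B_def by blast
    qed
    have "subring B" unfolding subring_def
    proof (intro conjI ballI)
      show "1 \<in> B" using MB subringD(2)[OF M(1)] by blast
      fix s t assume "s \<in> B" "t \<in> B"
      then obtain b k b' k' where st: "s = b * inverse ?v ^ k" "b \<in> M" "t = b' * inverse ?v ^ k'" "b' \<in> M"
        unfolding B_def by blast
      have "s - t = (b * ?v ^ k' - b' * ?v ^ k) * inverse ?v ^ (k + k')"
        using \<open>?v \<noteq> 0\<close> by (simp add: st power_add field_simps)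
      moreover have "b * ?v ^ k' - b' * ?v ^ k \<in> M"
        using st vM by (intro subringD(5,6)[OF M(1)] subring_power[OF M(1)] au c subringD(2)[OF M(1)])
      ultimately show "s - t \<in> B" unfolding B_def by blast
      have "s * t = (b * b') * inverse ?v ^ (k + k')" by (simp add: st power_add mult_ac)
      moreover have "b * b' \<in> M" using st by (intro subringD[OF M(1)])
      ultimately show "s * t \<in> B" unfolding B_def by blast
    qed
    moreover have "u \<notin> B"
    proof
      assume "u \<in> B"
      then obtain b k where b: "u = b * inverse ?v ^ k" "b \<in> M" unfolding B_def by blast
      obtain c' where c': "c' \<in> M" "?v ^ k = 1 - a * c'" using pw by blast
      have "u * ?v ^ k = b" using b(1) \<open>?v \<noteq> 0\<close> by (simp add: field_simps)
      hence "u = b + (a * u) * c'" unfolding c'(2) by (simp add: algebra_simps)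
      hence "u = b + c'" using au by simp
      thus False using subringD(4)[OF M(1) b(2) c'(1)] M(3) by simp
    qed
    ultimately have "B = M" using MB M max by (auto simp: C_def)
    moreover have "1 * inverse ?v ^ 1 \<in> B" unfolding B_def using subringD(2)[OF M(1)] by blast
    ultimately show ?thesis using \<open>?v \<noteq> 0\<close> by simp
  qed
  have gen: "\<exists>p\<in>poly_over M. poly p x = u" if "x \<notin> M" for x
  proof (rule ccontr)
    assume no: "\<not> ?thesis"
    let ?B = "(\<lambda>p. poly p x) ` poly_over M"
    have "u \<notin> ?B" using no by auto
    moreover have MB: "M \<subseteq> ?B"
    proof
      fix b assume "b \<in> M"
      hence "monom b 0 \<in> poly_over M" by (rule poly_over_ops(4)[OF M(1)])
      thus "b \<in> ?B" by (rule rev_image_eqI) (simp add: poly_monom)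
    qed
    ultimately have "?B = M" using subring_image_poly[OF M(1)] M(2) max[of ?B] by (auto simp: C_def)
    moreover have "monom 1 1 \<in> poly_over M" by (rule poly_over_ops(4)[OF M(1) subringD(2)[OF M(1)]])
    hence "x \<in> ?B" by (rule rev_image_eqI) (simp add: poly_monom)
    ultimately show False using that by blast
  qed
  have "x \<in> M \<or> inverse x \<in> M" for x
  proof (rule ccontr)
    assume no: "\<not> ?thesis"
    hence x0: "x \<noteq> 0" using subringD(1)[OF M(1)] by auto
    define W where "W x p \<longleftrightarrow> p \<in> poly_over M \<and> poly p x = u" for x p
    have m1: "\<exists>p. W z p \<and> (\<forall>p'. W z p' \<longrightarrow> degree p \<le> degree p')" if "z \<notin> M" for z
      using ex_has_least_nat[of "W z" _ degree] gen[OF that] unfolding W_def by blast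
    obtain p where p: "W x p" "\<And>p'. W x p' \<Longrightarrow> degree p \<le> degree p'" using m1 no by blast
    obtain q where q: "W (inverse x) q" "\<And>p'. W (inverse x) p' \<Longrightarrow> degree q \<le> degree p'" using m1 no by blast
    have d1: "degree p \<ge> 1" if "W z p" for z p
    proof (rule ccontr)
      assume "\<not> ?thesis"
      hence "poly p z = coeff p 0" by (auto simp: not_le elim!: degree_eq_zeroE)
      thus False using that M(3) unfolding W_def poly_over_def by auto
    qed
    show False
    proof (cases "degree q \<le> degree p")
      case True
      have "\<exists>p'\<in>poly_over M. poly p' x = u \<and> degree p' < degree p"
        by (rule degree_reduction[OF M(1) _ au(2,1) unit, where y = "inverse x" and q = q])
           (use p q d1 x0 True in \<open>auto simp: W_def\<close>)
      then obtain p' where "W x p'" "degree p' < degree p" unfolding W_def by blast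
      thus ?thesis using p(2)[of p'] by simp
    next
      case False
      have "\<exists>p'\<in>poly_over M. poly p' (inverse x) = u \<and> degree p' < degree q"
        by (rule degree_reduction[OF M(1) _ au(2,1) unit, where y = x and q = p])
           (use p q d1 x0 False in \<open>auto simp: W_def\<close>)
      then obtain p' where "W (inverse x) p'" "degree p' < degree q" unfolding W_def by blast
      thus ?thesis using q(2)[of p'] by simp
    qed
  qed
  thus ?thesis using M by (auto simp: valuation_ring_def)
qed

text \<open>For a valuation ring, the maximal ideal. The residue field is never formed; equality in
  it is written \<open>a - b \<in> nonunits A\<close>.\<close>

definition nonunits :: "'k::field set \<Rightarrow> 'k set" where
  "nonunits A = {a \<in> A. a = 0 \<or> inverse a \<notin> A}"

context
  fixes A :: "'k::field set"
  assumes A: "valuation_ring A"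
begin

lemma vr_subring: "subring A" and vr_total: "a \<in> A \<or> inverse a \<in> A"
  using A by (auto simp: valuation_ring_def)

lemmas vr = subringD[OF vr_subring]

lemma nonunits_mult: "a \<in> A \<Longrightarrow> b \<in> nonunits A \<Longrightarrow> a * b \<in> nonunits A"
proof -
  assume a: "a \<in> A" and b: "b \<in> nonunits A"
  have "inverse b \<in> A" if "a \<noteq> 0" "b \<noteq> 0" "inverse (a * b) \<in> A"
    using vr(6)[OF a that(3)] that by (simp add: field_simps)
  thus ?thesis using a b by (auto simp: nonunits_def vr)
qed

lemma nonunits_add:
  assumes "a \<in> nonunits A" "b \<in> nonunits A" shows "a + b \<in> nonunits A"
proof -
  have *: "a + b \<in> nonunits A" if "a \<in> A" "b \<in> nonunits A" "b \<noteq> 0" "a / b \<in> A" for a b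
  proof -
    have "a + b = (1 + a / b) * b" using that by (simp add: field_simps)
    thus ?thesis using nonunits_mult[of "1 + a / b" b] that vr by simp
  qed
  have ab: "a \<in> A" "b \<in> A" using assms by (auto simp: nonunits_def)
  show ?thesis
  proof (cases "a = 0 \<or> b = 0")
    case True thus ?thesis using assms by auto
  next
    case False
    have "a / b \<in> A \<or> b / a \<in> A" using vr_total[of "a / b"] by (simp add: inverse_divide)
    thus ?thesis using *[of a b] *[of b a] assms ab False by (auto simp: add.commute)
  qed
qed

lemma nonunits_0: "0 \<in> nonunits A" and nonunits_1: "1 \<notin> nonunits A"
  using vr by (auto simp: nonunits_def)

lemma nonunits_in: "a \<in> nonunits A \<Longrightarrow> a \<in> A"
  by (simp add: nonunits_def)

lemma nonunits_uminus: "a \<in> nonunits A \<Longrightarrow> - a \<in> nonunits A"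
  using nonunits_mult[of "-1" a] vr by simp

lemma nonunits_diff: "a \<in> nonunits A \<Longrightarrow> b \<in> nonunits A \<Longrightarrow> a - b \<in> nonunits A"
  using nonunits_add[of a "- b"] nonunits_uminus[of b] by simp

lemma nonunits_prime: "a \<in> A \<Longrightarrow> b \<in> A \<Longrightarrow> a * b \<in> nonunits A \<Longrightarrow> a \<in> nonunits A \<or> b \<in> nonunits A"
  using vr(6)[of "inverse a" "inverse b"] by (auto simp: nonunits_def)

lemma nonunits_sum: "(\<And>i. i \<in> I \<Longrightarrow> f i \<in> nonunits A) \<Longrightarrow> (\<Sum>i\<in>I. f i) \<in> nonunits A"
  by (induction I rule: infinite_finite_induct) (auto intro: nonunits_0 nonunits_add)

lemma nonunits_power: "a \<in> nonunits A \<Longrightarrow> n \<ge> 1 \<Longrightarrow> a ^ n \<in> nonunits A"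
proof (induction n)
  case (Suc n)
  thus ?case using nonunits_mult[of "a ^ n" a] subring_power[OF vr_subring nonunits_in[OF Suc.prems(1)], of n]
    by (simp add: mult.commute)
qed simp

text \<open>If \<open>y\<close> were outside \<open>A\<close>, its inverse \<open>t\<close> would be
  a nonunit; multiplying the equation by \<open>t ^ e\<close> exhibits the leading coefficient as a
  sum of nonunits.\<close>

lemma valuation_ring_integrally_closed:
  assumes p: "p \<in> poly_over A" "degree p \<le> e" "coeff p e \<notin> nonunits A" and y: "poly p y = 0"
  shows "y \<in> A"
proof (rule ccontr)
  assume "y \<notin> A"
  define t where "t = inverse y"
  have y0: "y \<noteq> 0" using \<open>y \<notin> A\<close> vr(1) by auto
  have t: "t \<in> nonunits A" using \<open>y \<notin> A\<close> vr_total[of y] by (auto simp: t_def nonunits_def)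
  have "(\<Sum>i\<le>e. coeff p i * y ^ i) = 0"
    using y p(2) unfolding poly_altdef
    by (subst (asm) sum.mono_neutral_left[of "{..e}"]) (auto simp: coeff_eq_0)
  hence "0 = (\<Sum>i\<le>e. coeff p i * y ^ i) * t ^ e" by simp
  also have "\<dots> = (\<Sum>i\<le>e. coeff p i * t ^ (e - i))"
    unfolding sum_distrib_right
  proof (intro sum.cong refl)
    fix i assume "i \<in> {..e}"
    hence "t ^ e = t ^ i * t ^ (e - i)" by (simp flip: power_add)
    moreover have "y ^ i * t ^ i = 1" using y0 by (simp add: t_def flip: power_mult_distrib)
    ultimately show "coeff p i * y ^ i * t ^ e = coeff p i * t ^ (e - i)"
      by (simp add: mult.assoc)
  qed
  also have "\<dots> = (\<Sum>i<e. coeff p i * t ^ (e - i)) + coeff p e"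
    by (simp flip: lessThan_Suc_atMost)
  finally have "coeff p e = - (\<Sum>i<e. coeff p i * t ^ (e - i))" by (simp add: eq_neg_iff_add_eq_0 add.commute)
  moreover have "(\<Sum>i<e. coeff p i * t ^ (e - i)) \<in> nonunits A"
    using p t by (intro nonunits_sum nonunits_mult nonunits_power) (auto simp: poly_over_def)
  ultimately show False using p(3) nonunits_uminus by simp
qed

lemma poly_over_synthetic_div:
  assumes "c \<in> A" "p \<in> poly_over A" shows "synthetic_div p c \<in> poly_over A"
  using assms(2)
proof (induction p)
  case (pCons a p)
  have "coeff p i \<in> A" for i using pCons.prems coeff_pCons_Suc[of a p i] unfolding poly_over_def by (metis mem_Collect_eq)
  hence p: "p \<in> poly_over A" by (simp add: poly_over_def)
  have "coeff (pCons (poly p c) (synthetic_div p c)) i \<in> A" for i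
    using pCons.IH[OF p] poly_in_subring[OF vr_subring p assms(1)] by (cases i) (auto simp: poly_over_def)
  thus ?case by (simp add: synthetic_div_pCons poly_over_def)
qed (simp add: poly_over_def vr)

text \<open>A residually nonzero polynomial loses one residual root with each synthetic division,
  and the cofactor still has a coefficient outside the maximal ideal.\<close>

lemma finitely_many_residual_roots:
  assumes "p \<in> poly_over A" "\<exists>i. coeff p i \<notin> nonunits A"
  shows "\<exists>R. finite R \<and> (\<forall>y\<in>A. poly p y \<in> nonunits A \<longrightarrow> (\<exists>r\<in>R. y - r \<in> nonunits A))"
  using assms
proof (induction "degree p" arbitrary: p rule: less_induct)
  case less
  show ?case
  proof (cases "\<exists>y\<in>A. poly p y \<in> nonunits A")
    case False
    thus ?thesis by (intro exI[of _ "{}"]) auto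
  next
    case True
    then obtain c where c: "c \<in> A" "poly p c \<in> nonunits A" by blast
    let ?q = "synthetic_div p c"
    have eq: "p + smult c ?q = pCons (poly p c) ?q" by (rule synthetic_div_correct)
    have q: "?q \<in> poly_over A" by (rule poly_over_synthetic_div[OF c(1) less.prems(1)])
    have qn: "\<exists>i. coeff ?q i \<notin> nonunits A"
    proof (rule ccontr)
      assume "\<not> ?thesis"
      hence *: "\<And>i. coeff ?q i \<in> nonunits A" by blast
      have "coeff p i \<in> nonunits A" for i
      proof -
        have "coeff p i = coeff (pCons (poly p c) ?q) i - c * coeff ?q i"
          using arg_cong[OF eq, of "\<lambda>p. coeff p i"] by (simp add: algebra_simps)
        moreover have "coeff (pCons (poly p c) ?q) i \<in> nonunits A" using c * by (cases i) auto
        ultimately show ?thesis using nonunits_diff nonunits_mult[OF c(1) *] by auto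
      qed
      thus False using less.prems by blast
    qed
    have "degree p \<noteq> 0"
    proof
      assume "degree p = 0"
      then obtain a where "p = [:a:]" by (rule degree_eq_zeroE)
      thus False using qn nonunits_0 by auto
    qed
    hence "degree ?q < degree p" by (simp add: degree_synthetic_div)
    from less.hyps[OF this q qn] obtain R where
      R: "finite R" "\<And>y. y \<in> A \<Longrightarrow> poly ?q y \<in> nonunits A \<Longrightarrow> \<exists>r\<in>R. y - r \<in> nonunits A" by blast
    have "\<exists>r\<in>insert c R. y - r \<in> nonunits A" if y: "y \<in> A" "poly p y \<in> nonunits A" for y
    proof -
      have "poly p y + c * poly ?q y = poly p c + y * poly ?q y"
        using arg_cong[OF eq, of "\<lambda>p. poly p y"] by simp
      hence "(y - c) * poly ?q y = poly p y - poly p c" by (simp add: algebra_simps)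
      hence "(y - c) * poly ?q y \<in> nonunits A" using nonunits_diff[OF y(2) c(2)] by simp
      hence "y - c \<in> nonunits A \<or> poly ?q y \<in> nonunits A"
        by (intro nonunits_prime) (use y c vr poly_in_subring[OF vr_subring q] in auto)
      thus ?thesis using R(2)[OF y(1)] by auto
    qed
    thus ?thesis using R(1) by (intro exI[of _ "insert c R"]) auto
  qed
qed

end

text \<open>
  Subrings of the field are treated as rings of functions on the one-point type \<open>unit\<close>, so that the
  facts on minimal polynomials apply.
\<close>

definition avoids_large_primes :: "(unit \<Rightarrow> 'k::field_char_0) set \<Rightarrow> bool" where
  "avoids_large_primes S \<longleftrightarrow> fun_ring S \<and> (\<forall>h\<in>S. h () \<noteq> 0 \<longrightarrow>
     (\<exists>N. \<forall>p>N. prime p \<longrightarrow> (\<forall>k. \<forall>a\<in>S. h () ^ k \<noteq> of_nat p * a ())))"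

lemma avoids_large_primesD:
  "avoids_large_primes S \<Longrightarrow> h \<in> S \<Longrightarrow> h () \<noteq> 0 \<Longrightarrow>
     \<exists>N. \<forall>p>N. prime p \<longrightarrow> (\<forall>k. \<forall>a\<in>S. h () ^ k \<noteq> of_nat p * a ())"
  by (simp add: avoids_large_primes_def)

lemma avoids_large_primes_int: "avoids_large_primes (range (\<lambda>(n::int) (_::unit). of_int n :: 'k::field_char_0))"
proof -
  let ?S = "range (\<lambda>(n::int) (_::unit). of_int n :: 'k)"
  have "fun_ring ?S" unfolding fun_ring_def
  proof (intro conjI ballI)
    show "(\<lambda>_. 0) \<in> ?S" by (rule range_eqI[of _ _ 0]) simp
    show "(\<lambda>_. 1) \<in> ?S" by (rule range_eqI[of _ _ 1]) simp
    fix f assume "f \<in> ?S"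
    then obtain m where m: "f = (\<lambda>_. of_int m)" by auto
    show "(\<lambda>x. - f x) \<in> ?S" unfolding m by (rule range_eqI[of _ _ "- m"]) simp
    fix g assume "g \<in> ?S"
    then obtain n where n: "g = (\<lambda>_. of_int n)" by auto
    show "(\<lambda>x. f x + g x) \<in> ?S" unfolding m n by (rule range_eqI[of _ _ "m + n"]) simp
    show "(\<lambda>x. f x * g x) \<in> ?S" unfolding m n by (rule range_eqI[of _ _ "m * n"]) simp
  qed
  moreover have "\<exists>N. \<forall>p>N. prime p \<longrightarrow> (\<forall>k. \<forall>a\<in>?S. h () ^ k \<noteq> of_nat p * a ())"
    if h: "h \<in> ?S" "h () \<noteq> 0" for h
  proof -
    obtain n where n: "h = (\<lambda>_. of_int n)" using h by auto
    have n0: "n \<noteq> 0" using h n by auto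
    have False if p: "nat \<bar>n\<bar> < p" "prime p" and eq: "(of_int n :: 'k) ^ k = of_nat p * of_int m" for p k m
    proof -
      have "(of_int (n ^ k) :: 'k) = of_int (int p * m)" using eq by simp
      hence "n ^ k = int p * m" by (simp only: of_int_eq_iff)
      hence "int p dvd n ^ k" by simp
      hence "int p dvd n" using p(2) prime_dvd_power by (metis prime_nat_int_transfer)
      hence "int p \<le> \<bar>n\<bar>" using n0 zdvd_imp_le[of "int p" "\<bar>n\<bar>"] by simp
      thus False using p(1) by linarith
    qed
    thus ?thesis unfolding n by (intro exI[of _ "nat \<bar>n\<bar>"]) auto
  qed
  ultimately show ?thesis unfolding avoids_large_primes_def by blast
qed

text \<open>The property means that large primes stay nonunits after inverting \<open>h\<close>. For
  transcendental \<open>w\<close> it passes to \<open>adjoin S w\<close> by comparing leading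
  coefficients; for algebraic \<open>w\<close> by replacing \<open>h\<close> with a multiple in
  \<open>S\<close>.\<close>

lemma avoids_large_primes_adjoin:
  fixes S :: "(unit \<Rightarrow> 'k::field_char_0) set"
  assumes "avoids_large_primes S"
  shows "avoids_large_primes (adjoin S w)"
proof -
  have S: "fun_ring S" using assms by (simp add: avoids_large_primes_def)
  note A = adjoin_fun_ring[OF S, of w]
  have v: "vanishes UNIV f \<longleftrightarrow> f () = 0" for f :: "unit \<Rightarrow> 'k" by (simp add: vanishes_def)
  have irr: "irreducible_on T UNIV" for T :: "(unit \<Rightarrow> 'k) set" by (auto simp: irreducible_on_def v)
  have *: "\<exists>N. \<forall>p>N. prime p \<longrightarrow> (\<forall>k. \<forall>a\<in>adjoin S w. h () ^ k \<noteq> of_nat p * a ())"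
    if h: "h \<in> adjoin S w" "h () \<noteq> 0" for h
  proof (cases "algebraic_over S UNIV w")
    case True
    obtain F e where m: "min_polynomial S UNIV w F e" using min_polynomial_exists[OF S True] by blast
    have F: "F \<in> poly_maps S" "e \<ge> 1" "\<And>x. degree (F x) \<le> e" "poly (F ()) (w ()) = 0"
       and nz: "coeff (F ()) e \<noteq> 0"
      and min: "\<And>G i. G \<in> poly_maps S \<Longrightarrow> (\<And>x. degree (G x) < e) \<Longrightarrow> poly (G ()) (w ()) = 0 \<Longrightarrow> coeff (G ()) i = 0"
      using m unfolding min_polynomial_def v by auto
    obtain b r where br: "b \<in> adjoin S w" "r \<in> S" "r () \<noteq> 0" "b () * h () = r ()"
      using min_polynomial_associate[OF S irr True h(1)] h(2) v by auto
    \<comment> \<open>The exceptional primes are read off from \<open>f * r\<close>: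
      \<open>r\<close> replaces \<open>h\<close> by an element of \<open>S\<close>, and
      \<open>f\<close>, the leading coefficient of the minimal polynomial, absorbs the factors
      introduced by pseudo-division.\<close>
    define f where "f = (\<lambda>x. coeff (F x) e)"
    have f: "f \<in> S" unfolding f_def by (rule pm_coeff[OF S F(1)])
    have fr: "(\<lambda>x. f x * r x) \<in> S" by (rule fr_mult[OF S f br(2)])
    have "f () * r () \<noteq> 0" using nz br by (simp add: f_def)
    from avoids_large_primesD[OF assms fr this] obtain N where
      "\<forall>p>N. prime p \<longrightarrow> (\<forall>k. \<forall>a\<in>S. (f () * r ()) ^ k \<noteq> of_nat p * a ())" ..
    hence N: "\<And>p k a. p > N \<Longrightarrow> prime p \<Longrightarrow> a \<in> S \<Longrightarrow> (f () * r ()) ^ k \<noteq> of_nat p * a ()" by simp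
    have False if p: "p > N" "prime p" and a: "a \<in> adjoin S w" "h () ^ k = of_nat p * a ()" for p k a
    proof -
      have "(\<lambda>x. b x ^ k * a x) \<in> adjoin S w" by (intro fr_mult[OF A] fr_power[OF A] br a)
      then obtain G where G: "G \<in> poly_maps S" "\<And>x. b x ^ k * a x = poly (G x) (w x)"
        unfolding adjoin_def by (auto simp: fun_eq_iff)
      obtain D where "\<And>x. degree (G x) \<le> D" using G by (auto simp: poly_maps_def)
      then obtain s Q R where d: "R \<in> poly_maps S" "\<And>x. smult (f x ^ s) (G x) = Q x * F x + R x" "\<And>x. degree (R x) < e"
        using pseudo_division[OF S F(1) G(1) F(3,2), of D] unfolding f_def by blast
      have "f () ^ s * poly (G ()) (w ()) = poly (R ()) (w ())"
        using arg_cong[OF d(2)[of "()"], of "\<lambda>p. poly p (w ())"] F(4) by simp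
      moreover have "r () ^ k = of_nat p * poly (G ()) (w ())"
      proof -
        have "r () ^ k = b () ^ k * h () ^ k" by (simp add: power_mult_distrib flip: br(4))
        thus ?thesis by (simp add: a(2) mult_ac flip: G(2))
      qed
      ultimately have e1: "f () ^ s * r () ^ k = of_nat p * poly (R ()) (w ())" by simp
      have one: "(\<lambda>_. of_nat p) \<in> S"
      proof (induction p)
        case (Suc n) show ?case using fr_add[OF S fr_1[OF S] Suc] by simp
      qed (simp add: fr_0[OF S])
      \<comment> \<open>An identity in \<open>w\<close> of degree below \<open>e\<close> holds
        coefficientwise by minimality; its constant coefficient brings the divisibility by
        \<open>p\<close> down to \<open>S\<close>.\<close>
      define T where "T = (\<lambda>x. [:f x ^ s * r x ^ k:] - smult (of_nat p) (R x))"
      have "T \<in> poly_maps S" unfolding T_def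
        by (intro fr_diff[OF pm_fun_ring[OF S]] pm_const[OF S] pm_smult[OF S] fr_mult[OF S] fr_power[OF S] f br d one)
      moreover have "degree (T x) < e" for x
        unfolding T_def using d(3)[of x] F(2)
        by (intro degree_diff_less order.strict_trans1[OF degree_smult_le]) auto
      moreover have "poly (T ()) (w ()) = 0" using e1 by (simp add: T_def)
      ultimately have "coeff (T ()) 0 = 0" by (rule min)
      hence e2: "f () ^ s * r () ^ k = of_nat p * coeff (R ()) 0" by (simp add: T_def)
      have "(f () * r ()) ^ (s + k) = (f () ^ s * r () ^ k) * (f () ^ k * r () ^ s)"
        by (simp add: power_add power_mult_distrib mult_ac)
      also have "\<dots> = of_nat p * (coeff (R ()) 0 * (f () ^ k * r () ^ s))" by (simp add: e2)
      finally show False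
        using N[OF p, of "\<lambda>x. coeff (R x) 0 * (f x ^ k * r x ^ s)"]
          fr_mult[OF S pm_coeff[OF S d(1)] fr_mult[OF S fr_power[OF S f] fr_power[OF S br(2)]]] by blast
    qed
    thus ?thesis by blast
  next
    case False
    hence tr: "G () = 0" if "G \<in> poly_maps S" "poly (G ()) (w ()) = 0" for G
      using that unfolding algebraic_over_def v by (auto simp: poly_eq_iff)
    obtain G where G: "G \<in> poly_maps S" "h = (\<lambda>x. poly (G x) (w x))" using h by (auto simp: adjoin_def)
    define D where "D = degree (G ())"
    have "G () \<noteq> 0" using h G by auto
    hence lc: "coeff (G ()) D \<noteq> 0" by (simp add: D_def)
    from avoids_large_primesD[OF assms pm_coeff[OF S G(1), of D] this] obtain N where
      "\<forall>p>N. prime p \<longrightarrow> (\<forall>k. \<forall>a\<in>S. coeff (G ()) D ^ k \<noteq> of_nat p * a ())" ..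
    hence N: "\<And>p k a. p > N \<Longrightarrow> prime p \<Longrightarrow> a \<in> S \<Longrightarrow> coeff (G ()) D ^ k \<noteq> of_nat p * a ()" by simp
    have False if p: "p > N" "prime p" and a: "a \<in> adjoin S w" "h () ^ k = of_nat p * a ()" for p k a
    proof -
      obtain H where H: "H \<in> poly_maps S" "a = (\<lambda>x. poly (H x) (w x))" using a by (auto simp: adjoin_def)
      have one: "(\<lambda>_. of_nat p) \<in> S"
      proof (induction p)
        case (Suc n) show ?case using fr_add[OF S fr_1[OF S] Suc] by simp
      qed (simp add: fr_0[OF S])
      have "(\<lambda>x. G x ^ k - smult (of_nat p) (H x)) \<in> poly_maps S"
        by (intro fr_diff[OF pm_fun_ring[OF S]] fr_power[OF pm_fun_ring[OF S]] pm_smult[OF S] G H one)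
      from tr[OF this] have "G () ^ k = smult (of_nat p) (H ())" using a by (simp add: G H)
      hence "coeff (G () ^ k) (D * k) = of_nat p * coeff (H ()) (D * k)" by simp
      moreover have "coeff (G () ^ k) (D * k) = coeff (G ()) D ^ k"
        using lead_coeff_power[of "G ()" k] by (simp add: degree_power_eq[OF \<open>G () \<noteq> 0\<close>] D_def mult.commute)
      ultimately show False using N[OF p pm_coeff[OF S H(1)]] by simp
    qed
    thus ?thesis by blast
  qed
  thus ?thesis using A unfolding avoids_large_primes_def by blast
qed

text \<open>The localisation at \<open>h\<close> of a ring generated by \<open>\<Gamma>\<close> and
  \<open>h\<close> does not contain the inverse of a large prime \<open>p\<close>.
  \<open>valuation_ring_exists\<close> for \<open>u = inverse p\<close> keeps it that way, so
  \<open>p\<close> lands in the maximal ideal while \<open>h\<close> stays invertible.\<close>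

lemma valuation_ring_over_prime:
  fixes \<Gamma> :: "'k::field_char_0 set"
  assumes "finite \<Gamma>" "h \<noteq> 0"
  shows "\<exists>N. \<forall>p>N. prime p \<longrightarrow> (\<exists>A. valuation_ring A \<and> \<Gamma> \<subseteq> A \<and> h \<in> A \<and> h \<notin> nonunits A \<and> of_nat p \<in> nonunits A)"
proof -
  have "\<exists>S::(unit \<Rightarrow> 'k) set. avoids_large_primes S \<and> (\<forall>c\<in>\<Gamma>. (\<lambda>_. c) \<in> S)" if "finite \<Gamma>" for \<Gamma> :: "'k set"
    using that
  proof (induction \<Gamma> rule: finite_induct)
    case empty
    thus ?case using avoids_large_primes_int by blast
  next
    case (insert c \<Gamma>)
    then obtain S :: "(unit \<Rightarrow> 'k) set" where S: "avoids_large_primes S" "\<forall>c\<in>\<Gamma>. (\<lambda>_. c) \<in> S" by blast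
    have "fun_ring S" using S by (simp add: avoids_large_primes_def)
    hence "\<forall>c'\<in>insert c \<Gamma>. (\<lambda>_. c') \<in> adjoin S (\<lambda>_. c)" using S(2) by (auto intro: adjoin_self adjoin_base)
    thus ?case using avoids_large_primes_adjoin[OF S(1)] by blast
  qed
  from this[of "insert h \<Gamma>"] assms(1) obtain S :: "(unit \<Rightarrow> 'k) set" where
    S: "avoids_large_primes S" "\<forall>c\<in>insert h \<Gamma>. (\<lambda>_. c) \<in> S" by auto
  have R: "fun_ring S" using S by (simp add: avoids_large_primes_def)
  have "(\<lambda>_. h) \<in> S" using S by simp
  from avoids_large_primesD[OF S(1) this assms(2)] obtain N where
    "\<forall>p>N. prime p \<longrightarrow> (\<forall>k. \<forall>a\<in>S. h ^ k \<noteq> of_nat p * a ())" ..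
  hence N: "\<And>p k a. p > N \<Longrightarrow> prime p \<Longrightarrow> a \<in> S \<Longrightarrow> h ^ k \<noteq> of_nat p * a ()" by simp
  have "\<exists>A. valuation_ring A \<and> \<Gamma> \<subseteq> A \<and> h \<in> A \<and> h \<notin> nonunits A \<and> of_nat p \<in> nonunits A" if p: "p > N" "prime p" for p
  proof -
    have h: "(\<lambda>_. h) \<in> S" using S by simp
    define A where "A = {a () * inverse h ^ k | a k. a \<in> S}"
    have I: "a () * inverse h ^ k \<in> A" if "a \<in> S" for a k using that by (auto simp: A_def)
    have "subring A" unfolding subring_def
    proof (intro conjI ballI)
      show "1 \<in> A" using I[OF fr_1[OF R], of 0] by simp
      fix s t assume "s \<in> A" "t \<in> A"
      then obtain a k b l where st: "s = a () * inverse h ^ k" "a \<in> S" "t = b () * inverse h ^ l" "b \<in> S"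
        unfolding A_def by blast
      have "s - t = (a () * h ^ l - b () * h ^ k) * inverse h ^ (k + l)"
        using assms(2) by (simp add: st power_add field_simps)
      thus "s - t \<in> A"
        using I[OF fr_diff[OF R fr_mult[OF R st(2) fr_power[OF R h, of l]] fr_mult[OF R st(4) fr_power[OF R h, of k]]]] by simp
      have "s * t = (a () * b ()) * inverse h ^ (k + l)" by (simp add: st power_add mult_ac)
      thus "s * t \<in> A" using I[OF fr_mult[OF R st(2,4)]] by simp
    qed
    moreover have "inverse (of_nat p) \<notin> A"
    proof
      assume "inverse (of_nat p) \<in> A"
      then obtain a k where a: "a \<in> S" "inverse (of_nat p) = a () * inverse h ^ k" by (auto simp: A_def)
      have "of_nat p \<noteq> (0::'k)" using p(2) by auto
      hence "h ^ k = of_nat p * a ()" using a(2) assms(2) by (simp add: field_simps)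
      thus False using N[OF p a(1)] by blast
    qed
    moreover have sub: "c \<in> A" if "(\<lambda>_. c) \<in> S" for c using I[OF that, of 0] by simp
    moreover have "of_nat p \<in> A"
    proof (rule sub, induction p)
      case (Suc n) show ?case using fr_add[OF R fr_1[OF R] Suc] by simp
    qed (simp add: fr_0[OF R])
    ultimately obtain B where B: "valuation_ring B" "A \<subseteq> B" "inverse (of_nat p) \<notin> B"
      using valuation_ring_exists[of A "inverse (of_nat p)"] by auto
    have "inverse h \<in> A" using I[OF fr_1[OF R], of 1] by simp
    hence "h \<notin> nonunits B" using B assms(2) by (auto simp: nonunits_def)
    moreover have "of_nat p \<in> nonunits B" using B \<open>of_nat p \<in> A\<close> by (auto simp: nonunits_def)
    ultimately show ?thesis using B sub S(2) by blast
  qed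
  thus ?thesis by blast
qed

text \<open>
  Every polynomial function has its coefficients in a finitely generated ring; over a valuation
  ring containing them it preserves integrality and congruences.
\<close>

definition integral_over :: "nat set \<Rightarrow> 'k::field set \<Rightarrow> ((nat \<Rightarrow> 'k) \<Rightarrow> 'k) \<Rightarrow> bool" where
  "integral_over J A f \<longleftrightarrow> (\<forall>x. (\<forall>i\<in>J. x i \<in> A) \<longrightarrow> f x \<in> A) \<and>
     (\<forall>x y. (\<forall>i\<in>J. x i \<in> A \<and> y i \<in> A \<and> x i - y i \<in> nonunits A) \<longrightarrow> f x - f y \<in> nonunits A)"

lemma integral_over_fun_ring:
  assumes A: "valuation_ring A" shows "fun_ring {f. integral_over J A f}"
  unfolding fun_ring_def
proof (intro conjI ballI)
  show "(\<lambda>_. 0) \<in> {f. integral_over J A f}" "(\<lambda>_. 1) \<in> {f. integral_over J A f}"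
    using nonunits_0[OF A] vr[OF A] by (auto simp: integral_over_def)
  fix f assume "f \<in> {f. integral_over J A f}"
  hence f: "integral_over J A f" by simp
  have "- f x - - f y \<in> nonunits A" if "f x - f y \<in> nonunits A" for x y
    using nonunits_uminus[OF A that] by simp
  thus "(\<lambda>x. - f x) \<in> {f. integral_over J A f}"
    using f vr(3)[OF A] by (auto simp: integral_over_def)
  fix g assume "g \<in> {f. integral_over J A f}"
  hence g: "integral_over J A g" by simp
  have "f x + g x - (f y + g y) \<in> nonunits A"
    if "f x - f y \<in> nonunits A" "g x - g y \<in> nonunits A" for x y
    using nonunits_add[OF A that] by (metis add_diff_add)
  thus "(\<lambda>x. f x + g x) \<in> {f. integral_over J A f}"
    using f g vr(4)[OF A] by (auto simp: integral_over_def)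
  have "f x * g x - f y * g y \<in> nonunits A"
    if "f x - f y \<in> nonunits A" "g x - g y \<in> nonunits A" "g x \<in> A" "f y \<in> A" for x y
  proof -
    have "f x * g x - f y * g y = g x * (f x - f y) + f y * (g x - g y)" by (simp add: algebra_simps)
    thus ?thesis
      using nonunits_add[OF A nonunits_mult[OF A that(3,1)] nonunits_mult[OF A that(4,2)]] by simp
  qed
  thus "(\<lambda>x. f x * g x) \<in> {f. integral_over J A f}"
    using f g vr(6)[OF A] by (auto simp: integral_over_def)
qed

lemma pfuns_integral_over:
  assumes "f \<in> pfuns J"
  shows "\<exists>\<Gamma>. finite \<Gamma> \<and> (\<forall>A. valuation_ring A \<longrightarrow> \<Gamma> \<subseteq> A \<longrightarrow> integral_over J A f)"
  using assms
proof induction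
  case (const c)
  show ?case by (intro exI[of _ "{c}"]) (auto simp: integral_over_def nonunits_0)
next
  case (coord i)
  thus ?case by (intro exI[of _ "{}"]) (auto simp: integral_over_def)
next
  case (add f g)
  then obtain \<Gamma>1 \<Gamma>2 where G: "finite \<Gamma>1" "\<And>A. valuation_ring A \<Longrightarrow> \<Gamma>1 \<subseteq> A \<Longrightarrow> integral_over J A f"
    "finite \<Gamma>2" "\<And>A. valuation_ring A \<Longrightarrow> \<Gamma>2 \<subseteq> A \<Longrightarrow> integral_over J A g" by metis
  thus ?case using fr_add[OF integral_over_fun_ring, of _ f J g] by (intro exI[of _ "\<Gamma>1 \<union> \<Gamma>2"]) auto
next
  case (mult f g)
  then obtain \<Gamma>1 \<Gamma>2 where G: "finite \<Gamma>1" "\<And>A. valuation_ring A \<Longrightarrow> \<Gamma>1 \<subseteq> A \<Longrightarrow> integral_over J A f"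
    "finite \<Gamma>2" "\<And>A. valuation_ring A \<Longrightarrow> \<Gamma>2 \<subseteq> A \<Longrightarrow> integral_over J A g" by metis
  thus ?case using fr_mult[OF integral_over_fun_ring, of _ f J g] by (intro exI[of _ "\<Gamma>1 \<union> \<Gamma>2"]) auto
qed

lemma finite_pfuns_integral_over:
  assumes "finite \<F>" "\<F> \<subseteq> pfuns J"
  shows "\<exists>\<Gamma>. finite \<Gamma> \<and> (\<forall>A. valuation_ring A \<longrightarrow> \<Gamma> \<subseteq> A \<longrightarrow> (\<forall>f\<in>\<F>. integral_over J A f))"
proof -
  have "\<forall>f\<in>\<F>. \<exists>\<Gamma>. finite \<Gamma> \<and> (\<forall>A. valuation_ring A \<longrightarrow> \<Gamma> \<subseteq> A \<longrightarrow> integral_over J A f)"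
    using assms(2) pfuns_integral_over by blast
  then obtain \<Gamma> where "\<forall>f\<in>\<F>. finite (\<Gamma> f) \<and> (\<forall>A. valuation_ring A \<longrightarrow> \<Gamma> f \<subseteq> A \<longrightarrow> integral_over J A f)" by metis
  thus ?thesis using assms(1) by (intro exI[of _ "\<Union>(\<Gamma> ` \<F>)"]) (simp add: UN_subset_iff)
qed

lemma poly_maps_integral_over:
  assumes "F \<in> poly_maps (pfuns J)"
  shows "\<exists>\<Gamma>. finite \<Gamma> \<and> (\<forall>A. valuation_ring A \<longrightarrow> \<Gamma> \<subseteq> A \<longrightarrow> (\<forall>i. integral_over J A (\<lambda>x. coeff (F x) i)))"
proof -
  obtain D where D: "\<And>x. degree (F x) \<le> D" using assms by (auto simp: poly_maps_def)
  have "(\<lambda>i x. coeff (F x) i) ` {..D} \<subseteq> pfuns J" using assms by (auto simp: poly_maps_def)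
  from finite_pfuns_integral_over[OF _ this] obtain \<Gamma> where
    G: "finite \<Gamma>" "\<And>A i. valuation_ring A \<Longrightarrow> \<Gamma> \<subseteq> A \<Longrightarrow> i \<le> D \<Longrightarrow> integral_over J A (\<lambda>x. coeff (F x) i)" by auto
  have "integral_over J A (\<lambda>x. coeff (F x) i)" if A: "valuation_ring A" "\<Gamma> \<subseteq> A" for A i
  proof (cases "i \<le> D")
    case True thus ?thesis using G A by blast
  next
    case False
    hence "coeff (F x) i = 0" for x using D[of x] by (intro coeff_eq_0) simp
    thus ?thesis using vr(1)[OF A(1)] nonunits_0[OF A(1)] by (simp add: integral_over_def)
  qed
  thus ?thesis using G(1) by blast
qed

section \<open>Residual dynamics\<close>

lemma poly_maps_eval:
  assumes S: "fun_ring S" and F: "F \<in> poly_maps S" and w: "w \<in> S"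
  shows "(\<lambda>x. poly (F x) (w x)) \<in> S"
proof -
  obtain D where D: "\<And>x. degree (F x) \<le> D" using F by (auto simp: poly_maps_def)
  have "(\<lambda>x. poly (F x) (w x)) = (\<lambda>x. \<Sum>i\<le>D. coeff (F x) i * w x ^ i)"
  proof
    fix x
    show "poly (F x) (w x) = (\<Sum>i\<le>D. coeff (F x) i * w x ^ i)"
      unfolding poly_altdef using D[of x]
      by (intro sum.mono_neutral_left) (auto simp: coeff_eq_0)
  qed
  thus ?thesis using fr_sum[OF S, of "{..D}" "\<lambda>i x. coeff (F x) i * w x ^ i"]
      fr_mult[OF S pm_coeff[OF S F] fr_power[OF S w]] by simp
qed

lemma poly_maps_iterate:
  assumes S: "fun_ring S" and F: "F \<in> poly_maps S"
  shows "(\<lambda>x. iterate_poly n (F x)) \<in> poly_maps S"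
proof (induction n)
  case 0
  show ?case using pm_X[OF S] by (simp add: iterate_poly_def)
next
  case (Suc n)
  show ?case using poly_maps_pcompose[OF S F Suc] by (simp add: iterate_poly_def)
qed

lemma fun_ring_of_nat: "fun_ring S \<Longrightarrow> (\<lambda>_. of_nat n) \<in> S"
proof (induction n)
  case (Suc n)
  show ?case using fr_add[OF Suc.prems fr_1[OF Suc.prems] Suc.IH[OF Suc.prems]] by simp
qed (simp add: fr_0)

lemma poly_maps_pderiv:
  fixes F :: "'x \<Rightarrow> 'r::{comm_ring_1, semiring_no_zero_divisors} poly"
  assumes S: "fun_ring S" and F: "F \<in> poly_maps S"
  shows "(\<lambda>x. pderiv (F x)) \<in> poly_maps S"
proof -
  obtain D where D: "\<And>x. degree (F x) \<le> D" using F by (auto simp: poly_maps_def)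
  have "degree (pderiv (F x)) \<le> D" for x
    by (rule degree_le) (use D in \<open>auto simp: coeff_pderiv intro!: coeff_eq_0 order.strict_trans1[OF D]\<close>)
  moreover have "(\<lambda>x. coeff (pderiv (F x)) i) \<in> S" for i
    unfolding coeff_pderiv by (intro fr_mult[OF S] fun_ring_of_nat[OF S] pm_coeff[OF S F])
  ultimately show ?thesis by (auto simp: poly_maps_def)
qed

lemma iterate_poly_Suc: "iterate_poly (Suc n) p = p \<circ>\<^sub>p iterate_poly n p"
  by (simp add: iterate_poly_def)

lemma iterate_poly_0: "iterate_poly 0 p = [:0, 1:]"
  by (simp add: iterate_poly_def)

lemma poly_over_pcompose:
  assumes A: "subring A" and "p \<in> poly_over A" "q \<in> poly_over A" shows "p \<circ>\<^sub>p q \<in> poly_over A"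
  using assms(2)
proof (induction p)
  case 0
  thus ?case by (simp add: poly_over_def)
next
  case (pCons a p)
  have c: "coeff (pCons a p) i \<in> A" for i using pCons.prems by (simp add: poly_over_def)
  have "p \<in> poly_over A" using c[of "Suc i" for i] by (simp add: poly_over_def)
  moreover have "monom a 0 \<in> poly_over A" using c[of 0] by (intro poly_over_ops(4)[OF A]) simp
  ultimately show ?case
    using poly_over_ops(2)[OF A _ poly_over_ops(3)[OF A assms(3)], of "monom a 0" "p \<circ>\<^sub>p q"] pCons.IH
    by (simp add: pcompose_pCons monom_0)
qed

lemma poly_over_iterate:
  assumes A: "subring A" and "p \<in> poly_over A" shows "iterate_poly n p \<in> poly_over A"
proof (induction n)
  case 0
  show ?case using subringD[OF A] by (auto simp: iterate_poly_0 poly_over_def coeff_pCons split: nat.splits)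
next
  case (Suc n)
  thus ?case using poly_over_pcompose[OF A assms(2)] by (simp add: iterate_poly_Suc)
qed

lemma poly_over_pderiv:
  assumes A: "subring A" and "p \<in> poly_over A" shows "pderiv p \<in> poly_over A"
proof -
  have "of_nat n \<in> A" for n by (induction n) (auto intro: subringD[OF A])
  thus ?thesis using assms by (auto simp: poly_over_def coeff_pderiv simp del: of_nat_Suc intro!: subringD(6)[OF A])
qed

lemma funpow_period_add: "(f ^^ a) y = y \<Longrightarrow> (f ^^ (a * n)) y = y"
  by (induction n) (simp_all add: funpow_add)

text \<open>Bezout in the form \<open>a * u = b * v + gcd a b\<close>, because a map cannot be
  iterated backwards.\<close>

lemma funpow_period_gcd:
  assumes "(f ^^ a) y = y" "(f ^^ b) y = y" shows "(f ^^ gcd a b) y = y"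
proof (cases "a = 0")
  case False
  obtain u v where uv: "a * u = b * v + gcd a b" using bezout_nat[OF False] by blast
  have "y = (f ^^ (gcd a b + b * v)) y"
    using funpow_period_add[OF assms(1), of u] uv by (simp add: add.commute)
  also have "\<dots> = (f ^^ gcd a b) y"
    using funpow_period_add[OF assms(2), of v] by (simp add: funpow_add)
  finally show ?thesis by simp
qed (use assms in simp)

context
  fixes A :: "'k::field_char_0 set"
  assumes A: "valuation_ring A"
begin

text \<open>First-order expansion: \<open>s\<close> is the quotient of \<open>p - p(b)\<close> by
  \<open>X - b\<close>, evaluated at \<open>a\<close>; a second division by \<open>X - b\<close>
  shows that it is residually the derivative at \<open>b\<close>.\<close>

lemma poly_congruent:
  assumes p: "p \<in> poly_over A" and ab: "a \<in> A" "b \<in> A"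
  shows "\<exists>s\<in>A. poly p a - poly p b = (a - b) * s \<and> (a - b \<in> nonunits A \<longrightarrow> s - poly (pderiv p) b \<in> nonunits A)"
proof -
  let ?q = "synthetic_div p b"
  have q: "?q \<in> poly_over A" by (rule poly_over_synthetic_div[OF A ab(2) p])
  have eq: "p = [:- b, 1:] * ?q + [:poly p b:]" using synthetic_div_correct'[of b p] by simp
  have "poly p a = (a - b) * poly ?q a + poly p b" by (subst eq) (simp add: algebra_simps)
  moreover have "poly (pderiv p) b = poly ?q b"
    by (subst eq, simp only: pderiv_add pderiv_mult pderiv_pCons) simp
  moreover have "poly ?q a - poly ?q b \<in> nonunits A" if "a - b \<in> nonunits A"
  proof -
    let ?r = "synthetic_div ?q b"
    have r: "?r \<in> poly_over A" by (rule poly_over_synthetic_div[OF A ab(2) q])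
    have eqr: "?q = [:- b, 1:] * ?r + [:poly ?q b:]" using synthetic_div_correct'[of b ?q] by simp
    have "poly ?q a = (a - b) * poly ?r a + poly ?q b" by (subst eqr) (simp add: algebra_simps)
    hence "poly ?q a - poly ?q b = poly ?r a * (a - b)" by simp
    thus ?thesis using nonunits_mult[OF A poly_in_subring[OF vr_subring[OF A] r ab(1)] that] by simp
  qed
  ultimately show ?thesis
    using poly_in_subring[OF vr_subring[OF A] q ab(1)] by (intro bexI[of _ "poly ?q a"]) auto
qed

lemma congruent_trans: "a - b \<in> nonunits A \<Longrightarrow> b - c \<in> nonunits A \<Longrightarrow> a - c \<in> nonunits A"
  using nonunits_add[OF A, of "a - b" "b - c"] by simp

lemma congruent_sym: "a - b \<in> nonunits A \<Longrightarrow> b - a \<in> nonunits A"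
  using nonunits_uminus[OF A, of "a - b"] by simp

lemma congruent_mult:
  assumes "a - b \<in> nonunits A" "c - d \<in> nonunits A" "c \<in> A" "b \<in> A"
  shows "a * c - b * d \<in> nonunits A"
proof -
  have "a * c - b * d = c * (a - b) + b * (c - d)" by (simp add: algebra_simps)
  thus ?thesis using nonunits_add[OF A nonunits_mult[OF A assms(3,1)] nonunits_mult[OF A assms(4,2)]] by simp
qed

lemma congruent_power:
  assumes "a - b \<in> nonunits A" "a \<in> A" "b \<in> A" shows "a ^ n - b ^ n \<in> nonunits A"
proof (induction n)
  case (Suc n)
  show ?case using congruent_mult[OF assms(1) Suc] subring_power[OF vr_subring[OF A]] assms by simp
qed (simp add: nonunits_0[OF A])

lemma residually_fixed_orbit:
  assumes f: "f \<in> poly_over A" and y: "y \<in> A" "poly f y - y \<in> nonunits A"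
  shows "(poly f ^^ j) y \<in> A" "(poly f ^^ j) y - y \<in> nonunits A"
proof (induction j)
  case 0
  { case 1 show ?case using y by simp }
  { case 2 show ?case using nonunits_0[OF A] by simp }
next
  case (Suc j)
  { case 1 show ?case using poly_in_subring[OF vr_subring[OF A] f Suc(1)] by simp }
  { case 2
    obtain s where "s \<in> A" "poly f ((poly f ^^ j) y) - poly f y = ((poly f ^^ j) y - y) * s"
      using poly_congruent[OF f Suc(1) y(1)] by blast
    hence "poly f ((poly f ^^ j) y) - poly f y \<in> nonunits A"
      using nonunits_mult[OF A _ Suc(2)] by (simp add: mult.commute)
    from congruent_trans[OF this y(2)] show ?case by simp }
qed

text \<open>Telescoping along the orbit: the \<open>j\<close>-th step is the first one times a
  factor residually equal to \<open>\<mu> ^ j\<close>. Hence, if the geometric sum is residually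
  nonzero, a point of period dividing \<open>M\<close> is already fixed.\<close>

lemma residually_fixed_difference:
  assumes f: "f \<in> poly_over A" and y: "y \<in> A" "poly f y - y \<in> nonunits A"
  defines "\<mu> \<equiv> poly (pderiv f) y"
  shows "\<exists>s\<in>A. (poly f ^^ M) y - y = (poly f y - y) * s \<and> s - (\<Sum>j<M. \<mu> ^ j) \<in> nonunits A"
proof -
  note SA = vr_subring[OF A]
  have lA: "\<mu> \<in> A" unfolding \<mu>_def by (intro poly_in_subring[OF SA] poly_over_pderiv[OF SA] f y)
  have step: "\<exists>s\<in>A. (poly f ^^ Suc j) y - (poly f ^^ j) y = (poly f y - y) * s \<and> s - \<mu> ^ j \<in> nonunits A" for j
  proof (induction j)
    case 0
    show ?case using nonunits_0[OF A] subringD(2)[OF SA] by (intro bexI[of _ 1]) auto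
  next
    case (Suc j)
    then obtain s where s: "s \<in> A" "(poly f ^^ Suc j) y - (poly f ^^ j) y = (poly f y - y) * s" "s - \<mu> ^ j \<in> nonunits A"
      by blast
    let ?a = "(poly f ^^ Suc j) y" and ?b = "(poly f ^^ j) y"
    have ab: "?a \<in> A" "?b \<in> A" "?b - y \<in> nonunits A" "?a - y \<in> nonunits A"
      using residually_fixed_orbit[OF f y] by blast+
    obtain t where t: "t \<in> A" "poly f ?a - poly f ?b = (?a - ?b) * t" "?a - ?b \<in> nonunits A \<longrightarrow> t - poly (pderiv f) ?b \<in> nonunits A"
      using poly_congruent[OF f ab(1,2)] by blast
    have "?a - ?b \<in> nonunits A" using congruent_trans[OF ab(4) congruent_sym[OF ab(3)]] .
    moreover have "poly (pderiv f) ?b - \<mu> \<in> nonunits A"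
    proof -
      obtain r where "r \<in> A" "poly (pderiv f) ?b - poly (pderiv f) y = (?b - y) * r"
        using poly_congruent[OF poly_over_pderiv[OF SA f] ab(2) y(1)] by blast
      thus ?thesis using nonunits_mult[OF A _ ab(3), of r] by (simp add: \<mu>_def mult.commute)
    qed
    ultimately have "t - \<mu> \<in> nonunits A" using t(3) congruent_trans by blast
    hence "t * s - \<mu> * \<mu> ^ j \<in> nonunits A" using congruent_mult[OF _ s(3,1) lA] by blast
    moreover have "(poly f ^^ Suc (Suc j)) y - ?a = (poly f y - y) * (t * s)"
      using t(2) s(2) by simp
    ultimately show ?case using subringD(6)[OF SA t(1) s(1)] by (intro bexI[of _ "t * s"]) auto
  qed
  show ?thesis
  proof (induction M)
    case 0
    show ?case using nonunits_0[OF A] subringD(1)[OF SA] by (intro bexI[of _ 0]) auto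
  next
    case (Suc M)
    then obtain s where s: "s \<in> A" "(poly f ^^ M) y - y = (poly f y - y) * s" "s - (\<Sum>j<M. \<mu> ^ j) \<in> nonunits A" by blast
    obtain t where t: "t \<in> A" "(poly f ^^ Suc M) y - (poly f ^^ M) y = (poly f y - y) * t" "t - \<mu> ^ M \<in> nonunits A"
      using step by blast
    have "(poly f ^^ Suc M) y - y = (poly f y - y) * (s + t)" using s(2) t(2) by (simp add: algebra_simps)
    moreover have "(s + t) - (\<Sum>j<Suc M. \<mu> ^ j) \<in> nonunits A"
      using nonunits_add[OF A s(3) t(3)] by (simp add: algebra_simps)
    ultimately show ?case using subringD(4)[OF SA s(1) t(1)] by blast
  qed
qed

lemma residual_multiplier_iterate:
  assumes f: "f \<in> poly_over A" and y: "y \<in> A" "poly f y - y \<in> nonunits A"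
  shows "poly (pderiv (iterate_poly n f)) y - poly (pderiv f) y ^ n \<in> nonunits A"
proof (induction n)
  case 0
  show ?case using nonunits_0[OF A] by (simp add: iterate_poly_0 pderiv_pCons)
next
  case (Suc n)
  note SA = vr_subring[OF A]
  let ?b = "(poly f ^^ n) y"
  have "poly (pderiv (iterate_poly (Suc n) f)) y = poly (pderiv f) ?b * poly (pderiv (iterate_poly n f)) y"
    by (simp add: iterate_poly_Suc pderiv_pcompose poly_pcompose poly_iterate_poly)
  moreover have "poly (pderiv f) ?b - poly (pderiv f) y \<in> nonunits A"
  proof -
    obtain r where "r \<in> A" "poly (pderiv f) ?b - poly (pderiv f) y = (?b - y) * r"
      using poly_congruent[OF poly_over_pderiv[OF SA f] residually_fixed_orbit(1)[OF f y] y(1)] by blast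
    thus ?thesis using nonunits_mult[OF A _ residually_fixed_orbit(2)[OF f y], of r] by (simp add: mult.commute)
  qed
  moreover have "poly (pderiv (iterate_poly n f)) y \<in> A" "poly (pderiv f) y \<in> A"
    by (intro poly_in_subring[OF SA] poly_over_pderiv[OF SA] poly_over_iterate[OF SA] f y)+
  ultimately show ?case using congruent_mult[OF _ Suc] by simp
qed

text \<open>Bezout: otherwise \<open>1\<close> would be a combination of two nonunits.\<close>

lemma of_nat_unit:
  assumes p: "prime p" "of_nat p \<in> nonunits A" and n: "\<not> p dvd n"
  shows "of_nat n \<notin> nonunits A"
proof
  assume m: "of_nat n \<in> nonunits A"
  have "coprime p n" using p(1) n by (rule prime_imp_coprime)
  hence "gcd n p = 1" by (simp add: coprime_iff_gcd_eq_1 gcd.commute)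
  moreover have "n \<noteq> 0" using n by (cases "n = 0") auto
  ultimately obtain u v where "n * u = p * v + 1" using bezout_nat[of n p] by auto
  hence "(of_nat n * of_nat u :: 'k) = of_nat p * of_nat v + 1"
    by (metis of_nat_1 of_nat_add of_nat_mult)
  hence e: "(1::'k) = of_nat u * of_nat n - of_nat v * of_nat p" by (simp add: mult.commute)
  have o: "of_nat k \<in> A" for k by (induction k) (auto intro: vr[OF A])
  have "(1::'k) \<in> nonunits A"
    by (subst e) (intro nonunits_diff[OF A] nonunits_mult[OF A] o m p)
  thus False using nonunits_1[OF A] by simp
qed

text \<open>If the multiplier to the power \<open>N\<close> is residually not \<open>1\<close>, the
  geometric sum is nonzero and \<open>y\<close> is fixed by \<open>f\<close>. Otherwise its power
  \<open>R\<close> is residually \<open>1\<close>, and the sum reduces to an integer prime to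
  \<open>p\<close>. Since \<open>R\<close> does not involve \<open>N\<close>, only the exponent of
  \<open>p\<close> remains uncontrolled.\<close>

lemma period_divides:
  assumes p: "prime p" "of_nat p \<in> nonunits A"
    and f: "f \<in> poly_over A" and y: "y \<in> A" "poly f y - y \<in> nonunits A"
    and per: "(poly f ^^ N) y = y" "N \<ge> 1"
    and R: "poly (pderiv f) y ^ N - 1 \<in> nonunits A \<Longrightarrow> poly (pderiv f) y ^ R - 1 \<in> nonunits A"
  shows "\<exists>e. (poly f ^^ (R * p ^ e)) y = y"
proof -
  note SA = vr_subring[OF A]
  let ?l = "poly (pderiv f) y"
  have lA: "?l \<in> A" by (intro poly_in_subring[OF SA] poly_over_pderiv[OF SA] f y)
  show ?thesis
  proof (cases "?l ^ N - 1 \<in> nonunits A")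
    case False
    obtain s where s: "s \<in> A" "(poly f ^^ N) y - y = (poly f y - y) * s" "s - (\<Sum>j<N. ?l ^ j) \<in> nonunits A"
      using residually_fixed_difference[OF f y] by blast
    have "s \<noteq> 0"
    proof
      assume "s = 0"
      hence "(\<Sum>j<N. ?l ^ j) \<in> nonunits A" using s(3) nonunits_uminus[OF A, of "- (\<Sum>j<N. ?l ^ j)"] by simp
      hence "(?l - 1) * (\<Sum>j<N. ?l ^ j) \<in> nonunits A"
        using vr(5)[OF A lA vr(2)[OF A]] nonunits_mult[OF A] by blast
      moreover have "(?l - 1) * (\<Sum>j<N. ?l ^ j) = ?l ^ N - 1" by (simp add: power_diff_1_eq)
      ultimately show False using False by simp
    qed
    hence "poly f y = y" using s(2) per(1) by simp
    hence "(poly f ^^ n) y = y" for n by (induction n) auto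
    thus ?thesis by blast
  next
    case True
    \<comment> \<open>With \<open>N = p ^ e * N1\<close>, the iterate \<open>g\<close> has residual
      multiplier \<open>1\<close>, and \<open>g^N1\<close> fixes \<open>y\<close> because
      \<open>R * p ^ e * N1 = R * N\<close>. The geometric sum for \<open>g\<close> is residually
      \<open>N1\<close>.\<close>
    define e N1 where "e = multiplicity p N" and "N1 = N div p ^ e"
    have N: "N = p ^ e * N1" by (simp add: N1_def e_def multiplicity_dvd)
    have nd: "\<not> p dvd N1"
      unfolding N1_def e_def using per(2) p(1) by (intro multiplicity_decompose) auto
    define g where "g = iterate_poly (R * p ^ e) f"
    have gA: "g \<in> poly_over A" unfolding g_def by (rule poly_over_iterate[OF SA f])
    have gy: "poly g y - y \<in> nonunits A"
      unfolding g_def poly_iterate_poly by (rule residually_fixed_orbit(2)[OF f y])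
    have "?l ^ (R * p ^ e) - 1 ^ (p ^ e) \<in> nonunits A"
      unfolding power_mult by (rule congruent_power[OF R[OF True] subring_power[OF SA lA] subringD(2)[OF SA]])
    hence g1: "poly (pderiv g) y - 1 \<in> nonunits A"
      using congruent_trans[OF residual_multiplier_iterate[OF f y, of "R * p ^ e"]] unfolding g_def by simp
    have dA: "poly (pderiv g) y \<in> A" by (intro poly_in_subring[OF SA] poly_over_pderiv[OF SA] gA y)
    obtain s where s: "s \<in> A" "(poly g ^^ N1) y - y = (poly g y - y) * s"
      "s - (\<Sum>j<N1. poly (pderiv g) y ^ j) \<in> nonunits A"
      using residually_fixed_difference[OF gA y(1) gy] by blast
    have "(\<Sum>j<N1. poly (pderiv g) y ^ j - 1) \<in> nonunits A"
      using congruent_power[OF g1 dA vr(2)[OF A]] by (intro nonunits_sum[OF A]) simp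
    hence "(\<Sum>j<N1. poly (pderiv g) y ^ j) - of_nat N1 \<in> nonunits A" by (simp add: sum_subtractf)
    from congruent_trans[OF s(3) this] have "s - of_nat N1 \<in> nonunits A" .
    hence "s \<noteq> 0" using of_nat_unit[OF p nd] nonunits_uminus[OF A, of "- of_nat N1"] by auto
    moreover have "(poly g ^^ N1) y = y"
    proof -
      have "(poly g ^^ N1) y = (poly f ^^ (R * p ^ e * N1)) y"
        unfolding g_def by (induction N1) (simp_all add: poly_iterate_poly funpow_add)
      also have "R * p ^ e * N1 = N * R" using N by (simp add: mult_ac)
      finally show ?thesis using funpow_period_add[OF per(1)] by simp
    qed
    ultimately have "poly g y = y" using s(2) by simp
    thus ?thesis unfolding g_def poly_iterate_poly by blast
  qed
qed

text \<open>
  If \<open>f(y) - w\<close> vanishes to order exactly \<open>e\<close> at \<open>w\<close> with unit leading coefficient, then \<open>w\<close> is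
  its own only preimage in its residue class, so orbits can enter \<open>w\<close> only at the first moment
  they are residually equal to \<open>w\<close>.
\<close>

lemma residual_preimage_unique:
  assumes f: "f \<in> poly_over A" and w: "w \<in> A" "poly f w = w" and y: "y \<in> A" "y - w \<in> nonunits A"
    and fy: "poly f y = w"
    and e: "e \<ge> 1" "\<And>a. 1 \<le> a \<Longrightarrow> a < e \<Longrightarrow> coeff (f \<circ>\<^sub>p [:w, 1:]) a = 0" "coeff (f \<circ>\<^sub>p [:w, 1:]) e \<notin> nonunits A"
  shows "y = w"
proof -
  note SA = vr_subring[OF A]
  define q where "q = f \<circ>\<^sub>p [:w, 1:]"
  have "[:w, 1:] \<in> poly_over A" using w vr[OF A] by (auto simp: poly_over_def coeff_pCons split: nat.splits)
  hence qA: "q \<in> poly_over A" unfolding q_def by (rule poly_over_pcompose[OF SA f])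
  have q0: "coeff q 0 = w" using w by (simp add: q_def pcompose_coeff_0)
  \<comment> \<open>\<open>q\<close> is \<open>f\<close> expanded at \<open>w\<close>, and
    \<open>?r\<close> is the cofactor of \<open>X ^ e\<close> in \<open>q - w\<close>. Its value at
    \<open>0\<close> is no nonunit, so \<open>?r\<close> has no zero at a nonunit such as
    \<open>y - w\<close>.\<close>
  let ?r = "poly_shift e q"
  have rA: "?r \<in> poly_over A" using qA by (auto simp: poly_over_def coeff_poly_shift)
  have "q = [:w:] + monom 1 e * ?r"
  proof (rule poly_eqI)
    fix i
    show "coeff q i = coeff ([:w:] + monom 1 e * ?r) i"
      using q0 e(1,2) by (cases "i = 0") (auto simp: coeff_monom_mult coeff_poly_shift q_def coeff_pCons split: nat.splits)
  qed
  hence "poly q (y - w) = w + (y - w) ^ e * poly ?r (y - w)" by (metis poly_add poly_mult poly_monom mult_1 poly_const_conv)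
  moreover have "poly q (y - w) = w" using fy by (simp add: q_def poly_pcompose)
  ultimately have z: "(y - w) ^ e * poly ?r (y - w) = 0" by simp
  have "poly ?r (y - w) \<noteq> 0"
  proof
    assume "poly ?r (y - w) = 0"
    moreover obtain s where "s \<in> A" "poly ?r (y - w) - poly ?r 0 = (y - w - 0) * s"
      using poly_congruent[OF rA vr(5)[OF A y(1) w(1)] vr(1)[OF A]] by blast
    ultimately have "- poly ?r 0 = s * (y - w)" "s \<in> A" by (simp_all add: mult.commute)
    hence "- poly ?r 0 \<in> nonunits A" using nonunits_mult[OF A _ y(2)] by simp
    hence "poly ?r 0 \<in> nonunits A" using nonunits_uminus[OF A] by fastforce
    thus False using e(3) by (simp add: poly_0_coeff_0 coeff_poly_shift q_def)
  qed
  thus ?thesis using z by simp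
qed

end

section \<open>Uniform residual preperiods and periods\<close>

definition residually_finite :: "'k::field set \<Rightarrow> ('x \<Rightarrow> 'k) set \<Rightarrow> 'x set \<Rightarrow> bool" where
  "residually_finite A S D \<longleftrightarrow> (\<forall>f\<in>S. \<forall>x\<in>D. f x \<in> A) \<and>
     (\<exists>R\<subseteq>D. finite R \<and> (\<forall>x\<in>D. \<exists>r\<in>R. \<forall>f\<in>S. f x - f r \<in> nonunits A))"

text \<open>Only the orbits of the finitely many representatives matter; the sum of their preperiods
  and the product of their periods serve as common bound and common multiple.\<close>

lemma residual_preperiod_uniform:
  fixes E :: "nat \<Rightarrow> 'x \<Rightarrow> 'k::field_char_0"
  assumes A: "valuation_ring A" and rf: "residually_finite A S D" and E: "\<And>n. E n \<in> S"
    and pre: "\<And>x. x \<in> D \<Longrightarrow> \<exists>n m. n < m \<and> (\<forall>j. E (j + n) x = E (j + m) x)"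
  shows "\<exists>T L. L \<ge> 1 \<and> (\<forall>x\<in>D. \<forall>j\<ge>T. E (j + L) x - E j x \<in> nonunits A)"
proof -
  obtain R where R: "R \<subseteq> D" "finite R" "\<And>x. x \<in> D \<Longrightarrow> \<exists>r\<in>R. \<forall>f\<in>S. f x - f r \<in> nonunits A"
    using rf unfolding residually_finite_def by blast
  have "\<forall>r\<in>R. \<exists>n m. n < m \<and> (\<forall>j. E (j + n) r = E (j + m) r)" using pre R(1) by blast
  then obtain n m where nm: "\<And>r. r \<in> R \<Longrightarrow> n r < m r \<and> (\<forall>j. E (j + n r) r = E (j + m r) r)" by metis
  define T L where "T = (\<Sum>r\<in>R. n r)" and "L = (\<Prod>r\<in>R. m r - n r)"
  have "E (j + L) x - E j x \<in> nonunits A" if x: "x \<in> D" "j \<ge> T" for x j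
  proof -
    obtain r where r: "r \<in> R" "\<And>f. f \<in> S \<Longrightarrow> f x - f r \<in> nonunits A" using R(3)[OF x(1)] by blast
    have jn: "j \<ge> n r" using member_le_sum[of r R n] R(2) r(1) x(2) by (simp add: T_def)
    have step: "E (i + (m r - n r)) r = E i r" if "i \<ge> n r" for i
    proof -
      have "n r < m r" "E (i - n r + n r) r = E (i - n r + m r) r" using nm[OF r(1)] by blast+
      moreover have "i - n r + m r = i + (m r - n r)" using that \<open>n r < m r\<close> by simp
      ultimately show ?thesis using that by simp
    qed
    have "E (j + (m r - n r) * k) r = E j r" for k
    proof (induction k)
      case (Suc k)
      have "j + (m r - n r) * Suc k = (j + (m r - n r) * k) + (m r - n r)" by simp
      thus ?case using step[of "j + (m r - n r) * k"] jn Suc by (metis le_add1 order_trans)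
    qed simp
    moreover have "(m r - n r) dvd L" unfolding L_def using R(2) r(1) by (rule dvd_prodI)
    ultimately have "E (j + L) r = E j r" by (metis dvdE)
    moreover have "E (j + L) x - E (j + L) r \<in> nonunits A" "E j r - E j x \<in> nonunits A"
      using r(2)[OF E] congruent_sym[OF A] by blast+
    ultimately show ?thesis using congruent_trans[OF A] by metis
  qed
  moreover have "L \<ge> 1"
    unfolding L_def using nm by (simp add: Suc_le_eq prod_pos)
  ultimately show ?thesis by blast
qed

text \<open>From time \<open>T\<close> on, the orbits are residually fixed by the
  \<open>L\<close>-th iterate, and its multipliers at time \<open>T\<close> have finitely many
  residues. The product of the orders of these residues gives a factor independent of the point; the
  exponent of \<open>p\<close> may still vary.\<close>

lemma period_bound_one_prime:
  fixes P :: "'x \<Rightarrow> 'k::field_char_0 poly"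
  assumes A: "valuation_ring A" and p: "prime p" "of_nat p \<in> nonunits A"
    and S: "fun_ring S" and rf: "residually_finite A S D" and P: "P \<in> poly_maps S" and z: "z \<in> S"
    and pre: "\<And>x. x \<in> D \<Longrightarrow> \<exists>n m. n < m \<and> (poly (P x) ^^ n) (z x) = (poly (P x) ^^ m) (z x)"
  shows "\<exists>Q\<ge>1. \<forall>x\<in>D. \<exists>e j0. (poly (P x) ^^ (j0 + Q * p ^ e)) (z x) = (poly (P x) ^^ j0) (z x)"
proof -
  note SA = vr_subring[OF A]
  define E where "E n x = (poly (P x) ^^ n) (z x)" for n x
  have E: "E n \<in> S" for n
  proof -
    have "E n = (\<lambda>x. poly (iterate_poly n (P x)) (z x))" by (simp add: E_def poly_iterate_poly fun_eq_iff)
    thus ?thesis using poly_maps_eval[OF S poly_maps_iterate[OF S P] z] by simp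
  qed
  have pre': "\<exists>n m. n < m \<and> (\<forall>j. E (j + n) x = E (j + m) x)" if "x \<in> D" for x
    using pre[OF that] by (metis E_def comp_apply funpow_add)
  obtain T L where TL: "L \<ge> 1" "\<And>x j. x \<in> D \<Longrightarrow> j \<ge> T \<Longrightarrow> E (j + L) x - E j x \<in> nonunits A"
    using residual_preperiod_uniform[OF A rf E pre'] by blast
  obtain R where R: "R \<subseteq> D" "finite R" "\<And>x. x \<in> D \<Longrightarrow> \<exists>r\<in>R. \<forall>f\<in>S. f x - f r \<in> nonunits A"
    and SinA: "\<And>f x. f \<in> S \<Longrightarrow> x \<in> D \<Longrightarrow> f x \<in> A"
    using rf unfolding residually_finite_def by blast
  define f where "f x = iterate_poly L (P x)" for x
  have f: "f \<in> poly_maps S" using poly_maps_iterate[OF S P, of L] by (simp add: f_def[abs_def])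
  have fA: "f x \<in> poly_over A" if "x \<in> D" for x
    using SinA[OF pm_coeff[OF S f] that] by (simp add: poly_over_def)
  define mu where "mu x = poly (pderiv (f x)) (E T x)" for x
  have mu: "mu \<in> S" using poly_maps_eval[OF S poly_maps_pderiv[OF S f] E, of T] by (simp add: mu_def[abs_def])
  \<comment> \<open>The default \<open>1\<close> is for multipliers that are residually no roots of
    unity; for these the premise of \<open>root\<close> below never holds.\<close>
  define ro where "ro r = (if \<exists>n\<ge>1. mu r ^ n - 1 \<in> nonunits A then (SOME n. n \<ge> 1 \<and> mu r ^ n - 1 \<in> nonunits A) else 1)" for r
  have ro1: "ro r \<ge> 1" for r unfolding ro_def using someI_ex[of "\<lambda>n. n \<ge> 1 \<and> mu r ^ n - 1 \<in> nonunits A"] by auto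
  have ro2: "mu r ^ ro r - 1 \<in> nonunits A" if "\<exists>n\<ge>1. mu r ^ n - 1 \<in> nonunits A" for r
    unfolding ro_def using someI_ex[of "\<lambda>n. n \<ge> 1 \<and> mu r ^ n - 1 \<in> nonunits A"] that by auto
  define Q where "Q = (\<Prod>r\<in>R. ro r)"
  have Q1: "Q \<ge> 1" unfolding Q_def using ro1 by (simp add: Suc_le_eq prod_pos)
  have "\<exists>e j0. E (j0 + (L * Q) * p ^ e) x = E j0 x" if x: "x \<in> D" for x
  proof -
    obtain n m where nm: "n < m" "\<And>j. E (j + n) x = E (j + m) x" using pre'[OF x] by blast
    \<comment> \<open>Late enough for the true preperiod \<open>n\<close> as well as for the
      residual one \<open>T\<close>, and congruent to \<open>T\<close> modulo \<open>L\<close>, so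
      that \<open>y\<close> lies on the \<open>f\<close>-orbit of \<open>E T x\<close> and has the
      same residual multiplier.\<close>
    define j where "j = T + L * n"
    define y where "y = E j x"
    have fi: "(poly (f x) ^^ i) (E a x) = E (a + L * i) x" for i a
    proof (induction i)
      case (Suc i)
      have "a + L * Suc i = L + (a + L * i)" by simp
      hence "E (a + L * Suc i) x = (poly (P x) ^^ L) (E (a + L * i) x)" by (simp only: E_def funpow_add comp_apply)
      thus ?case using Suc by (simp add: f_def poly_iterate_poly)
    qed simp
    have y: "y \<in> A" "poly (f x) y - y \<in> nonunits A"
      using SinA[OF E x] TL(2)[OF x, of j] fi[of 1 j] by (auto simp: y_def j_def)
    have per: "(poly (f x) ^^ (m - n)) y = y"
    proof -
      have *: "E (i + (m - n)) x = E i x" if "i \<ge> n" for i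
        using nm(2)[of "i - n"] nm(1) that by (simp add: add.commute)
      have "E (i + (m - n) * k) x = E i x" if "i \<ge> n" for i k
      proof (induction k)
        case (Suc k)
        have e: "i + (m - n) * Suc k = (i + (m - n) * k) + (m - n)" by simp
        show ?case unfolding e using *[of "i + (m - n) * k"] that Suc by simp
      qed simp
      moreover have "j \<ge> n" using TL(1) by (simp add: j_def trans_le_add2)
      ultimately show ?thesis unfolding y_def fi by (simp add: mult.commute)
    qed
    obtain r where r: "r \<in> R" "\<And>f. f \<in> S \<Longrightarrow> f x - f r \<in> nonunits A" using R(3)[OF x] by blast
    have muA: "mu x \<in> A" "mu r \<in> A" "poly (pderiv (f x)) y \<in> A"
      using SinA[OF mu] x r R(1) poly_in_subring[OF SA poly_over_pderiv[OF SA fA[OF x]] y(1)] by auto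
    have l1: "poly (pderiv (f x)) y - mu x \<in> nonunits A"
    proof -
      have e: "E T x \<in> A" "poly (f x) (E T x) - E T x \<in> nonunits A"
        using SinA[OF E x] TL(2)[OF x, of T] fi[of 1 T] by auto
      have "y - E T x \<in> nonunits A"
        using residually_fixed_orbit(2)[OF A fA[OF x] e, of n] fi[of n T] by (simp add: y_def j_def)
      moreover obtain s where "s \<in> A" "poly (pderiv (f x)) y - poly (pderiv (f x)) (E T x) = (y - E T x) * s"
        using poly_congruent[OF A poly_over_pderiv[OF SA fA[OF x]] y(1) e(1)] by blast
      ultimately show ?thesis using nonunits_mult[OF A] by (simp add: mu_def mult.commute)
    qed
    hence l2: "poly (pderiv (f x)) y - mu r \<in> nonunits A" using r(2)[OF mu] congruent_trans[OF A] by blast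
    have root: "poly (pderiv (f x)) y ^ Q - 1 \<in> nonunits A" if "poly (pderiv (f x)) y ^ (m - n) - 1 \<in> nonunits A"
    proof -
      have "mu r ^ (m - n) - 1 \<in> nonunits A"
        using congruent_trans[OF A congruent_sym[OF A congruent_power[OF A l2 muA(3,2)]] that] .
      hence "mu r ^ ro r - 1 \<in> nonunits A" using nm(1) by (intro ro2) (auto intro!: exI[of _ "m - n"])
      from congruent_power[OF A this subring_power[OF SA muA(2)] subringD(2)[OF SA]]
      have "mu r ^ (ro r * k) - 1 \<in> nonunits A" for k by (simp add: power_mult)
      moreover have "ro r dvd Q" unfolding Q_def using R(2) r(1) by (rule dvd_prodI)
      ultimately have "mu r ^ Q - 1 \<in> nonunits A" by (metis dvdE)
      from congruent_trans[OF A congruent_power[OF A l2 muA(3,2)] this] show ?thesis .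
    qed
    have "m - n \<ge> 1" using nm(1) by simp
    from period_divides[OF A p fA[OF x] y per this root]
    obtain e where "(poly (f x) ^^ (Q * p ^ e)) y = y" by auto
    hence "E (j + (L * Q) * p ^ e) x = E j x" unfolding y_def fi by (simp add: mult.assoc)
    thus ?thesis by blast
  qed
  moreover have "L * Q \<ge> 1" using TL(1) Q1 by (metis mult_le_mono nat_mult_1)
  ultimately show ?thesis unfolding E_def by blast
qed

text \<open>The two bounds leave an unknown power of \<open>p\<close> and of \<open>q\<close>
  respectively. The greatest common divisor of \<open>a * p ^ e * b\<close> and
  \<open>b * q ^ d * a\<close> is \<open>a * b\<close>, whatever the exponents.\<close>

lemma period_bound:
  fixes P :: "'x \<Rightarrow> 'k::field_char_0 poly"
  assumes A: "valuation_ring A" "prime p" "of_nat p \<in> nonunits A" "fun_ring S" "residually_finite A S D" "P \<in> poly_maps S" "z \<in> S"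
    and B: "valuation_ring B" "prime q" "of_nat q \<in> nonunits B" "fun_ring U" "residually_finite B U D" "P \<in> poly_maps U" "z \<in> U"
    and pq: "p \<noteq> q"
    and pre: "\<And>x. x \<in> D \<Longrightarrow> \<exists>n m. n < m \<and> (poly (P x) ^^ n) (z x) = (poly (P x) ^^ m) (z x)"
  shows "\<exists>k\<ge>1. \<forall>x\<in>D. \<exists>j0. \<forall>j\<ge>j0. (poly (P x) ^^ (j + k)) (z x) = (poly (P x) ^^ j) (z x)"
proof -
  obtain a where a: "a \<ge> 1" "\<And>x. x \<in> D \<Longrightarrow> \<exists>e j0. (poly (P x) ^^ (j0 + a * p ^ e)) (z x) = (poly (P x) ^^ j0) (z x)"
    using period_bound_one_prime[OF A pre] by blast
  obtain b where b: "b \<ge> 1" "\<And>x. x \<in> D \<Longrightarrow> \<exists>e j0. (poly (P x) ^^ (j0 + b * q ^ e)) (z x) = (poly (P x) ^^ j0) (z x)"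
    using period_bound_one_prime[OF B pre] by blast
  have "\<exists>j0. \<forall>j\<ge>j0. (poly (P x) ^^ (j + a * b)) (z x) = (poly (P x) ^^ j) (z x)" if x: "x \<in> D" for x
  proof -
    let ?f = "poly (P x)"
    obtain e j1 where 1: "(?f ^^ (j1 + a * p ^ e)) (z x) = (?f ^^ j1) (z x)" using a(2)[OF x] by blast
    obtain d j2 where 2: "(?f ^^ (j2 + b * q ^ d)) (z x) = (?f ^^ j2) (z x)" using b(2)[OF x] by blast
    have later: "(?f ^^ n) ((?f ^^ j) (z x)) = (?f ^^ j) (z x)"
      if "(?f ^^ (i + n)) (z x) = (?f ^^ i) (z x)" "i \<le> j" for i j n
    proof -
      have "(?f ^^ n) ((?f ^^ j) (z x)) = (?f ^^ (j - i)) ((?f ^^ (i + n)) (z x))"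
        using that(2) by (simp flip: funpow_add comp_apply[of "_ ^^ _" "_ ^^ _"] add: add.commute)
      also have "\<dots> = (?f ^^ j) (z x)" using that by (simp flip: funpow_add comp_apply[of "_ ^^ _" "_ ^^ _"])
      finally show ?thesis .
    qed
    have "(?f ^^ (j + a * b)) (z x) = (?f ^^ j) (z x)" if j: "j \<ge> max j1 j2" for j
    proof -
      let ?y = "(?f ^^ j) (z x)"
      have p1: "(?f ^^ (a * p ^ e)) ?y = ?y" and p2: "(?f ^^ (b * q ^ d)) ?y = ?y"
        using later[OF 1, of j] later[OF 2, of j] j by auto
      have "(?f ^^ (a * p ^ e * b)) ?y = ?y" "(?f ^^ (b * q ^ d * a)) ?y = ?y"
        using funpow_period_add[OF p1, of b] funpow_period_add[OF p2, of a] by auto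
      hence "(?f ^^ gcd (a * p ^ e * b) (b * q ^ d * a)) ?y = ?y" by (rule funpow_period_gcd)
      moreover have "gcd (a * p ^ e * b) (b * q ^ d * a) = a * b"
      proof -
        have "coprime (p ^ e) (q ^ d)" using A(2) B(2) pq by (simp add: primes_coprime)
        have "gcd (a * p ^ e * b) (b * q ^ d * a) = gcd ((a * b) * p ^ e) ((a * b) * q ^ d)" by (simp add: mult_ac)
        also have "\<dots> = (a * b) * gcd (p ^ e) (q ^ d)" by (simp only: gcd_mult_distrib_nat)
        also have "gcd (p ^ e) (q ^ d) = 1" using \<open>coprime (p ^ e) (q ^ d)\<close> by (simp only: coprime_iff_gcd_eq_1)
        finally show ?thesis by simp
      qed
      ultimately show ?thesis by (simp add: add.commute[of j] funpow_add)
    qed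
    thus ?thesis by blast
  qed
  moreover have "a * b \<ge> 1" using a(1) b(1) by (metis mult_le_mono nat_mult_1)
  ultimately show ?thesis by blast
qed

text \<open>Over the residue class of \<open>c\<close> the leading coefficient of each relation
  stays outside the maximal ideal. The other coordinates are therefore integral, and their residues
  are roots of the residual polynomial of \<open>F c\<close>, which is the same for all points of
  \<open>D\<close>.\<close>

lemma residually_finite_points:
  fixes D :: "(nat \<Rightarrow> 'k::field_char_0) set"
  assumes A: "valuation_ring A" and I: "finite I"
    and D: "\<And>x i. x \<in> D \<Longrightarrow> i \<in> X \<Longrightarrow> x i \<in> A \<and> x i - c i \<in> nonunits A" and c: "\<And>i. i \<in> X \<Longrightarrow> c i \<in> A"
    and rel: "\<And>j. j \<in> I - X \<Longrightarrow> \<exists>F e. (\<forall>x. degree (F x) \<le> e) \<and>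
      (\<forall>i. integral_over X A (\<lambda>x. coeff (F x) i)) \<and> coeff (F c) e \<notin> nonunits A \<and> (\<forall>x\<in>D. poly (F x) (x j) = 0)"
  shows "residually_finite A {f. integral_over I A f} D" and "x \<in> D \<Longrightarrow> i \<in> I \<Longrightarrow> x i \<in> A"
proof -
  note SA = vr_subring[OF A]
  have "\<exists>R. finite R \<and> (\<forall>x\<in>D. x j \<in> A \<and> (\<exists>r\<in>R. x j - r \<in> nonunits A))" if j: "j \<in> I" for j
  proof (cases "j \<in> X")
    case True
    thus ?thesis using D by (intro exI[of _ "{c j}"]) auto
  next
    case False
    then obtain F e where F: "\<And>x. degree (F x) \<le> e" "\<And>i. integral_over X A (\<lambda>x. coeff (F x) i)"
      "coeff (F c) e \<notin> nonunits A" "\<And>x. x \<in> D \<Longrightarrow> poly (F x) (x j) = 0"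
      using rel[of j] j by blast
    have Fc: "F c \<in> poly_over A" using F(2) c by (auto simp: poly_over_def integral_over_def)
    have FA: "F x \<in> poly_over A" if "x \<in> D" for x using F(2) D that by (auto simp: poly_over_def integral_over_def)
    have co: "coeff (F x) i - coeff (F c) i \<in> nonunits A" if "x \<in> D" for x i
      using F(2) D c that unfolding integral_over_def by blast
    obtain R where R: "finite R" "\<And>y. y \<in> A \<Longrightarrow> poly (F c) y \<in> nonunits A \<Longrightarrow> \<exists>r\<in>R. y - r \<in> nonunits A"
      using finitely_many_residual_roots[OF A Fc] F(3) by metis
    have xA: "x j \<in> A" if x: "x \<in> D" for x
    proof (rule valuation_ring_integrally_closed[OF A FA[OF x] F(1) _ F(4)[OF x]])
      show "coeff (F x) e \<notin> nonunits A"
      proof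
        assume "coeff (F x) e \<in> nonunits A"
        from nonunits_diff[OF A this co[OF x, of e]] show False using F(3) by simp
      qed
    qed
    have "poly (F c) (x j) \<in> nonunits A" if x: "x \<in> D" for x
    proof -
      have "poly (F x) (x j) - poly (F c) (x j) = (\<Sum>i\<le>e. (coeff (F x) i - coeff (F c) i) * x j ^ i)"
      proof -
        have "poly (F y) (x j) = (\<Sum>i\<le>e. coeff (F y) i * x j ^ i)" for y
          unfolding poly_altdef using F(1)[of y]
          by (intro sum.mono_neutral_left) (auto simp: coeff_eq_0)
        thus ?thesis by (simp add: sum_subtractf left_diff_distrib)
      qed
      also have "\<dots> = (\<Sum>i\<le>e. x j ^ i * (coeff (F x) i - coeff (F c) i))" by (simp add: mult.commute)
      also have "\<dots> \<in> nonunits A"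
        using co[OF x] by (intro nonunits_sum[OF A] nonunits_mult[OF A] subring_power[OF SA] xA x)
      finally have "- poly (F c) (x j) \<in> nonunits A" using F(4)[OF x] by simp
      thus ?thesis using nonunits_uminus[OF A] by fastforce
    qed
    thus ?thesis using R xA by blast
  qed
  then obtain R where R: "\<And>j. j \<in> I \<Longrightarrow> finite (R j)" "\<And>j x. j \<in> I \<Longrightarrow> x \<in> D \<Longrightarrow> x j \<in> A"
    "\<And>j x. j \<in> I \<Longrightarrow> x \<in> D \<Longrightarrow> \<exists>r\<in>R j. x j - r \<in> nonunits A" by metis
  thus "x \<in> D \<Longrightarrow> i \<in> I \<Longrightarrow> x i \<in> A" by blast
  \<comment> \<open>The vector of chosen residues takes values in a finite product; points of
    \<open>D\<close> chosen over its values are the representatives.\<close>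
  define \<rho> where "\<rho> x = (\<lambda>j\<in>I. SOME r. r \<in> R j \<and> x j - r \<in> nonunits A)" for x
  have \<rho>: "\<rho> x j \<in> R j \<and> x j - \<rho> x j \<in> nonunits A" if "j \<in> I" "x \<in> D" for x j
    using someI_ex[OF R(3)[OF that, unfolded Bex_def]] that(1) by (simp add: \<rho>_def)
  have "\<rho> ` D \<subseteq> Pi\<^sub>E I R" using \<rho> by (auto simp: \<rho>_def)
  hence fin: "finite (\<rho> ` D)" by (rule finite_subset) (rule finite_PiE[OF I R(1)])
  obtain Q where Q: "Q \<subseteq> D" "finite Q" "\<rho> ` D = \<rho> ` Q" using finite_subset_image[OF fin order_refl] by auto
  have "\<exists>r\<in>Q. \<forall>f\<in>{f. integral_over I A f}. f x - f r \<in> nonunits A" if x: "x \<in> D" for x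
  proof -
    obtain r where r: "r \<in> Q" "\<rho> x = \<rho> r" using Q(3) x by (metis imageE imageI)
    have "x j - r j \<in> nonunits A" if "j \<in> I" for j
      using \<rho>[OF that x] \<rho>[OF that, of r] r Q(1) congruent_trans[OF A, of "x j" "\<rho> x j" "r j"]
        congruent_sym[OF A, of "r j" "\<rho> x j"] by auto
    thus ?thesis using R(2) x r(1) Q(1) by (intro bexI[of _ r]) (auto simp: integral_over_def)
  qed
  moreover have "f x \<in> A" if "integral_over I A f" "x \<in> D" for f x
    using that R(2) by (auto simp: integral_over_def)
  ultimately show "residually_finite A {f. integral_over I A f} D"
    unfolding residually_finite_def using Q by blast
qed

section \<open>Pointwise preperiodic families are uniformly preperiodic\<close>

text \<open>\<open>closed\<close> makes \<open>Y\<close> algebraic: points obtained by lifting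
  integer values of the basis coordinates belong to \<open>Y\<close>, where preperiodicity is
  assumed.\<close>

locale preperiodic_family =
  fixes N :: nat and Y :: "(nat \<Rightarrow> 'k::{alg_closed_field, field_char_0}) set"
    and P :: "(nat \<Rightarrow> 'k) \<Rightarrow> 'k poly" and z :: "(nat \<Rightarrow> 'k) \<Rightarrow> 'k" and d :: nat
  assumes irr: "irreducible_on (pfuns {..<N}) Y"
    and closed: "\<And>x. (\<forall>i\<ge>N. x i = 0) \<Longrightarrow> (\<forall>f\<in>pfuns {..<N}. vanishes Y f \<longrightarrow> f x = 0) \<Longrightarrow> x \<in> Y"
    and P: "P \<in> poly_maps (pfuns {..<N})" and z: "z \<in> pfuns {..<N}"
    and d: "d \<ge> 2" "\<And>x. x \<in> Y \<Longrightarrow> degree (P x) = d"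
    and preperiodic: "\<And>x. x \<in> Y \<Longrightarrow> \<exists>n m. n < m \<and> (poly (P x) ^^ n) (z x) = (poly (P x) ^^ m) (z x)"

lemma (in preperiodic_family) transcendence_basis:
  "\<exists>X\<subseteq>{..<N}. (\<forall>f\<in>pfuns X. vanishes Y f \<longrightarrow> (\<forall>x. f x = 0)) \<and>
     (\<forall>j\<in>{..<N} - X. algebraic_over (pfuns X) Y (\<lambda>x. x j))"
proof -
  define ind where "ind X \<longleftrightarrow> X \<subseteq> {..<N} \<and> (\<forall>f\<in>pfuns X. vanishes Y f \<longrightarrow> (\<forall>x::nat \<Rightarrow> 'k. f x = 0))" for X
  have "ind {}" unfolding ind_def
  proof (intro conjI ballI impI allI)
    fix f :: "(nat \<Rightarrow> 'k) \<Rightarrow> 'k" and x assume f: "f \<in> pfuns {}" "vanishes Y f"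
    obtain y where "y \<in> Y" using irr by (auto simp: irreducible_on_def)
    moreover have "f x = f y" by (rule pfuns_cong[OF f(1)]) auto
    ultimately show "f x = 0" using f(2) by (simp add: vanishes_def)
  qed auto
  moreover have "finite {X. ind X}" by (rule finite_subset[of _ "Pow {..<N}"]) (auto simp: ind_def)
  ultimately obtain X where X: "ind X" "\<And>X'. ind X' \<Longrightarrow> X \<subseteq> X' \<Longrightarrow> X' = X"
    using finite_has_maximal[of "{X. ind X}"] by auto
  have "algebraic_over (pfuns X) Y (\<lambda>x. x j)" if j: "j \<in> {..<N} - X" for j
  proof -
    have "\<not> ind (insert j X)" using X(2)[of "insert j X"] j by auto
    then obtain f x where f: "f \<in> pfuns (insert j X)" "vanishes Y f" "f x \<noteq> 0"
      using j X(1) unfolding ind_def by auto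
    obtain F where F: "F \<in> poly_maps (pfuns X)" "f = (\<lambda>x. poly (F x) (x j))"
      using f(1) by (auto simp: pfuns_insert adjoin_def)
    have "F x \<noteq> 0" using f(3) F(2) by auto
    then obtain i where i: "coeff (F x) i \<noteq> 0" by (auto simp: poly_eq_iff)
    have "\<not> vanishes Y (\<lambda>x. coeff (F x) i)"
      using X(1) pm_coeff[OF pfuns_fun_ring F(1)] i unfolding ind_def by blast
    thus ?thesis using F f(2) unfolding algebraic_over_def by blast
  qed
  moreover have "X \<subseteq> {..<N}" "\<forall>f\<in>pfuns X. vanishes Y f \<longrightarrow> (\<forall>x. f x = 0)" using X(1) by (simp_all add: ind_def)
  ultimately show ?thesis by (intro exI[of _ X] conjI ballI) auto
qed

locale preperiodic_family_basis = preperiodic_family N Y P z d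
  for N Y and P :: "(nat \<Rightarrow> 'k::{alg_closed_field, field_char_0}) \<Rightarrow> 'k poly" and z d +
  fixes X :: "nat set" and F :: "nat \<Rightarrow> (nat \<Rightarrow> 'k) \<Rightarrow> 'k poly" and e :: "nat \<Rightarrow> nat"
  assumes XN: "X \<subseteq> {..<N}" and indep: "\<And>f x. f \<in> pfuns X \<Longrightarrow> vanishes Y f \<Longrightarrow> f x = 0"
    and F: "\<And>j. j \<in> {..<N} - X \<Longrightarrow> F j \<in> poly_maps (pfuns X)"
      "\<And>j x. j \<in> {..<N} - X \<Longrightarrow> degree (F j x) \<le> e j"
      "\<And>j x. j \<in> {..<N} - X \<Longrightarrow> x \<in> Y \<Longrightarrow> poly (F j x) (x j) = 0"
      "\<And>j. j \<in> {..<N} - X \<Longrightarrow> \<not> vanishes Y (\<lambda>x. coeff (F j x) (e j))"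
begin

lemmas fX = finite_subset[OF XN finite_lessThan]

definition E :: "nat \<Rightarrow> (nat \<Rightarrow> 'k) \<Rightarrow> 'k" where
  "E n x = (poly (P x) ^^ n) (z x)"

text \<open>Where this product is nonzero, all relations \<open>F j\<close> keep their formal
  degree; its value there is then made a unit for all large primes.\<close>

definition lead :: "(nat \<Rightarrow> 'k) \<Rightarrow> 'k" where
  "lead x = (\<Prod>j\<in>{..<N} - X. coeff (F j x) (e j))"

definition grid_points :: "(nat \<Rightarrow> int) \<Rightarrow> int \<Rightarrow> (nat \<Rightarrow> 'k) set" where
  "grid_points c M = {x \<in> Y. \<exists>y. \<forall>i\<in>X. x i = of_int (c i + M * y i)}"

lemma irrX: "irreducible_on (pfuns X) Y"
  using irreducible_on_mono[OF irr pfuns_mono[OF XN]] .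

text \<open>A nonzero polynomial in the basis coordinates does not vanish on \<open>Y\<close> by
  \<open>indep\<close>, and \<open>Y\<close> is irreducible.\<close>

lemma nonzero_mult:
  fixes f g :: "(nat \<Rightarrow> 'k) \<Rightarrow> 'k"
  assumes "f \<in> pfuns X" "g \<in> pfuns X" "f x \<noteq> 0" "g y \<noteq> 0" shows "\<exists>v. f v * g v \<noteq> 0"
proof -
  have "\<not> vanishes Y f" "\<not> vanishes Y g" using indep assms by blast+
  hence "\<not> vanishes Y (\<lambda>x. f x * g x)" using irreducible_on_mult[OF irrX assms(1,2)] by blast
  thus ?thesis by (auto simp: vanishes_def)
qed

lemma nonzero_prod:
  fixes f :: "'i \<Rightarrow> (nat \<Rightarrow> 'k) \<Rightarrow> 'k"
  assumes "finite I" "\<And>i. i \<in> I \<Longrightarrow> f i \<in> pfuns X" "\<And>i. i \<in> I \<Longrightarrow> \<exists>x. f i x \<noteq> 0"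
  shows "\<exists>x. (\<Prod>i\<in>I. f i x) \<noteq> 0"
  using assms
proof (induction I rule: finite_induct)
  case (insert i I)
  obtain x where x: "(\<Prod>i\<in>I. f i x) \<noteq> 0" using insert.IH insert.prems by (meson insertI2)
  obtain y where y: "f i y \<noteq> 0" using insert.prems by blast
  have pr: "(\<lambda>x. \<Prod>i\<in>I. f i x) \<in> pfuns X" using insert.prems by (intro fr_prod[OF pfuns_fun_ring]) auto
  have "\<exists>v. f i v * (\<Prod>i\<in>I. f i v) \<noteq> 0"
    by (rule nonzero_mult[where f = "f i" and g = "\<lambda>x. \<Prod>i\<in>I. f i x", OF insert.prems(1)[OF insertI1] pr y x])
  thus ?case using insert.hyps by simp
qed auto

lemma lead: "lead \<in> pfuns X" "\<exists>x. lead x \<noteq> 0"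
proof -
  show "lead \<in> pfuns X" unfolding lead_def[abs_def]
    by (intro fr_prod[OF pfuns_fun_ring] pm_coeff[OF pfuns_fun_ring] F)
  show "\<exists>x. lead x \<noteq> 0" unfolding lead_def
    using F(4) by (intro nonzero_prod pm_coeff[OF pfuns_fun_ring] F) (auto simp: vanishes_def)
qed

lemma E_in: "fun_ring S \<Longrightarrow> P \<in> poly_maps S \<Longrightarrow> z \<in> S \<Longrightarrow> E n \<in> S"
proof -
  assume S: "fun_ring S" "P \<in> poly_maps S" "z \<in> S"
  have "E n = (\<lambda>x. poly (iterate_poly n (P x)) (z x))" by (simp add: E_def poly_iterate_poly fun_eq_iff)
  thus ?thesis using poly_maps_eval[OF S(1) poly_maps_iterate[OF S(1,2)] S(3)] by simp
qed

lemma algebraic_coords: "j \<in> {..<N} - X \<Longrightarrow> algebraic_over (pfuns X) Y (\<lambda>x. x j)"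
  using F unfolding algebraic_over_def vanishes_def by meson

text \<open>The modulus is any multiple of \<open>p\<close>, since the same points must also satisfy
  congruences modulo a second prime or an earlier modulus.\<close>

definition good_reduction :: "'k set \<Rightarrow> nat \<Rightarrow> (nat \<Rightarrow> int) \<Rightarrow> bool" where
  "good_reduction A p c \<longleftrightarrow> valuation_ring A \<and> of_nat p \<in> nonunits A \<and>
    P \<in> poly_maps {f. integral_over {..<N} A f} \<and> z \<in> {f. integral_over {..<N} A f} \<and>
    (\<forall>M. int p dvd M \<longrightarrow> residually_finite A {f. integral_over {..<N} A f} (grid_points c M) \<and>
       (\<forall>x\<in>grid_points c M. (\<forall>i<N. x i \<in> A) \<and> (\<forall>i\<in>X. x i - of_int (c i) \<in> nonunits A)))"

text \<open>\<open>A\<close> is chosen to contain the coefficients of \<open>P\<close>, of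
  \<open>z\<close> and of all relations, with \<open>h * lead c\<close> outside the maximal ideal;
  as both factors lie in \<open>A\<close>, neither is a nonunit.\<close>

lemma reduction:
  assumes c: "lead (\<lambda>i. of_int (c i)) \<noteq> 0" and \<Gamma>: "finite \<Gamma>" and h: "h \<noteq> 0"
  shows "\<exists>B. \<forall>p>B. prime p \<longrightarrow> (\<exists>A. good_reduction A p c \<and> \<Gamma> \<subseteq> A \<and> h \<in> A \<and> h \<notin> nonunits A)"
proof -
  let ?c = "\<lambda>i. of_int (c i) :: 'k" and ?J = "{..<N} - X"
  obtain \<Gamma>1 where G1: "finite \<Gamma>1" "\<And>A. valuation_ring A \<Longrightarrow> \<Gamma>1 \<subseteq> A \<Longrightarrow> (\<forall>i. integral_over {..<N} A (\<lambda>x. coeff (P x) i))"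
    using poly_maps_integral_over[OF P] by blast
  obtain \<Gamma>2 where G2: "finite \<Gamma>2" "\<And>A. valuation_ring A \<Longrightarrow> \<Gamma>2 \<subseteq> A \<Longrightarrow> integral_over {..<N} A z"
    using pfuns_integral_over[OF z] by blast
  have "\<forall>j\<in>?J. \<exists>G. finite G \<and> (\<forall>A. valuation_ring A \<longrightarrow> G \<subseteq> A \<longrightarrow> (\<forall>i. integral_over X A (\<lambda>x. coeff (F j x) i)))"
    using poly_maps_integral_over[OF F(1)] by blast
  then obtain G where G: "\<And>j. j \<in> ?J \<Longrightarrow> finite (G j)"
    "\<And>j A i. j \<in> ?J \<Longrightarrow> valuation_ring A \<Longrightarrow> G j \<subseteq> A \<Longrightarrow> integral_over X A (\<lambda>x. coeff (F j x) i)" by metis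
  define \<Gamma>' where "\<Gamma>' = insert h (\<Gamma> \<union> \<Gamma>1 \<union> \<Gamma>2 \<union> \<Union>(G ` ?J))"
  have "finite \<Gamma>'" using \<Gamma> G1 G2 G by (auto simp: \<Gamma>'_def)
  moreover have "h * lead ?c \<noteq> 0" using h c by simp
  ultimately obtain B where B: "\<And>p. p > B \<Longrightarrow> prime p \<Longrightarrow> \<exists>A. valuation_ring A \<and> \<Gamma>' \<subseteq> A \<and> h * lead ?c \<in> A \<and>
      h * lead ?c \<notin> nonunits A \<and> of_nat p \<in> nonunits A"
    using valuation_ring_over_prime[of \<Gamma>' "h * lead ?c"] by blast
  show ?thesis
  proof (intro exI[of _ B] allI impI)
    fix p assume p: "p > B" "prime p"
    then obtain A where A: "valuation_ring A" "\<Gamma>' \<subseteq> A" "h * lead ?c \<notin> nonunits A" "of_nat p \<in> nonunits A" using B by blast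
    note SA = vr_subring[OF A(1)]
    have ints: "of_int n \<in> A" for n
    proof (cases n)
      case (nonneg m)
      have "of_nat m \<in> A" by (induction m) (auto intro: vr[OF A(1)])
      thus ?thesis using nonneg by simp
    next
      case (neg m)
      have "of_nat k \<in> A" for k by (induction k) (auto intro: vr[OF A(1)])
      hence "- of_nat (Suc m) \<in> A" using vr(3)[OF A(1)] by blast
      thus ?thesis using neg by (metis of_int_minus of_int_of_nat_eq)
    qed
    have hA: "h \<in> A" "\<Gamma> \<subseteq> A" "\<Gamma>1 \<subseteq> A" "\<Gamma>2 \<subseteq> A" using A(2) by (auto simp: \<Gamma>'_def)
    have intF: "integral_over X A (\<lambda>x. coeff (F j x) i)" if "j \<in> ?J" for j i
    proof -
      have "G j \<subseteq> A" using A(2) that unfolding \<Gamma>'_def by blast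
      thus ?thesis by (rule G(2)[OF that A(1)])
    qed
    have cf: "coeff (F j ?c) i \<in> A" if "j \<in> ?J" for j i using intF[OF that, of i] ints by (auto simp: integral_over_def)
    have leadA: "lead ?c \<in> A"
    proof -
      have "(\<Prod>j\<in>I. coeff (F j ?c) (e j)) \<in> A" if "I \<subseteq> ?J" for I
        using that by (induction I rule: infinite_finite_induct) (auto intro!: vr(2,6)[OF A(1)] cf)
      thus ?thesis by (auto simp: lead_def)
    qed
    have hn: "h \<notin> nonunits A" and ln: "lead ?c \<notin> nonunits A"
      using A(3) nonunits_mult[OF A(1) leadA, of h] nonunits_mult[OF A(1) hA(1), of "lead ?c"] by (auto simp: mult.commute)
    have cn: "coeff (F j ?c) (e j) \<notin> nonunits A" if j: "j \<in> ?J" for j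
    proof
      assume n: "coeff (F j ?c) (e j) \<in> nonunits A"
      have "(\<Prod>j\<in>I. coeff (F j ?c) (e j)) \<in> A" if "I \<subseteq> ?J" for I
        using that by (induction I rule: infinite_finite_induct) (auto intro!: vr(2,6)[OF A(1)] cf)
      from nonunits_mult[OF A(1) this n, of "?J - {j}"] have "lead ?c \<in> nonunits A"
        unfolding lead_def using j by (subst prod.remove[OF _ j]) (auto simp: mult.commute)
      thus False using ln by simp
    qed
    have gp: "x i \<in> A \<and> x i - ?c i \<in> nonunits A" if xi: "x \<in> grid_points c M" "i \<in> X" "int p dvd M" for x i M
    proof -
      obtain y where y: "x i = of_int (c i + M * y i)" using xi(1,2) by (auto simp: grid_points_def)
      obtain m where m: "M = int p * m" using xi(3) by blast
      have "x i - ?c i = of_int (m * y i) * of_nat p" by (simp add: y m mult_ac)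
      thus ?thesis using y ints[of "c i + M * y i"] nonunits_mult[OF A(1) ints A(4)] by metis
    qed
    have "residually_finite A {f. integral_over {..<N} A f} (grid_points c M) \<and>
       (\<forall>x\<in>grid_points c M. (\<forall>i<N. x i \<in> A) \<and> (\<forall>i\<in>X. x i - of_int (c i) \<in> nonunits A))" if M: "int p dvd M" for M
    proof -
      have rel: "\<exists>Fj ej. (\<forall>x. degree (Fj x) \<le> ej) \<and>
        (\<forall>i. integral_over X A (\<lambda>x. coeff (Fj x) i)) \<and> coeff (Fj ?c) ej \<notin> nonunits A \<and> (\<forall>x\<in>grid_points c M. poly (Fj x) (x j) = 0)"
        if "j \<in> ?J" for j
        using F(2,3)[OF that] intF[OF that] cn[OF that]
        by (intro exI[of _ "F j"] exI[of _ "e j"]) (auto simp: grid_points_def)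
      have gp': "\<And>x i. x \<in> grid_points c M \<Longrightarrow> i \<in> X \<Longrightarrow> x i \<in> A \<and> x i - ?c i \<in> nonunits A"
        using gp M by blast
      have ints': "\<And>i. i \<in> X \<Longrightarrow> ?c i \<in> A" by (rule ints)
      have "residually_finite A {f. integral_over {..<N} A f} (grid_points c M)"
        using A(1) finite_lessThan[of N] gp' ints' rel by (rule residually_finite_points(1))
      moreover have "\<And>x i. x \<in> grid_points c M \<Longrightarrow> i \<in> {..<N} \<Longrightarrow> x i \<in> A"
        using A(1) finite_lessThan[of N] gp' ints' rel by (rule residually_finite_points(2))
      ultimately show ?thesis using gp' by simp
    qed
    moreover have "P \<in> poly_maps {f. integral_over {..<N} A f}"
      using G1(2)[OF A(1) hA(3)] P by (auto simp: poly_maps_def)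
    moreover have "integral_over {..<N} A z" using G2(2)[OF A(1) hA(4)] .
    ultimately have "good_reduction A p c" using A(1,4) by (simp add: good_reduction_def)
    thus "\<exists>A. good_reduction A p c \<and> \<Gamma> \<subseteq> A \<and> h \<in> A \<and> h \<notin> nonunits A" using hA hn by blast
  qed
qed

text \<open>Two primes beyond the bound for \<open>c\<close> act on the same set of points once the
  modulus is their product.\<close>

lemma uniform_period:
  "\<exists>c M k. M \<noteq> 0 \<and> lead (\<lambda>i. of_int (c i)) \<noteq> 0 \<and> k \<ge> 1 \<and>
     (\<forall>x\<in>grid_points c M. \<exists>j0. \<forall>j\<ge>j0. E (j + k) x = E j x)"
proof -
  obtain c :: "nat \<Rightarrow> int" where c: "lead (\<lambda>i. of_int (c i)) \<noteq> 0"
  proof -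
    obtain x where "lead x \<noteq> 0" using lead by blast
    from pfuns_nonzero_on_grid[OF fX lead(1) this, of 1 "\<lambda>_. 0"] show ?thesis using that by auto
  qed
  from reduction[OF c finite.emptyI one_neq_zero] obtain B where
    "\<forall>p>B. prime p \<longrightarrow> (\<exists>A. good_reduction A p c \<and> {} \<subseteq> A \<and> 1 \<in> A \<and> 1 \<notin> nonunits A)" ..
  hence B: "\<And>p. p > B \<Longrightarrow> prime p \<Longrightarrow> \<exists>A. good_reduction A p c" by blast
  obtain p where p: "prime p" "p > B" using bigger_prime by blast
  obtain q where q: "prime q" "q > p" using bigger_prime by blast
  let ?M = "int p * int q"
  have "q > B" using p q by simp
  then obtain A C where "good_reduction A p c" "good_reduction C q c" using B p q by blast
  hence A: "valuation_ring A" "of_nat p \<in> nonunits A" "P \<in> poly_maps {f. integral_over {..<N} A f}"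
      "z \<in> {f. integral_over {..<N} A f}" "residually_finite A {f. integral_over {..<N} A f} (grid_points c ?M)"
    and C: "valuation_ring C" "of_nat q \<in> nonunits C" "P \<in> poly_maps {f. integral_over {..<N} C f}"
      "z \<in> {f. integral_over {..<N} C f}" "residually_finite C {f. integral_over {..<N} C f} (grid_points c ?M)"
    by (simp_all add: good_reduction_def)
  have "p \<noteq> q" using q by simp
  from period_bound[OF A(1) p(1) A(2) integral_over_fun_ring[OF A(1)] A(5,3,4)
      C(1) q(1) C(2) integral_over_fun_ring[OF C(1)] C(5,3,4) this] preperiodic
  obtain k where "k \<ge> 1" "\<forall>x\<in>grid_points c ?M. \<exists>j0. \<forall>j\<ge>j0. E (j + k) x = E j x"
    unfolding E_def grid_points_def by auto
  moreover have "?M \<noteq> 0" using p q by (auto simp: prime_gt_0_nat)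
  ultimately show ?thesis using c by blast
qed

text \<open>
  The fixed points \<open>w\<close> of the \<open>k\<close>-th iterate form a finite cover of \<open>Y\<close>. On each component of it
  the local degree of the iterate at \<open>w\<close> is generically some \<open>e\<close>; the coefficient of order \<open>e\<close> in the
  expansion at \<open>w\<close> divides a nonzero function \<open>H\<close> of the basis coordinates.
\<close>

lemma fixed_point_component:
  assumes k: "k \<ge> 1" and irrW: "irreducible_on (pfuns {..<Suc N}) W"
    and W: "W \<subseteq> {x(N := w) | x w. x \<in> Y \<and> poly (iterate_poly k (P x)) w = w}"
  shows "\<exists>r b H. r \<ge> 1 \<and> b \<in> pfuns {..<Suc N} \<and> H \<in> pfuns X \<and> (\<exists>x. H x \<noteq> 0) \<and>
    (\<forall>x\<in>W. (\<forall>a. 1 \<le> a \<longrightarrow> a < r \<longrightarrow> coeff (iterate_poly k (P x) \<circ>\<^sub>p [:x N, 1:]) a = 0) \<and>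
       b x * coeff (iterate_poly k (P x) \<circ>\<^sub>p [:x N, 1:]) r = H x)"
proof -
  let ?g = "\<lambda>x. iterate_poly k (P x)"
  define G where "G a x = coeff (?g x \<circ>\<^sub>p [:x N, 1:]) a" for a x
  note R = pfuns_fun_ring and R1 = pfuns_fun_ring[of "{..<Suc N}"]
  have NN: "pfuns {..<N} \<subseteq> pfuns {..<Suc N}" "pfuns X \<subseteq> pfuns {..<N}"
    using pfuns_mono[of "{..<N}" "{..<Suc N}"] pfuns_mono[OF XN] by auto
  have P1: "P \<in> poly_maps (pfuns {..<Suc N})" using P NN by (auto simp: poly_maps_def)
  have g: "?g \<in> poly_maps (pfuns {..<N})" "?g \<in> poly_maps (pfuns {..<Suc N})"
    using poly_maps_iterate[OF R P] poly_maps_iterate[OF R P1] by auto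
  have lin: "(\<lambda>x. [:x N, 1:]) \<in> poly_maps (pfuns {..<Suc N})"
  proof -
    have "(\<lambda>x. [:x N:] + [:0, 1:]) \<in> poly_maps (pfuns {..<Suc N})"
      by (intro fr_add[OF pm_fun_ring[OF R1]] pm_const[OF R1] pm_X[OF R1] pfuns.coord) simp
    thus ?thesis by simp
  qed
  have G: "G a \<in> pfuns {..<Suc N}" for a
    unfolding G_def[abs_def] by (rule pm_coeff[OF R1 poly_maps_pcompose[OF R1 g(2) lin]])
  have base: "f (x(N := w)) = f x" if "f \<in> pfuns {..<N}" for f x w
    by (rule pfuns_cong[OF that]) auto
  have pbase: "Q (x(N := w)) = Q x" if "Q \<in> poly_maps (pfuns {..<N})" for Q x w
    by (rule poly_maps_cong[OF that]) auto
  have degg: "degree (?g x) = d ^ k \<and> ?g x \<noteq> 0" if "x \<in> W" for x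
  proof -
    from subsetD[OF W that] obtain y w where y: "x = y(N := w)" "y \<in> Y" by auto
    have "degree (iterate_poly n (P y)) = d ^ n" for n
      using d(2)[OF y(2)] by (induction n) (simp_all add: iterate_poly_0 iterate_poly_Suc degree_pcompose)
    moreover have "d ^ k \<noteq> 0" using d(1) by simp
    ultimately show ?thesis using pbase[OF g(1), of y w] y(1) by (metis degree_0)
  qed
  have fixw: "poly (?g x) (x N) = x N" if x: "x \<in> W" for x
  proof -
    from subsetD[OF W x] obtain y w where y: "x = y(N := w)" "poly (?g y) w = w" by auto
    thus ?thesis using pbase[OF g(1), of y w] by simp
  qed
  \<comment> \<open>The generic local degree on \<open>W\<close>. It exists because the coefficient
    of order \<open>d ^ k\<close>, the leading coefficient of the iterate, does not vanish.\<close>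
  define r where "r = (LEAST a. a \<ge> 1 \<and> \<not> vanishes W (G a))"
  have "d ^ k \<ge> 1 \<and> \<not> vanishes W (G (d ^ k))"
  proof -
    obtain x where x: "x \<in> W" using irrW by (auto simp: irreducible_on_def)
    have dg: "degree (?g x \<circ>\<^sub>p [:x N, 1:]) = d ^ k" using degg[OF x] by (simp add: degree_pcompose)
    moreover have "d ^ k \<noteq> 0" using d(1) by simp
    ultimately have "G (d ^ k) x \<noteq> 0" unfolding G_def by (metis degree_0 leading_coeff_0_iff)
    thus ?thesis using x d(1) by (auto simp: vanishes_def)
  qed
  from LeastI[of "\<lambda>a. a \<ge> 1 \<and> \<not> vanishes W (G a)", OF this] have r: "r \<ge> 1" "\<not> vanishes W (G r)"
    unfolding r_def by auto
  have r0: "G a x = 0" if "1 \<le> a" "a < r" "x \<in> W" for a x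
    using not_less_Least[of a "\<lambda>a. a \<ge> 1 \<and> \<not> vanishes W (G a)"] that unfolding r_def vanishes_def by blast
  have "\<exists>b\<in>pfuns {..<Suc N}. \<exists>H\<in>pfuns X. (\<exists>x. H x \<noteq> 0) \<and> (\<forall>x\<in>W. b x * G r x = H x)"
  proof (cases "\<exists>H\<in>pfuns X. (\<exists>x. H x \<noteq> 0) \<and> vanishes W H")
    \<comment> \<open>Here \<open>W\<close> does not dominate the basis coordinates:
      \<open>H\<close> vanishes on \<open>W\<close>, so \<open>b = 0\<close> satisfies the identity,
      and points with \<open>H\<close> nonzero avoid \<open>W\<close>.\<close>
    case True
    then obtain H where "H \<in> pfuns X" "\<exists>x. H x \<noteq> 0" "vanishes W H" by blast
    thus ?thesis by (intro bexI[of _ "\<lambda>_. 0"] bexI[of _ H]) (auto simp: vanishes_def intro: pfuns.const)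
  next
    case False
    have S: "pfuns {..<Suc N} = adjoin (pfuns {..<N}) (\<lambda>x. x N)" by (simp add: lessThan_Suc pfuns_insert)
    \<comment> \<open>The fixed-point equation makes the new coordinate algebraic; since
      \<open>d ^ k \<ge> 2\<close>, subtracting \<open>X\<close> leaves the leading coefficient of
      the iterate untouched.\<close>
    have "algebraic_over (pfuns {..<N}) W (\<lambda>x. x N)"
      unfolding algebraic_over_def
    proof (intro bexI conjI exI)
      show "(\<lambda>x. ?g x - [:0, 1:]) \<in> poly_maps (pfuns {..<N})"
        by (intro fr_diff[OF pm_fun_ring[OF R]] g pm_X[OF R])
      show "vanishes W (\<lambda>x. poly (?g x - [:0, 1:]) (x N))" using fixw by (simp add: vanishes_def)
      obtain x where x: "x \<in> W" using irrW by (auto simp: irreducible_on_def)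
      have "d ^ k \<ge> 2" using d(1) k self_le_power[of d k] by simp
      hence "coeff ([:0, 1:] :: 'k poly) (d ^ k) = 0" by (intro coeff_eq_0) simp
      moreover have "coeff (?g x) (d ^ k) \<noteq> 0" using degg[OF x] by (metis leading_coeff_0_iff)
      ultimately show "\<not> vanishes W (\<lambda>x. coeff (?g x - [:0, 1:]) (d ^ k))" using x by (auto simp: vanishes_def)
    qed
    from min_polynomial_associate[OF R irrW[unfolded S] this G[unfolded S] r(2)] obtain b1 s where
      b1: "b1 \<in> pfuns {..<Suc N}" "s \<in> pfuns {..<N}" "\<not> vanishes W s" "\<And>x. x \<in> W \<Longrightarrow> b1 x * G r x = s x"
      unfolding S[symmetric] by blast
    have un: "X \<union> ({..<N} - X) = {..<N}" using XN by auto
    have "algebraic_over (pfuns X) W (\<lambda>x. x j)" if j: "j \<in> {..<N} - X" for j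
      unfolding algebraic_over_def
    proof (intro bexI conjI exI)
      show Fj: "F j \<in> poly_maps (pfuns X)" by (rule F(1)[OF j])
      have Fj': "F j \<in> poly_maps (pfuns {..<N})" using Fj NN(2) by (auto simp: poly_maps_def)
      show "vanishes W (\<lambda>x. poly (F j x) (x j))"
        unfolding vanishes_def
      proof
        fix x assume "x \<in> W"
        from subsetD[OF W this] obtain y w where y: "x = y(N := w)" "y \<in> Y" by auto
        thus "poly (F j x) (x j) = 0" using F(3)[OF j y(2)] pbase[OF Fj', of y w] j by simp
      qed
      show "\<not> vanishes W (\<lambda>x. coeff (F j x) (e j))"
        using False F(4)[OF j] pm_coeff[OF R Fj] by (auto simp: vanishes_def)
    qed
    note alg = this
    have "irreducible_on (pfuns (X \<union> ({..<N} - X))) W" unfolding un by (rule irreducible_on_mono[OF irrW NN(1)])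
    from algebraic_tower_associate[OF _ this alg, of s] b1(2,3) obtain b2 H where
      "b2 \<in> pfuns {..<N}" "H \<in> pfuns X" "\<not> vanishes W H" "\<And>x. x \<in> W \<Longrightarrow> b2 x * s x = H x"
      unfolding un by auto
    thus ?thesis using b1 NN
      by (intro bexI[of _ "\<lambda>x. b2 x * b1 x"] bexI[of _ H]) (auto simp: vanishes_def mult.assoc intro!: pfuns.mult)
  qed
  thus ?thesis using r r0 unfolding G_def by blast
qed

lemma grid_points_subset: "grid_points (\<lambda>i. c i + M * y i) (M * q) \<subseteq> grid_points c M"
proof
  fix x assume "x \<in> grid_points (\<lambda>i. c i + M * y i) (M * q)"
  then obtain v where "x \<in> Y" "\<forall>i\<in>X. x i = of_int (c i + M * y i + M * q * v i)" by (auto simp: grid_points_def)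
  hence "\<forall>i\<in>X. x i = of_int (c i + M * (y i + q * v i))" by (simp add: algebra_simps)
  thus "x \<in> grid_points c M" using \<open>x \<in> Y\<close> unfolding grid_points_def mem_Collect_eq
    by (intro conjI exI[of _ "\<lambda>i. y i + q * v i"])
qed

text \<open>Every orbit of the \<open>k\<close>-th iterate ends at a fixed point \<open>w\<close>,
  at a time depending on \<open>x\<close>; residually it equals \<open>w\<close> from a uniform time
  \<open>T\<close> on. As \<open>w\<close> has no other preimage in its residue class, true equality
  propagates back to \<open>T\<close>.\<close>

lemma uniform_preperiod:
  assumes M: "M \<noteq> 0" and c: "lead (\<lambda>i. of_int (c i)) \<noteq> 0" and k: "k \<ge> 1"
    and per: "\<And>x. x \<in> grid_points c M \<Longrightarrow> \<exists>j0. \<forall>j\<ge>j0. E (j + k) x = E j x"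
  shows "\<exists>c' M' T. M' \<noteq> 0 \<and> (\<forall>x\<in>grid_points c' M'. E (T + k) x = E T x)"
proof -
  let ?Z = "{x(N := w) | x w. x \<in> Y \<and> poly (iterate_poly k (P x)) w = w}"
  let ?g = "\<lambda>x. iterate_poly k (P x)"
  have "noetherian (pfuns {..<Suc N} :: ((nat \<Rightarrow> 'k) \<Rightarrow> 'k) set)" by (rule pfuns_noetherian) simp
  from finite_irreducible_decomposition[OF this, of ?Z] obtain \<Y> where
    Y: "finite \<Y>" "\<Union>\<Y> = ?Z" "\<And>W. W \<in> \<Y> \<Longrightarrow> irreducible_on (pfuns {..<Suc N}) W" by metis
  have "\<forall>W\<in>\<Y>. \<exists>r b H. r \<ge> 1 \<and> b \<in> pfuns {..<Suc N} \<and> H \<in> pfuns X \<and> (\<exists>x. H x \<noteq> 0) \<and>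
    (\<forall>x\<in>W. (\<forall>a. 1 \<le> a \<longrightarrow> a < r \<longrightarrow> coeff (?g x \<circ>\<^sub>p [:x N, 1:]) a = 0) \<and> b x * coeff (?g x \<circ>\<^sub>p [:x N, 1:]) r = H x)"
    using fixed_point_component[OF k Y(3)] Y(2) by blast
  then obtain r b H where
    rbH: "\<forall>W\<in>\<Y>. r W \<ge> 1 \<and> b W \<in> pfuns {..<Suc N} \<and> H W \<in> pfuns X \<and> (\<exists>x. H W x \<noteq> 0) \<and>
    (\<forall>x\<in>W. (\<forall>a. 1 \<le> a \<longrightarrow> a < r W \<longrightarrow> coeff (?g x \<circ>\<^sub>p [:x N, 1:]) a = 0) \<and>
       b W x * coeff (?g x \<circ>\<^sub>p [:x N, 1:]) (r W) = H W x)"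
    by metis
  define H' where "H' x = (\<Prod>W\<in>\<Y>. H W x)" for x
  have H': "H' \<in> pfuns X" "\<exists>x. H' x \<noteq> 0"
    unfolding H'_def[abs_def] using rbH by (auto intro!: fr_prod[OF pfuns_fun_ring] nonzero_prod Y(1))
  obtain v where "lead v * H' v \<noteq> 0" using nonzero_mult[OF lead(1) H'(1)] lead(2) H'(2) by blast
  \<comment> \<open>The new point stays in the class of \<open>c\<close> modulo \<open>M\<close>, so
    that \<open>per\<close> remains available, and avoids the zeros of \<open>lead\<close> and of
    every \<open>H W\<close>.\<close>
  from pfuns_nonzero_on_grid[OF fX pfuns.mult[OF lead(1) H'(1)] this M, of c] obtain y where
    y: "lead (\<lambda>i. of_int (c i + M * y i)) * H' (\<lambda>i. of_int (c i + M * y i)) \<noteq> 0" by blast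
  define c' where "c' = (\<lambda>i. c i + M * y i)"
  let ?c' = "\<lambda>i. of_int (c' i) :: 'k"
  have c': "lead ?c' \<noteq> 0" "H' ?c' \<noteq> 0" using y by (auto simp: c'_def)
  obtain \<Gamma>1 where G1: "finite \<Gamma>1" "\<And>A f. valuation_ring A \<Longrightarrow> \<Gamma>1 \<subseteq> A \<Longrightarrow> f \<in> b ` \<Y> \<Longrightarrow> integral_over {..<Suc N} A f"
    using finite_pfuns_integral_over[of "b ` \<Y>" "{..<Suc N}"] Y(1) rbH by (metis finite_imageI image_subsetI)
  obtain \<Gamma>2 where G2: "finite \<Gamma>2" "\<And>A f. valuation_ring A \<Longrightarrow> \<Gamma>2 \<subseteq> A \<Longrightarrow> f \<in> H ` \<Y> \<Longrightarrow> integral_over X A f"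
    using finite_pfuns_integral_over[of "H ` \<Y>" X] Y(1) rbH by (metis finite_imageI image_subsetI)
  have "finite (\<Gamma>1 \<union> \<Gamma>2)" using G1(1) G2(1) by simp
  from reduction[OF c'(1) this c'(2)] obtain B where B: "\<And>p. p > B \<Longrightarrow> prime p \<Longrightarrow>
      \<exists>A. good_reduction A p c' \<and> \<Gamma>1 \<union> \<Gamma>2 \<subseteq> A \<and> H' ?c' \<in> A \<and> H' ?c' \<notin> nonunits A" by auto
  obtain p where p: "prime p" "p > B" using bigger_prime by blast
  \<comment> \<open>A multiple of \<open>M\<close> keeps the points in the old class, and the factor
    \<open>p\<close> fixes their residues.\<close>
  define M' where "M' = M * int p"
  from B[OF p(2,1)] obtain A where GA: "good_reduction A p c'" "\<Gamma>1 \<union> \<Gamma>2 \<subseteq> A" "H' ?c' \<notin> nonunits A" by auto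
  have A: "valuation_ring A" "\<Gamma>1 \<union> \<Gamma>2 \<subseteq> A" "H' ?c' \<notin> nonunits A"
    "P \<in> poly_maps {f. integral_over {..<N} A f}" "z \<in> {f. integral_over {..<N} A f}"
    "\<And>M. int p dvd M \<Longrightarrow> residually_finite A {f. integral_over {..<N} A f} (grid_points c' M) \<and>
       (\<forall>x\<in>grid_points c' M. (\<forall>i<N. x i \<in> A) \<and> (\<forall>i\<in>X. x i - of_int (c' i) \<in> nonunits A))"
    using GA by (auto simp: good_reduction_def)
  have rf: "residually_finite A {f. integral_over {..<N} A f} (grid_points c' M')"
    and gp: "\<And>x i. x \<in> grid_points c' M' \<Longrightarrow> i < N \<Longrightarrow> x i \<in> A"
      "\<And>x i. x \<in> grid_points c' M' \<Longrightarrow> i \<in> X \<Longrightarrow> x i - of_int (c' i) \<in> nonunits A"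
    using A(6)[of M'] by (auto simp: M'_def)
  note S = integral_over_fun_ring[OF A(1), of "{..<N}"] and SA = vr_subring[OF A(1)]
  have ES: "E n \<in> {f. integral_over {..<N} A f}" for n by (rule E_in[OF S A(4,5)])
  have EA: "E n x \<in> A" if "x \<in> grid_points c' M'" for n x
    using rf ES that unfolding residually_finite_def by blast
  have sub: "grid_points c' M' \<subseteq> grid_points c M" unfolding c'_def M'_def by (rule grid_points_subset)
  have Ek: "poly (?g x) (E j x) = E (j + k) x" for j x
    by (simp add: poly_iterate_poly E_def funpow_add add.commute[of j])
  have pre: "\<exists>n m. n < m \<and> (\<forall>j. E (k * (j + n)) x = E (k * (j + m)) x)" if x: "x \<in> grid_points c' M'" for x
  proof -
    obtain j0 where "\<forall>j\<ge>j0. E (j + k) x = E j x" using per x sub by blast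
    moreover have "k * (j + j0) \<ge> j0" for j using k by (metis le_add2 mult_le_mono nat_mult_1 order_trans)
    ultimately have "E (k * (j + j0)) x = E (k * (j + Suc j0)) x" for j
      by (metis add_Suc_right add.commute mult_Suc_right)
    thus ?thesis by (intro exI[of _ j0] exI[of _ "Suc j0"]) auto
  qed
  have ES': "(\<lambda>x. E (k * n) x) \<in> {f. integral_over {..<N} A f}" for n using ES[of "k * n"] by simp
  obtain T L where TL: "L \<ge> 1" "\<And>x j. x \<in> grid_points c' M' \<Longrightarrow> j \<ge> T \<Longrightarrow> E (k * (j + L)) x - E (k * j) x \<in> nonunits A"
    using residual_preperiod_uniform[OF A(1) rf ES' pre] by blast
  have "E (k * T + k) x = E (k * T) x" if x: "x \<in> grid_points c' M'" for x
  proof -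
    obtain j0 where j0: "\<And>j. j \<ge> j0 \<Longrightarrow> E (j + k) x = E j x" using per x sub by blast
    define w where "w = E (k * j0) x"
    have wc: "E (k * j) x = w" if "j \<ge> j0" for j
      using that
    proof (induction j rule: dec_induct)
      case (step n)
      have "k * n \<ge> j0" using step(1) k by (metis mult_le_mono nat_mult_1)
      from j0[OF this] show ?case using step by (simp add: add.commute)
    qed (simp add: w_def)
    have gw: "poly (?g x) w = w" using Ek[of x "k * j0"] wc[of "Suc j0"] by (simp add: w_def add.commute)
    have wA: "w \<in> A" unfolding w_def by (rule EA[OF x])
    have xY: "x \<in> Y" using x by (simp add: grid_points_def)
    \<comment> \<open>The point of the fixed-point cover over \<open>x\<close> given by the limit
      \<open>w\<close>; the component containing it supplies the order \<open>r W\<close> and the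
      unit bound on the coefficient of that order.\<close>
    define x' where "x' = x(N := w)"
    have "x' \<in> ?Z" using xY gw unfolding x'_def by blast
    then obtain W where W: "W \<in> \<Y>" "x' \<in> W" using Y(2) by blast
    have gA: "?g x \<in> poly_over A"
    proof -
      have "coeff (P x) i \<in> A" for i
        using A(4) gp(1)[OF x] by (auto simp: poly_maps_def integral_over_def)
      thus ?thesis by (intro poly_over_iterate[OF SA]) (simp add: poly_over_def)
    qed
    have gx: "?g x' = ?g x"
    proof -
      have "P x' = P x" by (rule poly_maps_cong[OF P]) (auto simp: x'_def)
      thus ?thesis by simp
    qed
    have taylor: "\<And>a. 1 \<le> a \<Longrightarrow> a < r W \<Longrightarrow> coeff (?g x \<circ>\<^sub>p [:w, 1:]) a = 0"
      "b W x' * coeff (?g x \<circ>\<^sub>p [:w, 1:]) (r W) = H W x'" "r W \<ge> 1"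
    proof -
      have "x' N = w" by (simp add: x'_def)
      moreover have "r W \<ge> 1 \<and> (\<forall>a. 1 \<le> a \<longrightarrow> a < r W \<longrightarrow> coeff (?g x' \<circ>\<^sub>p [:x' N, 1:]) a = 0) \<and>
          b W x' * coeff (?g x' \<circ>\<^sub>p [:x' N, 1:]) (r W) = H W x'"
        using bspec[OF rbH W(1)] W(2) by blast
      ultimately show "\<And>a. 1 \<le> a \<Longrightarrow> a < r W \<Longrightarrow> coeff (?g x \<circ>\<^sub>p [:w, 1:]) a = 0"
        "b W x' * coeff (?g x \<circ>\<^sub>p [:w, 1:]) (r W) = H W x'" "r W \<ge> 1" unfolding gx by auto
    qed
    have HWn: "H W ?c' \<notin> nonunits A"
    proof
      assume n: "H W ?c' \<in> nonunits A"
      have ints: "of_int n \<in> A" for n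
      proof (cases n)
        case (nonneg m)
        have "of_nat m \<in> A" by (induction m) (auto intro: vr[OF A(1)])
        thus ?thesis using nonneg by simp
      next
        case (neg m)
        have "of_nat k \<in> A" for k by (induction k) (auto intro: vr[OF A(1)])
        hence "- of_nat (Suc m) \<in> A" using vr(3)[OF A(1)] by blast
        thus ?thesis using neg by (metis of_int_minus of_int_of_nat_eq)
      qed
      have "H V ?c' \<in> A" if "V \<in> \<Y>" for V
        using G2(2)[OF A(1), of "H V"] A(2) that ints by (auto simp: integral_over_def)
      hence "(\<Prod>V\<in>I. H V ?c') \<in> A" if "I \<subseteq> \<Y>" for I
        using that by (induction I rule: infinite_finite_induct) (auto intro!: vr(2,6)[OF A(1)])
      from nonunits_mult[OF A(1) this n, of "\<Y> - {W}"] have "H' ?c' \<in> nonunits A"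
        unfolding H'_def using Y(1) W(1) by (subst prod.remove[OF _ W(1)]) (auto simp: mult.commute)
      thus False using A(3) by simp
    qed
    have "H W x' - H W ?c' \<in> nonunits A"
    proof -
      have "x' i - ?c' i \<in> nonunits A \<and> x' i \<in> A \<and> ?c' i \<in> A" if i: "i \<in> X" for i
      proof -
        have "i < N" using i XN by auto
        hence "x' i = x i" "x i \<in> A" using gp(1)[OF x] by (auto simp: x'_def)
        moreover have "?c' i = x i - (x i - ?c' i)" by simp
        hence "?c' i \<in> A" using vr(5)[OF A(1) \<open>x i \<in> A\<close> nonunits_in[OF A(1) gp(2)[OF x i]]] by simp
        ultimately show ?thesis using gp(2)[OF x i] by simp
      qed
      thus ?thesis using G2(2)[OF A(1), of "H W"] A(2) W(1) by (auto simp: integral_over_def)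
    qed
    hence Hx: "H W x' \<notin> nonunits A" using HWn nonunits_diff[OF A(1), of "H W x'" "H W x' - H W ?c'"] by auto
    have "x' i \<in> A" if "i < Suc N" for i using that gp(1)[OF x] wA by (auto simp: x'_def less_Suc_eq)
    hence bA: "b W x' \<in> A" using G1(2)[OF A(1), of "b W"] A(2) W(1) by (auto simp: integral_over_def)
    have Gn: "coeff (?g x \<circ>\<^sub>p [:w, 1:]) (r W) \<notin> nonunits A"
      using nonunits_mult[OF A(1) bA] taylor(2) Hx by metis
    \<comment> \<open>The orbit is residually \<open>L\<close>-periodic from \<open>T\<close> on and
      finally equal to \<open>w\<close>, hence residually equal to \<open>w\<close>
      throughout.\<close>
    have res: "E (k * j) x - w \<in> nonunits A" if j: "j \<ge> T" for j
    proof -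
      have "E (k * (j + L * n)) x - E (k * j) x \<in> nonunits A" for n
      proof (induction n)
        case (Suc n)
        have e: "j + L * Suc n = (j + L * n) + L" by simp
        show ?case unfolding e
          using congruent_trans[OF A(1) TL(2)[OF x, of "j + L * n"] Suc] j by simp
      qed (simp add: nonunits_0[OF A(1)])
      moreover have "j + L * j0 \<ge> j0" using TL(1) by (simp add: trans_le_add2)
      ultimately have "w - E (k * j) x \<in> nonunits A" using wc by metis
      thus ?thesis by (rule congruent_sym[OF A(1)])
    qed
    \<comment> \<open>Backwards induction from \<open>T + j0\<close> to \<open>T\<close>, one
      preimage at a time.\<close>
    have "E (k * (T + (j0 - n))) x = w" if "n \<le> j0" for n
      using that
    proof (induction n)
      case 0
      thus ?case using wc[of "T + j0"] by simp
    next
      case (Suc n)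
      let ?j = "T + (j0 - Suc n)"
      have "T + (j0 - n) = Suc ?j" using Suc.prems by simp
      hence "poly (?g x) (E (k * ?j) x) = w" using Suc Ek[of x "k * ?j"] by (simp add: add.commute)
      from residual_preimage_unique[OF A(1) gA wA gw EA[OF x] res this taylor(3,1) Gn] show ?case by simp
    qed
    from this[of j0] have "E (k * T) x = w" by simp
    thus ?thesis using Ek[of x "k * T"] gw by simp
  qed
  moreover have "M' \<noteq> 0" using M p(1) by (auto simp: M'_def)
  ultimately show ?thesis by blast
qed

text \<open>The relation on grid points extends to \<open>Y\<close> by density: if it failed, it
  would have a nonzero multiple \<open>H\<close> in the basis coordinates, and an integer point of
  the residue class with \<open>H\<close> nonzero could be lifted to \<open>Y\<close>.\<close>

theorem uniformly_preperiodic_basis: "\<exists>n m. n < m \<and> vanishes Y (\<lambda>x. E m x - E n x)"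
proof -
  obtain c M k where "M \<noteq> 0" "lead (\<lambda>i. of_int (c i)) \<noteq> 0" and k: "k \<ge> 1"
    and "\<forall>x\<in>grid_points c M. \<exists>j0. \<forall>j\<ge>j0. E (j + k) x = E j x"
    using uniform_period by blast
  then obtain c' M' T where T: "M' \<noteq> 0" "\<And>x. x \<in> grid_points c' M' \<Longrightarrow> E (T + k) x = E T x"
    using uniform_preperiod by metis
  let ?f = "\<lambda>x. E (T + k) x - E T x" and ?D = "{..<N} - X"
  have un: "X \<union> ?D = {..<N}" using XN by auto
  have f: "?f \<in> pfuns {..<N}" using E_in[OF pfuns_fun_ring P z] by (intro fr_diff[OF pfuns_fun_ring]) auto
  have "vanishes Y ?f"
  proof (rule ccontr)
    assume nv: "\<not> ?thesis"
    obtain b H where H: "b \<in> pfuns {..<N}" "H \<in> pfuns X" "\<not> vanishes Y H" "\<And>x. x \<in> Y \<Longrightarrow> b x * ?f x = H x"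
      using algebraic_tower_associate[OF _ _ algebraic_coords, of ?D ?f] irr f nv unfolding un by auto
    obtain H0 where H0: "H0 \<in> pfuns X" "\<not> vanishes Y H0"
      "\<And>y. (\<forall>f\<in>pfuns X. vanishes Y f \<longrightarrow> f y = 0) \<Longrightarrow> H0 y \<noteq> 0 \<Longrightarrow>
         \<exists>x. (\<forall>i\<in>X. x i = y i) \<and> (\<forall>f\<in>pfuns {..<N}. vanishes Y f \<longrightarrow> f x = 0)"
      using algebraic_tower_lift[OF _ _ _ algebraic_coords, of ?D] irr unfolding un by auto
    obtain v where "H v * H0 v \<noteq> 0" using nonzero_mult[OF H(2) H0(1)] H(3) H0(2) by (auto simp: vanishes_def)
    from pfuns_nonzero_on_grid[OF fX pfuns.mult[OF H(2) H0(1)] this T(1), of c'] obtain y where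
      y: "H (\<lambda>i. of_int (c' i + M' * y i)) \<noteq> 0" "H0 (\<lambda>i. of_int (c' i + M' * y i)) \<noteq> 0" by auto
    have "\<exists>x. (\<forall>i\<in>X. x i = of_int (c' i + M' * y i)) \<and> (\<forall>f\<in>pfuns {..<N}. vanishes Y f \<longrightarrow> f x = 0)"
      by (rule H0(3)[OF _ y(2)]) (intro ballI impI indep)
    then obtain x where x': "(\<forall>i\<in>X. x i = of_int (c' i + M' * y i)) \<and> (\<forall>f\<in>pfuns {..<N}. vanishes Y f \<longrightarrow> f x = 0)" ..
    have x: "\<And>i. i \<in> X \<Longrightarrow> x i = of_int (c' i + M' * y i)"
      "\<And>f. f \<in> pfuns {..<N} \<Longrightarrow> vanishes Y f \<Longrightarrow> f x = 0" using x' by simp_all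
    \<comment> \<open>The lift is controlled only in the coordinates below \<open>N\<close>; the
      others are set to \<open>0\<close> so that \<open>closed\<close> applies.\<close>
    define x' where "x' i = (if i < N then x i else 0)" for i
    have eq: "f x' = f x" if "f \<in> pfuns {..<N}" for f by (rule pfuns_cong[OF that]) (simp add: x'_def)
    have "x' \<in> Y"
    proof (rule closed)
      show "\<forall>f\<in>pfuns {..<N}. vanishes Y f \<longrightarrow> f x' = 0"
      proof (intro ballI impI)
        fix f assume "f \<in> pfuns {..<N}" "vanishes Y f"
        thus "f x' = 0" using x(2)[of f] eq[of f] by simp
      qed
    qed (simp add: x'_def)
    moreover have x'X: "\<And>i. i \<in> X \<Longrightarrow> x' i = of_int (c' i + M' * y i)" using x(1) XN by (auto simp: x'_def)
    ultimately have "x' \<in> grid_points c' M'" unfolding grid_points_def by blast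
    hence "?f x' = 0" using T(2) by simp
    hence "H x' = 0" using H(4)[OF \<open>x' \<in> Y\<close>] by simp
    moreover have "H x' = H (\<lambda>i. of_int (c' i + M' * y i))" by (rule pfuns_cong[OF H(2)]) (rule x'X)
    ultimately show False using y(1) by simp
  qed
  thus ?thesis using k by (intro exI[of _ T] exI[of _ "T + k"]) auto
qed

end

theorem (in preperiodic_family) uniformly_preperiodic:
  "\<exists>n m. n < m \<and> (\<forall>x\<in>Y. (poly (P x) ^^ n) (z x) = (poly (P x) ^^ m) (z x))"
proof -
  obtain X where X': "X \<subseteq> {..<N} \<and> (\<forall>f\<in>pfuns X. vanishes Y f \<longrightarrow> (\<forall>x. f x = 0)) \<and>
     (\<forall>j\<in>{..<N} - X. algebraic_over (pfuns X) Y (\<lambda>x. x j))"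
    using transcendence_basis by (elim exE)
  have X: "X \<subseteq> {..<N}" "\<And>f x. f \<in> pfuns X \<Longrightarrow> vanishes Y f \<Longrightarrow> f x = 0"
    "\<And>j. j \<in> {..<N} - X \<Longrightarrow> algebraic_over (pfuns X) Y (\<lambda>x. x j)" using X' by simp_all
  have "\<forall>j\<in>{..<N} - X. \<exists>F e. F \<in> poly_maps (pfuns X) \<and> (\<forall>x. degree (F x) \<le> e) \<and>
    (\<forall>x\<in>Y. poly (F x) (x j) = 0) \<and> \<not> vanishes Y (\<lambda>x. coeff (F x) e)"
  proof
    fix j assume "j \<in> {..<N} - X"
    from min_polynomial_exists[OF pfuns_fun_ring X(3)[OF this]] obtain F e where
      m: "min_polynomial (pfuns X) Y (\<lambda>x. x j) F e" by blast
    note m' = m[unfolded min_polynomial_def]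
    have "F \<in> poly_maps (pfuns X)" "\<forall>x. degree (F x) \<le> e" "\<not> vanishes Y (\<lambda>x. coeff (F x) e)"
      "vanishes Y (\<lambda>x. poly (F x) (x j))" using m' by simp_all
    thus "\<exists>F e. F \<in> poly_maps (pfuns X) \<and> (\<forall>x. degree (F x) \<le> e) \<and>
      (\<forall>x\<in>Y. poly (F x) (x j) = 0) \<and> \<not> vanishes Y (\<lambda>x. coeff (F x) e)"
      unfolding vanishes_def[of Y "\<lambda>x. poly (F x) (x j)"] by (intro exI conjI)
  qed
  then obtain F e where "\<forall>j\<in>{..<N} - X. F j \<in> poly_maps (pfuns X) \<and> (\<forall>x. degree (F j x) \<le> e j) \<and>
    (\<forall>x\<in>Y. poly (F j x) (x j) = 0) \<and> \<not> vanishes Y (\<lambda>x. coeff (F j x) (e j))"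
    unfolding bchoice_iff by (elim exE)
  then interpret preperiodic_family_basis N Y P z d X F e
    using X by unfold_locales auto
  show ?thesis using uniformly_preperiodic_basis unfolding E_def vanishes_def by fastforce
qed

section \<open>Zariski charts\<close>

text \<open>The topology on \<open>V\<close> is given by principal open sets. The functions live on
  the whole type and only their values on \<open>V\<close> count, so one ring can serve several
  spaces.\<close>

definition zariski_chart :: "'b topology \<Rightarrow> 'b set \<Rightarrow> ('b \<Rightarrow> 'k::field) set \<Rightarrow> bool" where
  "zariski_chart T V S \<longleftrightarrow> openin T V \<and> fun_ring S \<and>
     (\<forall>A\<subseteq>V. openin T A \<longleftrightarrow> (\<forall>x\<in>A. \<exists>q\<in>S. q x \<noteq> 0 \<and> (\<forall>y\<in>V. q y \<noteq> 0 \<longrightarrow> y \<in> A)))"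

context
  fixes T :: "'b topology" and V :: "'b set" and S :: "('b \<Rightarrow> 'k::field) set"
  assumes Z: "zariski_chart T V S"
begin

lemma zc_open: "openin T V" and zc_ring: "fun_ring S"
  using Z by (auto simp: zariski_chart_def)

lemma zc_openin: "A \<subseteq> V \<Longrightarrow> openin T A \<longleftrightarrow> (\<forall>x\<in>A. \<exists>q\<in>S. q x \<noteq> 0 \<and> (\<forall>y\<in>V. q y \<noteq> 0 \<longrightarrow> y \<in> A))"
  using Z by (simp add: zariski_chart_def)

lemma zc_nbhd:
  assumes "openin T A" "x \<in> A" "x \<in> V" shows "\<exists>q\<in>S. q x \<noteq> 0 \<and> (\<forall>y\<in>V. q y \<noteq> 0 \<longrightarrow> y \<in> A)"
proof -
  have "openin T (A \<inter> V)" using assms(1) zc_open by (rule openin_Int)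
  thus ?thesis using zc_openin[of "A \<inter> V"] assms(2,3) by blast
qed

lemma zc_principal: "f \<in> S \<Longrightarrow> openin T {y \<in> V. f y \<noteq> 0}"
  by (subst zc_openin) auto

lemma zc_sub: "V \<subseteq> topspace T"
  using zc_open by (rule openin_subset)

text \<open>Principal open sets turn functions into closed sets. Together with
  \<open>irreducible_in_chart\<close> this trades topological irreducibility for a prime vanishing
  ideal.\<close>

lemma irreducible_on_chart:
  assumes irr: "irreducible_in T W" and ne: "W \<inter> V \<noteq> {}"
  shows "irreducible_on S (W \<inter> V)"
  unfolding irreducible_on_def
proof (intro conjI ballI impI)
  fix f g assume fg: "f \<in> S" "g \<in> S" "vanishes (W \<inter> V) (\<lambda>x. f x * g x)"
  let ?A = "topspace T - {y \<in> V. f y \<noteq> 0}" and ?B = "topspace T - {y \<in> V. g y \<noteq> 0}"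
  have "closedin T ?A" "closedin T ?B" using zc_principal fg by auto
  moreover have "W \<subseteq> ?A \<union> ?B" using irr fg(3) by (auto simp: irreducible_in_def vanishes_def)
  ultimately have "W \<subseteq> ?A \<or> W \<subseteq> ?B" using irr by (simp add: irreducible_in_def)
  thus "vanishes (W \<inter> V) f \<or> vanishes (W \<inter> V) g" by (auto simp: vanishes_def)
qed (use ne in auto)

lemma irreducible_in_chart:
  assumes irr: "irreducible_on S W" and W: "W \<subseteq> V"
  shows "irreducible_in T W"
  unfolding irreducible_in_def
proof (intro conjI allI impI)
  show "W \<subseteq> topspace T" using W zc_sub by blast
  show "W \<noteq> {}" using irr by (simp add: irreducible_on_def)
  fix A B assume AB: "closedin T A \<and> closedin T B \<and> W \<subseteq> A \<union> B"
  show "W \<subseteq> A \<or> W \<subseteq> B"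
  proof (rule ccontr)
    assume "\<not> ?thesis"
    then obtain x y where xy: "x \<in> W" "x \<notin> A" "y \<in> W" "y \<notin> B" by blast
    have "x \<in> V" "y \<in> V" "x \<in> topspace T" "y \<in> topspace T" using xy W zc_sub by auto
    have "openin T (topspace T - A)" "openin T (topspace T - B)" using AB by auto
    from zc_nbhd[OF this(1), of x] zc_nbhd[OF this(2), of y] obtain p q where
      p: "p \<in> S" "p x \<noteq> 0" "\<And>y. y \<in> V \<Longrightarrow> p y \<noteq> 0 \<Longrightarrow> y \<notin> A" and
      q: "q \<in> S" "q y \<noteq> 0" "\<And>y. y \<in> V \<Longrightarrow> q y \<noteq> 0 \<Longrightarrow> y \<notin> B"
      using xy \<open>x \<in> V\<close> \<open>y \<in> V\<close> \<open>x \<in> topspace T\<close> \<open>y \<in> topspace T\<close> by (metis DiffD2 DiffI)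
    have "p v * q v = 0" if "v \<in> W" for v using that AB W p(3)[of v] q(3)[of v] by fastforce
    hence "vanishes W (\<lambda>v. p v * q v)" by (simp add: vanishes_def)
    hence "vanishes W p \<or> vanishes W q" using irr p q by (auto simp: irreducible_on_def)
    thus False using xy p q by (auto simp: vanishes_def)
  qed
qed

lemma closure_chart:
  assumes "W \<subseteq> V" "y \<in> V"
  shows "y \<in> T closure_of W \<longleftrightarrow> (\<forall>f\<in>S. vanishes W f \<longrightarrow> f y = 0)"
proof
  assume y: "y \<in> T closure_of W"
  show "\<forall>f\<in>S. vanishes W f \<longrightarrow> f y = 0"
  proof (intro ballI impI)
    fix f assume f: "f \<in> S" "vanishes W f"
    have "W \<subseteq> topspace T - {y \<in> V. f y \<noteq> 0}" using f(2) assms(1) zc_sub by (auto simp: vanishes_def)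
    moreover have "closedin T (topspace T - {y \<in> V. f y \<noteq> 0})" using zc_principal[OF f(1)] by auto
    ultimately have "y \<in> topspace T - {y \<in> V. f y \<noteq> 0}" using y closure_of_minimal by blast
    thus "f y = 0" using assms(2) by auto
  qed
next
  assume R: "\<forall>f\<in>S. vanishes W f \<longrightarrow> f y = 0"
  show "y \<in> T closure_of W"
    unfolding in_closure_of
  proof (intro conjI allI impI)
    show "y \<in> topspace T" using assms(2) zc_sub by blast
    fix A assume "y \<in> A \<and> openin T A"
    then obtain q where q: "q \<in> S" "q y \<noteq> 0" "\<forall>y\<in>V. q y \<noteq> 0 \<longrightarrow> y \<in> A" using zc_nbhd assms(2) by blast
    hence "\<not> vanishes W q" using R by blast
    thus "\<exists>y. y \<in> W \<and> y \<in> A" using q(3) assms(1) by (auto simp: vanishes_def)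
  qed
qed

lemma irreducible_in_closure:
  assumes "irreducible_in T W" shows "irreducible_in T (T closure_of W)"
  unfolding irreducible_in_def
proof (intro conjI allI impI)
  have sub: "W \<subseteq> T closure_of W" using assms by (simp add: irreducible_in_def closure_of_subset)
  show "T closure_of W \<subseteq> topspace T" by (rule closure_of_subset_topspace)
  show "T closure_of W \<noteq> {}" using sub assms by (auto simp: irreducible_in_def)
  fix A B assume AB: "closedin T A \<and> closedin T B \<and> T closure_of W \<subseteq> A \<union> B"
  moreover from this have "W \<subseteq> A \<union> B" using sub by blast
  ultimately have "W \<subseteq> A \<or> W \<subseteq> B" using assms unfolding irreducible_in_def by blast
  thus "T closure_of W \<subseteq> A \<or> T closure_of W \<subseteq> B" using AB closure_of_minimal by blast
qed

text \<open>\<open>W\<close> is covered by the closure of its trace and the complement of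
  \<open>V\<close>; irreducibility excludes the latter. A hypersurface is thereby recovered from its
  trace in a chart.\<close>

lemma closed_irreducible_eq_closure:
  assumes "irreducible_in T W" "closedin T W" "W \<inter> V \<noteq> {}"
  shows "W = T closure_of (W \<inter> V)"
proof -
  have "W \<subseteq> T closure_of (W \<inter> V) \<union> (topspace T - V)"
    using assms(1) closure_of_subset[of "W \<inter> V" T] zc_sub by (auto simp: irreducible_in_def)
  moreover have "closedin T (topspace T - V)" using zc_open by auto
  ultimately have "W \<subseteq> T closure_of (W \<inter> V) \<or> W \<subseteq> topspace T - V"
    using assms(1) closedin_closure_of unfolding irreducible_in_def by blast
  hence "W \<subseteq> T closure_of (W \<inter> V)" using assms(3) by blast
  moreover have "T closure_of (W \<inter> V) \<subseteq> W" using assms(2) by (intro closure_of_minimal) auto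
  ultimately show ?thesis by blast
qed

text \<open>The closures of \<open>W1\<close> and \<open>W2\<close> would form a chain of length two
  above \<open>H\<close>. Strictness is recorded by functions because it then survives taking
  closures.\<close>

lemma hypersurface_no_chain:
  assumes H: "irreducible_hypersurface T H" and ne: "H \<inter> V \<noteq> {}"
    and W: "irreducible_on S W1" "irreducible_on S W2" "H \<inter> V \<subseteq> W1" "W1 \<subseteq> W2" "W2 \<subseteq> V"
    and f: "f1 \<in> S" "vanishes (H \<inter> V) f1" "\<not> vanishes W1 f1" "f2 \<in> S" "vanishes W1 f2" "\<not> vanishes W2 f2"
  shows False
proof -
  define C where "C i = (if i = 0 then H else if i = 1 then T closure_of W1 else T closure_of W2)" for i :: nat
  have Hc: "closedin T H" "irreducible_in T H" "codimension T H = 1"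
    using H by (auto simp: irreducible_hypersurface_def)
  note Heq = closed_irreducible_eq_closure[OF Hc(2,1) ne]
  have W1V: "W1 \<subseteq> V" using W by blast
  have irr: "irreducible_in T (C i)" "closedin T (C i)" for i
    using Hc irreducible_in_closure irreducible_in_chart[OF W(1) W1V] irreducible_in_chart[OF W(2,5)]
    by (auto simp: C_def)
  have s1: "C 0 \<subset> C 1"
  proof
    show "C 0 \<subseteq> C 1" using Heq closure_of_mono[OF W(3), of T] by (simp add: C_def)
    obtain x where x: "x \<in> W1" "f1 x \<noteq> 0" using f(3) by (auto simp: vanishes_def)
    hence "x \<notin> H" using f(2) W1V by (auto simp: vanishes_def)
    moreover have "x \<in> T closure_of W1" using x W1V zc_sub by (meson closure_of_subset subset_iff)
    ultimately show "C 0 \<noteq> C 1" by (auto simp: C_def)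
  qed
  have s2: "C 1 \<subset> C 2"
  proof
    show "C 1 \<subseteq> C 2" using closure_of_mono[OF W(4), of T] by (simp add: C_def)
    obtain x where x: "x \<in> W2" "f2 x \<noteq> 0" using f(6) by (auto simp: vanishes_def)
    hence "x \<notin> T closure_of W1" using closure_chart[OF W1V, of x] f W by blast
    moreover have "x \<in> T closure_of W2" using x W zc_sub by (meson closure_of_subset subset_iff)
    ultimately show "C 1 \<noteq> C 2" by (auto simp: C_def)
  qed
  have "enat 2 \<le> codimension T H"
    unfolding codimension_def
  proof (rule Sup_upper, rule CollectI, intro exI conjI)
    show "C 0 = H" by (simp add: C_def)
    show "\<forall>i\<le>2. closedin T (C i) \<and> irreducible_in T (C i)" using irr by blast
    show "\<forall>i<2. C i \<subset> C (Suc i)"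
    proof (intro allI impI)
      fix i :: nat assume "i < 2"
      hence "i = 0 \<or> i = 1" by auto
      thus "C i \<subset> C (Suc i)" using s1 s2 by (elim disjE) (simp_all add: numeral_2_eq_2)
    qed
  qed simp
  thus False using Hc(3) by (simp add: one_enat_def)
qed

text \<open>A converse when the chart is the whole space: the closure of \<open>W\<close> gives
  codimension at least one, and \<open>no\<close> excludes chains of length two once strict
  inclusions are replaced by functions.\<close>

lemma hypersurface_intro:
  assumes V: "V = topspace T" and irr: "irreducible_on S H" and HV: "H \<subseteq> V"
    and cl: "\<And>y. y \<in> V \<Longrightarrow> (\<forall>f\<in>S. vanishes H f \<longrightarrow> f y = 0) \<Longrightarrow> y \<in> H"
    and W: "irreducible_on S W" "H \<subseteq> W" "W \<subseteq> V" "f \<in> S" "vanishes H f" "\<not> vanishes W f"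
    and no: "\<And>W1 W2 f1 f2. irreducible_on S W1 \<Longrightarrow> irreducible_on S W2 \<Longrightarrow> H \<subseteq> W1 \<Longrightarrow> W1 \<subseteq> W2 \<Longrightarrow> W2 \<subseteq> V \<Longrightarrow>
      f1 \<in> S \<Longrightarrow> vanishes H f1 \<Longrightarrow> \<not> vanishes W1 f1 \<Longrightarrow> f2 \<in> S \<Longrightarrow> vanishes W1 f2 \<Longrightarrow> \<not> vanishes W2 f2 \<Longrightarrow> False"
  shows "irreducible_hypersurface T H"
proof -
  have Hirr: "irreducible_in T H" by (rule irreducible_in_chart[OF irr HV])
  have "T closure_of H \<subseteq> H" using closure_chart[OF HV] cl closure_of_subset_topspace[of T H] V by blast
  hence Hcl: "closedin T H" using closure_of_subset_eq HV V by blast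
  define D where "D i = (if i = 0 then H else T closure_of W)" for i :: nat
  have "enat 1 \<le> codimension T H"
    unfolding codimension_def
  proof (rule Sup_upper, rule CollectI, intro exI conjI)
    show "D 0 = H" by (simp add: D_def)
    show "\<forall>i\<le>1. closedin T (D i) \<and> irreducible_in T (D i)"
      using Hcl Hirr irreducible_in_closure[OF irreducible_in_chart[OF W(1,3)]] by (simp add: D_def)
    obtain x where x: "x \<in> W" "f x \<noteq> 0" using W(6) by (auto simp: vanishes_def)
    hence "x \<in> T closure_of W" using W(3) zc_sub by (meson closure_of_subset subset_iff)
    moreover have "x \<notin> H" using x W(5) by (auto simp: vanishes_def)
    moreover have "H \<subseteq> T closure_of W" using W(2,3) zc_sub closure_of_subset[of W T] by blast
    ultimately show "\<forall>i<1. D i \<subset> D (Suc i)" by (auto simp: D_def)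
  qed simp
  moreover have "codimension T H \<le> enat 1"
    unfolding codimension_def
  proof (rule Sup_least, elim CollectE exE conjE)
    fix e and n :: nat and C
    assume e: "e = enat n" and C: "C 0 = H" "\<forall>i\<le>n. closedin T (C i) \<and> irreducible_in T (C i)" "\<forall>i<n. C i \<subset> C (Suc i)"
    have "n \<le> 1"
    proof (rule ccontr)
      assume "\<not> n \<le> 1"
      hence c: "C 0 \<subset> C 1" "C 1 \<subset> C 2" and ir: "irreducible_in T (C 1)" "irreducible_in T (C 2)" "closedin T (C 1)"
        using C(2,3) by (auto simp: numeral_2_eq_2)
      have sub: "C 1 \<subseteq> V" "C 2 \<subseteq> V" using ir V by (auto simp: irreducible_in_def)
      have on: "irreducible_on S (C 1)" "irreducible_on S (C 2)"
        using irreducible_on_chart[OF ir(1)] irreducible_on_chart[OF ir(2)] sub ir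
        by (auto simp: irreducible_in_def Int_absorb2)
      obtain x where x: "x \<in> C 1" "x \<notin> H" using c C(1) by blast
      then obtain f1 where f1: "f1 \<in> S" "vanishes H f1" "f1 x \<noteq> 0" using cl sub by blast
      obtain y where y: "y \<in> C 2" "y \<notin> C 1" using c by blast
      have "T closure_of C 1 = C 1" using ir(3) by (rule closure_of_closedin)
      then obtain f2 where f2: "f2 \<in> S" "vanishes (C 1) f2" "f2 y \<noteq> 0"
        using closure_chart[OF sub(1), of y] y sub(2) by blast
      show False
        by (rule no[OF on _ _ sub(2) f1(1,2) _ f2(1,2)])
           (use c C(1) x f1 y f2 in \<open>auto simp: vanishes_def\<close>)
    qed
    thus "e \<le> enat 1" using e by simp
  qed
  ultimately have "codimension T H = 1" by (simp add: one_enat_def)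
  thus ?thesis using Hcl Hirr by (simp add: irreducible_hypersurface_def)
qed

end

section \<open>Rings generated by functions\<close>

inductive_set gen_funs :: "('b \<Rightarrow> 'k::field) set \<Rightarrow> ('b \<Rightarrow> 'k) set" for C where
  const: "(\<lambda>_. c) \<in> gen_funs C"
| gen: "f \<in> C \<Longrightarrow> f \<in> gen_funs C"
| add: "f \<in> gen_funs C \<Longrightarrow> g \<in> gen_funs C \<Longrightarrow> (\<lambda>x. f x + g x) \<in> gen_funs C"
| mult: "f \<in> gen_funs C \<Longrightarrow> g \<in> gen_funs C \<Longrightarrow> (\<lambda>x. f x * g x) \<in> gen_funs C"

lemma gen_funs_ring: "fun_ring (gen_funs C)"
  unfolding fun_ring_def
proof (intro conjI ballI)
  fix f assume "f \<in> gen_funs C"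
  from gen_funs.mult[OF gen_funs.const[of "-1"] this] show "(\<lambda>x. - f x) \<in> gen_funs C" by simp
qed (auto intro: gen_funs.intros)

lemma gen_funs_least: "fun_ring S \<Longrightarrow> (\<And>c. (\<lambda>_. c) \<in> S) \<Longrightarrow> C \<subseteq> S \<Longrightarrow> gen_funs C \<subseteq> S"
proof
  fix f assume S: "fun_ring S" "\<And>c. (\<lambda>_. c) \<in> S" "C \<subseteq> S" and "f \<in> gen_funs C"
  from this(4) show "f \<in> S" by induction (use S in \<open>auto intro: fr_add fr_mult\<close>)
qed

lemma gen_funs_insert: "gen_funs (insert w C) = adjoin (gen_funs C) w"
proof
  show "gen_funs (insert w C) \<subseteq> adjoin (gen_funs C) w"
    using adjoin_base[OF gen_funs_ring] adjoin_self[OF gen_funs_ring]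
    by (intro gen_funs_least adjoin_fun_ring gen_funs_ring) (auto intro: gen_funs.intros)
  have sub: "gen_funs C \<subseteq> gen_funs (insert w C)"
    by (intro gen_funs_least gen_funs_ring) (auto intro: gen_funs.intros)
  show "adjoin (gen_funs C) w \<subseteq> gen_funs (insert w C)"
  proof
    fix f assume "f \<in> adjoin (gen_funs C) w"
    then obtain F where F: "F \<in> poly_maps (gen_funs C)" "f = (\<lambda>x. poly (F x) (w x))" by (auto simp: adjoin_def)
    have "F \<in> poly_maps (gen_funs (insert w C))" using F(1) sub by (auto simp: poly_maps_def)
    thus "f \<in> gen_funs (insert w C)"
      unfolding F(2) by (intro poly_maps_eval gen_funs_ring gen_funs.gen) auto
  qed
qed

lemma gen_funs_comp: "gen_funs ((\<lambda>c. c \<circ> h) ` C) = (\<lambda>f. f \<circ> h) ` gen_funs C"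
proof (intro equalityI subsetI)
  fix f assume "f \<in> gen_funs ((\<lambda>c. c \<circ> h) ` C)"
  thus "f \<in> (\<lambda>f. f \<circ> h) ` gen_funs C"
  proof induction
    case (const c)
    show ?case by (rule image_eqI[of _ _ "\<lambda>_. c"]) (auto intro: gen_funs.intros)
  next
    case (gen f)
    thus ?case by (auto intro: gen_funs.intros)
  next
    case (add f g)
    then obtain f' g' where "f = f' \<circ> h" "g = g' \<circ> h" "f' \<in> gen_funs C" "g' \<in> gen_funs C" by blast
    thus ?case by (intro image_eqI[of _ _ "\<lambda>x. f' x + g' x"]) (auto intro: gen_funs.intros)
  next
    case (mult f g)
    then obtain f' g' where "f = f' \<circ> h" "g = g' \<circ> h" "f' \<in> gen_funs C" "g' \<in> gen_funs C" by blast
    thus ?case by (intro image_eqI[of _ _ "\<lambda>x. f' x * g' x"]) (auto intro: gen_funs.intros)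
  qed
next
  fix f assume "f \<in> (\<lambda>f. f \<circ> h) ` gen_funs C"
  then obtain g where g: "f = g \<circ> h" "g \<in> gen_funs C" by blast
  from g(2) have "g \<circ> h \<in> gen_funs ((\<lambda>c. c \<circ> h) ` C)"
  proof induction
    case (add f g)
    from gen_funs.add[OF add.IH] show ?case by (simp add: comp_def)
  next
    case (mult f g)
    from gen_funs.mult[OF mult.IH] show ?case by (simp add: comp_def)
  qed (auto simp: comp_def intro: gen_funs.intros)
  thus "f \<in> gen_funs ((\<lambda>c. c \<circ> h) ` C)" using g by simp
qed

lemma pfuns_gen_funs: "pfuns J = gen_funs ((\<lambda>i x. x i) ` J)"
proof (intro equalityI subsetI)
  fix f :: "(nat \<Rightarrow> 'a) \<Rightarrow> 'a" assume "f \<in> pfuns J"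
  thus "f \<in> gen_funs ((\<lambda>i x. x i) ` J)" by induction (auto intro: gen_funs.intros)
next
  fix f :: "(nat \<Rightarrow> 'a) \<Rightarrow> 'a" assume "f \<in> gen_funs ((\<lambda>i x. x i) ` J)"
  thus "f \<in> pfuns J" by induction (auto intro: pfuns.intros)
qed

lemma pfuns_comp: "(\<lambda>f. f \<circ> h) ` pfuns J = gen_funs ((\<lambda>i x. h x i) ` J)"
proof -
  have "(\<lambda>c. c \<circ> h) ` ((\<lambda>i x. x i) ` J) = (\<lambda>i x. h x i) ` J" by (simp add: image_image comp_def)
  thus ?thesis using gen_funs_comp[of h "(\<lambda>i x. x i) ` J"] by (simp add: pfuns_gen_funs)
qed

lemma irreducible_on_image:
  fixes S :: "('b \<Rightarrow> 'c::comm_ring_1) set"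
  shows
  "irreducible_on S (h ` Y) \<longleftrightarrow> irreducible_on ((\<lambda>f. f \<circ> h) ` S) Y"
proof -
  have v: "vanishes (h ` Y) f = vanishes Y (f \<circ> h)" for f :: "_ \<Rightarrow> 'c" by (auto simp: vanishes_def)
  have "vanishes (h ` Y) (\<lambda>x. f x * g x) = vanishes Y (\<lambda>x. (f \<circ> h) x * (g \<circ> h) x)" for f g :: "_ \<Rightarrow> 'c"
    by (auto simp: vanishes_def)
  thus ?thesis unfolding irreducible_on_def by (auto simp: v)
qed

text \<open>Polynomials over a domain form a domain. Two functions nonzero on the cylinder have
  coefficients nonzero on \<open>E\<close>; irreducibility gives a common point where both are
  nonzero, and over it the product is a nonzero polynomial, which has a non-root in an infinite
  field.\<close>

lemma irreducible_on_cylinder: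
  fixes S :: "('b \<Rightarrow> 'k::field_char_0) set"
  assumes irr: "irreducible_on S E"
  shows "irreducible_on (adjoin ((\<lambda>f. f \<circ> fst) ` S) snd) (E \<times> UNIV)"
  unfolding irreducible_on_def
proof (intro conjI ballI impI)
  show "E \<times> (UNIV::'k set) \<noteq> {}" using irr by (auto simp: irreducible_on_def)
  fix f g :: "'b \<times> 'k \<Rightarrow> 'k"
  assume "f \<in> adjoin ((\<lambda>f. f \<circ> fst) ` S) snd" "g \<in> adjoin ((\<lambda>f. f \<circ> fst) ` S) snd"
    and v: "vanishes (E \<times> UNIV) (\<lambda>x. f x * g x)"
  then obtain F G where F: "F \<in> poly_maps ((\<lambda>f. f \<circ> fst) ` S)" "f = (\<lambda>x. poly (F x) (snd x))"
    and G: "G \<in> poly_maps ((\<lambda>f. f \<circ> fst) ` S)" "g = (\<lambda>x. poly (G x) (snd x))" by (auto simp: adjoin_def)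
  have c: "\<exists>c\<in>S. \<forall>x. coeff (H x) i = c (fst x)" if "H \<in> poly_maps ((\<lambda>f. f \<circ> fst) ` S)" for H i
  proof -
    have "(\<lambda>x. coeff (H x) i) \<in> (\<lambda>f. f \<circ> fst) ` S" using that by (simp add: poly_maps_def)
    thus ?thesis by (auto simp: fun_eq_iff)
  qed
  have eqF: "F (t, z) = F (t, 0)" "G (t, z) = G (t, 0)" for t z
    using c[OF F(1)] c[OF G(1)] by (intro poly_eqI; metis fst_conv)+
  show "vanishes (E \<times> UNIV) f \<or> vanishes (E \<times> UNIV) g"
  proof (rule ccontr)
    assume "\<not> ?thesis"
    then obtain t z s y where ts: "t \<in> E" "f (t, z) \<noteq> 0" "s \<in> E" "g (s, y) \<noteq> 0" by (auto simp: vanishes_def)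
    hence "F (t, z) \<noteq> 0" "G (s, y) \<noteq> 0" using F(2) G(2) by auto
    then obtain i j where ij: "coeff (F (t, z)) i \<noteq> 0" "coeff (G (s, y)) j \<noteq> 0" by (auto simp: poly_eq_iff)
    obtain a b where a: "a \<in> S" "\<And>x. coeff (F x) i = a (fst x)" and b: "b \<in> S" "\<And>x. coeff (G x) j = b (fst x)"
      using c[OF F(1), of i] c[OF G(1), of j] by blast
    have "\<not> vanishes E a" "\<not> vanishes E b" using ij a(2) b(2) ts by (auto simp: vanishes_def)
    hence "\<not> vanishes E (\<lambda>x. a x * b x)" using irr a(1) b(1) by (auto simp: irreducible_on_def)
    then obtain u where u: "u \<in> E" "a u \<noteq> 0" "b u \<noteq> 0" by (auto simp: vanishes_def)
    hence "F (u, 0) * G (u, 0) \<noteq> 0" using a(2)[of "(u, 0)"] b(2)[of "(u, 0)"] by auto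
    then obtain v where "poly (F (u, 0) * G (u, 0)) v \<noteq> 0" using poly_all_0_iff_0 by blast
    hence "f (u, v) * g (u, v) \<noteq> 0" using F(2) G(2) eqF[of u v] by simp
    thus False using v u by (auto simp: vanishes_def)
  qed
qed

section \<open>Affine charts of varieties\<close>

definition coord_ring :: "nat \<Rightarrow> ('b \<Rightarrow> nat \<Rightarrow> 'k::field) \<Rightarrow> ('b \<Rightarrow> 'k) set" where
  "coord_ring n \<phi> = gen_funs ((\<lambda>i t. \<phi> t i) ` {..<n})"

lemma coord_ring_ring: "fun_ring (coord_ring n \<phi>)"
  by (simp add: coord_ring_def gen_funs_ring)

lemma coord_ring_const: "(\<lambda>_. c) \<in> coord_ring n \<phi>"
  by (simp add: coord_ring_def gen_funs.const)

lemma coord_ring_pfuns: "coord_ring n \<phi> = (\<lambda>f. f \<circ> \<phi>) ` poly_funs n"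
  by (simp add: coord_ring_def pfuns_comp poly_funs_pfuns)

definition quotient_near :: "('b \<Rightarrow> 'k::field) set \<Rightarrow> 'b set \<Rightarrow> 'b \<Rightarrow> ('b \<Rightarrow> 'k) \<Rightarrow> bool" where
  "quotient_near S U x f \<longleftrightarrow> (\<exists>p\<in>S. \<exists>q\<in>S. q x \<noteq> 0 \<and> (\<forall>y\<in>U. q y \<noteq> 0 \<longrightarrow> f y = p y / q y))"

definition chart :: "('b, 'k::field) fspace \<Rightarrow> 'b set \<Rightarrow> nat \<Rightarrow> ('b \<Rightarrow> nat \<Rightarrow> 'k) \<Rightarrow> bool" where
  "chart X U n \<phi> \<longleftrightarrow> inj_on \<phi> U \<and> algebraic_set n (\<phi> ` U) \<and> zariski_chart (zariski X) U (coord_ring n \<phi>) \<and>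
     (\<forall>x\<in>U. \<forall>f. regular_at X x f \<longleftrightarrow> quotient_near (coord_ring n \<phi>) U x f)"

text \<open>Only the generating sets need checking: finite intersections are handled by multiplying
  functions, and unions are immediate.\<close>

lemma zariski_chart_generated:
  assumes S: "fun_ring S"
    and B: "\<And>B x. B \<in> \<B> \<Longrightarrow> x \<in> B \<Longrightarrow> x \<in> V \<Longrightarrow> \<exists>q\<in>S. q x \<noteq> 0 \<and> (\<forall>y\<in>V. q y \<noteq> 0 \<longrightarrow> y \<in> B)"
    and q: "\<And>q. q \<in> S \<Longrightarrow> openin (topology_generated_by \<B>) {y \<in> V. q y \<noteq> 0}"
  shows "zariski_chart (topology_generated_by \<B>) V S"
proof -
  have *: "\<forall>x\<in>A. x \<in> V \<longrightarrow> (\<exists>q\<in>S. q x \<noteq> 0 \<and> (\<forall>y\<in>V. q y \<noteq> 0 \<longrightarrow> y \<in> A))"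
    if "generate_topology_on \<B> A" for A
    using that
  proof induction
    case (Int A1 A2)
    show ?case
    proof (intro ballI impI)
      fix x assume x: "x \<in> A1 \<inter> A2" "x \<in> V"
      obtain q1 where q1: "q1 \<in> S" "q1 x \<noteq> 0" "\<And>y. y \<in> V \<Longrightarrow> q1 y \<noteq> 0 \<Longrightarrow> y \<in> A1"
        using Int.IH(1) x by (metis IntD1)
      obtain q2 where q2: "q2 \<in> S" "q2 x \<noteq> 0" "\<And>y. y \<in> V \<Longrightarrow> q2 y \<noteq> 0 \<Longrightarrow> y \<in> A2"
        using Int.IH(2) x by (metis IntD2)
      show "\<exists>q\<in>S. q x \<noteq> 0 \<and> (\<forall>y\<in>V. q y \<noteq> 0 \<longrightarrow> y \<in> A1 \<inter> A2)"
      proof (intro bexI conjI ballI impI IntI)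
        show "(\<lambda>y. q1 y * q2 y) \<in> S" by (rule fr_mult[OF S q1(1) q2(1)])
        show "q1 x * q2 x \<noteq> 0" using q1(2) q2(2) by simp
        fix y assume "y \<in> V" "q1 y * q2 y \<noteq> 0"
        thus "y \<in> A1" "y \<in> A2" using q1(3) q2(3) by auto
      qed
    qed
  next
    case (UN K)
    show ?case
    proof (intro ballI impI)
      fix x assume x: "x \<in> \<Union>K" "x \<in> V"
      then obtain k where k: "k \<in> K" "x \<in> k" by blast
      then obtain q1 where "q1 \<in> S" "q1 x \<noteq> 0" "\<forall>y\<in>V. q1 y \<noteq> 0 \<longrightarrow> y \<in> k" using UN.IH x(2) by blast
      thus "\<exists>q\<in>S. q x \<noteq> 0 \<and> (\<forall>y\<in>V. q y \<noteq> 0 \<longrightarrow> y \<in> \<Union>K)" using k(1) by blast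
    qed
  next
    case (Basis s)
    thus ?case using B by blast
  qed simp
  have op: "openin (topology_generated_by \<B>) A"
    if A: "A \<subseteq> V" "\<forall>x\<in>A. \<exists>q\<in>S. q x \<noteq> 0 \<and> (\<forall>y\<in>V. q y \<noteq> 0 \<longrightarrow> y \<in> A)" for A
  proof (subst openin_subopen, intro ballI)
    fix x assume x: "x \<in> A"
    then obtain q1 where "q1 \<in> S" "q1 x \<noteq> 0" "\<forall>y\<in>V. q1 y \<noteq> 0 \<longrightarrow> y \<in> A" using A(2) by blast
    thus "\<exists>T. openin (topology_generated_by \<B>) T \<and> x \<in> T \<and> T \<subseteq> A"
      using q[of q1] x A(1) by (intro exI[of _ "{y \<in> V. q1 y \<noteq> 0}"]) auto
  qed
  have "openin (topology_generated_by \<B>) V" using q[OF fr_1[OF S]] by simp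
  thus ?thesis
    unfolding zariski_chart_def
  proof (intro conjI allI impI S)
    fix A assume A: "A \<subseteq> V"
    show "openin (topology_generated_by \<B>) A \<longleftrightarrow> (\<forall>x\<in>A. \<exists>q\<in>S. q x \<noteq> 0 \<and> (\<forall>y\<in>V. q y \<noteq> 0 \<longrightarrow> y \<in> A))"
    proof
      assume "openin (topology_generated_by \<B>) A"
      hence "generate_topology_on \<B> A" by (simp only: openin_topology_generated_by_iff)
      note nb = *[OF this]
      show "\<forall>x\<in>A. \<exists>q\<in>S. q x \<noteq> 0 \<and> (\<forall>y\<in>V. q y \<noteq> 0 \<longrightarrow> y \<in> A)"
      proof
        fix x assume x: "x \<in> A"
        from mp[OF bspec[OF nb x] subsetD[OF A x]] show "\<exists>q\<in>S. q x \<noteq> 0 \<and> (\<forall>y\<in>V. q y \<noteq> 0 \<longrightarrow> y \<in> A)" .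
      qed
    qed (rule op[OF A])
  qed
qed

lemma affine_fspace_chart: "zariski_chart (zariski (affine_fspace n V)) V (poly_funs n)"
proof -
  have S: "fun_ring (poly_funs n :: ((nat \<Rightarrow> 'a) \<Rightarrow> 'a) set)" by (simp add: poly_funs_pfuns pfuns_fun_ring)
  show ?thesis unfolding affine_fspace_def select_convs
  proof (rule zariski_chart_generated[OF S])
    fix q :: "(nat \<Rightarrow> 'a) \<Rightarrow> 'a" assume "q \<in> poly_funs n"
    thus "openin (topology_generated_by {{x \<in> V. f x \<noteq> 0} |f. f \<in> poly_funs n}) {y \<in> V. q y \<noteq> 0}"
      by (intro topology_generated_by_Basis) blast
  qed blast
qed

lemma affine_fspace_points: "points (affine_fspace n V) = V"
proof
  show "V \<subseteq> points (affine_fspace n V)" by (rule zc_sub[OF affine_fspace_chart])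
  show "points (affine_fspace n V) \<subseteq> V"
    unfolding affine_fspace_def select_convs topology_generated_by_topspace by blast
qed

lemma affine_fspace_regular:
  "regular_at (affine_fspace n V) x f \<longleftrightarrow> quotient_near (poly_funs n) V x f"
  by (simp add: affine_fspace_def quotient_near_def)

lemma affine_line_chart: "zariski_chart (zariski affine_line) UNIV (range poly :: ('k::field \<Rightarrow> 'k) set)"
proof -
  have S: "fun_ring (range poly :: ('k \<Rightarrow> 'k) set)" unfolding fun_ring_def
  proof (intro conjI ballI)
    show "(\<lambda>_. 0) \<in> range (poly :: 'k poly \<Rightarrow> _)" by (rule range_eqI[of _ _ 0]) auto
    show "(\<lambda>_. 1) \<in> range (poly :: 'k poly \<Rightarrow> _)" by (rule range_eqI[of _ _ 1]) auto
    fix f :: "'k \<Rightarrow> 'k" assume "f \<in> range poly"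
    then obtain p where p: "f = poly p" by blast
    show "(\<lambda>x. - f x) \<in> range poly" by (rule range_eqI[of _ _ "- p"]) (auto simp: p)
    fix g :: "'k \<Rightarrow> 'k" assume "g \<in> range poly"
    then obtain q where q: "g = poly q" by blast
    show "(\<lambda>x. f x + g x) \<in> range poly" by (rule range_eqI[of _ _ "p + q"]) (auto simp: p q)
    show "(\<lambda>x. f x * g x) \<in> range poly" by (rule range_eqI[of _ _ "p * q"]) (auto simp: p q)
  qed
  show ?thesis unfolding affine_line_def select_convs
    by (rule zariski_chart_generated[OF S]) (auto intro: topology_generated_by_Basis)
qed

text \<open>The isomorphism \<open>f\<close> itself serves as coordinate map.
  \<open>germ_local\<close> is what replaces \<open>h \<circ> g \<circ> f\<close>, equal to
  \<open>h\<close> on \<open>U\<close> only, by \<open>h\<close>.\<close>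

lemma variety_chart:
  assumes "variety X" "t \<in> points X"
  shows "\<exists>U n \<phi>. chart X U n \<phi> \<and> t \<in> U"
proof -
  have gl: "germ_local X" using assms by (simp add: variety_def)
  obtain U n V where U: "t \<in> U" "openin (zariski X) U" and V: "algebraic_set n V"
    and iso: "isomorphic (open_subspace X U) (affine_fspace n V)"
    using assms unfolding variety_def by blast
  obtain f g where f: "morphism (open_subspace X U) (affine_fspace n V) f"
    and g: "morphism (affine_fspace n V) (open_subspace X U) g"
    and gf: "\<And>x. x \<in> points (open_subspace X U) \<Longrightarrow> g (f x) = x" and fg: "\<And>y. y \<in> points (affine_fspace n V) \<Longrightarrow> f (g y) = y"
    using iso unfolding isomorphic_def by blast
  have UX: "U \<subseteq> points X" using U(2) by (rule openin_subset)
  have pU: "points (open_subspace X U) = U" using UX by (auto simp: open_subspace_def)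
  note pV = affine_fspace_points[of n V]
  have cf: "continuous_map (subtopology (zariski X) U) (zariski (affine_fspace n V)) f"
    and cg: "continuous_map (zariski (affine_fspace n V)) (subtopology (zariski X) U) g"
    using f g by (simp_all add: morphism_def open_subspace_def)
  have fV: "f x \<in> V" if "x \<in> U" for x
    using continuous_map_image_subset_topspace[OF cf] that pV UX by auto
  have gU: "g y \<in> U" if "y \<in> V" for y
    using continuous_map_image_subset_topspace[OF cg] that pV by auto
  have gf': "g (f x) = x" if "x \<in> U" for x using gf pU that by blast
  have fg': "f (g y) = y" if "y \<in> V" for y using fg pV that by blast
  have img: "f ` U = V" using fV gU fg' by force
  have inj: "inj_on f U" using gf' by (metis inj_onI)
  have "zariski_chart (zariski X) U (coord_ring n f)"
    unfolding zariski_chart_def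
  proof (intro conjI allI impI)
    fix A assume A: "A \<subseteq> U"
    show "openin (zariski X) A \<longleftrightarrow> (\<forall>x\<in>A. \<exists>q\<in>coord_ring n f. q x \<noteq> 0 \<and> (\<forall>y\<in>U. q y \<noteq> 0 \<longrightarrow> y \<in> A))"
    proof
      assume "openin (zariski X) A"
      hence "openin (subtopology (zariski X) U) A" using A by (simp add: openin_open_subtopology U)
      hence o: "openin (zariski (affine_fspace n V)) {y \<in> V. g y \<in> A}"
        using openin_continuous_map_preimage[OF cg] pV by simp
      show "\<forall>x\<in>A. \<exists>q\<in>coord_ring n f. q x \<noteq> 0 \<and> (\<forall>y\<in>U. q y \<noteq> 0 \<longrightarrow> y \<in> A)"
      proof
        fix x assume x: "x \<in> A"
        hence "f x \<in> {y \<in> V. g y \<in> A}" "f x \<in> V" using A fV gf' by auto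
        from zc_nbhd[OF affine_fspace_chart o this] obtain q where
          q: "q \<in> poly_funs n" "q (f x) \<noteq> 0" "\<forall>y\<in>V. q y \<noteq> 0 \<longrightarrow> y \<in> {y \<in> V. g y \<in> A}" by blast
        have "y \<in> A" if "y \<in> U" "q (f y) \<noteq> 0" for y
          using q(3) fV[OF that(1)] that(2) gf'[OF that(1)] by auto
        thus "\<exists>q\<in>coord_ring n f. q x \<noteq> 0 \<and> (\<forall>y\<in>U. q y \<noteq> 0 \<longrightarrow> y \<in> A)"
          using q by (intro bexI[of _ "q \<circ> f"]) (auto simp: coord_ring_pfuns)
      qed
    next
      assume R: "\<forall>x\<in>A. \<exists>q\<in>coord_ring n f. q x \<noteq> 0 \<and> (\<forall>y\<in>U. q y \<noteq> 0 \<longrightarrow> y \<in> A)"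
      show "openin (zariski X) A"
      proof (subst openin_subopen, intro ballI)
        fix x assume x: "x \<in> A"
        then obtain q where q: "q \<in> poly_funs n" "q (f x) \<noteq> 0" "\<forall>y\<in>U. q (f y) \<noteq> 0 \<longrightarrow> y \<in> A"
          using R by (force simp: coord_ring_pfuns)
        have "openin (subtopology (zariski X) U) {y \<in> U. f y \<in> {y \<in> V. q y \<noteq> 0}}"
          using openin_continuous_map_preimage[OF cf zc_principal[OF affine_fspace_chart q(1)]] UX
          by (simp add: Int_absorb1 Int_absorb2)
        hence "openin (zariski X) {y \<in> U. f y \<in> {y \<in> V. q y \<noteq> 0}}" by (simp add: openin_open_subtopology U)
        thus "\<exists>T. openin (zariski X) T \<and> x \<in> T \<and> T \<subseteq> A"
          using q x A fV by (intro exI[of _ "{y \<in> U. f y \<in> {y \<in> V. q y \<noteq> 0}}"]) auto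
      qed
    qed
  qed (use U coord_ring_ring in auto)
  moreover have "regular_at X x h \<longleftrightarrow> quotient_near (coord_ring n f) U x h" if x: "x \<in> U" for x h
  proof
    assume "regular_at X x h"
    hence "regular_at (affine_fspace n V) (f x) (h \<circ> g)"
      using g fV[OF x] gf'[OF x] pV unfolding morphism_def open_subspace_def by simp
    then obtain p q where pq: "p \<in> poly_funs n" "q \<in> poly_funs n" "q (f x) \<noteq> 0" "\<forall>y\<in>V. q y \<noteq> 0 \<longrightarrow> h (g y) = p y / q y"
      unfolding affine_fspace_regular quotient_near_def by auto
    have "\<forall>y\<in>U. q (f y) \<noteq> 0 \<longrightarrow> h y = p (f y) / q (f y)" using pq(4) fV gf' by metis
    thus "quotient_near (coord_ring n f) U x h" unfolding quotient_near_def coord_ring_pfuns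
      using pq by (intro bexI[of _ "p \<circ> f"] bexI[of _ "q \<circ> f"]) auto
  next
    assume "quotient_near (coord_ring n f) U x h"
    then obtain p q where pq: "p \<in> poly_funs n" "q \<in> poly_funs n" "q (f x) \<noteq> 0" "\<forall>y\<in>U. q (f y) \<noteq> 0 \<longrightarrow> h y = p (f y) / q (f y)"
      unfolding quotient_near_def coord_ring_pfuns by auto
    have "regular_at (affine_fspace n V) (f x) (h \<circ> g)"
      unfolding affine_fspace_regular quotient_near_def using pq gU fg'
      by (intro bexI[of _ p] bexI[of _ q]) auto
    hence "regular_at X x ((h \<circ> g) \<circ> f)"
      using f x pU unfolding morphism_def by (simp add: open_subspace_def)
    moreover have "\<forall>y\<in>U. ((h \<circ> g) \<circ> f) y = h y" using gf' by simp
    ultimately show "regular_at X x h" using gl U(2) x unfolding germ_local_def by blast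
  qed
  ultimately have "chart X U n f" unfolding chart_def using inj img V by simp
  thus ?thesis using U(1) by blast
qed

lemma coord_ring_localize:
  assumes p: "p \<in> coord_ring (Suc n) (\<lambda>y. (\<phi> y)(n := inverse (q y)))" and q: "q \<in> coord_ring n \<phi>"
  shows "\<exists>r\<in>coord_ring n \<phi>. \<exists>k. \<forall>y. q y \<noteq> 0 \<longrightarrow> p y = r y / q y ^ k"
proof -
  note R = coord_ring_ring[of n \<phi>]
  have "(\<lambda>i t. ((\<phi> t)(n := inverse (q t))) i) ` {..<Suc n} = insert (\<lambda>t. inverse (q t)) ((\<lambda>i t. \<phi> t i) ` {..<n})"
    by (auto simp: lessThan_Suc image_iff)
  hence "coord_ring (Suc n) (\<lambda>y. (\<phi> y)(n := inverse (q y))) = adjoin (coord_ring n \<phi>) (\<lambda>t. inverse (q t))"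
    by (simp add: coord_ring_def gen_funs_insert)
  then obtain F where F: "F \<in> poly_maps (coord_ring n \<phi>)" "p = (\<lambda>x. poly (F x) (inverse (q x)))"
    using p by (auto simp: adjoin_def)
  then obtain D where D: "\<And>x. degree (F x) \<le> D" by (auto simp: poly_maps_def)
  let ?r = "\<lambda>y. \<Sum>i\<le>D. coeff (F y) i * q y ^ (D - i)"
  have "?r \<in> coord_ring n \<phi>"
    by (intro fr_sum[OF R] fr_mult[OF R] fr_power[OF R] pm_coeff[OF R] F q)
  moreover have "p y = ?r y / q y ^ D" if y: "q y \<noteq> 0" for y
  proof -
    have "p y = (\<Sum>i\<le>D. coeff (F y) i * inverse (q y) ^ i)"
      unfolding F(2) poly_altdef using D[of y]
      by (intro sum.mono_neutral_left) (auto simp: coeff_eq_0)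
    also have "\<dots> = (\<Sum>i\<le>D. coeff (F y) i * q y ^ (D - i) / q y ^ D)"
    proof (intro sum.cong refl)
      fix i assume "i \<in> {..D}"
      hence "q y ^ D = q y ^ i * q y ^ (D - i)" by (simp flip: power_add)
      thus "coeff (F y) i * inverse (q y) ^ i = coeff (F y) i * q y ^ (D - i) / q y ^ D"
        using y by (simp add: field_simps)
    qed
    finally show ?thesis by (simp add: sum_divide_distrib)
  qed
  ultimately show ?thesis by (intro bexI[of _ ?r] exI[of _ D] allI impI)
qed

lemma coord_ring_extend: "q \<in> coord_ring n \<phi> \<Longrightarrow> q \<in> coord_ring (Suc n) (\<lambda>y. (\<phi> y)(n := w y))"
proof -
  have "(\<lambda>i t. ((\<phi> t)(n := w t)) i) ` {..<Suc n} = insert w ((\<lambda>i t. \<phi> t i) ` {..<n})"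
    by (auto simp: lessThan_Suc image_iff)
  thus "q \<in> coord_ring n \<phi> \<Longrightarrow> q \<in> coord_ring (Suc n) (\<lambda>y. (\<phi> y)(n := w y))"
    using adjoin_base[OF gen_funs_ring] by (simp add: coord_ring_def gen_funs_insert)
qed

lemma algebraic_set_memI: "algebraic_set n V \<Longrightarrow> x \<in> affine_space n \<Longrightarrow>
    (\<And>f. f \<in> poly_funs n \<Longrightarrow> vanishes V f \<Longrightarrow> f x = 0) \<Longrightarrow> x \<in> V"
  unfolding algebraic_set_def vanishes_def by blast

lemma algebraic_setI:
  assumes "V \<subseteq> affine_space n" and "\<And>x. x \<in> affine_space n \<Longrightarrow>
    (\<And>f. f \<in> poly_funs n \<Longrightarrow> vanishes V f \<Longrightarrow> f x = 0) \<Longrightarrow> x \<in> V"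
  shows "algebraic_set n V"
  unfolding algebraic_set_def
proof (intro exI[of _ "{f \<in> poly_funs n. vanishes V f}"] conjI equalityI subsetI)
  fix x assume "x \<in> V"
  thus "x \<in> {x \<in> affine_space n. \<forall>f\<in>{f \<in> poly_funs n. vanishes V f}. f x = 0}"
    using assms(1) by (auto simp: vanishes_def)
next
  fix x assume "x \<in> {x \<in> affine_space n. \<forall>f\<in>{f \<in> poly_funs n. vanishes V f}. f x = 0}"
  thus "x \<in> V" using assms(2)[of x] by auto
qed auto

lemma algebraic_set_sub: "algebraic_set n V \<Longrightarrow> V \<subseteq> affine_space n"
  by (auto simp: algebraic_set_def)

text \<open>
  A subset cut out of \<open>V \<times> line\<close> by a function is algebraic; this covers principal open sets (via
  \<open>q x * w = 1\<close>) and the fixed-point cover.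
\<close>

lemma algebraic_set_extend:
  assumes V: "algebraic_set n V" and h: "h \<in> poly_funs (Suc n)"
  shows "algebraic_set (Suc n) {x(n := w) | x w. x \<in> V \<and> h (x(n := w)) = 0}"
proof (rule algebraic_setI)
  let ?W = "{x(n := w) | x w. x \<in> V \<and> h (x(n := w)) = 0}"
  show "?W \<subseteq> affine_space (Suc n)" using algebraic_set_sub[OF V] by (auto simp: affine_space_def)
  fix x assume x: "x \<in> affine_space (Suc n)" "\<And>f. f \<in> poly_funs (Suc n) \<Longrightarrow> vanishes ?W f \<Longrightarrow> f x = 0"
  have "x(n := 0) \<in> V"
  proof (rule algebraic_set_memI[OF V])
    show "x(n := 0) \<in> affine_space n" using x(1) by (auto simp: affine_space_def)
    fix f :: "(nat \<Rightarrow> 'a) \<Rightarrow> 'a" assume f: "f \<in> poly_funs n" "vanishes V f"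
    have e: "f (y(n := w)) = f y" for y w
      using f(1) unfolding poly_funs_pfuns by (rule pfuns_cong) auto
    have "f \<in> poly_funs (Suc n)" using f(1) pfuns_mono[of "{..<n}" "{..<Suc n}"] by (auto simp: poly_funs_pfuns)
    moreover have "vanishes ?W f" using f(2) e by (auto simp: vanishes_def)
    ultimately show "f (x(n := 0)) = 0" using x(2) e by simp
  qed
  moreover have "h ((x(n := 0))(n := x n)) = 0" using x(2)[OF h] by (auto simp: vanishes_def)
  ultimately have "(x(n := 0))(n := x n) \<in> ?W" by blast
  thus "x \<in> ?W" by simp
qed

text \<open>Rabinowitsch's trick: the inverse of \<open>q\<close> becomes a further coordinate, and
  functions of the larger ring are brought back to the old one by clearing powers of
  \<open>q\<close>.\<close>

lemma chart_principal:
  assumes ch: "chart X U n \<phi>" and q: "q \<in> coord_ring n \<phi>"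
  shows "chart X {y \<in> U. q y \<noteq> 0} (Suc n) (\<lambda>y. (\<phi> y)(n := inverse (q y)))"
proof -
  let ?U = "{y \<in> U. q y \<noteq> 0}" and ?\<psi> = "\<lambda>y. (\<phi> y)(n := inverse (q y))"
  let ?R = "coord_ring n \<phi>" and ?S = "coord_ring (Suc n) ?\<psi>"
  note R = coord_ring_ring[of n \<phi>]
  have inj: "inj_on \<phi> U" and alg: "algebraic_set n (\<phi> ` U)" and zc: "zariski_chart (zariski X) U ?R"
    and reg: "\<And>x f. x \<in> U \<Longrightarrow> regular_at X x f \<longleftrightarrow> quotient_near ?R U x f"
    using ch by (auto simp: chart_def)
  have aff: "\<phi> y n = 0" if "y \<in> U" for y using algebraic_set_sub[OF alg] that by (auto simp: affine_space_def)
  have RS: "?R \<subseteq> ?S" using coord_ring_extend[of _ n \<phi> "\<lambda>y. inverse (q y)"] by blast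
  obtain q' where q': "q' \<in> poly_funs n" "q = q' \<circ> \<phi>" using q by (auto simp: coord_ring_pfuns)
  have "inj_on ?\<psi> ?U"
  proof (rule inj_onI)
    fix x y assume xy: "x \<in> ?U" "y \<in> ?U" "?\<psi> x = ?\<psi> y"
    have "(?\<psi> x)(n := 0) = (?\<psi> y)(n := 0)" using xy(3) by simp
    hence "\<phi> x = \<phi> y" using aff xy(1,2) by (simp add: fun_upd_idem)
    thus "x = y" using inj xy by (auto dest: inj_onD)
  qed
  moreover have "algebraic_set (Suc n) (?\<psi> ` ?U)"
  proof -
    let ?h = "\<lambda>x. q' x * x n - 1"
    have h: "?h \<in> poly_funs (Suc n)"
      using q'(1) pfuns_mono[of "{..<n}" "{..<Suc n}"] unfolding poly_funs_pfuns
      by (intro fr_diff[OF pfuns_fun_ring] pfuns.mult pfuns.const pfuns.coord) auto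
    have e: "q' (y(n := w)) = q' y" for y w
      using q'(1) unfolding poly_funs_pfuns by (rule pfuns_cong) auto
    have "?\<psi> ` ?U = {x(n := w) | x w. x \<in> \<phi> ` U \<and> ?h (x(n := w)) = 0}"
    proof (intro equalityI subsetI)
      fix v assume "v \<in> ?\<psi> ` ?U"
      then obtain y where y: "y \<in> U" "q y \<noteq> 0" "v = ?\<psi> y" by blast
      have "?h (?\<psi> y) = 0" using y(2) e by (simp add: q'(2))
      thus "v \<in> {x(n := w) | x w. x \<in> \<phi> ` U \<and> ?h (x(n := w)) = 0}" using y by blast
    next
      fix v assume "v \<in> {x(n := w) | x w. x \<in> \<phi> ` U \<and> ?h (x(n := w)) = 0}"
      then obtain y w where y: "v = (\<phi> y)(n := w)" "y \<in> U" "q y * w = 1" using e q'(2) by auto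
      hence "q y \<noteq> 0" "w = inverse (q y)" by (auto simp: inverse_unique)
      thus "v \<in> ?\<psi> ` ?U" using y by blast
    qed
    thus ?thesis using algebraic_set_extend[OF alg h] by simp
  qed
  moreover have "zariski_chart (zariski X) ?U ?S"
    unfolding zariski_chart_def
  proof (intro conjI allI impI)
    show "openin (zariski X) ?U" by (rule zc_principal[OF zc q])
    show "fun_ring ?S" by (rule coord_ring_ring)
    fix A assume A: "A \<subseteq> ?U"
    hence AU: "A \<subseteq> U" by blast
    show "openin (zariski X) A \<longleftrightarrow> (\<forall>x\<in>A. \<exists>q\<in>?S. q x \<noteq> 0 \<and> (\<forall>y\<in>?U. q y \<noteq> 0 \<longrightarrow> y \<in> A))"
    proof
      assume "openin (zariski X) A"
      thus "\<forall>x\<in>A. \<exists>q\<in>?S. q x \<noteq> 0 \<and> (\<forall>y\<in>?U. q y \<noteq> 0 \<longrightarrow> y \<in> A)"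
        using zc_openin[OF zc AU] RS by blast
    next
      assume H: "\<forall>x\<in>A. \<exists>q\<in>?S. q x \<noteq> 0 \<and> (\<forall>y\<in>?U. q y \<noteq> 0 \<longrightarrow> y \<in> A)"
      show "openin (zariski X) A"
        unfolding zc_openin[OF zc AU]
      proof
        fix x assume x: "x \<in> A"
        then obtain p where p: "p \<in> ?S" "p x \<noteq> 0" "\<forall>y\<in>?U. p y \<noteq> 0 \<longrightarrow> y \<in> A" using H by blast
        obtain r k where r: "r \<in> ?R" "\<forall>y. q y \<noteq> 0 \<longrightarrow> p y = r y / q y ^ k"
          using coord_ring_localize[OF p(1) q] by blast
        have "q x \<noteq> 0" using x A by blast
        hence "r x * q x \<noteq> 0" using p(2) r(2) by auto
        moreover have "y \<in> A" if "y \<in> U" "r y * q y \<noteq> 0" for y using p(3) r(2) that by auto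
        ultimately show "\<exists>q\<in>?R. q x \<noteq> 0 \<and> (\<forall>y\<in>U. q y \<noteq> 0 \<longrightarrow> y \<in> A)"
          using fr_mult[OF R r(1) q] by (intro bexI[of _ "\<lambda>x. r x * q x"]) auto
      qed
    qed
  qed
  moreover have "regular_at X x f \<longleftrightarrow> quotient_near ?S ?U x f" if x: "x \<in> ?U" for x f
  proof -
    have "quotient_near ?R U x f \<longleftrightarrow> quotient_near ?S ?U x f"
    proof
      assume "quotient_near ?R U x f"
      thus "quotient_near ?S ?U x f" unfolding quotient_near_def using RS by blast
    next
      assume "quotient_near ?S ?U x f"
      then obtain p s where ps: "p \<in> ?S" "s \<in> ?S" "s x \<noteq> 0" "\<forall>y\<in>?U. s y \<noteq> 0 \<longrightarrow> f y = p y / s y"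
        unfolding quotient_near_def by blast
      obtain a k where a: "a \<in> ?R" "\<forall>y. q y \<noteq> 0 \<longrightarrow> p y = a y / q y ^ k"
        using coord_ring_localize[OF ps(1) q] by blast
      obtain b l where b: "b \<in> ?R" "\<forall>y. q y \<noteq> 0 \<longrightarrow> s y = b y / q y ^ l"
        using coord_ring_localize[OF ps(2) q] by blast
      \<comment> \<open>The exponents are one larger than clearing denominators requires, so that a
        nonzero \<open>?den\<close> forces \<open>q y \<noteq> 0\<close> even for
        \<open>k = 0\<close>.\<close>
      let ?num = "\<lambda>y. a y * q y ^ Suc l" and ?den = "\<lambda>y. b y * q y ^ Suc k"
      have "?num \<in> ?R" "?den \<in> ?R" by (intro fr_mult[OF R] fr_power[OF R] a b q)+
      moreover have "?den x \<noteq> 0" using x ps(3) b(2) by auto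
      moreover have "f y = ?num y / ?den y" if "y \<in> U" "?den y \<noteq> 0" for y
      proof -
        have qy: "q y \<noteq> 0" "b y \<noteq> 0" using that(2) by auto
        hence "f y = p y / s y" using ps(4) b(2) that(1) by auto
        thus ?thesis using a(2) b(2) qy by (simp add: field_simps)
      qed
      ultimately show "quotient_near ?R U x f" unfolding quotient_near_def
        by (intro bexI[of _ ?num] bexI[of _ ?den] conjI ballI impI)
    qed
    thus ?thesis using reg x by auto
  qed
  ultimately show ?thesis unfolding chart_def by blast
qed

lemma chartD:
  assumes "chart X U n \<phi>"
  shows "inj_on \<phi> U" "algebraic_set n (\<phi> ` U)" "zariski_chart (zariski X) U (coord_ring n \<phi>)"
    "x \<in> U \<Longrightarrow> regular_at X x f \<longleftrightarrow> quotient_near (coord_ring n \<phi>) U x f"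
    "openin (zariski X) U" "U \<subseteq> points X"
proof -
  have zc: "zariski_chart (zariski X) U (coord_ring n \<phi>)" using assms by (simp add: chart_def)
  show "inj_on \<phi> U" "algebraic_set n (\<phi> ` U)" "zariski_chart (zariski X) U (coord_ring n \<phi>)"
    "x \<in> U \<Longrightarrow> regular_at X x f \<longleftrightarrow> quotient_near (coord_ring n \<phi>) U x f"
    using assms by (simp_all add: chart_def)
  show "openin (zariski X) U" by (rule zc_open[OF zc])
  show "U \<subseteq> points X" by (rule zc_sub[OF zc])
qed

lemma chart_regular:
  assumes "chart X U n \<phi>" "f \<in> coord_ring n \<phi>" shows "regular_on X U f"
  unfolding regular_on_def
proof
  fix x assume "x \<in> U"
  moreover have "quotient_near (coord_ring n \<phi>) U x f" unfolding quotient_near_def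
    using assms(2) coord_ring_const[of 1] by (intro bexI[of _ f] bexI[of _ "\<lambda>_. 1"]) auto
  ultimately show "regular_at X x f" using chartD(4)[OF assms(1)] by blast
qed

section \<open>The product of a chart with the affine line\<close>

definition line_ring :: "nat \<Rightarrow> ('b \<Rightarrow> nat \<Rightarrow> 'k::field) \<Rightarrow> ('b \<times> 'k \<Rightarrow> 'k) set" where
  "line_ring n \<phi> = adjoin ((\<lambda>f. f \<circ> fst) ` coord_ring n \<phi>) snd"

lemma coord_ring_fst: "(\<lambda>f. f \<circ> fst) ` coord_ring n \<phi> = coord_ring n (\<phi> \<circ> fst)"
proof -
  have "(\<lambda>c. c \<circ> fst) ` ((\<lambda>i t. \<phi> t i) ` {..<n}) = (\<lambda>i t. (\<phi> \<circ> fst) t i) ` {..<n}" by (auto simp: image_image comp_def)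
  thus ?thesis unfolding coord_ring_def gen_funs_comp[symmetric] by (rule arg_cong)
qed

lemma line_ring_ring: "fun_ring (line_ring n \<phi>)"
  unfolding line_ring_def coord_ring_fst by (intro adjoin_fun_ring coord_ring_ring)

lemma line_ring_base: "f \<in> coord_ring n \<phi> \<Longrightarrow> (\<lambda>x. f (fst x)) \<in> line_ring n \<phi>"
proof -
  assume "f \<in> coord_ring n \<phi>"
  hence "f \<circ> fst \<in> coord_ring n (\<phi> \<circ> fst)" using coord_ring_fst by blast
  from adjoin_base[OF coord_ring_ring this] have "f \<circ> fst \<in> line_ring n \<phi>"
    by (simp only: line_ring_def coord_ring_fst)
  thus ?thesis by (simp only: comp_def)
qed

lemma line_ring_snd: "snd \<in> line_ring n \<phi>"
  unfolding line_ring_def coord_ring_fst by (rule adjoin_self[OF coord_ring_ring])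

lemma line_ring_const: "(\<lambda>_. c) \<in> line_ring n \<phi>"
  by (rule line_ring_base[OF coord_ring_const])

lemma line_ring_poly: "(\<lambda>x. poly a (snd x)) \<in> line_ring n \<phi>"
proof -
  have "(\<lambda>_. a) \<in> poly_maps (line_ring n \<phi>)" using line_ring_const by (auto simp: poly_maps_def)
  from poly_maps_eval[OF line_ring_ring this line_ring_snd] show ?thesis .
qed

lemma line_ring_rep:
  assumes "F \<in> line_ring n \<phi>"
  shows "\<exists>D c. (\<forall>i. c i \<in> coord_ring n \<phi>) \<and> (\<forall>y v. F (y, v) = (\<Sum>i\<le>(D::nat). c i y * v ^ i))"
proof -
  obtain G where G: "G \<in> poly_maps ((\<lambda>f. f \<circ> fst) ` coord_ring n \<phi>)" "F = (\<lambda>x. poly (G x) (snd x))"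
    using assms by (auto simp: line_ring_def adjoin_def)
  obtain D where D: "\<And>x. degree (G x) \<le> D" using G by (auto simp: poly_maps_def)
  have "\<forall>i. \<exists>c\<in>coord_ring n \<phi>. (\<lambda>x. coeff (G x) i) = c \<circ> fst" using G(1) by (auto simp: poly_maps_def)
  then obtain c where c: "\<And>i. c i \<in> coord_ring n \<phi>" "\<And>i. (\<lambda>x. coeff (G x) i) = c i \<circ> fst" by metis
  have "F (y, v) = (\<Sum>i\<le>D. c i y * v ^ i)" for y v
  proof -
    have "F (y, v) = (\<Sum>i\<le>D. coeff (G (y, v)) i * v ^ i)"
      unfolding G(2) poly_altdef using D[of "(y, v)"]
      by simp (intro sum.mono_neutral_left; auto simp: coeff_eq_0)
    thus ?thesis using fun_cong[OF c(2), of "(y, v)"] by simp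
  qed
  thus ?thesis using c(1) by blast
qed

lemma line_ring_slice: "F \<in> line_ring n \<phi> \<Longrightarrow> (\<lambda>y. F (y, v)) \<in> coord_ring n \<phi>"
proof -
  assume "F \<in> line_ring n \<phi>"
  then obtain D c where c: "\<And>i. c i \<in> coord_ring n \<phi>" "\<And>y v. F (y, v) = (\<Sum>i\<le>(D::nat). c i y * v ^ i)"
    using line_ring_rep by blast
  show ?thesis unfolding c(2)
    by (intro fr_sum[OF coord_ring_ring] fr_mult[OF coord_ring_ring] c coord_ring_const)
qed

lemma affine_line_regular_poly: "regular_on affine_line UNIV (poly a)"
  unfolding regular_on_def affine_line_def select_convs
proof
  fix z
  show "\<exists>p q. poly q z \<noteq> 0 \<and> (\<forall>w. poly q w \<noteq> 0 \<longrightarrow> poly a w = poly p w / poly q w)"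
    by (rule exI[of _ a], rule exI[of _ 1]) simp
qed

lemma line_ring_tensor:
  fixes X :: "('b, 'k::field) fspace"
  assumes ch: "chart X U n \<phi>" and F: "F \<in> line_ring n \<phi>"
  shows "F \<in> tensor_funs X affine_line U UNIV"
proof -
  obtain D c where c: "\<And>i. c i \<in> coord_ring n \<phi>" "\<And>y v. F (y, v) = (\<Sum>i\<le>(D::nat). c i y * v ^ i)"
    using line_ring_rep[OF F] by blast
  have p: "regular_on affine_line UNIV (\<lambda>v::'k. v ^ i)" for i
  proof -
    have "poly (monom 1 i) = (\<lambda>v::'k. v ^ i)" by (simp add: poly_monom fun_eq_iff)
    thus ?thesis using affine_line_regular_poly[of "monom 1 i :: 'k poly"] by simp
  qed
  show ?thesis unfolding tensor_funs_def
    by (rule CollectI, rule exI[of _ "Suc D"], rule exI[of _ c], rule exI[of _ "\<lambda>i v. v ^ i"])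
       (use c p chart_regular[OF ch c(1)] in \<open>auto simp: lessThan_Suc_atMost\<close>)
qed

text \<open>Finitely many germs have a common denominator near a point. The factors \<open>u\<close>
  and \<open>e\<close> of \<open>D\<close> are nonzero only inside the prescribed open sets, so
  \<open>D\<close> also keeps track of where the representation is valid.\<close>

lemma tensor_quotient:
  assumes ch: "chart X U n \<phi>" and h: "h \<in> tensor_funs X affine_line U0 V0"
    and op: "openin (zariski X) U0" "openin (zariski affine_line) V0" and t: "t \<in> U" "t \<in> U0" "z \<in> V0"
  shows "\<exists>N\<in>line_ring n \<phi>. \<exists>D\<in>line_ring n \<phi>. D (t, z) \<noteq> 0 \<and>
    (\<forall>y\<in>U. \<forall>v. D (y, v) \<noteq> 0 \<longrightarrow> y \<in> U0 \<and> v \<in> V0 \<and> h (y, v) = N (y, v) / D (y, v))"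
proof -
  note R = line_ring_ring[of n \<phi>] and zc = chartD(3)[OF ch]
  obtain m :: nat and f g where fg: "\<And>i. i < m \<Longrightarrow> regular_on X U0 (f i)" "\<And>i. i < m \<Longrightarrow> regular_on affine_line V0 (g i)"
    and h': "h = (\<lambda>(x, y). \<Sum>i<m. f i x * g i y)"
    using h unfolding tensor_funs_def by blast
  have "\<forall>i\<in>{..<m}. \<exists>p q. p \<in> coord_ring n \<phi> \<and> q \<in> coord_ring n \<phi> \<and> q t \<noteq> 0 \<and> (\<forall>y\<in>U. q y \<noteq> 0 \<longrightarrow> f i y = p y / q y)"
  proof
    fix i assume "i \<in> {..<m}"
    hence "regular_at X t (f i)" using fg(1)[of i] t by (simp add: regular_on_def)
    hence "quotient_near (coord_ring n \<phi>) U t (f i)" using chartD(4)[OF ch t(1)] by simp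
    thus "\<exists>p q. p \<in> coord_ring n \<phi> \<and> q \<in> coord_ring n \<phi> \<and> q t \<noteq> 0 \<and> (\<forall>y\<in>U. q y \<noteq> 0 \<longrightarrow> f i y = p y / q y)"
      unfolding quotient_near_def by blast
  qed
  then obtain p q where pq: "\<And>i. i < m \<Longrightarrow> p i \<in> coord_ring n \<phi>" "\<And>i. i < m \<Longrightarrow> q i \<in> coord_ring n \<phi>"
    "\<And>i. i < m \<Longrightarrow> q i t \<noteq> 0" "\<And>i y. i < m \<Longrightarrow> y \<in> U \<Longrightarrow> q i y \<noteq> 0 \<Longrightarrow> f i y = p i y / q i y"
    unfolding bchoice_iff by auto
  have "\<forall>i\<in>{..<m}. \<exists>a b. poly b z \<noteq> 0 \<and> (\<forall>w. poly b w \<noteq> 0 \<longrightarrow> g i w = poly a w / poly b w)"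
  proof
    fix i assume "i \<in> {..<m}"
    hence "regular_at affine_line z (g i)" using fg(2)[of i] t by (simp add: regular_on_def)
    thus "\<exists>a b. poly b z \<noteq> 0 \<and> (\<forall>w. poly b w \<noteq> 0 \<longrightarrow> g i w = poly a w / poly b w)"
      unfolding affine_line_def by auto
  qed
  then obtain a b where ab: "\<And>i. i < m \<Longrightarrow> poly (b i) z \<noteq> 0"
    "\<And>i w. i < m \<Longrightarrow> poly (b i) w \<noteq> 0 \<Longrightarrow> g i w = poly (a i) w / poly (b i) w"
    unfolding bchoice_iff by auto
  obtain u where u: "u \<in> coord_ring n \<phi>" "u t \<noteq> 0" "\<forall>y\<in>U. u y \<noteq> 0 \<longrightarrow> y \<in> U0"
    using zc_nbhd[OF zc op(1) t(2,1)] by blast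
  obtain e' where "e' \<in> range poly" "e' z \<noteq> 0" "\<forall>y\<in>UNIV. e' y \<noteq> 0 \<longrightarrow> y \<in> V0"
    using zc_nbhd[OF affine_line_chart op(2) t(3) UNIV_I] by blast
  then obtain e where e: "poly e z \<noteq> 0" "\<And>y. poly e y \<noteq> 0 \<Longrightarrow> y \<in> V0" by blast
  define E where "E i x = q i (fst x) * poly (b i) (snd x)" for i x
  define D where "D x = u (fst x) * poly e (snd x) * (\<Prod>i<m. E i x)" for x
  define N where "N x = u (fst x) * poly e (snd x) * (\<Sum>i<m. p i (fst x) * poly (a i) (snd x) * (\<Prod>j\<in>{..<m} - {i}. E j x))" for x
  have ER: "E i \<in> line_ring n \<phi>" if "i < m" for i
    unfolding E_def[abs_def] by (intro fr_mult[OF R] line_ring_base line_ring_poly pq(2)[OF that])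
  have "D \<in> line_ring n \<phi>" unfolding D_def[abs_def]
    by (intro fr_mult[OF R] line_ring_base line_ring_poly u fr_prod[OF R] ER) simp
  moreover have "N \<in> line_ring n \<phi>" unfolding N_def[abs_def]
    by (intro fr_mult[OF R] line_ring_base line_ring_poly u fr_sum[OF R] fr_prod[OF R] ER pq(1)) auto
  moreover have "D (t, z) \<noteq> 0" using u e pq(3) ab(1) by (simp add: D_def E_def)
  moreover have "y \<in> U0 \<and> v \<in> V0 \<and> h (y, v) = N (y, v) / D (y, v)" if y: "y \<in> U" "D (y, v) \<noteq> 0" for y v
  proof -
    have nz: "u y \<noteq> 0" "poly e v \<noteq> 0" "\<And>i. i < m \<Longrightarrow> q i y \<noteq> 0 \<and> poly (b i) v \<noteq> 0"
      using y(2) by (auto simp: D_def E_def)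
    have "f i y * g i v = p i y * poly (a i) v * (\<Prod>j\<in>{..<m} - {i}. E j (y, v)) / (\<Prod>j<m. E j (y, v))" if i: "i < m" for i
    proof -
      have nzp: "(\<Prod>j\<in>{..<m} - {i}. E j (y, v)) \<noteq> 0" using nz by (simp add: E_def)
      have "(\<Prod>j<m. E j (y, v)) = E i (y, v) * (\<Prod>j\<in>{..<m} - {i}. E j (y, v))" using i by (intro prod.remove) auto
      moreover have "f i y * g i v = p i y * poly (a i) v / E i (y, v)"
        using pq(4)[OF i y(1)] ab(2)[OF i] nz(3)[OF i] by (simp add: E_def)
      ultimately show ?thesis using nzp by simp
    qed
    hence "h (y, v) = (\<Sum>i<m. p i y * poly (a i) v * (\<Prod>j\<in>{..<m} - {i}. E j (y, v))) / (\<Prod>j<m. E j (y, v))"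
      by (simp add: h' sum_divide_distrib)
    also have "\<dots> = N (y, v) / D (y, v)" using nz(1,2) by (simp add: N_def D_def)
    finally show ?thesis using u(3) e(2) nz y(1) by blast
  qed
  ultimately show ?thesis by blast
qed

lemma line_chart:
  assumes ch: "chart X U n \<phi>"
  shows "zariski_chart (zariski (times_line X)) (U \<times> UNIV) (line_ring n \<phi>)"
  unfolding product_def select_convs
proof (rule zariski_chart_generated[OF line_ring_ring])
  let ?B = "{{p \<in> U \<times> V. h p \<noteq> 0} |U V h. openin (zariski X) U \<and> openin (zariski affine_line) V \<and> h \<in> tensor_funs X affine_line U V}"
  fix q assume q: "q \<in> line_ring n \<phi>"
  have "{p \<in> U \<times> UNIV. q p \<noteq> 0} \<in> ?B"
    using chartD(5)[OF ch] zc_open[OF affine_line_chart] line_ring_tensor[OF ch q] by blast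
  thus "openin (topology_generated_by ?B) {y \<in> U \<times> UNIV. q y \<noteq> 0}" by (rule topology_generated_by_Basis)
next
  fix B x
  assume "B \<in> {{p \<in> U \<times> V. h p \<noteq> 0} |U V h. openin (zariski X) U \<and> openin (zariski affine_line) V \<and> h \<in> tensor_funs X affine_line U V}"
    and x: "x \<in> B" "x \<in> U \<times> UNIV"
  then obtain U0 V0 h where B: "B = {p \<in> U0 \<times> V0. h p \<noteq> 0}" "openin (zariski X) U0" "openin (zariski affine_line) V0"
    "h \<in> tensor_funs X affine_line U0 V0" by blast
  obtain t z where tz: "x = (t, z)" by (cases x)
  have t: "t \<in> U" "t \<in> U0" "z \<in> V0" "h (t, z) \<noteq> 0" using x tz B(1) by auto
  obtain N D where ND: "N \<in> line_ring n \<phi>" "D \<in> line_ring n \<phi>" "D (t, z) \<noteq> 0"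
    "\<forall>y\<in>U. \<forall>v. D (y, v) \<noteq> 0 \<longrightarrow> y \<in> U0 \<and> v \<in> V0 \<and> h (y, v) = N (y, v) / D (y, v)"
    using tensor_quotient[OF ch B(4,2,3) t(1-3)] by blast
  have "N (t, z) \<noteq> 0" using ND(3,4) t by auto
  show "\<exists>q\<in>line_ring n \<phi>. q x \<noteq> 0 \<and> (\<forall>y\<in>U \<times> UNIV. q y \<noteq> 0 \<longrightarrow> y \<in> B)"
  proof (intro bexI conjI ballI impI)
    show "(\<lambda>y. N y * D y) \<in> line_ring n \<phi>" by (rule fr_mult[OF line_ring_ring ND(1,2)])
    show "N x * D x \<noteq> 0" using \<open>N (t, z) \<noteq> 0\<close> ND(3) tz by simp
    fix y assume y: "y \<in> U \<times> UNIV" "N y * D y \<noteq> 0"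
    obtain s v where sv: "y = (s, v)" by (cases y)
    have "s \<in> U0 \<and> v \<in> V0 \<and> h (s, v) = N (s, v) / D (s, v)" using ND(4) y sv by auto
    thus "y \<in> B" using B(1) y(2) sv by auto
  qed
qed

lemma line_points: "(\<And>t. t \<in> points X \<Longrightarrow> \<exists>U n \<phi>. chart X U n \<phi> \<and> t \<in> U) \<Longrightarrow> points (times_line X) = points X \<times> UNIV"
proof
  show "points (times_line X) \<subseteq> points X \<times> UNIV"
    unfolding product_def select_convs topology_generated_by_topspace by (auto dest: openin_subset)
  assume *: "\<And>t. t \<in> points X \<Longrightarrow> \<exists>U n \<phi>. chart X U n \<phi> \<and> t \<in> U"
  show "points X \<times> UNIV \<subseteq> points (times_line X)"
  proof
    fix x :: "'a \<times> 'b" assume "x \<in> points X \<times> UNIV"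
    then obtain U n \<phi> where U: "chart X U n \<phi>" "fst x \<in> U" using *[of "fst x"] by auto
    hence "x \<in> U \<times> UNIV" by (cases x) auto
    thus "x \<in> points (times_line X)" using zc_sub[OF line_chart[OF U(1)]] by blast
  qed
qed

text \<open>Lagrange interpolation at \<open>0, ..., d\<close>, which are distinct in characteristic
  \<open>0\<close>. A morphism gives access to the values of a family; this recovers its
  coefficients.\<close>

lemma coeff_interpolation:
  fixes d :: nat
  shows "\<exists>a. \<forall>p::'k::field_char_0 poly. degree p \<le> d \<longrightarrow> (\<forall>j. coeff p j = (\<Sum>i\<le>d. a j i * poly p (of_nat i)))"
proof -
  define L where "L i = smult (inverse (\<Prod>j\<in>{..d} - {i}. of_nat i - of_nat j)) (\<Prod>j\<in>{..d} - {i}. [:- of_nat j, 1 :: 'k:])" for i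
  have Ld: "degree (L i) \<le> d" if "i \<le> d" for i
  proof -
    have "degree (\<Prod>j\<in>{..d} - {i}. [:- of_nat j, 1 :: 'k:]) \<le> (\<Sum>j\<in>{..d} - {i}. degree [:- of_nat j, 1 :: 'k:])"
      using degree_prod_sum_le[of "{..d} - {i}" "\<lambda>j. [:- of_nat j, 1 :: 'k:]"] by (simp add: comp_def)
    thus ?thesis unfolding L_def using that by (intro order.trans[OF degree_smult_le]) simp
  qed
  have L1: "poly (L i) (of_nat k) = (if k = i then 1 else 0)" if "i \<le> d" "k \<le> d" for i k
    using that by (auto simp: L_def poly_prod)
  have "coeff p j = (\<Sum>i\<le>d. coeff (L i) j * poly p (of_nat i))" if p: "degree p \<le> d" for p j
  proof -
    let ?q = "\<Sum>i\<le>d. smult (poly p (of_nat i)) (L i)"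
    have "p = ?q"
    proof (rule poly_eqI_degree[of "of_nat ` {..d}"])
      fix x :: 'k assume "x \<in> of_nat ` {..d}"
      then obtain k where k: "k \<le> d" "x = of_nat k" by auto
      have "poly ?q x = (\<Sum>i\<le>d. if k = i then poly p (of_nat i) else 0)"
        unfolding poly_sum k(2) using L1 k(1) by (intro sum.cong) auto
      thus "poly p x = poly ?q x" using k by simp
    next
      have c: "card (of_nat ` {..d} :: 'k set) = Suc d" by (subst card_image) (auto simp: inj_on_def)
      show "degree p < card (of_nat ` {..d} :: 'k set)" using c p by simp
      have "degree ?q \<le> d" using Ld by (intro degree_sum_le order.trans[OF degree_smult_le]) auto
      thus "degree ?q < card (of_nat ` {..d} :: 'k set)" using c by simp
    qed
    hence "coeff p j = coeff ?q j" by simp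
    also have "\<dots> = (\<Sum>i\<le>d. coeff (L i) j * poly p (of_nat i))" by (simp add: coeff_sum mult.commute)
    finally show ?thesis .
  qed
  thus ?thesis by (intro exI[of _ "\<lambda>j i. coeff (L i) j"]) blast
qed

text \<open>The second coordinate is regular on the product; its pullback under the family is
  \<open>poly (P t) z\<close>, and fixing \<open>z\<close> leaves a quotient of functions of the
  parameter.\<close>

lemma algebraic_family_values:
  assumes fam: "algebraic_family X d P" and ch: "chart X U n \<phi>" and t: "t \<in> U"
  shows "quotient_near (coord_ring n \<phi>) U t (\<lambda>s. poly (P s) z)"
proof -
  have tX: "t \<in> points X" using chartD(6)[OF ch] t by blast
  have "(t, z) \<in> points (times_line X)" using zc_sub[OF line_chart[OF ch]] t by blast
  note R = line_ring_ring[of n \<phi>]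
  have one: "(\<lambda>_. 1) \<in> tensor_funs X affine_line U UNIV" and sn: "snd \<in> tensor_funs X affine_line U UNIV"
    using line_ring_tensor[OF ch line_ring_const[of 1]] line_ring_tensor[OF ch line_ring_snd] by auto
  have reg: "regular_at (times_line X) (t, poly (P t) z) snd"
    unfolding product_def select_convs
  proof (rule exI[of _ U], rule exI[of _ UNIV], intro conjI)
    show "openin (zariski X) U" by (rule chartD(5)[OF ch])
    show "openin (zariski affine_line) (UNIV :: 'b set)" by (rule zc_open[OF affine_line_chart])
    show "(t, poly (P t) z) \<in> U \<times> UNIV" using t by simp
    show "\<exists>h\<in>tensor_funs X affine_line U UNIV. \<exists>h'\<in>tensor_funs X affine_line U UNIV.
       h' (t, poly (P t) z) \<noteq> 0 \<and> (\<forall>r\<in>U \<times> UNIV. h' r \<noteq> 0 \<longrightarrow> snd r = h r / h' r)"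
      by (rule bexI[OF _ sn], rule bexI[OF _ one]) simp
  qed
  have "regular_at (times_line X) (t, z) (g \<circ> (\<lambda>(t, z). (t, poly (P t) z)))"
    if "regular_at (times_line X) ((\<lambda>(t, z). (t, poly (P t) z)) (t, z)) g" for g :: "'a \<times> 'b \<Rightarrow> 'b"
    using fam \<open>(t, z) \<in> points (times_line X)\<close> that unfolding algebraic_family_def morphism_def by blast
  from this[of snd] reg have "regular_at (times_line X) (t, z) (snd \<circ> (\<lambda>(t, z). (t, poly (P t) z)))" by simp
  then obtain U0 V0 h h' where o: "openin (zariski X) U0" "openin (zariski affine_line) V0" "(t, z) \<in> U0 \<times> V0"
    "h \<in> tensor_funs X affine_line U0 V0" "h' \<in> tensor_funs X affine_line U0 V0" "h' (t, z) \<noteq> 0"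
    and eq: "\<forall>r\<in>U0 \<times> V0. h' r \<noteq> 0 \<longrightarrow> (snd \<circ> (\<lambda>(t, z). (t, poly (P t) z))) r = h r / h' r"
    unfolding product_def select_convs by blast
  have t0: "t \<in> U0" "z \<in> V0" using o(3) by auto
  obtain N D where ND: "N \<in> line_ring n \<phi>" "D \<in> line_ring n \<phi>" "D (t, z) \<noteq> 0"
    "\<And>y v. y \<in> U \<Longrightarrow> D (y, v) \<noteq> 0 \<Longrightarrow> y \<in> U0 \<and> v \<in> V0 \<and> h (y, v) = N (y, v) / D (y, v)"
    using tensor_quotient[OF ch o(4,1,2) t t0] by blast
  obtain N' D' where ND': "N' \<in> line_ring n \<phi>" "D' \<in> line_ring n \<phi>" "D' (t, z) \<noteq> 0"
    "\<And>y v. y \<in> U \<Longrightarrow> D' (y, v) \<noteq> 0 \<Longrightarrow> y \<in> U0 \<and> v \<in> V0 \<and> h' (y, v) = N' (y, v) / D' (y, v)"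
    using tensor_quotient[OF ch o(5,1,2) t t0] by blast
  \<comment> \<open>This is \<open>N / D\<close> divided by \<open>N' / D'\<close>, with an extra
    factor \<open>D'\<close> on both sides so that a nonzero denominator also makes
    \<open>D'\<close> nonzero.\<close>
  let ?p = "\<lambda>x. N x * D' x * D' x" and ?q = "\<lambda>x. D x * N' x * D' x"
  have N'0: "N' (t, z) \<noteq> 0" using ND'(3,4) t o(6) by auto
  show ?thesis unfolding quotient_near_def
  proof (rule bexI[of _ "\<lambda>y. ?p (y, z)"], rule bexI[of _ "\<lambda>y. ?q (y, z)"], intro conjI ballI impI)
    show "(\<lambda>y. ?p (y, z)) \<in> coord_ring n \<phi>" "(\<lambda>y. ?q (y, z)) \<in> coord_ring n \<phi>"
      by (intro line_ring_slice fr_mult[OF R] ND ND')+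
    show "?q (t, z) \<noteq> 0" using ND(3) ND'(3) N'0 by simp
    fix y assume y: "y \<in> U" "?q (y, z) \<noteq> 0"
    have nz: "D (y, z) \<noteq> 0" "N' (y, z) \<noteq> 0" "D' (y, z) \<noteq> 0" using y(2) by auto
    have 1: "y \<in> U0" "z \<in> V0" "h (y, z) = N (y, z) / D (y, z)" using ND(4)[OF y(1) nz(1)] by auto
    have 2: "h' (y, z) = N' (y, z) / D' (y, z)" using ND'(4)[OF y(1) nz(3)] by auto
    have "poly (P y) z = h (y, z) / h' (y, z)" using bspec[OF eq, of "(y, z)"] 1 2 nz by simp
    thus "poly (P y) z = ?p (y, z) / ?q (y, z)" using 1 2 nz by (simp add: field_simps)
  qed
qed

text \<open>The values at \<open>0, ..., d\<close> involve finitely many denominators. On the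
  principal open set where they are invertible, interpolation puts the coefficients into the
  coordinate ring; \<open>Q\<close> is given everywhere by these formulas and agrees with
  \<open>P\<close> on \<open>U\<close>.\<close>

lemma algebraic_family_chart:
  fixes P :: "'a \<Rightarrow> 'k::field_char_0 poly"
  assumes var: "variety X" and fam: "algebraic_family X d P" and t: "t \<in> points X"
  shows "\<exists>U n \<phi> Q. chart X U n \<phi> \<and> t \<in> U \<and> Q \<in> poly_maps (coord_ring n \<phi>) \<and> (\<forall>y\<in>U. Q y = P y)"
proof -
  obtain U n \<phi> where ch: "chart X U n \<phi>" and tU: "t \<in> U" using variety_chart[OF var t] by blast
  let ?R = "coord_ring n \<phi>"
  note R = coord_ring_ring[of n \<phi>]
  have "\<forall>i. \<exists>p q. p \<in> ?R \<and> q \<in> ?R \<and> q t \<noteq> 0 \<and> (\<forall>y\<in>U. q y \<noteq> 0 \<longrightarrow> poly (P y) (of_nat i) = p y / q y)"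
    using algebraic_family_values[OF fam ch tU] unfolding quotient_near_def by blast
  then obtain p q where pq: "\<And>i::nat. p i \<in> ?R" "\<And>i. q i \<in> ?R" "\<And>i. q i t \<noteq> 0"
    "\<And>i y. y \<in> U \<Longrightarrow> q i y \<noteq> 0 \<Longrightarrow> poly (P y) (of_nat i) = p i y / q i y"
    unfolding choice_iff by auto
  define w where "w y = (\<Prod>i\<le>d. q i y)" for y
  have w: "w \<in> ?R" unfolding w_def[abs_def] by (intro fr_prod[OF R] pq)
  let ?U = "{y \<in> U. w y \<noteq> 0}" and ?\<psi> = "\<lambda>y. (\<phi> y)(n := inverse (w y))"
  let ?S = "coord_ring (Suc n) ?\<psi>"
  note S = coord_ring_ring[of "Suc n" ?\<psi>]
  have ch': "chart X ?U (Suc n) ?\<psi>" by (rule chart_principal[OF ch w])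
  have tU': "t \<in> ?U" using tU pq(3) by (simp add: w_def)
  have RS: "f \<in> ?S" if "f \<in> ?R" for f by (rule coord_ring_extend[OF that])
  have inv: "(\<lambda>y. inverse (w y)) \<in> ?S"
  proof -
    have "(\<lambda>t. ?\<psi> t n) \<in> ?S" unfolding coord_ring_def by (rule gen_funs.gen) blast
    thus ?thesis by simp
  qed
  obtain a where a: "\<And>p :: 'k poly. degree p \<le> d \<Longrightarrow> (\<forall>j. coeff p j = (\<Sum>i\<le>d. a j i * poly p (of_nat i)))"
    using coeff_interpolation by blast
  define val where "val i y = p i y * (\<Prod>k\<in>{..d} - {i}. q k y) * inverse (w y)" for i y
  have val: "val i \<in> ?S" for i unfolding val_def[abs_def]
    by (intro fr_mult[OF S] fr_prod[OF S] inv RS pq)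
  have valeq: "poly (P y) (of_nat i) = val i y" if "y \<in> ?U" "i \<le> d" for y i
  proof -
    have nz: "q k y \<noteq> 0" if "k \<le> d" for k using \<open>y \<in> ?U\<close> that by (auto simp: w_def)
    have "w y = q i y * (\<Prod>k\<in>{..d} - {i}. q k y)" unfolding w_def using that by (intro prod.remove) auto
    moreover have "(\<Prod>k\<in>{..d} - {i}. q k y) \<noteq> 0" using nz by simp
    ultimately show ?thesis using pq(4)[of y i] nz[OF that(2)] that(1) by (simp add: val_def field_simps)
  qed
  define Q where "Q y = (\<Sum>j\<le>d. monom (\<Sum>i\<le>d. a j i * val i y) j)" for y
  have "Q \<in> poly_maps ?S" unfolding Q_def[abs_def]
    by (intro fr_sum[OF pm_fun_ring[OF S]] pm_monom[OF S] fr_sum[OF S] fr_mult[OF S] val coord_ring_const)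
  moreover have "Q y = P y" if y: "y \<in> ?U" for y
  proof -
    have deg: "degree (P y) \<le> d" using fam y chartD(6)[OF ch] by (auto simp: algebraic_family_def)
    have "P y = (\<Sum>j\<le>d. monom (coeff (P y) j) j)" using deg by (simp add: poly_as_sum_of_monoms')
    also have "\<dots> = Q y" unfolding Q_def using a[OF deg] valeq[OF y] by (intro sum.cong arg_cong2[of _ _ _ _ monom]) auto
    finally show ?thesis by simp
  qed
  ultimately show ?thesis using ch' tU' by blast
qed

section \<open>Affine varieties with prescribed points\<close>

text \<open>Carries the structure of an affine algebraic set over to a prescribed set of points, so
  that the cover can have pairs \<open>(t, w)\<close> as points and \<open>fst\<close> as its
  morphism.\<close>

definition affine_model :: "'b set \<Rightarrow> nat \<Rightarrow> ('b \<Rightarrow> nat \<Rightarrow> 'k::field) \<Rightarrow> ('b, 'k) fspace" where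
  "affine_model V n \<phi> =
     \<lparr>zariski = topology_generated_by {{x \<in> V. f x \<noteq> 0} | f. f \<in> coord_ring n \<phi>},
      regular_at = quotient_near (coord_ring n \<phi>) V\<rparr>"

lemma affine_model_chart:
  assumes "inj_on \<phi> V" "algebraic_set n (\<phi> ` V)"
  shows "chart (affine_model V n \<phi>) V n \<phi>"
  unfolding chart_def
proof (intro conjI assms)
  show "zariski_chart (zariski (affine_model V n \<phi>)) V (coord_ring n \<phi>)"
    unfolding affine_model_def select_convs
    by (rule zariski_chart_generated[OF coord_ring_ring]) (blast, intro topology_generated_by_Basis, blast)
qed (simp add: affine_model_def)

lemma affine_model_points:
  assumes "inj_on \<phi> V" "algebraic_set n (\<phi> ` V)" shows "points (affine_model V n \<phi>) = V"
proof
  show "V \<subseteq> points (affine_model V n \<phi>)" by (rule chartD(6)[OF affine_model_chart[OF assms]])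
  show "points (affine_model V n \<phi>) \<subseteq> V"
    unfolding affine_model_def select_convs topology_generated_by_topspace by blast
qed

lemma variety_global_chart:
  assumes ch: "chart X V n \<phi>" and V: "V = points X"
  shows "variety X"
  unfolding variety_def
proof (intro conjI)
  note zc = chartD(3)[OF ch] and reg = chartD(4)[OF ch] and R = coord_ring_ring[of n \<phi>]
  show "germ_local X" unfolding germ_local_def
  proof (intro allI impI, elim conjE)
    fix U x f g assume U: "openin (zariski X) U" "x \<in> U" and fg: "\<forall>y\<in>U. f y = g y" and f: "regular_at X x f"
    have x: "x \<in> V" using U openin_subset V by blast
    obtain s where s: "s \<in> coord_ring n \<phi>" "s x \<noteq> 0" "\<forall>y\<in>V. s y \<noteq> 0 \<longrightarrow> y \<in> U" using zc_nbhd[OF zc U x] by blast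
    obtain p q where pq: "p \<in> coord_ring n \<phi>" "q \<in> coord_ring n \<phi>" "q x \<noteq> 0" "\<forall>y\<in>V. q y \<noteq> 0 \<longrightarrow> f y = p y / q y"
      using f reg[OF x] unfolding quotient_near_def by blast
    have "quotient_near (coord_ring n \<phi>) V x g" unfolding quotient_near_def
    proof (rule bexI[of _ "\<lambda>y. p y * s y"], rule bexI[of _ "\<lambda>y. q y * s y"], intro conjI ballI impI)
      show "(\<lambda>y. p y * s y) \<in> coord_ring n \<phi>" "(\<lambda>y. q y * s y) \<in> coord_ring n \<phi>"
        by (intro fr_mult[OF R] pq s)+
      show "q x * s x \<noteq> 0" using pq s by simp
      fix y assume "y \<in> V" "q y * s y \<noteq> 0"
      thus "g y = p y * s y / (q y * s y)" using pq(4) s(3) fg by force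
    qed
    thus "regular_at X x g" using reg[OF x] by blast
  qed
  show "\<exists>\<U>. finite \<U> \<and> \<Union>\<U> = points X \<and> (\<forall>U\<in>\<U>. openin (zariski X) U \<and>
      (\<exists>n V. algebraic_set n V \<and> isomorphic (open_subspace X U) (affine_fspace n V)))"
  proof (intro exI[of _ "{V}"] conjI ballI)
    fix U assume "U \<in> {V}"
    hence U: "U = V" by simp
    show "openin (zariski X) U" unfolding U by (rule chartD(5)[OF ch])
    let ?W = "\<phi> ` V" and ?g = "inv_into V \<phi>"
    have g: "?g (\<phi> x) = x" if "x \<in> V" for x using chartD(1)[OF ch] that by simp
    have eqX: "open_subspace X V = X" using V by (simp add: open_subspace_def)
    have "morphism X (affine_fspace n ?W) \<phi>" unfolding morphism_def
    proof (intro conjI ballI allI impI)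
      show "continuous_map (zariski X) (zariski (affine_fspace n ?W)) \<phi>"
        unfolding continuous_map_alt
      proof (intro conjI allI impI)
        show "\<phi> \<in> points X \<rightarrow> points (affine_fspace n ?W)" using V by (auto simp: affine_fspace_points)
        fix O' assume O': "openin (zariski (affine_fspace n ?W)) O'"
        show "openin (zariski X) (\<phi> -` O' \<inter> points X)"
        proof (subst zc_openin[OF zc])
          show "\<phi> -` O' \<inter> points X \<subseteq> V" using V by blast
          show "\<forall>x\<in>\<phi> -` O' \<inter> points X. \<exists>q\<in>coord_ring n \<phi>. q x \<noteq> 0 \<and> (\<forall>y\<in>V. q y \<noteq> 0 \<longrightarrow> y \<in> \<phi> -` O' \<inter> points X)"
          proof
            fix x assume x: "x \<in> \<phi> -` O' \<inter> points X"
            then obtain q where q: "q \<in> poly_funs n" "q (\<phi> x) \<noteq> 0" "\<forall>y\<in>?W. q y \<noteq> 0 \<longrightarrow> y \<in> O'"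
              using zc_nbhd[OF affine_fspace_chart O', of "\<phi> x"] V by blast
            thus "\<exists>q\<in>coord_ring n \<phi>. q x \<noteq> 0 \<and> (\<forall>y\<in>V. q y \<noteq> 0 \<longrightarrow> y \<in> \<phi> -` O' \<inter> points X)"
              using V by (intro bexI[of _ "q \<circ> \<phi>"]) (auto simp: coord_ring_pfuns)
          qed
        qed
      qed
      fix x h assume x: "x \<in> points X" and "regular_at (affine_fspace n ?W) (\<phi> x) h"
      then obtain p q where pq: "p \<in> poly_funs n" "q \<in> poly_funs n" "q (\<phi> x) \<noteq> 0" "\<forall>y\<in>?W. q y \<noteq> 0 \<longrightarrow> h y = p y / q y"
        unfolding affine_fspace_regular quotient_near_def by blast
      have "quotient_near (coord_ring n \<phi>) V x (h \<circ> \<phi>)" unfolding quotient_near_def coord_ring_pfuns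
        using pq by (intro bexI[of _ "p \<circ> \<phi>"] bexI[of _ "q \<circ> \<phi>"]) auto
      thus "regular_at X x (h \<circ> \<phi>)" using reg x V by blast
    qed
    moreover have "morphism (affine_fspace n ?W) X ?g" unfolding morphism_def affine_fspace_points
    proof (intro conjI ballI allI impI)
      show "continuous_map (zariski (affine_fspace n ?W)) (zariski X) ?g"
        unfolding continuous_map_alt affine_fspace_points
      proof (intro conjI allI impI)
        show "?g \<in> ?W \<rightarrow> points X" using V g by auto
        fix O' assume O': "openin (zariski X) O'"
        show "openin (zariski (affine_fspace n ?W)) (?g -` O' \<inter> ?W)"
        proof (subst zc_openin[OF affine_fspace_chart])
          show "\<forall>x\<in>?g -` O' \<inter> ?W. \<exists>q\<in>poly_funs n. q x \<noteq> 0 \<and> (\<forall>y\<in>?W. q y \<noteq> 0 \<longrightarrow> y \<in> ?g -` O' \<inter> ?W)"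
          proof
            fix x assume "x \<in> ?g -` O' \<inter> ?W"
            then obtain y where y: "x = \<phi> y" "y \<in> V" "y \<in> O'" using g by auto
            obtain q where q: "q \<in> poly_funs n" "q (\<phi> y) \<noteq> 0" "\<forall>y\<in>V. q (\<phi> y) \<noteq> 0 \<longrightarrow> y \<in> O'"
              using zc_nbhd[OF zc O' y(3,2)] unfolding coord_ring_pfuns by auto
            thus "\<exists>q\<in>poly_funs n. q x \<noteq> 0 \<and> (\<forall>y\<in>?W. q y \<noteq> 0 \<longrightarrow> y \<in> ?g -` O' \<inter> ?W)"
              using y g by (intro bexI[of _ q]) auto
          qed
        qed auto
      qed
      fix x h assume "x \<in> ?W" and h: "regular_at X (?g x) h"
      then obtain y where y: "x = \<phi> y" "y \<in> V" by blast
      hence "quotient_near (coord_ring n \<phi>) V y h" using h g reg by simp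
      then obtain p q where "p \<in> poly_funs n" "q \<in> poly_funs n" "q (\<phi> y) \<noteq> 0" "\<forall>y\<in>V. q (\<phi> y) \<noteq> 0 \<longrightarrow> h y = p (\<phi> y) / q (\<phi> y)"
        unfolding quotient_near_def coord_ring_pfuns by auto
      thus "regular_at (affine_fspace n ?W) x (h \<circ> ?g)"
        unfolding affine_fspace_regular quotient_near_def using y g by (intro bexI[of _ p] bexI[of _ q]) auto
    qed
    ultimately have "isomorphic X (affine_fspace n ?W)" unfolding isomorphic_def
      using g V by (intro exI[of _ \<phi>] exI[of _ ?g]) (auto simp: affine_fspace_points)
    thus "\<exists>n V. algebraic_set n V \<and> isomorphic (open_subspace X U) (affine_fspace n V)"
      using chartD(2)[OF ch] U eqX by auto
  qed (use V in auto)
  show "closedin (zariski (product X X)) {(x, x) |x. x \<in> points X}"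
  proof -
    let ?T = "zariski (product X X)"
    \<comment> \<open>By injectivity of \<open>\<phi>\<close> the diagonal is the common zero set of
      the coordinate differences.\<close>
    define h where "h i = (\<lambda>(x, y). \<phi> x i - \<phi> y i)" for i
    have c: "(\<lambda>x. \<phi> x i) \<in> coord_ring n \<phi>" if "i < n" for i
      unfolding coord_ring_def using that by (intro gen_funs.gen) blast
    have tens: "(\<lambda>(x, y). f x * 1 + 1 * g y) \<in> tensor_funs X X V V" if "f \<in> coord_ring n \<phi>" "g \<in> coord_ring n \<phi>" for f g
      unfolding tensor_funs_def
      by (rule CollectI, rule exI[of _ 2], rule exI[of _ "\<lambda>i. if i = 0 then f else (\<lambda>_. 1)"],
          rule exI[of _ "\<lambda>i. if i = 0 then (\<lambda>_. 1) else g"])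
         (use chart_regular[OF ch] that coord_ring_const[of 1] in \<open>auto simp: numeral_2_eq_2\<close>)
    have hT: "h i \<in> tensor_funs X X V V" if "i < n" for i
      using tens[OF c[OF that] fr_uminus[OF R c[OF that]]] by (simp add: h_def case_prod_unfold)
    have oneT: "(\<lambda>_. 1) \<in> tensor_funs X X V V"
      using tens[OF coord_ring_const[of 1] coord_ring_const[of 0]] by (simp add: case_prod_unfold)
    have op: "openin ?T {p \<in> V \<times> V. f p \<noteq> 0}" if "f \<in> tensor_funs X X V V" for f
      unfolding product_def select_convs using that chartD(5)[OF ch] by (intro topology_generated_by_Basis) blast
    have top: "topspace ?T = V \<times> V"
    proof
      show "topspace ?T \<subseteq> V \<times> V"
        unfolding product_def select_convs topology_generated_by_topspace using V by (auto dest: openin_subset)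
      show "V \<times> V \<subseteq> topspace ?T" using openin_subset[OF op[OF oneT]] by simp
    qed
    have "topspace ?T - {(x, x) |x. x \<in> points X} = (\<Union>i<n. {p \<in> V \<times> V. h i p \<noteq> 0})"
    proof (intro equalityI subsetI)
      fix p assume p: "p \<in> topspace ?T - {(x, x) |x. x \<in> points X}"
      then obtain x y where xy: "p = (x, y)" "x \<in> V" "y \<in> V" "x \<noteq> y" using top V by auto
      hence "\<phi> x \<noteq> \<phi> y" using chartD(1)[OF ch] by (auto dest: inj_onD)
      then obtain i where i: "\<phi> x i \<noteq> \<phi> y i" by blast
      have "\<phi> x \<in> affine_space n" "\<phi> y \<in> affine_space n" using algebraic_set_sub[OF chartD(2)[OF ch]] xy by auto
      hence "i < n" using i by (metis (mono_tags, lifting) affine_space_def linorder_not_le mem_Collect_eq)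
      thus "p \<in> (\<Union>i<n. {p \<in> V \<times> V. h i p \<noteq> 0})" using xy i by (auto simp: h_def)
    qed (use top V in \<open>auto simp: h_def\<close>)
    moreover have "openin ?T (\<Union>i<n. {p \<in> V \<times> V. h i p \<noteq> 0})" by (intro openin_Union ballI) (use op hT in auto)
    moreover have "{(x, x) |x. x \<in> points X} \<subseteq> topspace ?T" using top V by auto
    ultimately show ?thesis by (simp add: closedin_def)
  qed
qed

lemma morphism_chart:
  assumes X: "chart X U n \<phi>" and Y: "chart Y V m \<psi>" "V = points Y" and f: "f ` V \<subseteq> U"
    and pull: "\<And>c. c \<in> coord_ring n \<phi> \<Longrightarrow> c \<circ> f \<in> coord_ring m \<psi>"
  shows "morphism Y X f"
  unfolding morphism_def
proof (intro conjI ballI allI impI)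
  show "continuous_map (zariski Y) (zariski X) f"
    unfolding continuous_map_alt
  proof (intro conjI allI impI)
    show "f \<in> points Y \<rightarrow> points X" using f chartD(6)[OF X] Y(2) by auto
    fix O' assume O': "openin (zariski X) O'"
    have sub: "f -` O' \<inter> points Y \<subseteq> V" using Y(2) by blast
    show "openin (zariski Y) (f -` O' \<inter> points Y)"
      unfolding zc_openin[OF chartD(3)[OF Y(1)] sub]
    proof
      fix x assume x: "x \<in> f -` O' \<inter> points Y"
      then obtain q where q: "q \<in> coord_ring n \<phi>" "q (f x) \<noteq> 0" "\<forall>y\<in>U. q y \<noteq> 0 \<longrightarrow> y \<in> O'"
        using zc_nbhd[OF chartD(3)[OF X] O', of "f x"] f Y(2) by blast
      thus "\<exists>q\<in>coord_ring m \<psi>. q x \<noteq> 0 \<and> (\<forall>y\<in>V. q y \<noteq> 0 \<longrightarrow> y \<in> f -` O' \<inter> points Y)"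
        using pull[OF q(1)] f Y(2) by (intro bexI[of _ "q \<circ> f"]) auto
    qed
  qed
  fix x h assume x: "x \<in> points Y" and h: "regular_at X (f x) h"
  have fx: "f x \<in> U" using x f Y(2) by blast
  obtain p q where pq: "p \<in> coord_ring n \<phi>" "q \<in> coord_ring n \<phi>" "q (f x) \<noteq> 0" "\<forall>y\<in>U. q y \<noteq> 0 \<longrightarrow> h y = p y / q y"
    using h chartD(4)[OF X fx] unfolding quotient_near_def by blast
  have "quotient_near (coord_ring m \<psi>) V x (h \<circ> f)" unfolding quotient_near_def
    using pull[OF pq(1)] pull[OF pq(2)] pq f by (intro bexI[of _ "p \<circ> f"] bexI[of _ "q \<circ> f"]) auto
  thus "regular_at Y x (h \<circ> f)" using chartD(4)[OF Y(1)] x Y(2) by blast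
qed

section \<open>Iterates near a fixed point\<close>

lemma degree_iterate_poly: "degree (iterate_poly n p) = degree p ^ n" for p :: "'k::field poly"
  by (induction n) (simp_all add: iterate_poly_0 iterate_poly_Suc degree_pcompose)

lemma pderiv_sum: "pderiv (\<Sum>i\<in>A. f i) = (\<Sum>i\<in>A. pderiv (f i))"
  by (induction A rule: infinite_finite_induct) (simp_all add: pderiv_add)

text \<open>Termwise division of \<open>a ^ i - b ^ i\<close> by \<open>a - b\<close>. At a common
  fixed point \<open>w\<close> the cofactor of degree \<open>i\<close> takes the value
  \<open>i * w ^ (i - 1)\<close>, which sums up to the derivative.\<close>

lemma divided_difference:
  fixes F :: "'x \<Rightarrow> 'k::field poly"
  assumes S: "fun_ring S" and F: "F \<in> poly_maps S" and a: "a \<in> poly_maps S" and b: "b \<in> poly_maps S"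
  shows "\<exists>D\<in>poly_maps S. (\<forall>x. F x \<circ>\<^sub>p a x - F x \<circ>\<^sub>p b x = (a x - b x) * D x) \<and>
    (\<forall>x w. poly (a x) w = w \<longrightarrow> poly (b x) w = w \<longrightarrow> poly (D x) w = poly (pderiv (F x)) w)"
proof -
  obtain B where B: "\<And>x. degree (F x) \<le> B" using F by (auto simp: poly_maps_def)
  define D where "D x = (\<Sum>i\<le>B. smult (coeff (F x) i) (\<Sum>j<i. b x ^ (i - Suc j) * a x ^ j))" for x
  note R = pm_fun_ring[OF S]
  have expand: "F x \<circ>\<^sub>p c = (\<Sum>i\<le>B. smult (coeff (F x) i) (c ^ i))" for x c
  proof -
    have "F x = (\<Sum>i\<le>B. monom (coeff (F x) i) i)" using B by (simp add: poly_as_sum_of_monoms')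
    hence "F x \<circ>\<^sub>p c = (\<Sum>i\<le>B. monom (coeff (F x) i) i) \<circ>\<^sub>p c" by simp
    also have "\<dots> = (\<Sum>i\<le>B. smult (coeff (F x) i) (c ^ i))"
      by (simp add: pcompose_sum monom_altdef pcompose_smult pcompose_pCons pcompose_power)
    finally show ?thesis .
  qed
  have "D \<in> poly_maps S" unfolding D_def[abs_def]
    by (intro fr_sum[OF R] pm_smult[OF S] pm_coeff[OF S F] fr_mult[OF R] fr_power[OF R] a b)
  moreover have "F x \<circ>\<^sub>p a x - F x \<circ>\<^sub>p b x = (a x - b x) * D x" for x
    unfolding expand D_def sum_distrib_left
    by (simp flip: sum_subtractf smult_diff_right add: power_diff_sumr2)
  moreover have "poly (D x) w = poly (pderiv (F x)) w" if "poly (a x) w = w" "poly (b x) w = w" for x w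
  proof -
    have "poly (D x) w = (\<Sum>i\<le>B. coeff (F x) i * (\<Sum>j<i. w ^ (i - Suc j) * w ^ j))"
      by (simp add: D_def poly_sum that)
    also have "\<dots> = (\<Sum>i\<le>B. coeff (F x) i * (of_nat i * w ^ (i - 1)))"
    proof (intro sum.cong refl arg_cong2[of _ _ _ _ "(*)"])
      fix i
      have "(\<Sum>j<i. w ^ (i - Suc j) * w ^ j) = (\<Sum>j<i. w ^ (i - 1))"
        by (intro sum.cong) (auto simp flip: power_add)
      thus "(\<Sum>j<i. w ^ (i - Suc j) * w ^ j) = of_nat i * w ^ (i - 1)" by simp
    qed
    also have "\<dots> = poly (pderiv (F x)) w"
    proof -
      have "pderiv (F x) = pderiv (\<Sum>i\<le>B. monom (coeff (F x) i) i)" using B by (simp add: poly_as_sum_of_monoms')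
      thus ?thesis by (simp add: pderiv_sum pderiv_monom poly_sum poly_monom mult_ac)
    qed
    finally show ?thesis .
  qed
  ultimately show ?thesis by blast
qed

text \<open>Induction through \<open>F^(N + 1) - X = (F(F^N) - F(X)) + (F - X)\<close>. At a fixed
  point the cofactor is the geometric sum of the multiplier, the quantity that
  \<open>suitable_iterate\<close> keeps nonzero.\<close>

lemma iterate_difference:
  fixes F :: "'x \<Rightarrow> 'k::field poly"
  assumes S: "fun_ring S" and F: "F \<in> poly_maps S"
  shows "\<exists>H\<in>poly_maps S. (\<forall>x. iterate_poly N (F x) - [:0, 1:] = (F x - [:0, 1:]) * H x) \<and>
    (\<forall>x w. poly (F x) w = w \<longrightarrow> poly (H x) w = (\<Sum>i<N. poly (pderiv (F x)) w ^ i))"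
proof (induction N)
  case 0
  show ?case by (intro bexI[of _ "\<lambda>_. 0"]) (auto simp: iterate_poly_0 intro: fr_0[OF pm_fun_ring[OF S]])
next
  case (Suc N)
  then obtain H where H: "H \<in> poly_maps S" "\<And>x. iterate_poly N (F x) - [:0, 1:] = (F x - [:0, 1:]) * H x"
    "\<And>x w. poly (F x) w = w \<Longrightarrow> poly (H x) w = (\<Sum>i<N. poly (pderiv (F x)) w ^ i)" by auto
  obtain D where D: "D \<in> poly_maps S"
    "\<And>x. F x \<circ>\<^sub>p iterate_poly N (F x) - F x \<circ>\<^sub>p [:0, 1:] = (iterate_poly N (F x) - [:0, 1:]) * D x"
    "\<And>x w. poly (iterate_poly N (F x)) w = w \<Longrightarrow> poly [:0, 1:] w = w \<Longrightarrow> poly (D x) w = poly (pderiv (F x)) w"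
    using divided_difference[OF S F poly_maps_iterate[OF S F] pm_X[OF S], of N] by auto
  note R = pm_fun_ring[OF S]
  show ?case
  proof (intro bexI[of _ "\<lambda>x. H x * D x + 1"] conjI allI impI)
    show "(\<lambda>x. H x * D x + 1) \<in> poly_maps S" by (intro fr_add[OF R] fr_mult[OF R] H D fr_1[OF R])
    fix x
    have "iterate_poly (Suc N) (F x) - [:0, 1:] = (F x \<circ>\<^sub>p iterate_poly N (F x) - F x) + (F x - [:0, 1:])"
      by (simp add: iterate_poly_Suc)
    also have "F x \<circ>\<^sub>p iterate_poly N (F x) - F x = (F x - [:0, 1:]) * H x * D x"
      using D(2)[of x] H(2)[of x] by simp
    finally show "iterate_poly (Suc N) (F x) - [:0, 1:] = (F x - [:0, 1:]) * (H x * D x + 1)"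
      by (simp add: algebra_simps)
    fix w assume w: "poly (F x) w = w"
    have "(poly (F x) ^^ N) w = w" using w by (induction N) auto
    hence "poly (D x) w = poly (pderiv (F x)) w" by (intro D(3)) (simp_all add: poly_iterate_poly)
    thus "poly (H x * D x + 1) w = (\<Sum>i<Suc N. poly (pderiv (F x)) w ^ i)"
      using H(3)[OF w] by (simp add: sum.lessThan_Suc_shift sum_distrib_left mult.commute del: sum.lessThan_Suc)
  qed
qed

lemma multiplier_iterate:
  fixes p :: "'k::field_char_0 poly"
  assumes "poly p w = w" shows "poly (pderiv (iterate_poly n p)) w = poly (pderiv p) w ^ n"
proof (induction n)
  case (Suc n)
  have "(poly p ^^ n) w = w" using assms by (induction n) auto
  thus ?case using Suc by (simp add: iterate_poly_Suc pderiv_pcompose poly_pcompose poly_iterate_poly)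
qed (simp add: iterate_poly_0 pderiv_pCons)

text \<open>
  After passing to an iterate, the multiplier at the periodic point is \<open>1\<close> or not a root of unity,
  so that no further iterate has additional periodic points merging into it.
\<close>

lemma suitable_iterate:
  fixes p :: "'k::field_char_0 poly"
  assumes pre: "a < b" "(poly p ^^ a) z = (poly p ^^ b) z"
  shows "\<exists>k n0 w. k \<ge> 1 \<and> w = (poly (iterate_poly k p) ^^ n0) z \<and> poly (iterate_poly k p) w = w \<and>
    ((\<exists>m\<ge>1. (poly p ^^ m) z = z) \<longrightarrow> n0 = 0) \<and>
    (\<forall>N\<ge>1. (\<Sum>i<N. poly (pderiv (iterate_poly k p)) w ^ i) \<noteq> 0)"
proof -
  have itk: "(poly (iterate_poly k p) ^^ j) y = (poly p ^^ (k * j)) y" for k j y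
  proof (induction j)
    case (Suc j)
    have "k * Suc j = k + k * j" by simp
    thus ?case using Suc by (simp only: funpow.simps comp_apply poly_iterate_poly funpow_add)
  qed simp
  \<comment> \<open>The landing point has to be the same for all multiples \<open>k0 * r\<close>,
    because \<open>r\<close> is chosen only after \<open>w\<close>, from the multiplier
    there.\<close>
  have "\<exists>k0 n0 w. k0 \<ge> 1 \<and> (\<forall>r\<ge>1. w = (poly p ^^ (k0 * r * n0)) z) \<and> (poly p ^^ k0) w = w \<and>
      ((\<exists>m\<ge>1. (poly p ^^ m) z = z) \<longrightarrow> n0 = 0)"
  proof (cases "\<exists>m\<ge>1. (poly p ^^ m) z = z")
    case True
    then obtain m where "m \<ge> 1" "(poly p ^^ m) z = z" by blast
    thus ?thesis by (intro exI[of _ m] exI[of _ 0] exI[of _ z]) auto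
  next
    case False
    let ?k = "b - a"
    have st: "(poly p ^^ (i + ?k)) z = (poly p ^^ i) z" if "i \<ge> a" for i
    proof -
      have eq: "(poly p ^^ (i - a + a)) z = (poly p ^^ (i - a + b)) z" using pre(2) by (simp only: funpow_add comp_apply)
      have e: "i - a + b = i + ?k" "i - a + a = i" using pre(1) that by auto
      show ?thesis using eq unfolding e by (rule sym)
    qed
    have st': "(poly p ^^ (i + ?k * j)) z = (poly p ^^ i) z" if "i \<ge> a" for i j
    proof (induction j)
      case (Suc j)
      have e: "i + ?k * Suc j = (i + ?k * j) + ?k" by simp
      show ?case unfolding e using st[of "i + ?k * j"] that Suc by simp
    qed simp
    \<comment> \<open>After \<open>a\<close> steps of length \<open>b - a\<close> the orbit has left
      its preperiod.\<close>
    have ka: "?k * a \<ge> a" using pre(1) by (cases "?k") auto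
    let ?w = "(poly p ^^ (?k * a)) z"
    have "?w = (poly p ^^ (?k * r * a)) z" if "r \<ge> 1" for r
    proof -
      have "k * r * a = k * a + k * ((r - 1) * a)" for k using that by (cases r) (auto simp: algebra_simps)
      from this[of ?k] show ?thesis using st'[OF ka, of "(r - 1) * a"] by simp
    qed
    moreover have "(poly p ^^ ?k) ?w = ?w" using st[OF ka] by (simp add: add.commute funpow_add)
    ultimately show ?thesis using False pre(1) by (intro exI[of _ ?k] exI[of _ a] exI[of _ ?w]) auto
  qed
  then obtain k0 n0 w where kw: "k0 \<ge> 1" "\<And>r. r \<ge> 1 \<Longrightarrow> w = (poly p ^^ (k0 * r * n0)) z" "(poly p ^^ k0) w = w"
    "(\<exists>m\<ge>1. (poly p ^^ m) z = z) \<longrightarrow> n0 = 0" by blast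
  define \<mu> where "\<mu> = poly (pderiv (iterate_poly k0 p)) w"
  \<comment> \<open>If \<open>\<mu>\<close> is a root of unity, then \<open>\<mu> ^ r = 1\<close>
    and the geometric sum is \<open>N\<close>. Otherwise \<open>r = 1\<close>, and the sum is
    nonzero because \<open>\<mu> ^ N \<noteq> 1\<close>.\<close>
  define r where "r = (if \<exists>r\<ge>1. \<mu> ^ r = 1 then (SOME r. r \<ge> 1 \<and> \<mu> ^ r = 1) else 1)"
  have r: "r \<ge> 1" "(\<exists>r\<ge>1. \<mu> ^ r = 1) \<Longrightarrow> \<mu> ^ r = 1"
    unfolding r_def using someI_ex[of "\<lambda>r. r \<ge> 1 \<and> \<mu> ^ r = 1"] by auto
  let ?g = "iterate_poly (k0 * r) p"
  have fixk0: "poly (iterate_poly k0 p) w = w" using kw(3) by (simp add: poly_iterate_poly)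
  have gr: "?g = iterate_poly r (iterate_poly k0 p)"
    unfolding poly_eq_poly_eq_iff[symmetric] by (simp add: fun_eq_iff poly_iterate_poly itk)
  have mult: "poly (pderiv ?g) w = \<mu> ^ r" unfolding gr \<mu>_def by (rule multiplier_iterate[OF fixk0])
  have "(\<Sum>i<N. poly (pderiv ?g) w ^ i) \<noteq> 0" if N: "N \<ge> 1" for N
  proof (cases "\<mu> ^ r = 1")
    case True
    thus ?thesis using N by (simp add: mult)
  next
    case False
    have "(\<mu> ^ r) ^ N \<noteq> 1"
    proof
      assume "(\<mu> ^ r) ^ N = 1"
      hence "\<mu> ^ (r * N) = 1" by (simp add: power_mult)
      moreover have "r * N \<ge> 1" using r(1) N by simp
      ultimately show False using r(2) False by blast
    qed
    moreover have "(\<mu> ^ r - 1) * (\<Sum>i<N. (\<mu> ^ r) ^ i) = (\<mu> ^ r) ^ N - 1" by (simp add: power_diff_1_eq)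
    ultimately show ?thesis unfolding mult by auto
  qed
  moreover have "k0 * r \<ge> 1" using kw(1) r(1) by simp
  moreover have "w = (poly ?g ^^ n0) z" using kw(2)[OF r(1)] by (simp add: itk)
  moreover have "poly ?g w = w"
    using kw(3) funpow_period_add[of k0 "poly p" w r] by (simp add: poly_iterate_poly)
  ultimately show ?thesis using kw(4) by blast
qed

section \<open>Irreducible hypersurfaces in a chart\<close>

lemma line_ring_pfuns: "line_ring n \<phi> = (\<lambda>f. f \<circ> (\<lambda>x. (\<phi> (fst x))(n := snd x))) ` pfuns {..<Suc n}"
proof -
  have "(\<lambda>i x. ((\<phi> (fst x))(n := snd x)) i) ` {..<Suc n} = insert snd ((\<lambda>i t. (\<phi> \<circ> fst) t i) ` {..<n})"
    by (auto simp: lessThan_Suc image_iff)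
  thus ?thesis
    by (simp only: line_ring_def coord_ring_fst pfuns_comp gen_funs_insert) (simp only: coord_ring_def)
qed

lemma gen_funs_noetherian: "finite C \<Longrightarrow> noetherian (gen_funs C)"
proof (induction C rule: finite_induct)
  case empty
  have "gen_funs {} = range (\<lambda>(c::'b) (_::'a). c)"
  proof (intro equalityI subsetI)
    fix f :: "'a \<Rightarrow> 'b" assume "f \<in> gen_funs {}"
    thus "f \<in> range (\<lambda>c _. c)" by induction auto
  qed (auto intro: gen_funs.intros)
  thus ?case using noetherian_constants by simp
next
  case (insert c C)
  thus ?case using noetherian_adjoin by (simp add: gen_funs_insert)
qed

lemma line_ring_noetherian: "noetherian (line_ring n \<phi>)"
  unfolding line_ring_def coord_ring_fst
  unfolding coord_ring_def by (intro noetherian_adjoin gen_funs_noetherian) simp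

text \<open>Otherwise each \<open>Y\<close> has a function vanishing on it but not on
  \<open>W\<close>; the product of these vanishes on the union, hence on \<open>W\<close>, against
  irreducibility.\<close>

lemma irreducible_in_union:
  fixes S :: "('x \<Rightarrow> 'r::idom) set"
  assumes S: "fun_ring S" and irr: "irreducible_on S W" and fin: "finite \<Y>" and W: "W \<subseteq> \<Union>\<Y>"
  shows "\<exists>Y\<in>\<Y>. \<forall>f\<in>S. vanishes Y f \<longrightarrow> vanishes W f"
proof (rule ccontr)
  assume no: "\<not> ?thesis"
  have "\<exists>f\<in>S. vanishes (\<Union>\<Z>) f \<and> \<not> vanishes W f" if "\<Z> \<subseteq> \<Y>" for \<Z>
    using finite_subset[OF that fin] that
  proof (induction \<Z> rule: finite_induct)
    case empty
    have "\<not> vanishes W (\<lambda>_. 1::'r)" using irr by (auto simp: irreducible_on_def vanishes_def)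
    thus ?case using fr_1[OF S] by (intro bexI[of _ "\<lambda>_. 1"]) (auto simp: vanishes_def)
  next
    case (insert Y \<Z>)
    then obtain f where f: "f \<in> S" "vanishes (\<Union>\<Z>) f" "\<not> vanishes W f" by auto
    obtain g where g: "g \<in> S" "vanishes Y g" "\<not> vanishes W g" using no insert.prems by auto
    have "\<not> vanishes W (\<lambda>x. f x * g x)" using irreducible_on_mult[OF irr f(1) g(1)] f(3) g(3) by blast
    moreover have "vanishes (\<Union>(insert Y \<Z>)) (\<lambda>x. f x * g x)" using f(2) g(2) by (auto simp: vanishes_def)
    ultimately show ?case using fr_mult[OF S f(1) g(1)] by (intro bexI[of _ "\<lambda>x. f x * g x"] conjI)
  qed
  from this[of \<Y>] W show False by (auto simp: vanishes_def)
qed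

locale pointed_chart =
  fixes \<Lambda> :: "('a, 'k::{alg_closed_field, field_char_0}) fspace" and d :: nat
    and t0 :: 'a and z0 :: 'k and Z :: "nat \<Rightarrow> ('a \<times> 'k) set"
    and U :: "'a set" and n :: nat and \<phi> :: "'a \<Rightarrow> nat \<Rightarrow> 'k" and Q :: "'a \<Rightarrow> 'k poly"
  assumes d: "d \<ge> 2" and ch: "chart \<Lambda> U n \<phi>" and t0: "t0 \<in> U"
    and Q: "Q \<in> poly_maps (coord_ring n \<phi>)" and dQ: "\<And>t. t \<in> U \<Longrightarrow> degree (Q t) = d"
    and Z: "\<And>i. irreducible_hypersurface (zariski (times_line \<Lambda>)) (Z i)"
    and tz: "\<And>i. (t0, z0) \<in> Z i" and injZ: "inj Z"
    and pre: "\<And>i t z. (t, z) \<in> Z i \<Longrightarrow> t \<in> U \<Longrightarrow> \<exists>a b. a < b \<and> (poly (Q t) ^^ a) z = (poly (Q t) ^^ b) z"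
begin

abbreviation "R \<equiv> line_ring n \<phi>"

definition V :: "('a \<times> 'k) set" where "V = U \<times> UNIV"

definition ZU :: "nat \<Rightarrow> ('a \<times> 'k) set" where "ZU i = Z i \<inter> V"

lemma zcR: "zariski_chart (zariski (times_line \<Lambda>)) V R"
  unfolding V_def by (rule line_chart[OF ch])

lemma tzU: "(t0, z0) \<in> ZU i"
  using tz t0 by (simp add: ZU_def V_def)

lemma ZV: "ZU i \<subseteq> V"
  by (simp add: ZU_def)

lemma Zne: "Z i \<inter> V \<noteq> {}"
  using tzU by (auto simp: ZU_def)

lemma ZU_irr: "irreducible_on R (ZU i)"
  unfolding ZU_def using irreducible_on_chart[OF zcR _ Zne] Z by (simp add: irreducible_hypersurface_def)

lemma Z_closure: "Z i = zariski (times_line \<Lambda>) closure_of ZU i"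
  unfolding ZU_def using closed_irreducible_eq_closure[OF zcR _ _ Zne] Z by (simp add: irreducible_hypersurface_def)

lemma ZU_closed: "y \<in> V \<Longrightarrow> (\<And>f. f \<in> R \<Longrightarrow> vanishes (ZU i) f \<Longrightarrow> f y = 0) \<Longrightarrow> y \<in> ZU i"
proof -
  assume y: "y \<in> V" and f: "\<And>f. f \<in> R \<Longrightarrow> vanishes (ZU i) f \<Longrightarrow> f y = 0"
  have "y \<in> Z i" by (subst Z_closure, subst closure_chart[OF zcR ZV y]) (use f in blast)
  thus "y \<in> ZU i" using y by (simp add: ZU_def)
qed

lemma ZU_inj: "ZU i = ZU j \<Longrightarrow> i = j"
  using Z_closure injZ by (metis injD)

lemma R_ring: "fun_ring R"
  by (rule line_ring_ring)

lemma lift_poly: "B \<in> poly_maps (coord_ring n \<phi>) \<Longrightarrow> (\<lambda>x. B (fst x)) \<in> poly_maps R"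
  using line_ring_base by (auto simp: poly_maps_def)

text \<open>
  A subset of \<open>V\<close> with finite fibres over \<open>\<Lambda>\<close> cannot be strictly larger than the hypersurface
  \<open>Z i\<close>: together with the cylinder over it, it would give a chain of length two.
\<close>

lemma ZU_maximal:
  assumes B: "B \<in> poly_maps (coord_ring n \<phi>)" and C: "irreducible_on R C" "C \<subseteq> V" "ZU i \<subseteq> C"
    and root: "\<And>t z. (t, z) \<in> C \<Longrightarrow> B t \<noteq> 0 \<and> poly (B t) z = 0"
  shows "C \<subseteq> ZU i"
proof (rule ccontr)
  assume "\<not> ?thesis"
  then obtain y where y: "y \<in> C" "y \<notin> ZU i" by blast
  hence "\<exists>f\<in>R. vanishes (ZU i) f \<and> f y \<noteq> 0" using ZU_closed[of y i] C(2) by blast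
  then obtain f where f: "f \<in> R" "vanishes (ZU i) f" "f y \<noteq> 0" by blast
  let ?W = "fst ` C \<times> (UNIV :: 'k set)" and ?h = "\<lambda>x. poly (B (fst x)) (snd x)"
  have "(\<lambda>g. g \<circ> fst) ` coord_ring n \<phi> \<subseteq> R" using line_ring_base by (auto simp: comp_def)
  hence "irreducible_on (coord_ring n \<phi>) (fst ` C)"
    unfolding irreducible_on_image by (rule irreducible_on_mono[OF C(1)])
  hence irrW: "irreducible_on R ?W" unfolding line_ring_def by (rule irreducible_on_cylinder)
  have h: "?h \<in> R" by (rule poly_maps_eval[OF R_ring lift_poly[OF B] line_ring_snd])
  have "vanishes C ?h" using root by (auto simp: vanishes_def)
  moreover have "\<not> vanishes ?W ?h"
  proof
    assume v: "vanishes ?W ?h"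
    have "B (fst y) \<noteq> 0" using root[of "fst y" "snd y"] y(1) by simp
    moreover have "poly (B (fst y)) v = 0" for v using v y(1) by (auto simp: vanishes_def)
    ultimately show False using poly_all_0_iff_0 by blast
  qed
  moreover have "C \<subseteq> ?W" by force
  moreover have "?W \<subseteq> V" using C(2) by (auto simp: V_def)
  moreover have "\<not> vanishes C f" using f(3) y(1) by (auto simp: vanishes_def)
  ultimately show False
    using hypersurface_no_chain[OF zcR Z Zne C(1) irrW _ _ _ f(1) _ _ h] C(3) f(2) by (simp add: ZU_def)
qed

text \<open>Each such hypersurface is the closure, inside the chart, of one of the finitely many
  irreducible pieces of the zero set of \<open>B\<close>: irreducibility puts it into such a
  closure, and \<open>ZU_maximal\<close> gives equality.\<close>

lemma finitely_many_ZU: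
  assumes B: "B \<in> poly_maps (coord_ring n \<phi>)" and nz: "\<And>t. t \<in> U \<Longrightarrow> B t \<noteq> 0"
  shows "finite {i. \<forall>(t, z)\<in>ZU i. poly (B t) z = 0}"
proof -
  let ?h = "\<lambda>x. poly (B (fst x)) (snd x)" and ?I = "{i. \<forall>(t, z)\<in>ZU i. poly (B t) z = 0}"
  have h: "?h \<in> R" by (rule poly_maps_eval[OF R_ring lift_poly[OF B] line_ring_snd])
  obtain \<Y> where Y: "finite \<Y> \<and> \<Union>\<Y> = {x \<in> V. ?h x = 0} \<and> (\<forall>Y\<in>\<Y>. irreducible_on R Y)"
    using finite_irreducible_decomposition[OF line_ring_noetherian[of n \<phi>], of "{x \<in> V. ?h x = 0}"] by (elim exE)
  define zcl where "zcl Y = {y \<in> V. \<forall>f\<in>R. vanishes Y f \<longrightarrow> f y = 0}" for Y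
  have "\<exists>Y\<in>\<Y>. ZU i = zcl Y" if i: "i \<in> ?I" for i
  proof -
    have sub: "ZU i \<subseteq> \<Union>\<Y>" using i Y ZV[of i] by auto
    have fin: "finite \<Y>" using Y by simp
    from irreducible_in_union[OF R_ring ZU_irr fin sub] obtain Y0 where
      Y0': "Y0 \<in> \<Y>" "\<forall>f\<in>R. vanishes Y0 f \<longrightarrow> vanishes (ZU i) f" ..
    have Y0: "Y0 \<in> \<Y>" "\<And>f. f \<in> R \<Longrightarrow> vanishes Y0 f \<Longrightarrow> vanishes (ZU i) f" using Y0' by simp_all
    have Y0V: "Y0 \<subseteq> V" "vanishes Y0 ?h" using Y0(1) Y by (auto simp: vanishes_def)
    have sub: "Y0 \<subseteq> zcl Y0" using Y0V by (auto simp: zcl_def vanishes_def)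
    have v: "vanishes (zcl Y0) f \<longleftrightarrow> vanishes Y0 f" if "f \<in> R" for f
      using that sub by (auto simp: zcl_def vanishes_def)
    have "irreducible_on R Y0" using Y Y0(1) by blast
    hence irr: "irreducible_on R (zcl Y0)" using sub fr_mult[OF R_ring] unfolding irreducible_on_def
      by (auto simp: v)
    have "ZU i \<subseteq> zcl Y0" using Y0(2) ZV[of i] by (auto simp: zcl_def vanishes_def)
    moreover have "zcl Y0 \<subseteq> ZU i"
    proof (rule ZU_maximal[OF B irr _ calculation])
      show "zcl Y0 \<subseteq> V" by (auto simp: zcl_def)
      fix t z assume tz: "(t, z) \<in> zcl Y0"
      hence "t \<in> U" by (auto simp: zcl_def V_def)
      moreover have "?h (t, z) = 0" using v[OF h] Y0V(2) tz unfolding vanishes_def by blast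
      ultimately show "B t \<noteq> 0 \<and> poly (B t) z = 0" using nz by simp
    qed
    ultimately show ?thesis using Y0(1) by blast
  qed
  hence "ZU ` ?I \<subseteq> zcl ` \<Y>" by blast
  moreover have "finite (zcl ` \<Y>)" using Y by simp
  ultimately have "finite (ZU ` ?I)" by (rule finite_subset)
  moreover have "inj_on ZU ?I" by (rule inj_onI) (rule ZU_inj)
  ultimately show ?thesis by (rule finite_imageD)
qed

text \<open>The chart coordinates together with \<open>z\<close> embed the trace of the hypersurface
  as an irreducible algebraic set, to which \<open>preperiodic_family\<close> applies.\<close>

lemma ZU_uniformly_preperiodic:
  "\<exists>a b. a < b \<and> (\<forall>(t, z)\<in>ZU i. (poly (Q t) ^^ a) z = (poly (Q t) ^^ b) z)"
proof -
  define \<iota> where "\<iota> x = (\<phi> (fst x))(n := snd x)" for x :: "'a \<times> 'k"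
  have Rp: "R = (\<lambda>f. f \<circ> \<iota>) ` pfuns {..<Suc n}" unfolding \<iota>_def[abs_def] by (rule line_ring_pfuns)
  obtain D where D: "\<And>t. degree (Q t) \<le> D" using Q by (auto simp: poly_maps_def)
  have "\<forall>j. \<exists>f\<in>poly_funs n. (\<lambda>t. coeff (Q t) j) = f \<circ> \<phi>"
    using pm_coeff[OF coord_ring_ring Q] by (auto simp: coord_ring_pfuns)
  then obtain f where f: "\<And>j. f j \<in> pfuns {..<n}" "\<And>j. (\<lambda>t. coeff (Q t) j) = f j \<circ> \<phi>"
    unfolding poly_funs_pfuns by metis
  have f': "f j \<in> pfuns {..<Suc n}" for j using f(1) pfuns_mono[of "{..<n}" "{..<Suc n}"] by auto
  \<comment> \<open>The family as a polynomial map in the chart coordinates; its coefficients do not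
    involve the last coordinate, which carries \<open>z\<close>.\<close>
  define P where "P x = (\<Sum>j\<le>D. monom (f j x) j)" for x
  note S = pfuns_fun_ring[of "{..<Suc n}"]
  have P: "P \<in> poly_maps (pfuns {..<Suc n})" unfolding P_def[abs_def]
    by (intro fr_sum[OF pm_fun_ring[OF S]] pm_monom[OF S] f')
  have PQ: "P (\<iota> x) = Q (fst x)" for x
  proof -
    have "f j (\<iota> x) = f j (\<phi> (fst x))" for j by (rule pfuns_cong[OF f(1)]) (auto simp: \<iota>_def)
    moreover have "f j (\<phi> t) = coeff (Q t) j" for j t using fun_cong[OF f(2)[of j], of t] by simp
    ultimately show ?thesis using D[of "fst x"] by (simp add: P_def poly_as_sum_of_monoms')
  qed
  interpret preperiodic_family "Suc n" "\<iota> ` ZU i" P "\<lambda>x. x n" d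
  proof
    show "irreducible_on (pfuns {..<Suc n}) (\<iota> ` ZU i)"
      unfolding irreducible_on_image Rp[symmetric] by (rule ZU_irr)
    show "P \<in> poly_maps (pfuns {..<Suc n})" by (rule P)
    show "(\<lambda>x. x n) \<in> pfuns {..<Suc n}" by (rule pfuns.coord) simp
    show "2 \<le> d" by (rule d)
    fix x
    { assume "x \<in> \<iota> ` ZU i"
      then obtain y where y: "y \<in> ZU i" "x = \<iota> y" by blast
      hence yU: "fst y \<in> U" using ZV[of i] by (auto simp: V_def)
      show "degree (P x) = d" unfolding y(2) PQ by (rule dQ[OF yU])
      have "\<exists>a b. a < b \<and> (poly (Q (fst y)) ^^ a) (snd y) = (poly (Q (fst y)) ^^ b) (snd y)"
        by (rule pre[of _ _ i]) (use y yU in \<open>auto simp: ZU_def\<close>)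
      thus "\<exists>a b. a < b \<and> (poly (P x) ^^ a) (x n) = (poly (P x) ^^ b) (x n)"
        unfolding y(2) PQ by (simp add: \<iota>_def) }
    assume x: "\<forall>i\<ge>Suc n. x i = 0" "\<forall>f\<in>pfuns {..<Suc n}. vanishes (\<iota> ` ZU i) f \<longrightarrow> f x = 0"
    \<comment> \<open>A function of the first \<open>n\<close> coordinates vanishing on the chart
      vanishes on the embedded hypersurface, so the truncated point lies in the chart.\<close>
    have "x(n := 0) \<in> \<phi> ` U"
    proof (rule algebraic_set_memI[OF chartD(2)[OF ch]])
      show "x(n := 0) \<in> affine_space n" using x(1) by (auto simp: affine_space_def)
      fix g :: "(nat \<Rightarrow> 'k) \<Rightarrow> 'k" assume g: "g \<in> poly_funs n" "vanishes (\<phi> ` U) g"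
      have e: "g (y(n := w)) = g y" for y w
        using g(1) unfolding poly_funs_pfuns by (rule pfuns_cong) auto
      have "g \<in> pfuns {..<Suc n}" using g(1) pfuns_mono[of "{..<n}" "{..<Suc n}"] by (auto simp: poly_funs_pfuns)
      moreover have "vanishes (\<iota> ` ZU i) g" using g(2) ZV[of i] e by (auto simp: vanishes_def \<iota>_def V_def)
      ultimately have "g x = 0" using x(2) by blast
      thus "g (x(n := 0)) = 0" using e by simp
    qed
    then obtain t where t: "t \<in> U" "x(n := 0) = \<phi> t" by auto
    have xi: "x = \<iota> (t, x n)" unfolding \<iota>_def fst_conv snd_conv t(2)[symmetric] by simp
    have "(t, x n) \<in> ZU i"
    proof (rule ZU_closed)
      show "(t, x n) \<in> V" using t by (simp add: V_def)
      fix h assume h: "h \<in> R" "vanishes (ZU i) h"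
      then obtain g where g: "g \<in> pfuns {..<Suc n}" "h = g \<circ> \<iota>" unfolding Rp by blast
      hence "vanishes (\<iota> ` ZU i) g" using h(2) by (auto simp: vanishes_def)
      hence "g x = 0" using x(2) g(1) by blast
      thus "h (t, x n) = 0" using g(2) xi by simp
    qed
    thus "x \<in> \<iota> ` ZU i" using xi by blast
  qed
  obtain a b where ab: "a < b" "\<forall>x\<in>\<iota> ` ZU i. (poly (P x) ^^ a) (x n) = (poly (P x) ^^ b) (x n)"
    using uniformly_preperiodic by blast
  have "(poly (Q t) ^^ a) z = (poly (Q t) ^^ b) z" if "(t, z) \<in> ZU i" for t z
    using bspec[OF ab(2) imageI[OF that]] PQ[of "(t, z)"] by (simp add: \<iota>_def)
  thus ?thesis using ab(1) by blast
qed

end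

section \<open>The fixed-point cover\<close>

text \<open>\<open>mult\<close> is required for every \<open>N\<close> because the return times on
  the different \<open>Z i\<close> come without a common bound.\<close>

locale pointed_cover = pointed_chart \<Lambda> d t0 z0 Z U n \<phi> Q
  for \<Lambda> :: "('a, 'k::{alg_closed_field, field_char_0}) fspace" and d t0 z0 Z U n \<phi> Q +
  fixes P :: "'a \<Rightarrow> 'k poly" and k n0 :: nat and w0 :: 'k
  assumes QP: "\<And>t. t \<in> U \<Longrightarrow> Q t = P t" and k: "k \<ge> 1"
    and w0: "w0 = (poly (iterate_poly k (Q t0)) ^^ n0) z0" "poly (iterate_poly k (Q t0)) w0 = w0"
    and mult: "\<And>N. N \<ge> 1 \<Longrightarrow> (\<Sum>i<N. poly (pderiv (iterate_poly k (Q t0))) w0 ^ i) \<noteq> 0"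
begin

definition g :: "'a \<Rightarrow> 'k poly" where "g t = iterate_poly k (Q t)"

definition A :: "nat \<Rightarrow> 'a \<times> 'k \<Rightarrow> 'k" where "A m x = (poly (g (fst x)) ^^ m) (snd x)"

definition V1 :: "('a \<times> 'k) set" where "V1 = {x \<in> V. poly (g (fst x)) (snd x) = snd x}"

definition emb :: "'a \<times> 'k \<Rightarrow> nat \<Rightarrow> 'k" where "emb x = (\<phi> (fst x))(n := snd x)"

definition M :: "('a \<times> 'k, 'k) fspace" where "M = affine_model V1 (Suc n) emb"

text \<open>Points over the cover are \<open>((t, w), z)\<close>; this projection forgets
  \<open>w\<close> and leads back to the original product.\<close>

definition base :: "('a \<times> 'k) \<times> 'k \<Rightarrow> 'a \<times> 'k" where "base q = (fst (fst q), snd q)"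

abbreviation "R3 \<equiv> line_ring (Suc n) emb"

definition V3 :: "(('a \<times> 'k) \<times> 'k) set" where "V3 = V1 \<times> UNIV"

lemma g_maps: "g \<in> poly_maps (coord_ring n \<phi>)"
  unfolding g_def[abs_def] by (rule poly_maps_iterate[OF coord_ring_ring Q])

lemma g_maps': "(\<lambda>x. g (fst x)) \<in> poly_maps R"
  by (rule lift_poly[OF g_maps])

lemma deg_g: "t \<in> U \<Longrightarrow> degree (iterate_poly m (g t)) = (d ^ k) ^ m"
  by (simp add: g_def degree_iterate_poly dQ)

lemma dk: "d ^ k \<ge> 2"
  using d k self_le_power[of d k] by simp

lemma dk_power: "(d ^ k) ^ m \<noteq> 0" "(d ^ k) ^ Suc m \<noteq> (d ^ k) ^ m"
proof -
  obtain D where D: "d ^ k = D" "D \<ge> 2" using dk by simp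
  show "(d ^ k) ^ m \<noteq> 0" "(d ^ k) ^ Suc m \<noteq> (d ^ k) ^ m" unfolding D(1) using D(2) by simp_all
qed

lemma iterates_distinct: "t \<in> U \<Longrightarrow> iterate_poly (Suc m) (g t) - iterate_poly m (g t) \<noteq> 0"
proof
  assume "t \<in> U" "iterate_poly (Suc m) (g t) - iterate_poly m (g t) = 0"
  hence "(d ^ k) ^ Suc m = (d ^ k) ^ m" by (metis deg_g eq_iff_diff_eq_0)
  thus False using dk_power(2) by blast
qed

lemma deg_g1: "t \<in> U \<Longrightarrow> degree (g t) = d ^ k"
  by (simp add: g_def degree_iterate_poly dQ)

lemma A_poly: "A m x = poly (iterate_poly m (g (fst x))) (snd x)"
  by (simp add: A_def poly_iterate_poly)

lemma A_in: "A m \<in> R"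
proof -
  have "A m = (\<lambda>x. poly (iterate_poly m (g (fst x))) (snd x))" by (simp add: A_poly fun_eq_iff)
  thus ?thesis using poly_maps_eval[OF R_ring poly_maps_iterate[OF R_ring g_maps'] line_ring_snd] by simp
qed

lemma A_Suc: "A (Suc m) x = poly (g (fst x)) (A m x)"
  by (simp add: A_def)

lemma A_base: "m \<ge> n0 \<Longrightarrow> A m (t0, z0) = w0"
proof (induction m rule: dec_induct)
  case base thus ?case using w0(1) by (simp add: A_def g_def)
next
  case (step m) thus ?case using w0(2) by (simp add: A_Suc g_def)
qed

text \<open>The points \<open>(t, w)\<close> of the cover have the same type and coordinates as the
  points \<open>(t, z)\<close> of the product, so its coordinate ring is \<open>R\<close>, read with
  \<open>w\<close> in place of \<open>z\<close>.\<close>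

lemma coord_R: "coord_ring (Suc n) emb = R"
  unfolding coord_ring_pfuns line_ring_pfuns poly_funs_pfuns emb_def[abs_def] ..

lemma R3_ring: "fun_ring R3"
  by (rule line_ring_ring)

lemma R3_fst: "f \<in> R \<Longrightarrow> (\<lambda>q. f (fst q)) \<in> R3"
  using line_ring_base[of f "Suc n" emb] by (simp add: coord_R)

text \<open>The same ring generated in another order: by definition \<open>z\<close> is adjoined to
  the functions of \<open>(t, w)\<close>, here \<open>w\<close> to those of \<open>(t, z)\<close>.
  In this form the fixed-point equation shows that \<open>w\<close> is algebraic over the functions
  pulled back by \<open>base\<close>.\<close>

lemma R3_base: "R3 = adjoin ((\<lambda>f. f \<circ> base) ` R) (\<lambda>q. snd (fst q))"
proof -
  define C where "C = (\<lambda>i t. (\<phi> \<circ> fst) (t :: 'a \<times> 'k) i) ` {..<n}"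
  define C' :: "(('a \<times> 'k) \<times> 'k \<Rightarrow> 'k) set" where "C' = (\<lambda>c. c \<circ> fst) ` C"
  have R: "R = gen_funs (insert snd C)"
    by (simp only: line_ring_def coord_ring_fst gen_funs_insert) (simp only: coord_ring_def C_def)
  have sf: "snd \<circ> fst = (\<lambda>q. snd (fst q))" and sb: "snd \<circ> base = snd" by (auto simp: base_def)
  have "(\<lambda>f. f \<circ> fst) ` R = gen_funs (insert (\<lambda>q. snd (fst q)) C')"
    unfolding R gen_funs_comp[symmetric] by (simp only: image_insert sf C'_def)
  hence R3: "R3 = gen_funs (insert snd (insert (\<lambda>q. snd (fst q)) C'))"
    unfolding line_ring_def[of "Suc n"] coord_R gen_funs_insert by simp
  have "(\<lambda>c. c \<circ> base) ` C = C'" unfolding C'_def C_def image_image by (simp add: comp_def base_def)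
  hence "(\<lambda>f. f \<circ> base) ` R = gen_funs (insert snd C')"
    unfolding R gen_funs_comp[symmetric] by (simp only: image_insert sb)
  hence "adjoin ((\<lambda>f. f \<circ> base) ` R) (\<lambda>q. snd (fst q)) = gen_funs (insert (\<lambda>q. snd (fst q)) (insert snd C'))"
    by (simp add: gen_funs_insert)
  thus ?thesis unfolding R3 by (simp only: insert_commute)
qed

lemma base_ring: "fun_ring ((\<lambda>f. f \<circ> base) ` R)"
proof -
  have "R = gen_funs (insert snd ((\<lambda>i t. (\<phi> \<circ> fst) t i) ` {..<n}))"
    by (simp only: line_ring_def coord_ring_fst gen_funs_insert) (simp only: coord_ring_def)
  thus ?thesis by (metis gen_funs_comp gen_funs_ring)
qed

lemma R3_comp_base: "f \<in> R \<Longrightarrow> (\<lambda>q. f (base q)) \<in> R3"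
proof -
  assume "f \<in> R"
  hence "f \<circ> base \<in> (\<lambda>f. f \<circ> base) ` R" by blast
  from adjoin_base[OF base_ring this] show ?thesis unfolding R3_base by (simp only: comp_def)
qed

lemma R3_w: "(\<lambda>q. snd (fst q)) \<in> R3"
  using R3_fst[OF line_ring_snd] .

lemma R3_z: "snd \<in> R3"
  by (rule line_ring_snd)

text \<open>Substitutes a function of \<open>(t, z)\<close> for \<open>w\<close>; with
  \<open>a = A m\<close> this carries irreducibility from \<open>ZU i\<close> to its lift.\<close>

lemma R3_section:
  assumes f: "f \<in> R3" and a: "a \<in> R" shows "(\<lambda>x. f ((fst x, a x), snd x)) \<in> R"
proof -
  obtain G where G: "G \<in> poly_maps ((\<lambda>f. f \<circ> base) ` R)" "f = (\<lambda>q. poly (G q) (snd (fst q)))"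
    using f unfolding R3_base by (auto simp: adjoin_def)
  obtain D where D: "\<And>x. degree (G x) \<le> D" using G by (auto simp: poly_maps_def)
  have "(\<lambda>x. coeff (G ((fst x, a x), snd x)) i) \<in> R" for i
  proof -
    have "(\<lambda>q. coeff (G q) i) \<in> (\<lambda>f. f \<circ> base) ` R" using G(1) by (simp add: poly_maps_def)
    then obtain c where c: "c \<in> R" "(\<lambda>q. coeff (G q) i) = c \<circ> base" by (elim imageE)
    have "coeff (G ((fst x, a x), snd x)) i = c x" for x
      using fun_cong[OF c(2), of "((fst x, a x), snd x)"] by (simp add: base_def)
    thus ?thesis using c(1) by simp
  qed
  moreover have "\<exists>D. \<forall>x. degree (G ((fst x, a x), snd x)) \<le> D" using D by (intro exI[of _ D] allI)
  ultimately have "(\<lambda>x. G ((fst x, a x), snd x)) \<in> poly_maps R" unfolding poly_maps_def by simp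
  from poly_maps_eval[OF R_ring this a] show ?thesis by (simp add: G(2))
qed

text \<open>The substitution for \<open>z\<close> behind the translations by \<open>w\<close> and
  \<open>- w\<close>.\<close>

lemma R3_substitute:
  assumes f: "f \<in> R3" and h: "h \<in> R3" shows "(\<lambda>q. f (fst q, h q)) \<in> R3"
proof -
  obtain D c where c: "\<And>i. c i \<in> coord_ring (Suc n) emb" "\<And>y v. f (y, v) = (\<Sum>i\<le>(D::nat). c i y * v ^ i)"
    using line_ring_rep[OF f] by blast
  have "(\<lambda>q. \<Sum>i\<le>D. c i (fst q) * h q ^ i) \<in> R3"
    by (intro fr_sum[OF R3_ring] fr_mult[OF R3_ring] line_ring_base c fr_power[OF R3_ring] h)
  thus ?thesis by (simp add: c(2))
qed

lemma emb_inj: "inj_on emb V1"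
proof (rule inj_onI)
  fix x y assume xy: "x \<in> V1" "y \<in> V1" "emb x = emb y"
  have U: "fst x \<in> U" "fst y \<in> U" using xy by (auto simp: V1_def V_def)
  have z: "\<phi> t n = 0" if "t \<in> U" for t
    using algebraic_set_sub[OF chartD(2)[OF ch]] that by (auto simp: affine_space_def)
  have "snd x = snd y" using fun_cong[OF xy(3), of n] by (simp add: emb_def)
  moreover have "(emb x)(n := 0) = (emb y)(n := 0)" using xy(3) by simp
  hence "\<phi> (fst x) = \<phi> (fst y)" using z U by (simp add: emb_def fun_upd_idem)
  hence "fst x = fst y" using chartD(1)[OF ch] U by (auto dest: inj_onD)
  ultimately show "x = y" by (simp add: prod_eq_iff)
qed

lemma emb_algebraic: "algebraic_set (Suc n) (emb ` V1)"
proof -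
  have "(\<lambda>x. poly (g (fst x)) (snd x) - snd x) \<in> R"
    by (intro fr_diff[OF R_ring] poly_maps_eval[OF R_ring g_maps'] line_ring_snd)
  then obtain h where h: "h \<in> pfuns {..<Suc n}" "(\<lambda>x. poly (g (fst x)) (snd x) - snd x) = h \<circ> emb"
    unfolding line_ring_pfuns emb_def[abs_def] by blast
  have he: "h (emb x) = 0 \<longleftrightarrow> poly (g (fst x)) (snd x) = snd x" for x
    using fun_cong[OF h(2), of x] by (metis comp_apply eq_iff_diff_eq_0)
  have "emb ` V1 = {x(n := w) | x w. x \<in> \<phi> ` U \<and> h (x(n := w)) = 0}"
  proof (intro equalityI subsetI)
    fix v assume "v \<in> emb ` V1"
    then obtain x where x: "x \<in> V1" "v = emb x" by blast
    hence "v = (\<phi> (fst x))(n := snd x)" "h v = 0" "fst x \<in> U" using he by (auto simp: emb_def V1_def V_def)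
    thus "v \<in> {x(n := w) | x w. x \<in> \<phi> ` U \<and> h (x(n := w)) = 0}" by blast
  next
    fix v assume "v \<in> {x(n := w) | x w. x \<in> \<phi> ` U \<and> h (x(n := w)) = 0}"
    then obtain t w where t: "t \<in> U" "v = (\<phi> t)(n := w)" "h ((\<phi> t)(n := w)) = 0" by blast
    hence "(t, w) \<in> V1" "v = emb (t, w)" using he[of "(t, w)"] by (auto simp: V1_def V_def emb_def)
    thus "v \<in> emb ` V1" by blast
  qed
  thus ?thesis using algebraic_set_extend[OF chartD(2)[OF ch], of h] h(1) by (simp add: poly_funs_pfuns)
qed

lemma chM: "chart M V1 (Suc n) emb"
  unfolding M_def by (rule affine_model_chart[OF emb_inj emb_algebraic])

lemma ptsM: "points M = V1"
  unfolding M_def by (rule affine_model_points[OF emb_inj emb_algebraic])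

lemma zc3: "zariski_chart (zariski (times_line M)) V3 R3"
  unfolding V3_def by (rule line_chart[OF chM])

lemma pts3: "points (times_line M) = V3"
  using line_points[of M] chM by (auto simp: V3_def ptsM)

lemma varM: "variety M"
  by (rule variety_global_chart[OF chM]) (simp add: ptsM)

lemma fst_morphism: "morphism M \<Lambda> fst"
proof (rule morphism_chart[OF ch chM])
  show "V1 = points M" by (simp add: ptsM)
  show "fst ` V1 \<subseteq> U" by (auto simp: V1_def V_def)
  fix c assume "c \<in> coord_ring n \<phi>"
  thus "c \<circ> fst \<in> coord_ring (Suc n) emb" using line_ring_base unfolding coord_R by (simp add: comp_def)
qed

lemma t0V1: "(t0, w0) \<in> V1"
  using t0 w0(2) by (simp add: V1_def V_def g_def)

lemma landing_time: "\<exists>m\<ge>n0. \<forall>x\<in>ZU i. poly (g (fst x)) (A m x) = A m x"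
proof -
  obtain a b where ab: "a < b" "\<forall>(t, z)\<in>ZU i. (poly (Q t) ^^ a) z = (poly (Q t) ^^ b) z"
    using ZU_uniformly_preperiodic[of i] by (elim exE conjE)
  \<comment> \<open>\<open>m \<ge> a\<close> passes the preperiod on \<open>ZU i\<close>;
    \<open>m \<ge> n0\<close> gives the value \<open>w0\<close> at \<open>(t0, z0)\<close>, where
    the cofactor \<open>H\<close> is known to be nonzero.\<close>
  define m N where "m = max n0 a" and "N = b - a"
  have N: "N \<ge> 1" using ab by (simp add: N_def)
  have itk: "(poly (g t) ^^ j) y = (poly (Q t) ^^ (k * j)) y" for t j y
  proof (induction j)
    case (Suc j)
    have "k * Suc j = k + k * j" by simp
    thus ?case using Suc by (simp only: funpow.simps comp_apply g_def poly_iterate_poly funpow_add)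
  qed simp
  have per: "poly (iterate_poly N (g (fst x))) (A m x) = A m x" if "x \<in> ZU i" for x
  proof -
    let ?f = "poly (Q (fst x))"
    have "m \<le> k * m" "a \<le> m" using k by (simp, simp add: m_def)
    hence "k * m \<ge> a" by linarith
    have eq: "(?f ^^ a) (snd x) = (?f ^^ b) (snd x)" using bspec[OF ab(2) that] by (simp add: case_prod_beta)
    have "(?f ^^ N) ((?f ^^ (k * m)) (snd x)) = (?f ^^ (k * m - a)) ((?f ^^ (N + a)) (snd x))"
    proof -
      have "N + k * m = (k * m - a) + (N + a)" using \<open>k * m \<ge> a\<close> by simp
      thus ?thesis by (metis comp_apply funpow_add)
    qed
    also have "N + a = b" using ab(1) by (simp add: N_def)
    also have "(?f ^^ b) (snd x) = (?f ^^ a) (snd x)" by (rule eq[symmetric])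
    also have "(?f ^^ (k * m - a)) ((?f ^^ a) (snd x)) = (?f ^^ (k * m)) (snd x)"
    proof -
      have "k * m = (k * m - a) + a" using \<open>k * m \<ge> a\<close> by simp
      thus ?thesis by (metis comp_apply funpow_add)
    qed
    finally have "(?f ^^ N) (A m x) = A m x" by (simp add: A_def itk)
    from funpow_period_add[OF this, of k] show ?thesis by (simp add: poly_iterate_poly itk mult.commute)
  qed
  obtain H where H: "H \<in> poly_maps (coord_ring n \<phi>)"
    "\<And>t. iterate_poly N (g t) - [:0, 1:] = (g t - [:0, 1:]) * H t"
    "\<And>t w. poly (g t) w = w \<Longrightarrow> poly (H t) w = (\<Sum>i<N. poly (pderiv (g t)) w ^ i)"
    using iterate_difference[OF coord_ring_ring g_maps, of N] by blast
  let ?f1 = "\<lambda>x. poly (g (fst x)) (A m x) - A m x" and ?f2 = "\<lambda>x. poly (H (fst x)) (A m x)"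
  have f1: "?f1 \<in> R" by (intro fr_diff[OF R_ring] poly_maps_eval[OF R_ring g_maps'] A_in)
  have f2: "?f2 \<in> R" by (rule poly_maps_eval[OF R_ring lift_poly[OF H(1)] A_in])
  have "?f2 x * ?f1 x = 0" if "x \<in> ZU i" for x
    using arg_cong[OF H(2)[of "fst x"], of "\<lambda>p. poly p (A m x)"] per[OF that] by (simp add: mult.commute)
  hence "vanishes (ZU i) (\<lambda>x. ?f2 x * ?f1 x)" by (simp add: vanishes_def)
  moreover have "\<not> vanishes (ZU i) ?f2"
  proof
    assume v: "vanishes (ZU i) ?f2"
    have "A m (t0, z0) = w0" by (rule A_base) (simp add: m_def)
    moreover have "poly (H t0) w0 \<noteq> 0" using H(3)[of t0 w0] w0(2) mult[OF N] by (simp add: g_def)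
    ultimately show False using v tzU[of i] by (auto simp: vanishes_def)
  qed
  ultimately have "vanishes (ZU i) ?f1" using irreducible_on_mult[OF ZU_irr f2 f1] by blast
  thus ?thesis by (intro exI[of _ m]) (auto simp: vanishes_def m_def)
qed

definition nn :: "nat \<Rightarrow> nat" where
  "nn i = (SOME m. m \<ge> n0 \<and> (\<forall>x\<in>ZU i. poly (g (fst x)) (A m x) = A m x))"

lemma nn: "nn i \<ge> n0" "\<And>x. x \<in> ZU i \<Longrightarrow> poly (g (fst x)) (A (nn i) x) = A (nn i) x"
  using someI_ex[OF landing_time[of i]] unfolding nn_def by blast+

definition sect :: "nat \<Rightarrow> 'a \<times> 'k \<Rightarrow> ('a \<times> 'k) \<times> 'k" where
  "sect i x = ((fst x, A (nn i) x), snd x)"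

definition Z' :: "nat \<Rightarrow> (('a \<times> 'k) \<times> 'k) set" where "Z' i = sect i ` ZU i"

lemma base_sect: "base (sect i x) = x"
  by (simp add: base_def sect_def)

lemma Z'_iff: "q \<in> Z' i \<longleftrightarrow> base q \<in> ZU i \<and> snd (fst q) = A (nn i) (base q)"
proof
  assume "q \<in> Z' i"
  then obtain x where "x \<in> ZU i" "q = sect i x" by (auto simp: Z'_def)
  thus "base q \<in> ZU i \<and> snd (fst q) = A (nn i) (base q)" by (simp add: base_sect) (simp add: sect_def)
next
  assume q: "base q \<in> ZU i \<and> snd (fst q) = A (nn i) (base q)"
  hence "q = sect i (base q)" by (simp add: sect_def base_def prod_eq_iff)
  thus "q \<in> Z' i" using q by (auto simp: Z'_def)
qed

lemma Z'_V3: "Z' i \<subseteq> V3"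
  using nn ZV by (fastforce simp: Z'_def sect_def V3_def V1_def V_def)

lemma Z'_base: "base ` Z' i = ZU i"
  by (auto simp: Z'_def image_image base_sect)

lemma Z'_irr: "irreducible_on R3 (Z' i)"
  unfolding Z'_def irreducible_on_image
proof (rule irreducible_on_mono[OF ZU_irr])
  show "(\<lambda>f. f \<circ> sect i) ` R3 \<subseteq> R" using R3_section[OF _ A_in] by (auto simp: comp_def sect_def)
qed

lemma base_irr: "irreducible_on R3 W \<Longrightarrow> irreducible_on R (base ` W)"
  unfolding irreducible_on_image
  by (rule irreducible_on_mono) (use R3_comp_base in \<open>auto simp: comp_def\<close>)

lemma base_V: "W \<subseteq> V3 \<Longrightarrow> base ` W \<subseteq> V"
  by (auto simp: V3_def V1_def V_def base_def)

lemma q0: "((t0, w0), z0) \<in> Z' i"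
  using tzU A_base[OF nn(1)] by (simp add: Z'_iff base_def)

lemma diff_in: "(\<lambda>q. snd (fst q) - A m (base q)) \<in> R3"
  by (intro fr_diff[OF R3_ring] R3_w R3_comp_base A_in)

text \<open>
  Both \<open>w\<close> and the landing value are roots of \<open>g - X\<close>; expanding at the latter, an irreducible
  set over \<open>ZU i\<close> on which they are not identical would force all coefficients to vanish.
\<close>

lemma Z'_component:
  assumes W: "irreducible_on R3 W" "Z' i \<subseteq> W" "W \<subseteq> V3" "base ` W \<subseteq> ZU i"
  shows "W \<subseteq> Z' i"
proof -
  let ?f = "\<lambda>q. snd (fst q) - A (nn i) (base q)"
  have fR: "?f \<in> R3" by (rule diff_in)
  have "vanishes W ?f"
  proof (rule ccontr)
    assume nv: "\<not> vanishes W ?f"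
    define B where "B x = (g (fst x) - [:0, 1:]) \<circ>\<^sub>p [:A (nn i) x, 1:]" for x
    have lin: "(\<lambda>x. [:A (nn i) x, 1:]) \<in> poly_maps R"
    proof -
      have "(\<lambda>x. [:A (nn i) x:] + [:0, 1:]) \<in> poly_maps R"
        by (intro fr_add[OF pm_fun_ring[OF R_ring]] pm_const[OF R_ring] pm_X[OF R_ring] A_in)
      thus ?thesis by simp
    qed
    have B: "B \<in> poly_maps R" unfolding B_def[abs_def]
      by (intro poly_maps_pcompose[OF R_ring] fr_diff[OF pm_fun_ring[OF R_ring]] g_maps' pm_X[OF R_ring] lin)
    have Bf: "poly (B (base q)) (?f q) = 0" if "q \<in> W" for q
    proof -
      have "q \<in> V3" using W(3) that by blast
      hence "poly (g (fst (fst q))) (snd (fst q)) = snd (fst q)" by (auto simp: V3_def V1_def)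
      thus ?thesis by (simp add: B_def poly_pcompose base_def)
    qed
    have "vanishes (ZU i) (\<lambda>x. coeff (B x) a)" for a
    proof (induction a rule: less_induct)
      case (less a)
      obtain D where D: "\<And>x. degree (B x) \<le> D" using B by (auto simp: poly_maps_def)
      \<comment> \<open>What remains of \<open>B\<close> after the power \<open>?f q ^ a\<close> is
        removed. On \<open>Z' i\<close> the argument \<open>?f\<close> is \<open>0\<close>, so
        \<open>?r\<close> is there the coefficient of order \<open>a\<close>.\<close>
      let ?r = "\<lambda>q. poly (poly_shift a (B (base q))) (?f q)"
      have sh: "(\<lambda>q. poly_shift a (B (base q))) \<in> poly_maps R3"
      proof -
        have "degree (poly_shift a (B (base q))) \<le> D" for q
          by (rule degree_le) (use D in \<open>auto simp: coeff_poly_shift intro!: coeff_eq_0 order.strict_trans1[OF D] trans_less_add1\<close>)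
        thus ?thesis using R3_comp_base[OF pm_coeff[OF R_ring B]] by (auto simp: poly_maps_def coeff_poly_shift)
      qed
      have rR: "?r \<in> R3" by (rule poly_maps_eval[OF R3_ring sh fR])
      have "?f q ^ a * ?r q = 0" if q: "q \<in> W" for q
      proof -
        have "base q \<in> ZU i" using W(4) q by blast
        hence "coeff (B (base q)) b = 0" if "b < a" for b using less.IH[OF that] by (simp add: vanishes_def)
        hence "B (base q) = monom 1 a * poly_shift a (B (base q))"
          by (intro poly_eqI) (auto simp: coeff_monom_mult coeff_poly_shift)
        hence "poly (B (base q)) (?f q) = ?f q ^ a * ?r q"
          by (metis poly_mult poly_monom mult_1)
        thus ?thesis using Bf[OF q] by simp
      qed
      hence "vanishes W (\<lambda>q. ?f q ^ a * ?r q)" by (simp add: vanishes_def)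
      hence vr: "vanishes W ?r"
        using irreducible_on_mult[OF W(1) fr_power[OF R3_ring fR] rR] irreducible_on_power[OF R3_ring W(1) fR nv] by blast
      show ?case unfolding vanishes_def
      proof
        fix x assume x: "x \<in> ZU i"
        hence s: "sect i x \<in> W" using W(2) by (auto simp: Z'_def)
        have "?f (sect i x) = 0" by (simp add: base_sect) (simp add: sect_def)
        hence "?r (sect i x) = coeff (B x) a" by (simp add: base_sect poly_0_coeff_0 coeff_poly_shift)
        thus "coeff (B x) a = 0" using vr s unfolding vanishes_def by metis
      qed
    qed
    hence "B (t0, z0) = 0" using tzU by (auto simp: vanishes_def poly_eq_iff)
    moreover have "degree (B (t0, z0)) = d ^ k"
    proof -
      have "degree (- [:0, 1:] :: 'k poly) < degree (g t0)" using deg_g1[OF t0] dk by simp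
      from degree_add_eq_left[OF this] have "degree (g t0 - [:0, 1:]) = d ^ k"
        using deg_g1[OF t0] by (simp only: diff_conv_add_uminus)
      thus ?thesis unfolding B_def fst_conv degree_pcompose by simp
    qed
    ultimately have "d ^ k = 0" by (simp only: degree_0)
    thus False using dk by linarith
  qed
  show ?thesis
  proof
    fix q assume q: "q \<in> W"
    have "base q \<in> ZU i" using W(4) q by (rule subsetD[OF _ imageI])
    moreover have "snd (fst q) - A (nn i) (base q) = 0" using \<open>vanishes W ?f\<close> q unfolding vanishes_def by (rule bspec)
    ultimately show "q \<in> Z' i" by (simp add: Z'_iff)
  qed
qed

text \<open>A chain of length two above \<open>Z' i\<close> projects by \<open>base\<close> to one
  above \<open>ZU i\<close>, which has codimension one. The lower inclusion stays strict by
  \<open>Z'_component\<close>, the upper one by incomparability. Codimension at least one is shown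
  by the cylinder over the image of \<open>Z' i\<close> in the cover.\<close>

lemma Z'_hypersurface: "irreducible_hypersurface (zariski (times_line M)) (Z' i)"
proof (rule hypersurface_intro[OF zc3 _ Z'_irr Z'_V3])
  show "V3 = points (times_line M)" by (simp add: pts3)
  show "y \<in> Z' i" if y: "y \<in> V3" "\<forall>f\<in>R3. vanishes (Z' i) f \<longrightarrow> f y = 0" for y
  proof -
    have "vanishes (Z' i) (\<lambda>q. snd (fst q) - A (nn i) (base q))" by (simp add: vanishes_def Z'_iff)
    hence "snd (fst y) = A (nn i) (base y)" using y(2) diff_in by fastforce
    moreover have "base y \<in> ZU i"
    proof (rule ZU_closed)
      show "base y \<in> V" using base_V[of "{y}"] y(1) by simp
      fix f assume f: "f \<in> R" "vanishes (ZU i) f"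
      have "vanishes (Z' i) (\<lambda>q. f (base q))" using f(2) by (simp add: vanishes_def Z'_iff)
      thus "f (base y) = 0" using y(2) R3_comp_base[OF f(1)] by blast
    qed
    ultimately show ?thesis by (simp add: Z'_iff)
  qed
  have "(\<lambda>f. f \<circ> fst) ` R \<subseteq> R3" using R3_fst by (auto simp: comp_def)
  hence "irreducible_on R (fst ` Z' i)"
    unfolding irreducible_on_image by (rule irreducible_on_mono[OF Z'_irr])
  thus "irreducible_on R3 (fst ` Z' i \<times> UNIV)"
    unfolding line_ring_def[of "Suc n"] coord_R by (rule irreducible_on_cylinder)
  show "Z' i \<subseteq> fst ` Z' i \<times> UNIV" by force
  show "fst ` Z' i \<times> UNIV \<subseteq> V3" using Z'_V3[of i] by (auto simp: V3_def)
  show "(\<lambda>q. snd (fst q) - A (nn i) (base q)) \<in> R3" by (rule diff_in)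
  show "vanishes (Z' i) (\<lambda>q. snd (fst q) - A (nn i) (base q))" by (simp add: vanishes_def Z'_iff)
  show "\<not> vanishes (fst ` Z' i \<times> UNIV) (\<lambda>q. snd (fst q) - A (nn i) (base q))"
  proof
    assume v: "vanishes (fst ` Z' i \<times> UNIV) (\<lambda>q. snd (fst q) - A (nn i) (base q))"
    \<comment> \<open>Along the line over \<open>(t0, w0)\<close> the iterate would be constant,
      although its degree is a power of \<open>d ^ k\<close>.\<close>
    have "(t0, w0) \<in> fst ` Z' i" using q0[of i] by force
    hence "w0 - A (nn i) (t0, z) = 0" for z using v unfolding vanishes_def base_def by force
    hence "poly ([:w0:] - iterate_poly (nn i) (g t0)) z = 0" for z by (simp add: A_poly)
    hence "[:w0:] - iterate_poly (nn i) (g t0) = 0" using poly_all_0_iff_0 by blast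
    hence "degree (iterate_poly (nn i) (g t0)) = 0" by (metis degree_pCons_0 eq_iff_diff_eq_0)
    thus False using deg_g[OF t0, of "nn i"] dk_power(1) by metis
  qed
  fix W1 W2 f1 f2
  assume W: "irreducible_on R3 W1" "irreducible_on R3 W2" "Z' i \<subseteq> W1" "W1 \<subseteq> W2" "W2 \<subseteq> V3"
    and f: "f1 \<in> R3" "vanishes (Z' i) f1" "\<not> vanishes W1 f1" "f2 \<in> R3" "vanishes W1 f2" "\<not> vanishes W2 f2"
  have W1V: "W1 \<subseteq> V3" using W by blast
  have "\<exists>h\<in>R. vanishes (ZU i) h \<and> \<not> vanishes (base ` W1) h"
  proof (rule ccontr)
    assume no: "\<not> ?thesis"
    have "base ` W1 \<subseteq> ZU i"
    proof
      fix x assume x: "x \<in> base ` W1"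
      show "x \<in> ZU i"
      proof (rule ZU_closed)
        show "x \<in> V" using base_V[OF W1V] x by blast
        fix f assume "f \<in> R" "vanishes (ZU i) f"
        hence "vanishes (base ` W1) f" using no by blast
        thus "f x = 0" using x unfolding vanishes_def by (rule bspec)
      qed
    qed
    hence "W1 \<subseteq> Z' i" by (rule Z'_component[OF W(1,3) W1V])
    thus False using f(2,3) by (auto simp: vanishes_def)
  qed
  then obtain h1 where h1: "h1 \<in> R" "vanishes (ZU i) h1" "\<not> vanishes (base ` W1) h1" by blast
  have "\<exists>h\<in>R. vanishes (base ` W1) h \<and> \<not> vanishes (base ` W2) h"
  proof (rule ccontr)
    assume no: "\<not> ?thesis"
    have alg: "algebraic_over ((\<lambda>f. f \<circ> base) ` R) W2 (\<lambda>q. snd (fst q))"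
      unfolding algebraic_over_def
    proof (intro bexI conjI exI)
      have "(\<lambda>x. g (fst x) - [:0, 1:]) \<in> poly_maps R"
        by (intro fr_diff[OF pm_fun_ring[OF R_ring]] g_maps' pm_X[OF R_ring])
      thus "(\<lambda>q. g (fst (base q)) - [:0, 1:]) \<in> poly_maps ((\<lambda>f. f \<circ> base) ` R)"
        unfolding poly_maps_def by (auto simp: image_iff fun_eq_iff)
      show "vanishes W2 (\<lambda>q. poly (g (fst (base q)) - [:0, 1:]) (snd (fst q)))"
        using W(5) by (auto simp: vanishes_def V3_def V1_def base_def)
      have "((t0, w0), z0) \<in> W2" using q0[of i] W(3,4) by blast
      moreover have "coeff (g t0) (d ^ k) \<noteq> 0" using deg_g1[OF t0] dk
        by (metis leading_coeff_0_iff degree_0 not_numeral_le_zero)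
      moreover have "coeff ([:0, 1:] :: 'k poly) (d ^ k) = 0" using dk by (intro coeff_eq_0) simp
      ultimately show "\<not> vanishes W2 (\<lambda>q. coeff (g (fst (base q)) - [:0, 1:]) (d ^ k))"
        unfolding vanishes_def base_def by force
    qed
    have "vanishes W2 f2"
    proof (rule algebraic_incomparability[OF base_ring W(2)[unfolded R3_base] alg W(4) _ f(4)[unfolded R3_base] f(5)])
      fix h assume "h \<in> (\<lambda>f. f \<circ> base) ` R" "vanishes W1 h"
      then obtain h' where "h' \<in> R" "h = h' \<circ> base" "vanishes (base ` W1) h'" by (auto simp: vanishes_def)
      thus "vanishes W2 h" using no by (auto simp: vanishes_def)
    qed
    thus False using f(6) by simp
  qed
  then obtain h2 where h2: "h2 \<in> R" "vanishes (base ` W1) h2" "\<not> vanishes (base ` W2) h2" by blast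
  have "Z i \<inter> V \<subseteq> base ` W1" using Z'_base[of i] image_mono[OF W(3), of base] by (simp add: ZU_def)
  thus False
    using hypersurface_no_chain[OF zcR Z Zne base_irr[OF W(1)] base_irr[OF W(2)] _ image_mono[OF W(4)] base_V[OF W(5)]
      h1(1) _ h1(3) h2] h1(2) by (simp add: ZU_def)
qed

lemma irreducible_in_M: "irreducible_in (zariski (times_line M)) W \<Longrightarrow> irreducible_on R3 W \<and> W \<subseteq> V3"
proof -
  assume W: "irreducible_in (zariski (times_line M)) W"
  hence sub: "W \<subseteq> V3" "W \<noteq> {}" using pts3 by (auto simp: irreducible_in_def)
  hence "W \<inter> V3 = W" by blast
  thus ?thesis using irreducible_on_chart[OF zc3 W] sub by simp
qed

lemma cover_base_change: "base_change \<Lambda> t0 z0 Z M fst (t0, w0) Z'"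
  unfolding base_change_def
proof (intro conjI allI)
  show "variety M" by (rule varM)
  show "morphism M \<Lambda> fst" by (rule fst_morphism)
  show "(t0, w0) \<in> points M" by (simp add: ptsM t0V1)
  show "inj Z'" by (rule injI) (metis Z'_base ZU_inj)
  fix i
  show "irreducible_hypersurface (zariski (times_line M)) (Z' i)" by (rule Z'_hypersurface)
  show "((t0, w0), z0) \<in> Z' i" by (rule q0)
  show "irreducible_component (zariski (times_line M)) {(t, z). t \<in> points M \<and> (fst t, z) \<in> Z i} (Z' i)"
    unfolding irreducible_component_def
  proof (intro conjI allI impI)
    show "irreducible_in (zariski (times_line M)) (Z' i)" by (rule irreducible_in_chart[OF zc3 Z'_irr Z'_V3])
    show "Z' i \<subseteq> {(t, z). t \<in> points M \<and> (fst t, z) \<in> Z i}"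
    proof
      fix q assume q: "q \<in> Z' i"
      have "q \<in> V3" using Z'_V3 q by (rule subsetD)
      moreover have "base q \<in> Z i" using q by (simp add: Z'_iff ZU_def)
      ultimately
      show "q \<in> {(t, z). t \<in> points M \<and> (fst t, z) \<in> Z i}" by (auto simp: V3_def ptsM base_def)
    qed
    fix W assume W: "irreducible_in (zariski (times_line M)) W \<and> Z' i \<subseteq> W \<and> W \<subseteq> {(t, z). t \<in> points M \<and> (fst t, z) \<in> Z i}"
    hence W': "irreducible_on R3 W" "W \<subseteq> V3" using irreducible_in_M by blast+
    have "base ` W \<subseteq> ZU i" using W base_V[OF W'(2)] by (auto simp: ZU_def base_def)
    hence "W \<subseteq> Z' i" using Z'_component[OF W'(1) _ W'(2)] W by blast
    thus "W = Z' i" using W by blast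
  qed
qed simp

section \<open>The translated family over the cover\<close>

definition QQ :: "'a \<times> 'k \<Rightarrow> 'k poly" where
  "QQ p = conj_poly 1 (- snd p) (iterate_poly k (P (fst p)))"

lemma QQ: "p \<in> V1 \<Longrightarrow> QQ p = g (fst p) \<circ>\<^sub>p [:snd p, 1:] - [:snd p:]"
proof -
  assume "p \<in> V1"
  hence "iterate_poly k (P (fst p)) = g (fst p)" using QP by (auto simp: V1_def V_def g_def)
  hence "poly (QQ p) x = poly (g (fst p) \<circ>\<^sub>p [:snd p, 1:] - [:snd p:]) x" for x
    by (simp add: QQ_def conj_poly_def poly_pcompose)
  thus ?thesis by (subst poly_eq_poly_eq_iff[symmetric]) auto
qed

lemma QQ_iterate: "p \<in> V1 \<Longrightarrow> (poly (QQ p) ^^ m) x = A m (fst p, x + snd p) - snd p"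
proof (induction m)
  case (Suc m)
  have "(poly (QQ p) ^^ Suc m) x = poly (QQ p) (A m (fst p, x + snd p) - snd p)" using Suc by simp
  also have "\<dots> = A (Suc m) (fst p, x + snd p) - snd p"
    by (simp add: QQ[OF Suc.prems] poly_pcompose A_Suc)
  finally show ?case .
qed (simp add: A_def)

lemma QQ_fixed: "p \<in> V1 \<Longrightarrow> poly (QQ p) 0 = 0"
  by (simp add: QQ poly_pcompose) (simp add: V1_def)

lemma QQ_nonzero: "p \<in> V1 \<Longrightarrow> QQ p \<noteq> 0"
proof
  assume p: "p \<in> V1" and z: "QQ p = 0"
  have "g (fst p) \<circ>\<^sub>p [:snd p, 1:] = [:snd p:]" using z QQ[OF p] by simp
  hence "degree (g (fst p) \<circ>\<^sub>p [:snd p, 1:]) = 0" by simp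
  moreover have "degree (g (fst p)) = d ^ k" using p deg_g1 by (auto simp: V1_def V_def)
  ultimately have "d ^ k = 0" by (simp only: degree_pcompose) simp
  thus False using dk by linarith
qed

text \<open>Agrees with \<open>QQ\<close> on the cover but is built from \<open>Q\<close> instead of
  \<open>P\<close>, so that its coefficients are elements of \<open>R\<close> and can be used as
  functions.\<close>

definition TT :: "'a \<times> 'k \<Rightarrow> 'k poly" where "TT p = g (fst p) \<circ>\<^sub>p [:snd p, 1:] - [:snd p:]"

lemma TT_maps: "TT \<in> poly_maps R"
proof -
  have "(\<lambda>x. [:snd x:] + [:0, 1:]) \<in> poly_maps R"
    by (intro fr_add[OF pm_fun_ring[OF R_ring]] pm_const[OF R_ring] pm_X[OF R_ring] line_ring_snd)
  hence lin: "(\<lambda>x. [:snd x, 1:]) \<in> poly_maps R" by simp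
  show ?thesis unfolding TT_def[abs_def]
    by (intro fr_diff[OF pm_fun_ring[OF R_ring]] poly_maps_pcompose[OF R_ring] g_maps' pm_const[OF R_ring] line_ring_snd lin)
qed

lemma local_degree_coeffs:
  assumes "p \<in> V1"
  shows "e \<le> local_degree 0 (QQ p) \<longleftrightarrow> (\<forall>a<e. coeff (TT p) a = 0)"
  using monom_1_dvd_iff[OF QQ_nonzero[OF assms], of e] monom_1_dvd_iff'[of e "QQ p"]
  by (simp add: local_degree_def TT_def QQ[OF assms])

lemma finitely_many_landing: "finite {i. \<forall>x\<in>ZU i. A (Suc m) x = A m x}"
proof -
  define B where "B t = iterate_poly (Suc m) (g t) - iterate_poly m (g t)" for t
  have "B \<in> poly_maps (coord_ring n \<phi>)" unfolding B_def[abs_def]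
    by (intro fr_diff[OF pm_fun_ring[OF coord_ring_ring]] poly_maps_iterate[OF coord_ring_ring] g_maps)
  moreover have "B t \<noteq> 0" if "t \<in> U" for t
    unfolding B_def by (rule iterates_distinct[OF that])
  ultimately have "finite {i. \<forall>(t, z)\<in>ZU i. poly (B t) z = 0}" by (rule finitely_many_ZU)
  moreover have "{i. \<forall>x\<in>ZU i. A (Suc m) x = A m x} = {i. \<forall>(t, z)\<in>ZU i. poly (B t) z = 0}"
    by (auto simp: B_def A_poly)
  ultimately show ?thesis by simp
qed

lemma not_locally_constant: "\<not> locally_constant_near (zariski M) (t0, w0) (\<lambda>p. local_degree 0 (QQ p))"
proof
  assume "locally_constant_near (zariski M) (t0, w0) (\<lambda>p. local_degree 0 (QQ p))"
  then obtain N where N: "openin (zariski M) N" "(t0, w0) \<in> N"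
    "\<forall>y\<in>N. local_degree 0 (QQ y) = local_degree 0 (QQ (t0, w0))"
    unfolding locally_constant_near_def by blast
  define e where "e = local_degree 0 (QQ (t0, w0))"
  obtain h where h: "h \<in> R" "h (t0, w0) \<noteq> 0" "\<forall>y\<in>V1. h y \<noteq> 0 \<longrightarrow> y \<in> N"
    using zc_nbhd[OF chartD(3)[OF chM] N(1,2) t0V1] unfolding coord_R by blast
  have low: "coeff (TT p) a = 0" if "p \<in> V1" "h p \<noteq> 0" "a < e" for p a
    using local_degree_coeffs[OF that(1), of e] N(3) h(3) that by (auto simp: e_def)
  have top: "coeff (TT (t0, w0)) e \<noteq> 0"
    using local_degree_coeffs[OF t0V1, of "Suc e"] low[OF t0V1 h(2)] by (auto simp: e_def less_Suc_eq)
  have step: "vanishes (Z' i) (\<lambda>q. A m (base q) - snd (fst q))"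
    if m: "m \<ge> n0" and v: "vanishes (Z' i) (\<lambda>q. A (Suc m) (base q) - snd (fst q))" for m i
  proof -
    \<comment> \<open>Where its lower coefficients vanish, \<open>TT\<close> is \<open>X ^ e\<close>
      times the shifted polynomial. At the base point \<open>?f\<close> is \<open>0\<close> and
      \<open>?u\<close> is the coefficient of order \<open>e\<close>, which is nonzero.\<close>
    let ?f = "\<lambda>q. A m (base q) - snd (fst q)" and ?u = "\<lambda>q. poly (poly_shift e (TT (fst q))) (A m (base q) - snd (fst q))"
    have fR: "?f \<in> R3" by (intro fr_diff[OF R3_ring] R3_w R3_comp_base A_in)
    obtain D where D: "\<And>x. degree (TT x) \<le> D" using TT_maps by (auto simp: poly_maps_def)
    have "degree (poly_shift e (TT x)) \<le> D" for x
      by (rule degree_le) (use D in \<open>auto simp: coeff_poly_shift intro!: coeff_eq_0 order.strict_trans1[OF D] trans_less_add1\<close>)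
    hence "(\<lambda>q. poly_shift e (TT (fst q))) \<in> poly_maps R3"
      using R3_fst[OF pm_coeff[OF R_ring TT_maps]] by (auto simp: poly_maps_def coeff_poly_shift)
    hence uR: "?u \<in> R3" by (rule poly_maps_eval[OF R3_ring _ fR])
    \<comment> \<open>The lower coefficients are known to vanish only where \<open>h\<close> is
      nonzero; the factor \<open>h\<close> makes the identity below hold on all of
      \<open>Z' i\<close>.\<close>
    let ?hu = "\<lambda>q. h (fst q) * ?u q"
    have huR: "?hu \<in> R3" by (rule fr_mult[OF R3_ring R3_fst[OF h(1)] uR])
    have "?f q ^ e * ?hu q = 0" if q: "q \<in> Z' i" for q
    proof (cases "h (fst q) = 0")
      case False
      have qV: "fst q \<in> V1" using subsetD[OF Z'_V3 q] by (auto simp: V3_def)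
      have "TT (fst q) = monom 1 e * poly_shift e (TT (fst q))"
        using low[OF qV False] by (intro poly_eqI) (auto simp: coeff_monom_mult coeff_poly_shift)
      hence "poly (TT (fst q)) (?f q) = ?f q ^ e * ?u q" by (metis poly_mult poly_monom mult_1)
      moreover have "poly (TT (fst q)) (?f q) = A (Suc m) (base q) - snd (fst q)"
        by (simp add: TT_def poly_pcompose A_Suc base_def)
      moreover have "A (Suc m) (base q) - snd (fst q) = 0" using v q unfolding vanishes_def by (rule bspec)
      ultimately have "?f q ^ e * ?u q = 0" by simp
      thus ?thesis by (metis mult.left_commute mult_zero_right)
    qed simp
    hence "vanishes (Z' i) (\<lambda>q. ?hu q * ?f q ^ e)" by (simp add: vanishes_def mult.commute)
    moreover have "\<not> vanishes (Z' i) ?hu"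
    proof
      assume "vanishes (Z' i) ?hu"
      hence "h (t0, w0) * poly (poly_shift e (TT (t0, w0))) (A m (t0, z0) - w0) = 0"
        using q0[of i] by (auto simp: vanishes_def base_def)
      thus False using h(2) top A_base[OF m] by (simp add: poly_0_coeff_0 coeff_poly_shift)
    qed
    ultimately have "vanishes (Z' i) (\<lambda>q. ?f q ^ e)"
      using irreducible_on_mult[OF Z'_irr huR fr_power[OF R3_ring fR]] by blast
    thus ?thesis using irreducible_on_power[OF R3_ring Z'_irr fR] by blast
  qed
  have "\<forall>x\<in>ZU i. A (Suc n0) x = A n0 x" for i
  proof -
    have "vanishes (Z' i) (\<lambda>q. A n0 (base q) - snd (fst q))"
    proof -
      \<comment> \<open>Descent from the landing time \<open>nn i\<close> to \<open>n0\<close>; all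
        times involved are at least \<open>n0\<close>, where the orbit of the base point rests at
        \<open>w0\<close>.\<close>
      have "vanishes (Z' i) (\<lambda>q. A (nn i - j) (base q) - snd (fst q))" if "j \<le> nn i - n0" for j
        using that
      proof (induction j)
        case 0
        show ?case by (simp add: vanishes_def Z'_iff)
      next
        case (Suc j)
        have "nn i - j = Suc (nn i - Suc j)" using Suc.prems by simp
        thus ?case using step[of "nn i - Suc j" i] Suc by simp
      qed
      from this[of "nn i - n0"] show ?thesis using nn(1)[of i] by simp
    qed
    hence "A n0 x = A (nn i) x" if "x \<in> ZU i" for x
      using that unfolding vanishes_def Z'_def by (simp add: base_sect) (simp add: sect_def)
    thus ?thesis using nn(2)[of _ i] by (simp add: A_Suc)
  qed
  hence "{i. \<forall>x\<in>ZU i. A (Suc n0) x = A n0 x} = UNIV" by blast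
  thus False using finitely_many_landing[of n0] by simp
qed

lemma QQ_super_attracting: "super_attracting (QQ (t0, w0)) 0"
proof -
  have "coeff (TT (t0, w0)) 1 = 0"
  proof (rule ccontr)
    assume nz: "coeff (TT (t0, w0)) 1 \<noteq> 0"
    let ?N = "{p \<in> V1. coeff (TT p) 1 \<noteq> 0}"
    have "(\<lambda>p. coeff (TT p) 1) \<in> coord_ring (Suc n) emb"
      unfolding coord_R by (rule pm_coeff[OF R_ring TT_maps])
    hence op: "openin (zariski M) ?N" by (rule zc_principal[OF chartD(3)[OF chM]])
    have one: "local_degree 0 (QQ p) = 1" if p: "p \<in> ?N" for p
    proof -
      have "coeff (TT p) 0 = 0"
        using QQ_fixed[of p] QQ[of p] p by (simp add: TT_def poly_0_coeff_0)
      hence "1 \<le> local_degree 0 (QQ p)" using local_degree_coeffs[of p 1] p by simp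
      moreover have "\<not> Suc 1 \<le> local_degree 0 (QQ p)" using local_degree_coeffs[of p "Suc 1"] p by auto
      ultimately show ?thesis by simp
    qed
    have "locally_constant_near (zariski M) (t0, w0) (\<lambda>p. local_degree 0 (QQ p))"
      unfolding locally_constant_near_def using op one nz t0V1 by (intro exI[of _ ?N]) auto
    thus False using not_locally_constant by blast
  qed
  hence "coeff (QQ (t0, w0)) 1 = 0" using QQ[OF t0V1] by (simp add: TT_def)
  thus ?thesis using QQ_fixed[OF t0V1] by (simp add: super_attracting_def poly_0_coeff_0 coeff_pderiv)
qed

lemma nn_at_top: "filterlim nn at_top sequentially"
  unfolding filterlim_at_top
proof
  fix m
  have "{i. nn i < m} \<subseteq> (\<Union>j<m. {i. \<forall>x\<in>ZU i. A (Suc j) x = A j x})"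
    using nn(2) by (auto simp: A_Suc)
  moreover have "finite (\<Union>j<m. {i. \<forall>x\<in>ZU i. A (Suc j) x = A j x})" using finitely_many_landing by blast
  ultimately have "finite {i. nn i < m}" by (rule finite_subset)
  then obtain b where "\<forall>i\<in>{i. nn i < m}. i < b" using finite_nat_set_iff_bounded by blast
  thus "eventually (\<lambda>i. m \<le> nn i) sequentially"
    unfolding eventually_sequentially by (intro exI[of _ b]) (auto simp: not_less[symmetric])
qed

text \<open>A larger irreducible set in the landing locus is translated back and projected by
  \<open>base\<close>. Its image lies in the zero set of a nonzero polynomial in \<open>z\<close>
  over each parameter, so \<open>ZU_maximal\<close> confines it to \<open>ZU i\<close>, and the
  landing condition determines \<open>w\<close>.\<close>

lemma conjugated_component:
  "irreducible_component (zariski (times_line M))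
     {(t, z). t \<in> points M \<and> (poly (QQ t) ^^ nn i) z = 0} ((\<lambda>(t, z). (t, 1 * z + - snd t)) ` Z' i)"
  unfolding irreducible_component_def
proof (intro conjI allI impI)
  let ?\<tau> = "\<lambda>(t, z). (t, 1 * z + - snd t) :: ('a \<times> 'k) \<times> 'k"
  let ?S = "{(t, z). t \<in> points M \<and> (poly (QQ t) ^^ nn i) z = 0}"
  have tau: "?\<tau> = (\<lambda>q. (fst q, snd q - snd (fst q)))" by auto
  have "(\<lambda>f. f \<circ> ?\<tau>) ` R3 \<subseteq> R3"
    unfolding tau using R3_substitute[OF _ fr_diff[OF R3_ring R3_z R3_w]] by (auto simp: comp_def)
  hence "irreducible_on R3 (?\<tau> ` Z' i)" unfolding irreducible_on_image by (rule irreducible_on_mono[OF Z'_irr])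
  moreover have "?\<tau> ` Z' i \<subseteq> V3" using Z'_V3[of i] by (auto simp: V3_def)
  ultimately show "irreducible_in (zariski (times_line M)) (?\<tau> ` Z' i)" by (rule irreducible_in_chart[OF zc3])
  show "?\<tau> ` Z' i \<subseteq> ?S"
  proof
    fix q assume "q \<in> ?\<tau> ` Z' i"
    then obtain r where r: "r \<in> Z' i" "q = (fst r, snd r - snd (fst r))" unfolding tau by blast
    have "fst r \<in> V1" using subsetD[OF Z'_V3 r(1)] by (auto simp: V3_def)
    thus "q \<in> ?S" using r by (simp add: ptsM QQ_iterate Z'_iff base_def)
  qed
  fix W assume W: "irreducible_in (zariski (times_line M)) W \<and> ?\<tau> ` Z' i \<subseteq> W \<and> W \<subseteq> ?S"
  hence W': "irreducible_on R3 W" "W \<subseteq> V3" using irreducible_in_M by blast+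
  let ?\<sigma> = "\<lambda>q. (fst q, snd q + snd (fst q)) :: ('a \<times> 'k) \<times> 'k"
  have st: "?\<sigma> (?\<tau> q) = q" "?\<tau> (?\<sigma> q) = q" for q by (simp_all add: case_prod_beta prod_eq_iff)
  have "(\<lambda>f. f \<circ> ?\<sigma>) ` R3 \<subseteq> R3"
    using R3_substitute[OF _ fr_add[OF R3_ring R3_z R3_w]] by (auto simp: comp_def)
  hence irr: "irreducible_on R3 (?\<sigma> ` W)" unfolding irreducible_on_image by (rule irreducible_on_mono[OF W'(1)])
  have sV: "?\<sigma> ` W \<subseteq> V3" using W'(2) by (auto simp: V3_def)
  have Zs: "Z' i \<subseteq> ?\<sigma> ` W"
  proof
    fix q assume "q \<in> Z' i"
    hence "?\<tau> q \<in> W" using conjunct1[OF conjunct2[OF W]] by (elim subsetD) (rule imageI)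
    hence "?\<sigma> (?\<tau> q) \<in> ?\<sigma> ` W" by (rule imageI)
    thus "q \<in> ?\<sigma> ` W" by (simp only: st(1))
  qed
  have land: "A (nn i) (base q) = snd (fst q)" "q \<in> V3" if q: "q \<in> ?\<sigma> ` W" for q
  proof -
    obtain r where r: "r \<in> W" "q = ?\<sigma> r" using q by blast
    show "q \<in> V3" using sV q by blast
    have "fst r \<in> V1" "(poly (QQ (fst r)) ^^ nn i) (snd r) = 0" using r(1) W ptsM by auto
    thus "A (nn i) (base q) = snd (fst q)" using QQ_iterate[of "fst r" "nn i" "snd r"] r(2) by (simp add: base_def)
  qed
  \<comment> \<open>Landing on a fixed point by time \<open>nn i\<close> means equality of two
    consecutive iterates; these differ as polynomials because their degrees do.\<close>
  define B where "B t = iterate_poly (Suc (nn i)) (g t) - iterate_poly (nn i) (g t)" for t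
  have B: "B \<in> poly_maps (coord_ring n \<phi>)" unfolding B_def[abs_def]
    by (intro fr_diff[OF pm_fun_ring[OF coord_ring_ring]] poly_maps_iterate[OF coord_ring_ring] g_maps)
  have "base ` ?\<sigma> ` W \<subseteq> ZU i"
  proof (rule ZU_maximal[OF B base_irr[OF irr] base_V[OF sV]])
    show "ZU i \<subseteq> base ` ?\<sigma> ` W" using image_mono[OF Zs, of base] Z'_base by simp
    fix t z assume "(t, z) \<in> base ` ?\<sigma> ` W"
    then obtain q where q: "(t, z) = base q" "q \<in> ?\<sigma> ` W" by (rule imageE)
    hence q: "q \<in> ?\<sigma> ` W" "base q = (t, z)" by simp_all
    have qV: "fst q \<in> V1" "fst (fst q) = t" using land(2)[OF q(1)] q(2) by (auto simp: V3_def base_def)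
    have t: "t \<in> U" using qV by (auto simp: V1_def V_def)
    have "B t \<noteq> 0" unfolding B_def by (rule iterates_distinct[OF t])
    moreover have "poly (B t) z = 0"
    proof -
      have "A (Suc (nn i)) (t, z) = A (nn i) (t, z)"
        using land(1)[OF q(1)] q(2) qV by (auto simp: A_Suc V1_def)
      thus ?thesis by (simp add: B_def A_poly)
    qed
    ultimately show "B t \<noteq> 0 \<and> poly (B t) z = 0" by blast
  qed
  hence base: "base (?\<sigma> p) \<in> ZU i" if "p \<in> W" for p by (rule subsetD) (intro imageI that)
  have "W \<subseteq> ?\<tau> ` Z' i"
  proof
    fix p assume p: "p \<in> W"
    have "?\<sigma> p \<in> Z' i" using base[OF p] land(1)[OF imageI[OF p]] unfolding Z'_iff by simp
    hence "?\<tau> (?\<sigma> p) \<in> ?\<tau> ` Z' i" by (rule imageI)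
    thus "p \<in> ?\<tau> ` Z' i" by (simp only: st(2))
  qed
  thus "W = ?\<tau> ` Z' i" using W by (intro equalityI) simp_all
qed

end

section \<open>The cover attached to the given family\<close>

theorem theorem12:
  fixes \<Lambda> :: "('a, 'k :: {alg_closed_field, field_char_0}) fspace"
    and P :: "'a \<Rightarrow> 'k poly" and d :: nat
    and t\<^sub>0 :: 'a and z\<^sub>0 :: 'k and Z :: "nat \<Rightarrow> ('a \<times> 'k) set"
  assumes "variety \<Lambda>"
    and "d \<ge> 2"
    and "algebraic_family \<Lambda> d P"
    and "t\<^sub>0 \<in> points \<Lambda>"
    and "inj Z"
    and "\<And>i. irreducible_hypersurface (zariski (times_line \<Lambda>)) (Z i)"
    and "\<And>i. Z i \<subseteq> Preper \<Lambda> P"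
    and "\<And>i. (t\<^sub>0, z\<^sub>0) \<in> Z i"
  shows "\<exists>(\<Lambda>' :: ('a \<times> 'k, 'k) fspace) \<pi> t\<^sub>0' Z' a b k l.
    base_change \<Lambda> t\<^sub>0 z\<^sub>0 Z \<Lambda>' \<pi> t\<^sub>0' Z' \<and>
    affine_family \<Lambda>' a b \<and>
    k \<ge> 1 \<and>
    ((\<exists>m\<ge>1. (poly (P t\<^sub>0) ^^ m) z\<^sub>0 = z\<^sub>0) \<longrightarrow> l = 0) \<and>
    (let Q = (\<lambda>t. conj_poly (a t) (b t) (iterate_poly k (P (\<pi> t))));
         w\<^sub>0 = a t\<^sub>0' * (poly (P t\<^sub>0) ^^ l) z\<^sub>0 + b t\<^sub>0';
         Y = (\<lambda>i. (\<lambda>(t, z). (t, a t * z + b t)) ` Z' i)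
     in (\<forall>t\<in>points \<Lambda>'. poly (Q t) w\<^sub>0 = w\<^sub>0) \<and>
        super_attracting (Q t\<^sub>0') w\<^sub>0 \<and>
        \<not> locally_constant_near (zariski \<Lambda>') t\<^sub>0' (\<lambda>t. local_degree w\<^sub>0 (Q t)) \<and>
        (\<exists>n :: nat \<Rightarrow> nat. filterlim n at_top sequentially \<and>
           (\<forall>i. irreducible_component (zariski (times_line \<Lambda>'))
                  {(t, z). t \<in> points \<Lambda>' \<and> (poly (Q t) ^^ n i) z = w\<^sub>0} (Y i))))"
proof -
  from algebraic_family_chart[OF assms(1,3,4)] obtain U n \<phi> Q
    where U: "chart \<Lambda> U n \<phi>" "t\<^sub>0 \<in> U" "Q \<in> poly_maps (coord_ring n \<phi>)" "\<forall>y\<in>U. Q y = P y"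
    by (elim exE conjE)
  have sub: "U \<subseteq> points \<Lambda>" by (rule chartD(6)[OF U(1)])
  interpret pointed_chart \<Lambda> d t\<^sub>0 z\<^sub>0 Z U n \<phi> Q
  proof
    show "degree (Q t) = d" if "t \<in> U" for t
      using assms(3) subsetD[OF sub that] bspec[OF U(4) that] by (simp add: algebraic_family_def)
    show "\<exists>a b. a < b \<and> (poly (Q t) ^^ a) z = (poly (Q t) ^^ b) z" if tz: "(t, z) \<in> Z i" and t: "t \<in> U" for i t z
    proof -
      \<comment> \<open>Pigeonhole: infinitely many exponents, starting from \<open>1\<close> as in
        \<open>Preper\<close>, but finitely many values.\<close>
      let ?h = "\<lambda>m. (poly (Q t) ^^ m) z"
      have "finite {(poly (P t) ^^ m) z | m. m \<ge> 1}" using subsetD[OF assms(7) tz] by (simp add: Preper_def)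
      also have "{(poly (P t) ^^ m) z | m. m \<ge> 1} = ?h ` {1..}" using bspec[OF U(4) t] by auto
      finally have "\<not> inj_on ?h {1..}" using finite_imageD[of ?h "{1..}"] infinite_Ici by blast
      then obtain a b where "a \<noteq> b" "?h a = ?h b" unfolding inj_on_def by blast
      thus ?thesis by (metis linorder_neqE_nat)
    qed
  qed (use assms U in simp_all)
  have PQ: "Q t\<^sub>0 = P t\<^sub>0" using U(2,4) by (rule bspec[rotated])
  obtain a b where "a < b" "(poly (P t\<^sub>0) ^^ a) z\<^sub>0 = (poly (P t\<^sub>0) ^^ b) z\<^sub>0"
    using pre[OF tz t0] unfolding PQ by (elim exE conjE)
  from suitable_iterate[OF this] obtain k n0 w where w: "k \<ge> 1"
    "w = (poly (iterate_poly k (P t\<^sub>0)) ^^ n0) z\<^sub>0" "poly (iterate_poly k (P t\<^sub>0)) w = w"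
    "(\<exists>m\<ge>1. (poly (P t\<^sub>0) ^^ m) z\<^sub>0 = z\<^sub>0) \<longrightarrow> n0 = 0"
    "\<forall>N\<ge>1. (\<Sum>i<N. poly (pderiv (iterate_poly k (P t\<^sub>0))) w ^ i) \<noteq> 0"
    by (elim exE conjE)
  interpret pointed_cover \<Lambda> d t\<^sub>0 z\<^sub>0 Z U n \<phi> Q P k n0 w
    by standard (use w U(4) PQ in simp_all)
  have itk: "(poly (iterate_poly k (P t\<^sub>0)) ^^ j) y = (poly (P t\<^sub>0) ^^ (k * j)) y" for j y
  proof (induction j)
    case (Suc j)
    have "k * Suc j = k + k * j" by simp
    thus ?case using Suc by (simp only: funpow.simps comp_apply poly_iterate_poly funpow_add)
  qed simp
  \<comment> \<open>Counted in iterates of \<open>P\<close>, the marked orbit point is reached after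
    \<open>k * n0\<close> steps; the translation by \<open>- snd\<close> moves it to
    \<open>0\<close>.\<close>
  have w0: "1 * (poly (P t\<^sub>0) ^^ (k * n0)) z\<^sub>0 + - snd (t\<^sub>0, w) = 0"
    using w(2) itk[of n0 z\<^sub>0] by simp
  have aff: "affine_family M (\<lambda>_. 1) (\<lambda>p. - snd p)"
    unfolding affine_family_def ptsM
  proof (intro conjI ballI)
    show "regular_on M V1 (\<lambda>_. 1)" by (rule chart_regular[OF chM coord_ring_const])
    show "regular_on M V1 (\<lambda>p. - snd p)"
      by (rule chart_regular[OF chM]) (unfold coord_R, rule fr_uminus[OF R_ring line_ring_snd])
  qed simp
  show ?thesis
  proof (intro exI conjI)
    show "base_change \<Lambda> t\<^sub>0 z\<^sub>0 Z M fst (t\<^sub>0, w) Z'" by (rule cover_base_change)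
    show "affine_family M (\<lambda>_. 1) (\<lambda>p. - snd p)" by (rule aff)
    show "k \<ge> 1" by (rule w(1))
    show "(\<exists>m\<ge>1. (poly (P t\<^sub>0) ^^ m) z\<^sub>0 = z\<^sub>0) \<longrightarrow> k * n0 = 0" using w(4) by simp
    have "(\<forall>t\<in>points M. poly (QQ t) 0 = 0) \<and> super_attracting (QQ (t\<^sub>0, w)) 0 \<and>
        \<not> locally_constant_near (zariski M) (t\<^sub>0, w) (\<lambda>t. local_degree 0 (QQ t)) \<and>
        (\<exists>n :: nat \<Rightarrow> nat. filterlim n at_top sequentially \<and>
           (\<forall>i. irreducible_component (zariski (times_line M))
                  {(t, z). t \<in> points M \<and> (poly (QQ t) ^^ n i) z = 0} ((\<lambda>(t, z). (t, 1 * z + - snd t)) ` Z' i)))"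
      by (intro conjI ballI exI[of _ nn] allI)
        (simp_all only: ptsM QQ_fixed QQ_super_attracting not_locally_constant nn_at_top conjugated_component[unfolded ptsM] not_False_eq_True)
    thus "let Q = (\<lambda>t. conj_poly ((\<lambda>_. 1) t) ((\<lambda>p. - snd p) t) (iterate_poly k (P (fst t))));
         w\<^sub>0 = (\<lambda>_. 1) (t\<^sub>0, w) * (poly (P t\<^sub>0) ^^ (k * n0)) z\<^sub>0 + (\<lambda>p. - snd p) (t\<^sub>0, w);
         Y = (\<lambda>i. (\<lambda>(t, z). (t, (\<lambda>_. 1) t * z + (\<lambda>p. - snd p) t)) ` Z' i)
     in (\<forall>t\<in>points M. poly (Q t) w\<^sub>0 = w\<^sub>0) \<and>
        super_attracting (Q (t\<^sub>0, w)) w\<^sub>0 \<and>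
        \<not> locally_constant_near (zariski M) (t\<^sub>0, w) (\<lambda>t. local_degree w\<^sub>0 (Q t)) \<and>
        (\<exists>n :: nat \<Rightarrow> nat. filterlim n at_top sequentially \<and>
           (\<forall>i. irreducible_component (zariski (times_line M))
                  {(t, z). t \<in> points M \<and> (poly (Q t) ^^ n i) z = w\<^sub>0} (Y i)))"
      unfolding Let_def w0 QQ_def .
  qed
qed

end
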